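(* Let $d\ge2$ and $T\in(0,\infty)$. There exists a constant $C=C(T)>0$ (for the given dimension $d$, depending only on $T$) such that for all dyadic numbers $1\le M\le N$ and all $u_N(0),v_M(0)\in L^2(\mathbb R^d)$ with $\Delta_Nu_N(0)=u_N(0)$ and $\Delta_Mv_M(0)=v_M(0)$, $$\big\|e^{itH}u_N(0)\cdot e^{itH}v_M(0)\big\|_{L^2_t([0,T],L^2_x(\mathbb R^d))}\le C\,\frac{M^{\frac{d-1}{2}}}{N^{\frac12}}\,\|u_N(0)\|_{L^2(\mathbb R^d)}\|v_M(0)\|_{L^2(\mathbb R^d)}.$$
   Context: $H=-\Delta+|x|^2$ on $\mathbb R^d$, and $e^{itH}$ is the unitary group it generates on $L^2(\mathbb R^d)$. Dyadic numbers are numbers $2^j$, $j\in\mathbb Z$. Fix $\eta\in C_0^\infty(\mathbb R)$ with $\eta=1$ on $[0,1]$ and $\eta=0$ on $[2,\infty)$, and put $\psi(x)=\eta(x)-\eta(4x)$. For $N\ge1$, $\Delta_N=\psi(H/N^2)$ is defined by the functional calculus of $H$. *)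

theory Defs
  imports "HOL-Analysis.Analysis"
begin

section \<open>The space $L^2$\<close>

text \<open>
  Elements of $L^2$ are represented by Borel functions. Identification almost everywhere is
  explicit: operators are graphs, or functions, that are only determined almost everywhere.
\<close>

definition L2 :: "('a::euclidean_space \<Rightarrow> complex) set" where
  "L2 = {f \<in> borel_measurable lborel. integrable lborel (\<lambda>x. (cmod (f x))\<^sup>2)}"

definition l2_inner :: "('a::euclidean_space \<Rightarrow> complex) \<Rightarrow> ('a \<Rightarrow> complex) \<Rightarrow> complex" where
  "l2_inner f g = (\<integral>x. cnj (f x) * g x \<partial>lborel)"

definition l2_norm :: "('a::euclidean_space \<Rightarrow> complex) \<Rightarrow> real" where
  "l2_norm f = sqrt (\<integral>x. (cmod (f x))\<^sup>2 \<partial>lborel)"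

definition ennreal_sqrt :: "ennreal \<Rightarrow> ennreal" where
  "ennreal_sqrt x = (if x = \<infinity> then \<infinity> else ennreal (sqrt (enn2real x)))"

text \<open>
  The norm of $L^2_t([0,T], L^2_x)$, with value $\infty$ outside that space.
\<close>

definition spacetime_norm :: "real \<Rightarrow> (real \<Rightarrow> 'a::euclidean_space \<Rightarrow> complex) \<Rightarrow> ennreal" where
  "spacetime_norm T w = ennreal_sqrt
     (\<integral>\<^sup>+t\<in>{0..T}. (\<integral>\<^sup>+x. ennreal ((cmod (w t x))\<^sup>2) \<partial>lborel) \<partial>lborel)"


section \<open>Spectral integrals\<close>

text \<open>
  A projection-valued measure on the Borel sets of the real line. Each \<open>E B\<close> is symmetric and
  defined on all of $L^2$, which makes it linear and compatible with equality almost everywhere;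
  it is idempotent by multiplicativity, hence an orthogonal projection. Then
  $\langle f, E(B) f\rangle = \|E(B) f\|^2$.
\<close>

definition projection_valued_measure ::
    "(real set \<Rightarrow> ('a::euclidean_space \<Rightarrow> complex) \<Rightarrow> ('a \<Rightarrow> complex)) \<Rightarrow> bool" where
  "projection_valued_measure E \<longleftrightarrow>
     (\<forall>B\<in>sets borel. \<forall>f\<in>L2. E B f \<in> L2) \<and>
     (\<forall>B\<in>sets borel. \<forall>f\<in>L2. \<forall>g\<in>L2. l2_inner (E B f) g = l2_inner f (E B g)) \<and>
     (\<forall>B\<in>sets borel. \<forall>C\<in>sets borel. \<forall>f\<in>L2. AE x in lborel. E (B \<inter> C) f x = E B (E C f) x) \<and>
     (\<forall>f\<in>L2. AE x in lborel. E UNIV f x = f x) \<and>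
     (\<forall>B :: nat \<Rightarrow> real set. range B \<subseteq> sets borel \<longrightarrow> disjoint_family B \<longrightarrow>
        (\<forall>f\<in>L2. (\<lambda>i. (l2_norm (E (B i) f))\<^sup>2) sums (l2_norm (E (\<Union>i. B i) f))\<^sup>2))"

definition spectral_measure ::
    "(real set \<Rightarrow> ('a::euclidean_space \<Rightarrow> complex) \<Rightarrow> ('a \<Rightarrow> complex)) \<Rightarrow>
     ('a \<Rightarrow> complex) \<Rightarrow> real measure" where
  "spectral_measure E f = measure_of UNIV (sets borel) (\<lambda>B. ennreal ((l2_norm (E B f))\<^sup>2))"

definition spectral_domain ::
    "(real set \<Rightarrow> ('a::euclidean_space \<Rightarrow> complex) \<Rightarrow> ('a \<Rightarrow> complex)) \<Rightarrow>
     (real \<Rightarrow> complex) \<Rightarrow> ('a \<Rightarrow> complex) set" where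
  "spectral_domain E F = {f \<in> L2. integrable (spectral_measure E f) (\<lambda>s. (cmod (F s))\<^sup>2)}"

text \<open>
  $\int F \, d\langle h, E f\rangle$, the integral against the complex measure being obtained from
  the positive measures $\langle f, E f\rangle$ by polarization.
\<close>

definition spectral_form ::
    "(real set \<Rightarrow> ('a::euclidean_space \<Rightarrow> complex) \<Rightarrow> ('a \<Rightarrow> complex)) \<Rightarrow>
     (real \<Rightarrow> complex) \<Rightarrow> ('a \<Rightarrow> complex) \<Rightarrow> ('a \<Rightarrow> complex) \<Rightarrow> complex" where
  "spectral_form E F h f =
     (\<Sum>k<4. (- \<i>) ^ k * (\<integral>s. F s \<partial>(spectral_measure E (\<lambda>x. h x + \<i> ^ k * f x)))) / 4"

text \<open>
  The graph of the (possibly unbounded) operator $\int F \, dE$. Its domain is dense, so the image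
  of \<open>f\<close> is determined almost everywhere.
\<close>

definition spectral_integral ::
    "(real set \<Rightarrow> ('a::euclidean_space \<Rightarrow> complex) \<Rightarrow> ('a \<Rightarrow> complex)) \<Rightarrow>
     (real \<Rightarrow> complex) \<Rightarrow> (('a \<Rightarrow> complex) \<times> ('a \<Rightarrow> complex)) set" where
  "spectral_integral E F =
     {(f, g). f \<in> spectral_domain E F \<and> g \<in> L2 \<and>
        (\<forall>h\<in>spectral_domain E F. l2_inner h g = spectral_form E F h f)}"

text \<open>
  For a self-adjoint operator with graph \<open>A\<close>, the spectral theorem gives a projection-valued
  measure \<open>E\<close> with $A = \int s \, dE(s)$, unique up to equality almost everywhere.
\<close>

definition spectral_resolution ::
    "(('a::euclidean_space \<Rightarrow> complex) \<times> ('a \<Rightarrow> complex)) set \<Rightarrow>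
     real set \<Rightarrow> ('a \<Rightarrow> complex) \<Rightarrow> ('a \<Rightarrow> complex)" where
  "spectral_resolution A =
     (SOME E. projection_valued_measure E \<and> spectral_integral E complex_of_real = A)"

text \<open>
  A representative of $F(A) f$, meaningful for \<open>f\<close> in the domain of $F(A)$; for bounded Borel \<open>F\<close>
  this is all of $L^2$.
\<close>

definition functional_calculus ::
    "(('a::euclidean_space \<Rightarrow> complex) \<times> ('a \<Rightarrow> complex)) set \<Rightarrow>
     (real \<Rightarrow> complex) \<Rightarrow> ('a \<Rightarrow> complex) \<Rightarrow> ('a \<Rightarrow> complex)" where
  "functional_calculus A F f = (SOME g. (f, g) \<in> spectral_integral (spectral_resolution A) F)"


section \<open>The harmonic oscillator\<close>

definition partial_deriv ::
    "'a::euclidean_space \<Rightarrow> ('a \<Rightarrow> complex) \<Rightarrow> ('a \<Rightarrow> complex)" where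
  "partial_deriv b f = (\<lambda>x. frechet_derivative f (at x) b)"

definition schwartz :: "('a::euclidean_space \<Rightarrow> complex) \<Rightarrow> bool" where
  "schwartz f \<longleftrightarrow>
     (\<forall>bs. set bs \<subseteq> Basis \<longrightarrow>
        (\<forall>x. foldr partial_deriv bs f differentiable (at x)) \<and>
        (\<forall>k::nat. bounded (range (\<lambda>x. norm x ^ k *\<^sub>R foldr partial_deriv bs f x))))"

definition harmonic_expression :: "('a::euclidean_space \<Rightarrow> complex) \<Rightarrow> ('a \<Rightarrow> complex)" where
  "harmonic_expression f x =
     - (\<Sum>b\<in>Basis. partial_deriv b (partial_deriv b f) x) + (norm x)\<^sup>2 *\<^sub>R f x"

text \<open>
  The graph of the self-adjoint operator $H = -\Delta + |x|^2$: the closure in $L^2 \times L^2$ of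
  the differential expression on Schwartz functions, on which it is essentially self-adjoint.
\<close>

definition harmonic_oscillator :: "(('a::euclidean_space \<Rightarrow> complex) \<times> ('a \<Rightarrow> complex)) set" where
  "harmonic_oscillator =
     {(f, g). f \<in> L2 \<and> g \<in> L2 \<and>
        (\<exists>\<phi> :: nat \<Rightarrow> 'a \<Rightarrow> complex. (\<forall>n. schwartz (\<phi> n)) \<and>
           (\<lambda>n. l2_norm (\<lambda>x. \<phi> n x - f x)) \<longlonglongrightarrow> 0 \<and>
           (\<lambda>n. l2_norm (\<lambda>x. harmonic_expression (\<phi> n) x - g x)) \<longlonglongrightarrow> 0)}"

text \<open>
  By Stone's theorem the unitary group generated by \<open>H\<close> is given by the functional calculus.
\<close>

definition propagator :: "real \<Rightarrow> ('a::euclidean_space \<Rightarrow> complex) \<Rightarrow> ('a \<Rightarrow> complex)" where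
  "propagator t = functional_calculus harmonic_oscillator (\<lambda>s. exp (\<i> * of_real (t * s)))"


section \<open>Dyadic frequency localization\<close>

definition dyadic :: "real set" where
  "dyadic = {2 powi j | j :: int. True}"

definition smooth :: "(real \<Rightarrow> complex) \<Rightarrow> bool" where
  "smooth f \<longleftrightarrow> (\<forall>k x. ((\<lambda>g y. vector_derivative g (at y)) ^^ k) f differentiable (at x))"

definition cutoff :: "(real \<Rightarrow> complex) \<Rightarrow> bool" where
  "cutoff \<eta> \<longleftrightarrow> smooth \<eta> \<and> bounded {x. \<eta> x \<noteq> 0} \<and>
     (\<forall>x\<in>{0..1}. \<eta> x = 1) \<and> (\<forall>x\<ge>2. \<eta> x = 0)"

definition frequency_localization ::
    "(real \<Rightarrow> complex) \<Rightarrow> real \<Rightarrow> ('a::euclidean_space \<Rightarrow> complex) \<Rightarrow> ('a \<Rightarrow> complex)" where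
  "frequency_localization \<eta> N =
     functional_calculus harmonic_oscillator
       (let \<psi> = (\<lambda>x. \<eta> x - \<eta> (4 * x)) in (\<lambda>s. \<psi> (s / N\<^sup>2)))"

end

(*
  In the basis of Hermite functions the operator H is diagonal, with eigenvalues 2|alpha| + d, and
  so is its projection-valued measure. Frequency localized data are therefore finite Hermite sums.
  Up to a phase the evolution is periodic in time, so that on [0, m pi] the product of two solutions
  decouples into the parts with a fixed total energy |alpha| + |beta|.

  On the line, the rotation by pi/4 turns h_p(x) h_(n-p)(x) into the sum over k of
  K_p(k) h_k(sqrt 2 x) h_(n-k)(0) with the Kravchuk coefficients K_p(k). If p carries almost all of
  the energy n, then n - k is essentially at least a fixed proportion of n, and h_(n-k)(0)^2 is at
  most of order (n - k)^(-1/2), which gains the factor N^(-1). If M is much smaller than N, this is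
  applied in a coordinate in which the high frequency datum has energy of order N^2; the other
  coordinates cost M^(d-1) by Cauchy-Schwarz. If M is comparable with N, it suffices to rotate in
  all coordinates and to bound the sum of the products of the h_(tau_i)(0)^2 over |tau| = n by a
  multiple of (n + 1)^((d-2)/2).
*)

theory Submission
  imports Defs "HOL-Probability.Probability" "HOL-Computational_Algebra.Polynomial"
begin

section \<open>The space of square integrable functions\<close>

text \<open>The tails of the Kravchuk coefficients are never estimated pointwise. The square of
  \<open>hermf m 0\<close> is at most \<open>1 / sqrt (m + 1)\<close>, and AM-GM gives
  \<open>1 / sqrt (m + 1) \<le> (sqrt n / (m + 1) + 1 / sqrt n) / 2\<close>, so the gain needs only
  the mean of \<open>1 / (n - k + 1)\<close>. That mean is the quadratic form of the inverse of a
  tridiagonal matrix in the index \<open>p\<close>, with diagonal \<open>n / 2 + 1\<close> and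
  hopping terms that are small for \<open>p\<close> near \<open>n\<close>; an energy estimate with a
  cut-off suffices. Its smallness condition \<open>32 * (n - p) \<le> n\<close> fixes the threshold
  \<open>N^2 = 512 * d * M^2\<close> between the two regimes. The other obstacle is that
  \<open>propagator\<close> and \<open>frequency_localization\<close> rest on a projection-valued
  measure picked by \<open>SOME\<close>. Existence of a diagonal one is therefore not enough: every
  projection-valued measure that resolves H has to be diagonal in the Hermite basis. This takes the
  exact graph of the closure, obtained by testing H on Schwartz functions against Hermite functions,
  and the location of the spectral measure of each eigenfunction.\<close>

lemma L2_I: "f \<in> borel_measurable lborel \<Longrightarrow> integrable lborel (\<lambda>x. (cmod (f x))\<^sup>2) \<Longrightarrow> f \<in> L2"
  by (simp add: L2_def)

lemma L2_measurable: "f \<in> L2 \<Longrightarrow> f \<in> borel_measurable borel"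
  by (simp add: L2_def)

lemma cnj_borel_measurable [measurable]: "cnj \<in> borel_measurable borel"
  by (intro borel_measurable_continuous_onI continuous_intros)

lemma L2_integrable: "f \<in> L2 \<Longrightarrow> integrable lborel (\<lambda>x. (cmod (f x))\<^sup>2)"
  by (simp add: L2_def)

lemma l2_norm_nonneg [simp]: "l2_norm f \<ge> 0"
  by (simp add: l2_norm_def)

lemma l2_norm_sq: "(l2_norm f)\<^sup>2 = (\<integral>x. (cmod (f x))\<^sup>2 \<partial>lborel)"
  by (simp add: l2_norm_def)

lemma L2_scale: "f \<in> L2 \<Longrightarrow> (\<lambda>x. c * f x) \<in> L2"
  by (auto simp: L2_def norm_mult power_mult_distrib)

lemma L2_zero: "(\<lambda>x. 0) \<in> L2"
  by (auto simp: L2_def)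

lemma norm_add_sq_le: "(norm (a + b :: 'b::real_normed_vector))\<^sup>2 \<le> 2 * (norm a)\<^sup>2 + 2 * (norm b)\<^sup>2"
proof -
  have "(norm (a + b))\<^sup>2 \<le> (norm a + norm b)\<^sup>2"
    by (intro power_mono norm_triangle_ineq) auto
  also have "\<dots> \<le> 2 * (norm a)\<^sup>2 + 2 * (norm b)\<^sup>2"
    using zero_le_power2[of "norm a - norm b"] by (simp add: power2_eq_square algebra_simps)
  finally show ?thesis .
qed

lemma L2_add:
  assumes "f \<in> L2" "g \<in> L2" shows "(\<lambda>x. f x + g x) \<in> L2"
proof (rule L2_I)
  show m: "(\<lambda>x. f x + g x) \<in> borel_measurable lborel" using assms[THEN L2_measurable] by measurable
  have "integrable lborel (\<lambda>x. 2 * (cmod (f x))\<^sup>2 + 2 * (cmod (g x))\<^sup>2)"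
    using assms by (intro Bochner_Integration.integrable_add integrable_mult_right L2_integrable)
  then show "integrable lborel (\<lambda>x. (cmod (f x + g x))\<^sup>2)"
    by (rule Bochner_Integration.integrable_bound) (use m norm_add_sq_le[of "f _" "g _"] in auto)
qed

lemma L2_uminus: "f \<in> L2 \<Longrightarrow> (\<lambda>x. - f x) \<in> L2"
  by (auto simp: L2_def)

lemma L2_diff: "f \<in> L2 \<Longrightarrow> g \<in> L2 \<Longrightarrow> (\<lambda>x. f x - g x) \<in> L2"
  using L2_add[OF _ L2_uminus] by simp

lemma L2_sum: "(\<And>i. i \<in> A \<Longrightarrow> f i \<in> L2) \<Longrightarrow> (\<lambda>x. \<Sum>i\<in>A. f i x) \<in> L2"
  by (induction A rule: infinite_finite_induct) (auto intro: L2_add L2_zero)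

lemma L2_inner_integrable:
  assumes "f \<in> L2" "g \<in> L2" shows "integrable lborel (\<lambda>x. cnj (f x) * g x)"
proof (rule Bochner_Integration.integrable_bound)
  show "integrable lborel (\<lambda>x. (cmod (f x))\<^sup>2 + (cmod (g x))\<^sup>2)"
    using assms by (intro Bochner_Integration.integrable_add L2_integrable)
  show "(\<lambda>x. cnj (f x) * g x) \<in> borel_measurable lborel"
    using assms[THEN L2_measurable] by measurable
  have "cmod a * cmod b \<le> (cmod a)\<^sup>2 + (cmod b)\<^sup>2" for a b
  proof -
    have "0 \<le> cmod a * cmod b" by simp
    with sum_squares_bound[of "cmod a" "cmod b"] show ?thesis by linarith
  qed
  then show "AE x in lborel. norm (cnj (f x) * g x) \<le> norm ((cmod (f x))\<^sup>2 + (cmod (g x))\<^sup>2)"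
    by (auto simp: norm_mult)
qed

lemma l2_inner_add_right:
  assumes "f \<in> L2" "g \<in> L2" "h \<in> L2"
  shows "l2_inner f (\<lambda>x. g x + h x) = l2_inner f g + l2_inner f h"
  using assms by (simp add: l2_inner_def distrib_left L2_inner_integrable)

lemma l2_inner_diff_right:
  assumes "f \<in> L2" "g \<in> L2" "h \<in> L2"
  shows "l2_inner f (\<lambda>x. g x - h x) = l2_inner f g - l2_inner f h"
  using assms by (simp add: l2_inner_def right_diff_distrib L2_inner_integrable)

lemma l2_inner_add_left:
  assumes "f \<in> L2" "g \<in> L2" "h \<in> L2"
  shows "l2_inner (\<lambda>x. g x + h x) f = l2_inner g f + l2_inner h f"
  using assms by (simp add: l2_inner_def distrib_right L2_inner_integrable)

lemma l2_inner_scale_right: "l2_inner f (\<lambda>x. c * g x) = c * l2_inner f g"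
  by (simp add: l2_inner_def mult.left_commute)

lemma l2_inner_scale_left: "l2_inner (\<lambda>x. c * f x) g = cnj c * l2_inner f g"
  by (simp add: l2_inner_def mult.assoc)

lemma l2_inner_sum_right:
  assumes "f \<in> L2" "\<And>i. i \<in> A \<Longrightarrow> g i \<in> L2"
  shows "l2_inner f (\<lambda>x. \<Sum>i\<in>A. g i x) = (\<Sum>i\<in>A. l2_inner f (g i))"
  using assms(2)
proof (induction A rule: infinite_finite_induct)
  case (insert a A)
  then show ?case using assms(1) by (simp add: l2_inner_add_right L2_sum)
qed (auto simp: l2_inner_def)

lemma l2_inner_commute: "l2_inner g f = cnj (l2_inner f g)"
  unfolding l2_inner_def by (subst Bochner_Integration.integral_cnj[symmetric]) (simp add: mult.commute)

lemma l2_inner_self: "l2_inner f f = of_real ((l2_norm f)\<^sup>2)"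
proof -
  have "cnj z * z = of_real ((cmod z)\<^sup>2)" for z
    using complex_norm_square[of z] by (simp add: mult.commute)
  then show ?thesis by (simp add: l2_inner_def l2_norm_sq integral_complex_of_real[symmetric] del: of_real_power integral_complex_of_real)
qed

lemma l2_norm_zero_AE: "f \<in> L2 \<Longrightarrow> l2_norm f = 0 \<Longrightarrow> AE x in lborel. f x = 0"
proof -
  assume f: "f \<in> L2" and "l2_norm f = 0"
  then have "(\<integral>x. (cmod (f x))\<^sup>2 \<partial>lborel) = 0" by (simp add: l2_norm_sq[symmetric])
  with integral_nonneg_eq_0_iff_AE[OF L2_integrable[OF f]]
  show ?thesis by auto
qed

lemma l2_norm_cong_AE:
  assumes "f \<in> borel_measurable lborel" "g \<in> borel_measurable lborel" "AE x in lborel. f x = g x"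
  shows "l2_norm f = l2_norm g"
proof -
  have "(\<integral>x. (cmod (f x))\<^sup>2 \<partial>lborel) = (\<integral>x. (cmod (g x))\<^sup>2 \<partial>lborel)"
    by (rule integral_cong_AE) (use assms in auto)
  then show ?thesis by (simp add: l2_norm_def)
qed

lemma l2_inner_cong_AE:
  assumes "f \<in> L2" "g \<in> L2" "h \<in> L2" "AE x in lborel. g x = h x"
  shows "l2_inner f g = l2_inner f h"
proof -
  have [measurable]: "f \<in> borel_measurable borel" "g \<in> borel_measurable borel" "h \<in> borel_measurable borel"
    using assms by (auto intro: L2_measurable)
  show ?thesis unfolding l2_inner_def by (rule integral_cong_AE) (use assms(4) in auto)
qed

lemma l2_cauchy_schwarz_abs:
  assumes f: "f \<in> L2" and g: "g \<in> L2"
  shows "(\<integral>x. cmod (f x) * cmod (g x) \<partial>lborel) \<le> l2_norm f * l2_norm g"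
proof -
  have [measurable]: "f \<in> borel_measurable borel" "g \<in> borel_measurable borel"
    using assms by (auto intro: L2_measurable)
  show ?thesis
proof (cases "l2_norm f = 0 \<or> l2_norm g = 0")
  case True
  then have "AE x in lborel. f x = 0 \<or> g x = 0"
    using l2_norm_zero_AE[OF f] l2_norm_zero_AE[OF g] by auto
  then have "(\<integral>x. cmod (f x) * cmod (g x) \<partial>lborel) = (\<integral>x. 0 \<partial>(lborel :: 'a measure))"
    by (intro integral_cong_AE) auto
  then show ?thesis by simp
next
  case False
  then have pos: "l2_norm f > 0" "l2_norm g > 0"
    using l2_norm_nonneg[of f] l2_norm_nonneg[of g] by linarith+
  \<comment> \<open>This weight makes the two integrated halves of the AM-GM bound equal: each is
    half of \<open>l2_norm f * l2_norm g\<close>.\<close>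
  define s where "s = l2_norm g / l2_norm f"
  have s: "s > 0" using pos by (simp add: s_def)
  have amgm: "a * b \<le> (s * a\<^sup>2 + b\<^sup>2 / s) / 2" for a b :: real
    using zero_le_power2[of "s * a - b"] s by (simp add: field_simps power2_eq_square)
  have "(\<integral>x. cmod (f x) * cmod (g x) \<partial>lborel)
      \<le> (\<integral>x. (s * (cmod (f x))\<^sup>2 + (cmod (g x))\<^sup>2 / s) / 2 \<partial>lborel)"
  proof (rule integral_mono)
    show "integrable lborel (\<lambda>x. cmod (f x) * cmod (g x))"
      using integrable_norm[OF L2_inner_integrable[OF f g]] by (simp add: norm_mult)
    show "integrable lborel (\<lambda>x. (s * (cmod (f x))\<^sup>2 + (cmod (g x))\<^sup>2 / s) / 2)"
      using f g by (intro integrable_divide Bochner_Integration.integrable_add integrable_mult_right L2_integrable)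
  qed (use amgm in auto)
  also have "\<dots> = (s * (l2_norm f)\<^sup>2 + (l2_norm g)\<^sup>2 / s) / 2"
    using f g by (simp add: l2_norm_sq L2_integrable)
  also have "\<dots> = l2_norm f * l2_norm g"
    using pos by (simp add: s_def field_simps power2_eq_square)
  finally show ?thesis .
qed
qed

lemma l2_cauchy_schwarz:
  assumes "f \<in> L2" "g \<in> L2" shows "cmod (l2_inner f g) \<le> l2_norm f * l2_norm g"
proof -
  have "cmod (l2_inner f g) \<le> (\<integral>x. cmod (cnj (f x) * g x) \<partial>lborel)"
    unfolding l2_inner_def by (rule integral_norm_bound)
  with l2_cauchy_schwarz_abs[OF assms] show ?thesis by (simp add: norm_mult)
qed

lemma l2_norm_add_sq:
  assumes "f \<in> L2" "g \<in> L2"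
  shows "(l2_norm (\<lambda>x. f x + g x))\<^sup>2 = (l2_norm f)\<^sup>2 + 2 * Re (l2_inner f g) + (l2_norm g)\<^sup>2"
proof -
  have "complex_of_real ((l2_norm (\<lambda>x. f x + g x))\<^sup>2) = l2_inner (\<lambda>x. f x + g x) (\<lambda>x. f x + g x)"
    by (simp only: l2_inner_self)
  also have "\<dots> = l2_inner f f + l2_inner f g + (l2_inner g f + l2_inner g g)"
    using assms by (simp add: l2_inner_add_left l2_inner_add_right L2_add)
  finally have "complex_of_real ((l2_norm (\<lambda>x. f x + g x))\<^sup>2) = \<dots>" .
  from arg_cong[OF this, of Re] show ?thesis
    by (subst (asm) l2_inner_commute[of g f]) (simp add: l2_inner_self)
qed

lemma l2_norm_scale: "l2_norm (\<lambda>x. c * f x) = cmod c * l2_norm f"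
  by (simp add: l2_norm_def norm_mult power_mult_distrib real_sqrt_mult)

lemma l2_norm_minus_commute: "l2_norm (\<lambda>x. f x - g x) = l2_norm (\<lambda>x. g x - f x)"
  by (simp add: l2_norm_def norm_minus_commute)

lemma l2_inner_tendsto:
  assumes "\<And>n. f n \<in> L2" "g \<in> L2" "h \<in> L2" "(\<lambda>n. l2_norm (\<lambda>x. f n x - g x)) \<longlonglongrightarrow> 0"
  shows "(\<lambda>n. l2_inner h (f n)) \<longlonglongrightarrow> l2_inner h g"
proof (rule LIM_zero_cancel, rule Lim_null_comparison)
  have "cmod (l2_inner h (f n) - l2_inner h g) \<le> l2_norm h * l2_norm (\<lambda>x. f n x - g x)" for n
    using l2_cauchy_schwarz[OF assms(3) L2_diff[OF assms(1)[of n] assms(2)]] assms(1-3)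
    by (simp add: l2_inner_diff_right)
  then show "\<forall>\<^sub>F n in sequentially. cmod (l2_inner h (f n) - l2_inner h g)
      \<le> l2_norm h * l2_norm (\<lambda>x. f n x - g x)" by simp
  show "(\<lambda>n. l2_norm h * l2_norm (\<lambda>x. f n x - g x)) \<longlonglongrightarrow> 0"
    using tendsto_mult_right_zero[OF assms(4)] .
qed

lemma nn_integral_L2: "f \<in> L2 \<Longrightarrow> (\<integral>\<^sup>+x. ennreal ((cmod (f x))\<^sup>2) \<partial>lborel) = ennreal ((l2_norm f)\<^sup>2)"
  by (simp add: nn_integral_eq_integral L2_integrable l2_norm_sq)

text \<open>
  Along a subsequence with increments of norm at most \<open>2 ^ - k\<close> the weighted series
  \<open>\<Sum>k. 2 ^ k * |increment k|\<^sup>2\<close> is integrable, hence finite almost everywhere, which makes the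
  increments themselves absolutely summable almost everywhere.
\<close>

lemma L2_complete_fast:
  fixes g :: "nat \<Rightarrow> 'a::euclidean_space \<Rightarrow> complex"
  assumes g: "\<And>n. g n \<in> L2"
    and inc: "\<And>k. l2_norm (\<lambda>x. g (Suc k) x - g k x) \<le> (1/2) ^ k"
  shows "\<exists>h \<in> borel_measurable lborel. AE x in lborel. (\<lambda>n. g n x) \<longlonglongrightarrow> h x"
proof -
  define d where "d k x = g (Suc k) x - g k x" for k x
  have d: "d k \<in> L2" for k unfolding d_def by (intro L2_diff g)
  have gm [measurable]: "g n \<in> borel_measurable lborel" for n using L2_measurable[OF g] by simp
  have dm [measurable]: "d n \<in> borel_measurable lborel" for n using L2_measurable[OF d] by simp
  let ?S = "\<lambda>x. \<Sum>k. ennreal (2 ^ k * (cmod (d k x))\<^sup>2)"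
  have dn: "l2_norm (d k) \<le> (1/2) ^ k" for k
    using inc[of k] unfolding d_def[abs_def] .
  have "(\<integral>\<^sup>+x. ?S x \<partial>lborel) = (\<Sum>k. \<integral>\<^sup>+x. ennreal (2 ^ k * (cmod (d k x))\<^sup>2) \<partial>lborel)"
    by (rule nn_integral_suminf) measurable
  also have "\<dots> \<le> (\<Sum>k. ennreal ((1/2) ^ k))"
  proof (intro suminf_le)
    fix k
    have "(\<integral>\<^sup>+x. ennreal (2 ^ k * (cmod (d k x))\<^sup>2) \<partial>lborel)
      = ennreal (2 ^ k) * (\<integral>\<^sup>+x. ennreal ((cmod (d k x))\<^sup>2) \<partial>lborel)"
      by (subst nn_integral_cmult[symmetric]) (auto simp: ennreal_mult)
    also have "\<dots> = ennreal (2 ^ k * (l2_norm (d k))\<^sup>2)"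
      by (simp add: nn_integral_L2[OF d] ennreal_mult)
    also have "\<dots> \<le> ennreal ((1/2) ^ k)"
    proof (rule ennreal_leI)
      have "2 ^ k * (l2_norm (d k))\<^sup>2 \<le> 2 ^ k * ((1/2) ^ k)\<^sup>2"
        using dn[of k] by (intro mult_left_mono power_mono) auto
      also have "\<dots> = (1/2) ^ k"
        by (simp add: power2_eq_square power_one_over field_simps)
      finally show "2 ^ k * (l2_norm (d k))\<^sup>2 \<le> (1/2) ^ k" .
    qed
    finally show "(\<integral>\<^sup>+x. ennreal (2 ^ k * (cmod (d k x))\<^sup>2) \<partial>lborel) \<le> ennreal ((1/2) ^ k)" .
  qed auto
  also have "\<dots> = ennreal (\<Sum>k. (1/2) ^ k)"
    by (rule suminf_ennreal2) auto
  also have "\<dots> < \<infinity>" by simp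
  finally have "(\<integral>\<^sup>+x. ?S x \<partial>lborel) \<noteq> \<infinity>" by simp
  then have fin: "AE x in lborel. ?S x \<noteq> \<infinity>"
    by (intro nn_integral_noteq_infinite) auto
  have conv: "convergent (\<lambda>n. g n x)" if "?S x \<noteq> \<infinity>" for x
  proof -
    have "summable (\<lambda>k. 2 ^ k * (cmod (d k x))\<^sup>2)"
      using that by (intro summable_suminf_not_top) auto
    then have "Bseq (\<lambda>k. 2 ^ k * (cmod (d k x))\<^sup>2)"
      by (intro convergent_imp_Bseq) (auto simp: convergent_def dest: summable_LIMSEQ_zero)
    \<comment> \<open>A bound on the terms is all that is kept of the weighted series; it forces the
      increments to decay like \<open>2 ^ (- k / 2)\<close>, which is summable.\<close>
    then obtain K where K: "K > 0" "\<And>k. 2 ^ k * (cmod (d k x))\<^sup>2 \<le> K"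
      by (auto simp: Bseq_def)
    have bd: "cmod (d k x) \<le> sqrt K * (sqrt (1/2)) ^ k" for k
    proof (rule power2_le_imp_le)
      have "(cmod (d k x))\<^sup>2 \<le> K * (1/2) ^ k"
        using K(2)[of k] by (simp add: power_one_over field_simps)
      also have "\<dots> = (sqrt K * sqrt (1/2) ^ k)\<^sup>2"
      proof -
        have "(sqrt (1/2) ^ k)\<^sup>2 = (sqrt (1/2) * sqrt (1/2)) ^ k"
          by (simp only: power2_eq_square power_mult_distrib)
        then have "(sqrt (1/2) ^ k)\<^sup>2 = (1/2) ^ k" by simp
        then show ?thesis using K(1) by (simp only: power_mult_distrib real_sqrt_pow2)
      qed
      finally show "(cmod (d k x))\<^sup>2 \<le> (sqrt K * sqrt (1/2) ^ k)\<^sup>2" .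
    qed (use K in auto)
    have "summable (\<lambda>k. sqrt K * (sqrt (1/2)) ^ k)"
      by (intro summable_mult summable_geometric) (auto simp: real_sqrt_divide)
    then have "summable (\<lambda>k. d k x)"
      by (rule summable_comparison_test'[where N=0]) (use bd in auto)
    then have "convergent (\<lambda>n. \<Sum>k<n. d k x)" by (simp add: summable_iff_convergent)
    moreover have "(\<Sum>k<n. d k x) = g n x - g 0 x" for n
      unfolding d_def by (rule sum_lessThan_telescope)
    ultimately have "convergent (\<lambda>n. g n x - g 0 x)" by simp
    from convergent_add[OF this convergent_const[of "g 0 x"]] show ?thesis by simp
  qed
  have "AE x in lborel. (\<lambda>n. g n x) \<longlonglongrightarrow> lim (\<lambda>n. g n x)"
    using fin by eventually_elim (use conv convergent_LIMSEQ_iff in blast)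
  moreover have "(\<lambda>x. lim (\<lambda>n. g n x)) \<in> borel_measurable lborel" by measurable
  ultimately show ?thesis by - (rule bexI[where x="\<lambda>x. lim (\<lambda>n. g n x)"])
qed

text \<open>A fast subsequence converges almost everywhere. Fatou's lemma carries the Cauchy bounds
  from the differences \<open>f n - f (r j)\<close> over to \<open>f n - h\<close>, so the pointwise
  limit is also the limit in norm of the whole sequence.\<close>

theorem L2_complete:
  fixes f :: "nat \<Rightarrow> 'a::euclidean_space \<Rightarrow> complex"
  assumes f: "\<And>n. f n \<in> L2"
    and cau: "\<And>e. e > 0 \<Longrightarrow> \<exists>n0. \<forall>m\<ge>n0. \<forall>n\<ge>n0. l2_norm (\<lambda>x. f m x - f n x) < e"
  shows "\<exists>h\<in>L2. (\<lambda>n. l2_norm (\<lambda>x. f n x - h x)) \<longlonglongrightarrow> 0"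
proof -
  have "\<forall>k. \<exists>n0. \<forall>m\<ge>n0. \<forall>n\<ge>n0. l2_norm (\<lambda>x. f m x - f n x) < (1/2) ^ k"
    using cau by auto
  then obtain N where N: "\<And>k m n. m \<ge> N k \<Longrightarrow> n \<ge> N k \<Longrightarrow> l2_norm (\<lambda>x. f m x - f n x) < (1/2) ^ k"
    by metis
  \<comment> \<open>The sum makes \<open>r\<close> increasing with \<open>r k \<ge> N k\<close>; the
    summand \<open>k\<close> gives \<open>r j \<ge> j\<close>, so that \<open>r j\<close> lies
    beyond \<open>N k\<close> as soon as \<open>j\<close> does.\<close>
  define r where "r k = k + (\<Sum>i\<le>k. N i)" for k
  have rN: "r k \<ge> N k" for k
    unfolding r_def using member_le_sum[of k "{..k}" N] by simp
  have rmono: "r k \<le> r (Suc k)" for k by (simp add: r_def)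
  have rk: "r k \<ge> k" for k by (simp add: r_def)
  obtain h where hm [measurable]: "h \<in> borel_measurable lborel"
    and h: "AE x in lborel. (\<lambda>k. f (r k) x) \<longlonglongrightarrow> h x"
  proof -
    have "\<exists>h \<in> borel_measurable lborel. AE x in lborel. (\<lambda>n. f (r n) x) \<longlonglongrightarrow> h x"
    proof (rule L2_complete_fast)
      show "l2_norm (\<lambda>x. f (r (Suc k)) x - f (r k) x) \<le> (1/2) ^ k" for k
        using N[of k "r (Suc k)" "r k"] rN[of k] rmono[of k] by simp
    qed (rule f)
    with that show ?thesis by blast
  qed
  have fm [measurable]: "f n \<in> borel_measurable lborel" for n using L2_measurable[OF f] by simp
  have bd: "(\<integral>\<^sup>+x. ennreal ((cmod (f n x - h x))\<^sup>2) \<partial>lborel) \<le> ennreal (((1/2) ^ k)\<^sup>2)"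
    if "n \<ge> N k" for n k
  proof -
    have "AE x in lborel. (\<lambda>j. ennreal ((cmod (f n x - f (r j) x))\<^sup>2)) \<longlonglongrightarrow> ennreal ((cmod (f n x - h x))\<^sup>2)"
      using h by eventually_elim (intro tendsto_ennrealI tendsto_intros)
    then have "AE x in lborel. ennreal ((cmod (f n x - h x))\<^sup>2)
        = liminf (\<lambda>j. ennreal ((cmod (f n x - f (r j) x))\<^sup>2))"
      by eventually_elim (metis lim_imp_Liminf sequentially_bot)
    then have "(\<integral>\<^sup>+x. ennreal ((cmod (f n x - h x))\<^sup>2) \<partial>lborel)
      = (\<integral>\<^sup>+x. liminf (\<lambda>j. ennreal ((cmod (f n x - f (r j) x))\<^sup>2)) \<partial>lborel)"
      by (rule nn_integral_cong_AE)
    also have "\<dots> \<le> liminf (\<lambda>j. \<integral>\<^sup>+x. ennreal ((cmod (f n x - f (r j) x))\<^sup>2) \<partial>lborel)"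
      by (rule nn_integral_liminf) measurable
    also have "\<dots> \<le> ennreal (((1/2) ^ k)\<^sup>2)"
    proof (rule Liminf_le)
      show "\<forall>\<^sub>F j in sequentially. (\<integral>\<^sup>+x. ennreal ((cmod (f n x - f (r j) x))\<^sup>2) \<partial>lborel) \<le> ennreal (((1/2) ^ k)\<^sup>2)"
        using eventually_ge_at_top[of "N k"]
      proof eventually_elim
        case (elim j)
        have "l2_norm (\<lambda>x. f n x - f (r j) x) \<le> (1/2) ^ k"
          using N[of k n "r j"] that elim rk[of j] by linarith
        then have "(l2_norm (\<lambda>x. f n x - f (r j) x))\<^sup>2 \<le> ((1/2) ^ k)\<^sup>2"
          by (intro power_mono) auto
        then show ?case by (simp add: nn_integral_L2[OF L2_diff[OF f f]] ennreal_leI)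
      qed
    qed simp
    finally show ?thesis .
  qed
  have diff: "(\<lambda>x. f n x - h x) \<in> L2" if "n \<ge> N k" for n k
  proof (rule L2_I)
    show "integrable lborel (\<lambda>x. (cmod (f n x - h x))\<^sup>2)"
      using bd[OF that] by (intro integrableI_nonneg) (auto simp: less_top[symmetric] top_unique)
  qed measurable
  have "h = (\<lambda>x. f (N 0) x - (f (N 0) x - h x))" by simp
  also have "\<dots> \<in> L2" by (intro L2_diff[OF f diff]) auto
  finally have h2: "h \<in> L2" .
  have le: "l2_norm (\<lambda>x. f n x - h x) \<le> (1/2) ^ k" if "n \<ge> N k" for n k
  proof (rule power2_le_imp_le)
    show "(l2_norm (\<lambda>x. f n x - h x))\<^sup>2 \<le> ((1/2) ^ k)\<^sup>2"
      using bd[OF that] by (simp add: nn_integral_L2[OF diff[OF that]])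
  qed simp
  have "(\<lambda>n. l2_norm (\<lambda>x. f n x - h x)) \<longlonglongrightarrow> 0"
  proof (rule LIMSEQ_I)
    fix e :: real assume "e > 0"
    then obtain k where k: "(1/2) ^ k < e" using real_arch_pow_inv[of e "1/2"] by auto
    show "\<exists>n0. \<forall>n\<ge>n0. norm (l2_norm (\<lambda>x. f n x - h x) - 0) < e"
      using le[of k] k by (intro exI[of _ "N k"]) (auto intro: le_less_trans)
  qed
  with h2 show ?thesis by blast
qed

section \<open>Hermite functions on the line\<close>

text \<open>These are the normalised Hermite functions
  \<open>H_k(x) exp(-x^2/2) / sqrt (2^k k! sqrt pi)\<close>. The normalised recurrence serves as
  definition because the whole development uses ladder relations and never the polynomials.\<close>

fun hermf :: "nat \<Rightarrow> real \<Rightarrow> real" where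
  "hermf 0 x = pi powr (-1/4) * exp (- x\<^sup>2 / 2)"
| "hermf (Suc 0) x = sqrt 2 * x * hermf 0 x"
| "hermf (Suc (Suc k)) x =
    (sqrt 2 * x * hermf (Suc k) x - sqrt (real k + 1) * hermf k x) / sqrt (real k + 2)"

text \<open>At \<open>k = 0\<close> the truncated index \<open>k - 1\<close> is harmless because of the factor \<open>sqrt 0\<close>.\<close>

lemma hermf_rec: "x * hermf k x = (sqrt (real k + 1) * hermf (Suc k) x + sqrt k * hermf (k - 1) x) / sqrt 2"
  by (cases k) (auto simp: field_simps)

lemma hermf_rec_up: "sqrt (real k + 1) * hermf (Suc k) x = sqrt 2 * x * hermf k x - sqrt k * hermf (k - 1) x"
  using hermf_rec[of x k] by (simp add: field_simps)

text \<open>This asymmetric form, lowering minus multiplication by \<open>x\<close>, is the one that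
  passes through the recurrence: after differentiation the only foreign term is
  \<open>hermf (j - 1)\<close>, which the recurrence itself eliminates. The symmetric form
  \<open>hermf_deriv\<close> is a corollary.\<close>

lemma hermf_deriv_aux:
  "(hermf k has_real_derivative sqrt 2 * sqrt k * hermf (k - 1) x - x * hermf k x) (at x)"
proof (induction k rule: less_induct)
  case (less k)
  consider "k = 0" | "k = 1" | j where "k = Suc (Suc j)" by (metis One_nat_def old.nat.exhaust)
  then show ?case
  proof cases
    case 1
    have "hermf 0 = (\<lambda>x. pi powr (-1/4) * exp (- x\<^sup>2 / 2))" by (simp add: fun_eq_iff)
    then show ?thesis using 1 by (auto intro!: derivative_eq_intros)
  next
    case 2
    have "hermf (Suc 0) = (\<lambda>x. sqrt 2 * x * (pi powr (-1/4) * exp (- x\<^sup>2 / 2)))" by (simp add: fun_eq_iff)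
    then show ?thesis using 2
      by (auto intro!: derivative_eq_intros simp: field_simps power2_eq_square)
  next
    case 3
    define a where "a = sqrt (real j + 1)"
    define b where "b = sqrt (real j + 2)"
    define c where "c = sqrt (real j)"
    have ab: "a * a = real j + 1" "b * b = real j + 2" "c * c = real j" "b > 0" "a > 0"
      by (auto simp: a_def b_def c_def)
    have eq: "hermf k = (\<lambda>x. (sqrt 2 * x * hermf (Suc j) x - a * hermf j x) / b)"
      using 3 by (simp add: fun_eq_iff a_def b_def)
    have d1: "(hermf (Suc j) has_real_derivative sqrt 2 * a * hermf j x - x * hermf (Suc j) x) (at x)"
      using less[of "Suc j"] 3 by (simp add: a_def add.commute)
    have d2: "(hermf j has_real_derivative sqrt 2 * c * hermf (j - 1) x - x * hermf j x) (at x)"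
      using less[of j] 3 by (simp add: c_def)
    have r: "c * hermf (j - 1) x = sqrt 2 * x * hermf j x - a * hermf (Suc j) x"
      using hermf_rec_up[of j x] by (simp add: a_def c_def)
    have "(hermf k has_real_derivative
      (sqrt 2 * hermf (Suc j) x + sqrt 2 * x * (sqrt 2 * a * hermf j x - x * hermf (Suc j) x)
        - a * (sqrt 2 * c * hermf (j - 1) x - x * hermf j x)) / b) (at x)"
      using DERIV_cdivide[OF DERIV_diff[OF DERIV_mult[OF DERIV_cmult_Id[of "sqrt 2"] d1] DERIV_cmult[OF d2, of a]], of b]
      unfolding eq by (simp add: mult_ac)
    also have "(sqrt 2 * hermf (Suc j) x + sqrt 2 * x * (sqrt 2 * a * hermf j x - x * hermf (Suc j) x)
        - a * (sqrt 2 * c * hermf (j - 1) x - x * hermf j x)) / b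
      = sqrt 2 * b * hermf (Suc j) x - x * hermf k x"
    proof -
      have s2: "sqrt 2 * (sqrt 2 * y) = 2 * y" for y :: real
        by (simp add: mult.assoc[symmetric])
      have "sqrt 2 * hermf (Suc j) x + sqrt 2 * x * (sqrt 2 * a * hermf j x - x * hermf (Suc j) x)
        - a * (sqrt 2 * c * hermf (j - 1) x - x * hermf j x)
        = sqrt 2 * hermf (Suc j) x + 2 * a * x * hermf j x - sqrt 2 * x\<^sup>2 * hermf (Suc j) x
          - a * sqrt 2 * (c * hermf (j - 1) x) + a * x * hermf j x"
        by (simp add: algebra_simps power2_eq_square s2)
      also have "\<dots> = sqrt 2 * hermf (Suc j) x - sqrt 2 * x\<^sup>2 * hermf (Suc j) x
           + (a * a) * sqrt 2 * hermf (Suc j) x + a * x * hermf j x"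
        unfolding r by (simp add: algebra_simps s2)
      also have "\<dots> = sqrt 2 * (b * b) * hermf (Suc j) x - x * (sqrt 2 * x * hermf (Suc j) x - a * hermf j x)"
        unfolding ab by (simp add: algebra_simps power2_eq_square)
      finally have num: "sqrt 2 * hermf (Suc j) x + sqrt 2 * x * (sqrt 2 * a * hermf j x - x * hermf (Suc j) x)
        - a * (sqrt 2 * c * hermf (j - 1) x - x * hermf j x)
        = sqrt 2 * (b * b) * hermf (Suc j) x - x * (sqrt 2 * x * hermf (Suc j) x - a * hermf j x)" .
      show ?thesis unfolding num eq using ab(4) by (simp add: diff_divide_distrib right_diff_distrib)
    qed
    finally show ?thesis using 3 by (simp add: b_def add.commute)
  qed
qed

lemma hermf_deriv:
  "(hermf k has_real_derivative (sqrt k * hermf (k - 1) x - sqrt (real k + 1) * hermf (Suc k) x) / sqrt 2) (at x)"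
proof -
  have "sqrt 2 * sqrt k * hermf (k - 1) x - x * hermf k x
    = (sqrt k * hermf (k - 1) x - sqrt (real k + 1) * hermf (Suc k) x) / sqrt 2"
    unfolding hermf_rec by (simp add: field_simps)
  with hermf_deriv_aux[of k x] show ?thesis by simp
qed

section \<open>Continuity, Gaussian decay and integrability of the Hermite functions\<close>

lemma continuous_on_hermf [continuous_intros]:
  "continuous_on A f \<Longrightarrow> continuous_on A (\<lambda>x. hermf k (f x))"
proof -
  have "continuous_on UNIV (hermf k)"
    by (meson DERIV_isCont hermf_deriv continuous_at_imp_continuous_on)
  then show "continuous_on A f \<Longrightarrow> continuous_on A (\<lambda>x. hermf k (f x))"
    by (rule continuous_on_compose2) auto
qed

lemma hermf_measurable [measurable]: "hermf k \<in> borel_measurable borel"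
  by (intro borel_measurable_continuous_onI continuous_intros)

text \<open>The power is at most \<open>1 + x^(2 j)\<close>, and \<open>x^(2 j)\<close> is, up to a
  constant, a single term of the exponential series of \<open>x^2 / 4\<close>.\<close>

lemma power_gauss_bounded: "\<exists>C. \<forall>x::real. \<bar>x ^ j\<bar> * exp (- x\<^sup>2 / 4) \<le> C"
proof (intro exI allI)
  fix x :: real
  have fact_le: "(x\<^sup>2 / 4) ^ j / fact j \<le> exp (x\<^sup>2 / 4)"
  proof -
    have "(\<Sum>n\<in>{j}. (x\<^sup>2 / 4) ^ n /\<^sub>R fact n) \<le> (\<Sum>n. (x\<^sup>2 / 4) ^ n /\<^sub>R fact n)"
      by (intro sum_le_suminf summable_exp_generic) auto
    then have "(x\<^sup>2 / 4) ^ j /\<^sub>R fact j \<le> exp (x\<^sup>2 / 4)" unfolding exp_def by simp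
    then show ?thesis by (simp only: real_scaleR_def divide_inverse_commute)
  qed
  have "\<bar>x ^ j\<bar> \<le> 1 + \<bar>x ^ j\<bar>\<^sup>2"
    using zero_le_power2[of "\<bar>x ^ j\<bar> - 1"] unfolding power2_diff by simp
  also have "\<bar>x ^ j\<bar>\<^sup>2 = 4 ^ j * fact j * ((x\<^sup>2 / 4) ^ j / fact j)"
  proof -
    have "(x\<^sup>2) ^ j = (x ^ j)\<^sup>2" by (simp only: power2_eq_square power_mult_distrib)
    then show ?thesis by (simp add: power_divide)
  qed
  also have "\<dots> \<le> 4 ^ j * fact j * exp (x\<^sup>2 / 4)"
    using fact_le by (intro mult_left_mono) auto
  finally have "\<bar>x ^ j\<bar> * exp (- x\<^sup>2 / 4) \<le> (1 + 4 ^ j * fact j * exp (x\<^sup>2 / 4)) * exp (- x\<^sup>2 / 4)"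
    by (intro mult_right_mono) auto
  also have "\<dots> = exp (- x\<^sup>2 / 4) + 4 ^ j * fact j"
    by (simp add: distrib_right mult.assoc exp_add[symmetric])
  also have "\<dots> \<le> 1 + 4 ^ j * fact j" by simp
  finally show "\<bar>x ^ j\<bar> * exp (- x\<^sup>2 / 4) \<le> 1 + 4 ^ j * fact j" .
qed

text \<open>Half of the Gaussian exponent is given up to absorb powers of \<open>x\<close>. Each use
  of the recurrence trades one index for one more power, which is why the power \<open>j\<close> is
  kept arbitrary in the induction.\<close>

lemma hermf_decay: "\<exists>C. \<forall>x. \<bar>x ^ j * hermf k x\<bar> \<le> C * exp (- x\<^sup>2 / 4)"
proof (induction k arbitrary: j rule: less_induct)
  case (less k)
  consider "k = 0" | "k = 1" | i where "k = Suc (Suc i)" by (metis One_nat_def old.nat.exhaust)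
  then show ?case
  proof cases
    case 1
    obtain C where C: "\<And>x::real. \<bar>x ^ j\<bar> * exp (- x\<^sup>2 / 4) \<le> C" using power_gauss_bounded by blast
    have "\<bar>x ^ j * hermf 0 x\<bar> \<le> pi powr (-1/4) * C * exp (- x\<^sup>2 / 4)" for x
    proof -
      have "\<bar>x ^ j * hermf 0 x\<bar> = pi powr (-1/4) * (\<bar>x ^ j\<bar> * exp (- x\<^sup>2 / 4)) * exp (- x\<^sup>2 / 4)"
        by (simp add: abs_mult mult.assoc exp_add[symmetric])
      also have "\<dots> \<le> pi powr (-1/4) * C * exp (- x\<^sup>2 / 4)"
        using C[of x] by (intro mult_right_mono mult_left_mono) auto
      finally show ?thesis .
    qed
    then show ?thesis using 1 by blast
  next
    case 2
    obtain C where C: "\<And>x. \<bar>x ^ Suc j * hermf 0 x\<bar> \<le> C * exp (- x\<^sup>2 / 4)"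
      using less[of 0 "Suc j"] 2 by auto
    have "\<bar>x ^ j * hermf 1 x\<bar> \<le> sqrt 2 * C * exp (- x\<^sup>2 / 4)" for x
      using mult_left_mono[OF C[of x], of "sqrt 2"] by (simp add: abs_mult mult_ac)
    then show ?thesis using 2 by blast
  next
    case 3
    obtain C where C: "\<And>x. \<bar>x ^ Suc j * hermf (Suc i) x\<bar> \<le> C * exp (- x\<^sup>2 / 4)"
      using less[of "Suc i" "Suc j"] 3 by auto
    obtain D where D: "\<And>x. \<bar>x ^ j * hermf i x\<bar> \<le> D * exp (- x\<^sup>2 / 4)"
      using less[of i j] 3 by auto
    have "\<bar>x ^ j * hermf k x\<bar> \<le> (sqrt 2 * C + sqrt (real i + 1) * D) / sqrt (real i + 2) * exp (- x\<^sup>2 / 4)" for x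
    proof -
      have "x ^ j * hermf k x = (sqrt 2 * (x ^ Suc j * hermf (Suc i) x) - sqrt (real i + 1) * (x ^ j * hermf i x)) / sqrt (real i + 2)"
        using 3 by (simp add: field_simps)
      then have "\<bar>x ^ j * hermf k x\<bar> = \<bar>sqrt 2 * (x ^ Suc j * hermf (Suc i) x) - sqrt (real i + 1) * (x ^ j * hermf i x)\<bar> / sqrt (real i + 2)"
        by (simp add: abs_divide)
      also have "\<dots> \<le> (sqrt 2 * \<bar>x ^ Suc j * hermf (Suc i) x\<bar> + sqrt (real i + 1) * \<bar>x ^ j * hermf i x\<bar>) / sqrt (real i + 2)"
        by (intro divide_right_mono order_trans[OF abs_triangle_ineq4]) (auto simp: abs_mult)
      also have "\<dots> \<le> (sqrt 2 * (C * exp (- x\<^sup>2 / 4)) + sqrt (real i + 1) * (D * exp (- x\<^sup>2 / 4))) / sqrt (real i + 2)"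
        by (intro divide_right_mono add_mono mult_left_mono C D) auto
      finally show ?thesis by (simp add: field_simps)
    qed
    then show ?thesis by blast
  qed
qed

lemma integrable_gauss: "a > 0 \<Longrightarrow> integrable lborel (\<lambda>x::real. exp (- a * x\<^sup>2))"
proof -
  assume a: "a > 0"
  have "integrable lborel (\<lambda>x. sqrt (2 * pi * (1 / sqrt (2 * a))\<^sup>2) * normal_density 0 (1 / sqrt (2 * a)) x)"
    using a by (intro integrable_mult_right integrable_normal_density) auto
  moreover have "sqrt (2 * pi * (1 / sqrt (2 * a))\<^sup>2) * normal_density 0 (1 / sqrt (2 * a)) x = exp (- a * x\<^sup>2)" for x
    using a by (simp add: normal_density_def power_divide)
  ultimately show ?thesis by simp
qed

lemma hermf_power_bounded: "\<exists>C. \<forall>x. \<bar>x ^ j * hermf k x\<bar> \<le> C"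
proof -
  obtain C where C: "\<And>x. \<bar>x ^ j * hermf k x\<bar> \<le> C * exp (- x\<^sup>2 / 4)" using hermf_decay by blast
  have "C \<ge> 0" using C[of 0] by (auto intro: order_trans[OF abs_ge_zero])
  then have "C * exp (- x\<^sup>2 / 4) \<le> C * 1" for x by (intro mult_left_mono) auto
  with C have "\<bar>x ^ j * hermf k x\<bar> \<le> C" for x using order_trans[of _ "C * exp (- x\<^sup>2 / 4)" C] by simp
  then show ?thesis by blast
qed

lemma hermf_integrable_power_mult: "integrable lborel (\<lambda>x. x ^ j * hermf k x * hermf l x)"
proof -
  obtain C where C: "\<And>x. \<bar>x ^ j * hermf k x\<bar> \<le> C * exp (- x\<^sup>2 / 4)" using hermf_decay by blast
  obtain D where D: "\<And>x. \<bar>x ^ 0 * hermf l x\<bar> \<le> D" using hermf_power_bounded by blast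
  have "integrable lborel (\<lambda>x. C * exp (- (1/4) * x\<^sup>2) * D)"
    using integrable_gauss[of "1/4"] by (intro integrable_mult_left integrable_mult_right) auto
  then show ?thesis
  proof (rule Bochner_Integration.integrable_bound)
    have "\<bar>x ^ j * hermf k x * hermf l x\<bar> \<le> C * exp (- x\<^sup>2 / 4) * D" for x
      unfolding abs_mult[of "x ^ j * hermf k x"] using C[of x] D[of x] by (intro mult_mono) auto
    then show "AE x in lborel. norm (x ^ j * hermf k x * hermf l x) \<le> norm (C * exp (- (1/4) * x\<^sup>2) * D)"
      by (intro AE_I2) (auto intro: order_trans[OF _ abs_ge_self] simp: algebra_simps)
  qed measurable
qed

lemma hermf_integrable_mult [simp]: "integrable lborel (\<lambda>x. hermf k x * hermf l x)"
  using hermf_integrable_power_mult[of 0 k l] by simp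

lemma hermf_tendsto_0:
  "(hermf k \<longlongrightarrow> 0) at_top" "(hermf k \<longlongrightarrow> 0) at_bot"
proof -
  obtain C where C: "\<And>x. \<bar>x ^ 1 * hermf k x\<bar> \<le> C" using hermf_power_bounded by blast
  have le: "\<bar>hermf k x\<bar> \<le> \<bar>C / x\<bar>" if "x \<noteq> 0" for x
    using C[of x] that by (simp add: abs_mult abs_divide field_simps)
  have "((\<lambda>x. C / x) \<longlongrightarrow> 0) at_top" "((\<lambda>x. C / x) \<longlongrightarrow> 0) at_bot" by real_asymp+
  from this[THEN tendsto_rabs_zero] have lim: "((\<lambda>x. \<bar>C / x\<bar>) \<longlongrightarrow> 0) at_top" "((\<lambda>x. \<bar>C / x\<bar>) \<longlongrightarrow> 0) at_bot" .
  show "(hermf k \<longlongrightarrow> 0) at_top"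
    by (rule Lim_null_comparison[OF _ lim(1)]) (rule eventually_mono[OF eventually_gt_at_top[of 0]], use le in \<open>simp del: abs_divide\<close>)
  show "(hermf k \<longlongrightarrow> 0) at_bot"
    by (rule Lim_null_comparison[OF _ lim(2)]) (rule eventually_mono[OF eventually_gt_at_bot[of 0]], use le in \<open>simp del: abs_divide\<close>)
qed

section \<open>Orthonormality on the line and pointwise bounds\<close>

lemma integral_derivative_halfline:
  fixes F f :: "real \<Rightarrow> real"
  assumes F: "\<And>x. (F has_real_derivative f x) (at x)" and f: "continuous_on UNIV f" "integrable lborel f"
    and lim: "(F \<longlongrightarrow> 0) at_bot"
  shows "F x = (\<integral>t. f t * indicator {..x} t \<partial>lborel)"
proof -
  have "(\<lambda>n. \<integral>t. f t * indicator {- real n..x} t \<partial>lborel) \<longlonglongrightarrow> (\<integral>t. f t * indicator {..x} t \<partial>lborel)"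
  proof (rule integral_dominated_convergence[where w="\<lambda>t. \<bar>f t\<bar>"])
    show "AE t in lborel. (\<lambda>n. f t * indicator {- real n..x} t) \<longlonglongrightarrow> f t * indicator {..x} t"
    proof (intro AE_I2 tendsto_eventually)
      fix t
      show "\<forall>\<^sub>F n in sequentially. f t * indicator {- real n..x} t = f t * indicator {..x} t"
        using eventually_ge_at_top[of "nat \<lceil>- t\<rceil>"]
        by eventually_elim (auto simp: indicator_def nat_le_iff ceiling_le_iff)
    qed
  qed (use f in \<open>auto simp: indicator_def\<close>)
  moreover have "\<forall>\<^sub>F n in sequentially. (\<integral>t. f t * indicator {- real n..x} t \<partial>lborel) = F x - F (- real n)"
    using eventually_ge_at_top[of "nat \<lceil>- x\<rceil>"]
  proof eventually_elim
    case (elim n)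
    then have "- real n \<le> x" by (simp add: nat_le_iff ceiling_le_iff)
    then show ?case
      by (intro integral_FTC_Icc_real) (use F f in \<open>auto simp: continuous_on_eq_continuous_at\<close>)
  qed
  ultimately have "(\<lambda>n. F x - F (- real n)) \<longlonglongrightarrow> (\<integral>t. f t * indicator {..x} t \<partial>lborel)"
    by (rule Lim_transform_eventually)
  moreover have "(\<lambda>n. F (- real n)) \<longlonglongrightarrow> 0"
    by (rule filterlim_compose[OF lim]) real_asymp
  from tendsto_diff[OF tendsto_const this] have "(\<lambda>n. F x - F (- real n)) \<longlonglongrightarrow> F x - 0" .
  ultimately show ?thesis using LIMSEQ_unique by fastforce
qed

lemma integral_derivative_line:
  fixes F f :: "real \<Rightarrow> real"
  assumes F: "\<And>x. (F has_real_derivative f x) (at x)" and f: "continuous_on UNIV f" "integrable lborel f"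
    and lim: "(F \<longlongrightarrow> 0) at_bot" "(F \<longlongrightarrow> 0) at_top"
  shows "(\<integral>t. f t \<partial>lborel) = 0"
proof -
  have "(\<lambda>n. \<integral>t. f t * indicator {..real n} t \<partial>lborel) \<longlonglongrightarrow> (\<integral>t. f t \<partial>lborel)"
  proof (rule integral_dominated_convergence[where w="\<lambda>t. \<bar>f t\<bar>"])
    show "AE t in lborel. (\<lambda>n. f t * indicator {..real n} t) \<longlonglongrightarrow> f t"
    proof (intro AE_I2 tendsto_eventually)
      fix t
      show "\<forall>\<^sub>F n in sequentially. f t * indicator {..real n} t = f t"
        using eventually_ge_at_top[of "nat \<lceil>t\<rceil>"]
        by eventually_elim (auto simp: indicator_def nat_le_iff ceiling_le_iff)
    qed
  qed (use f in \<open>auto simp: indicator_def\<close>)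
  then have "(\<lambda>n. F (real n)) \<longlonglongrightarrow> (\<integral>t. f t \<partial>lborel)"
    using integral_derivative_halfline[OF F f lim(1)] by simp
  moreover have "(\<lambda>n. F (real n)) \<longlonglongrightarrow> 0"
    by (rule filterlim_compose[OF lim(2)]) real_asymp
  ultimately show ?thesis using LIMSEQ_unique by blast
qed

declare hermf.simps [simp del]

text \<open>Two linear relations hold between the four neighbouring inner products: the derivative
  of \<open>hermf k * hermf l\<close> integrates to zero, and multiplication by \<open>x\<close> is
  symmetric. Subtracting them leaves the adjointness of raising and lowering.\<close>

lemma hermf_ladder:
  "sqrt (real k + 1) * (\<integral>x. hermf (Suc k) x * hermf l x \<partial>lborel)
    = sqrt l * (\<integral>x. hermf k x * hermf (l - 1) x \<partial>lborel)"
proof -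
  let ?I = "\<lambda>k l. \<integral>x. hermf k x * hermf l x \<partial>lborel"
  let ?A = "sqrt (real k + 1) * ?I (Suc k) l" and ?B = "sqrt k * ?I (k - 1) l"
    and ?C = "sqrt (real l + 1) * ?I k (Suc l)" and ?D = "sqrt l * ?I k (l - 1)"
  have zero: "(\<integral>x. (sqrt k * hermf (k - 1) x - sqrt (real k + 1) * hermf (Suc k) x) / sqrt 2 * hermf l x
      + (sqrt l * hermf (l - 1) x - sqrt (real l + 1) * hermf (Suc l) x) / sqrt 2 * hermf k x \<partial>lborel) = 0"
  proof (rule integral_derivative_line[where F="\<lambda>x. hermf k x * hermf l x"])
    show "((\<lambda>x. hermf k x * hermf l x) \<longlongrightarrow> 0) at_bot" "((\<lambda>x. hermf k x * hermf l x) \<longlongrightarrow> 0) at_top"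
      using tendsto_mult[OF hermf_tendsto_0(2) hermf_tendsto_0(2), of k l]
        tendsto_mult[OF hermf_tendsto_0(1) hermf_tendsto_0(1), of k l] by auto
    show "integrable lborel (\<lambda>x. (sqrt k * hermf (k - 1) x - sqrt (real k + 1) * hermf (Suc k) x) / sqrt 2 * hermf l x
      + (sqrt l * hermf (l - 1) x - sqrt (real l + 1) * hermf (Suc l) x) / sqrt 2 * hermf k x)"
      by (simp add: left_diff_distrib diff_divide_distrib mult.assoc)
  qed (auto intro!: derivative_eq_intros hermf_deriv continuous_intros)
  have arr: "(a - b) / s * c + (d - e) / s * f = (a * c - b * c + d * f - e * f) / s" for a b c d e f s :: real
    by (simp add: diff_divide_distrib add_divide_distrib left_diff_distrib)
  have "(\<lambda>x. (sqrt k * hermf (k - 1) x - sqrt (real k + 1) * hermf (Suc k) x) / sqrt 2 * hermf l x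
      + (sqrt l * hermf (l - 1) x - sqrt (real l + 1) * hermf (Suc l) x) / sqrt 2 * hermf k x)
    = (\<lambda>x. (sqrt k * (hermf (k - 1) x * hermf l x) - sqrt (real k + 1) * (hermf (Suc k) x * hermf l x)
      + sqrt l * (hermf k x * hermf (l - 1) x) - sqrt (real l + 1) * (hermf k x * hermf (Suc l) x)) / sqrt 2)"
    unfolding arr by (simp add: mult_ac)
  then have 1: "?B - ?A + ?D - ?C = 0" using zero by simp
  have "(\<integral>x. (x * hermf k x) * hermf l x \<partial>lborel) = (\<integral>x. (x * hermf l x) * hermf k x \<partial>lborel)"
    by (simp add: mult_ac)
  then have "(\<integral>x. (sqrt (real k + 1) * (hermf (Suc k) x * hermf l x) + sqrt k * (hermf (k - 1) x * hermf l x)) / sqrt 2 \<partial>lborel)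
    = (\<integral>x. (sqrt (real l + 1) * (hermf k x * hermf (Suc l) x) + sqrt l * (hermf k x * hermf (l - 1) x)) / sqrt 2 \<partial>lborel)"
    unfolding hermf_rec by (simp add: field_simps)
  then have 2: "?A + ?B = ?C + ?D" by simp
  from 1 2 show ?thesis by linarith
qed

text \<open>\<open>hermf_ladder\<close> lowers both indices at once, and it gives zero when the
  second index is already 0. What remains is the pair of zeros, a normal density of variance
  1/2.\<close>

lemma hermf_orthonormal: "(\<integral>x. hermf k x * hermf l x \<partial>lborel) = (if k = l then 1 else 0)"
proof -
  let ?I = "\<lambda>k l. \<integral>x. hermf k x * hermf l x \<partial>lborel"
  have comm: "?I k l = ?I l k" for k l by (simp add: mult.commute)
  have base: "?I 0 0 = 1"
  proof -
    have "hermf 0 x * hermf 0 x = normal_density 0 (1 / sqrt 2) x" for x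
    proof -
      have "hermf 0 x * hermf 0 x = (pi powr (-1/4) * pi powr (-1/4)) * (exp (- x\<^sup>2 / 2) * exp (- x\<^sup>2 / 2))"
        by (simp add: hermf.simps)
      also have "pi powr (-1/4) * pi powr (-1/4) = 1 / sqrt pi"
        by (simp add: powr_add[symmetric] powr_minus powr_half_sqrt inverse_eq_divide)
      also have "exp (- x\<^sup>2 / 2) * exp (- x\<^sup>2 / 2) = exp (- x\<^sup>2)"
        by (simp add: exp_add[symmetric])
      also have "1 / sqrt pi * exp (- x\<^sup>2) = normal_density 0 (1 / sqrt 2) x"
        by (simp add: normal_density_def power_divide)
      finally show ?thesis .
    qed
    then show ?thesis by simp
  qed
  have zero: "?I (Suc k) 0 = 0" for k
    using hermf_ladder[of k 0] by (simp add: add_eq_0_iff)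
  have "\<forall>l. ?I k l = (if k = l then 1 else 0)"
  proof (induction k)
    case 0
    show ?case
    proof
      fix l show "?I 0 l = (if 0 = l then 1 else 0)"
        using base zero comm[of 0 l] by (cases l) auto
    qed
  next
    case (Suc k)
    show ?case
    proof
      fix l
      show "?I (Suc k) l = (if Suc k = l then 1 else 0)"
      proof (cases l)
        case (Suc j)
        have "sqrt (real k + 1) * ?I (Suc k) l = sqrt (real j + 1) * ?I k j"
          using hermf_ladder[of k l] Suc by (simp add: add.commute)
        also have "\<dots> = (if k = j then sqrt (real k + 1) else 0)" using Suc.IH by simp
        finally show ?thesis using Suc by (auto simp: add_nonneg_eq_0_iff split: if_splits)
      qed (use zero in simp)
    qed
  qed
  then show ?thesis by blast
qed

text \<open>The derivative of the sum of squares telescopes (Christoffel--Darboux).\<close>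

lemma hermf_sum_sq_deriv:
  "((\<lambda>x. \<Sum>k\<le>K. (hermf k x)\<^sup>2) has_real_derivative
    - sqrt (2 * (real K + 1)) * (hermf K x * hermf (Suc K) x)) (at x)"
proof -
  have r2: "2 * h * (y / sqrt 2) = sqrt 2 * (h * y)" for h y :: real
  proof -
    have "2 * h * (y / sqrt 2) = (2 / sqrt 2) * (h * y)" by simp
    then show ?thesis by (simp only: real_div_sqrt[of 2])
  qed
  have d: "((\<lambda>x. (hermf k x)\<^sup>2) has_real_derivative
      sqrt 2 * (hermf k x * (sqrt k * hermf (k - 1) x - sqrt (real k + 1) * hermf (Suc k) x))) (at x)" for k
    using DERIV_mult[OF hermf_deriv[of k x] hermf_deriv[of k x]] unfolding r2[symmetric] power2_eq_square
    by (rule back_subst[where P="\<lambda>d. DERIV _ x :> d"]) simp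
  show ?thesis
  proof (induction K)
    case 0
    show ?case using d[of 0] by simp
  next
    case (Suc K)
    have s2: "sqrt 2 * (sqrt 2 * y) = 2 * y" for y :: real by (simp add: mult.assoc[symmetric])
    have "- sqrt (2 * (real K + 1)) * (hermf K x * hermf (Suc K) x) +
        sqrt 2 * (hermf (Suc K) x * (sqrt (Suc K) * hermf (Suc K - 1) x - sqrt (real (Suc K) + 1) * hermf (Suc (Suc K)) x))
      = - sqrt (2 * (real (Suc K) + 1)) * (hermf (Suc K) x * hermf (Suc (Suc K)) x)"
      unfolding real_sqrt_mult by (simp add: algebra_simps)
    with DERIV_add[OF Suc d[of "Suc K"]] show ?case by simp
  qed
qed

text \<open>Integrating the telescoped derivative from minus infinity leaves a single product of
  neighbouring Hermite functions, and AM-GM with normalisation bounds its integral by 1. The bound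
  is uniform in \<open>x\<close>; with \<open>K\<close> of order \<open>M^2\<close> it is the factor
  \<open>M\<close> that each free coordinate costs.\<close>

lemma hermf_sum_sq_le: "(\<Sum>k\<le>K. (hermf k x)\<^sup>2) \<le> sqrt (2 * (real K + 1))"
proof -
  let ?f = "\<lambda>t. - sqrt (2 * (real K + 1)) * (hermf K t * hermf (Suc K) t)"
  have "(\<Sum>k\<le>K. (hermf k x)\<^sup>2) = (\<integral>t. ?f t * indicator {..x} t \<partial>lborel)"
  proof (rule integral_derivative_halfline[where F="\<lambda>x. \<Sum>k\<le>K. (hermf k x)\<^sup>2"])
    have "((\<lambda>x. \<Sum>k\<le>K. (hermf k x)\<^sup>2) \<longlongrightarrow> (\<Sum>k\<le>K. 0\<^sup>2)) at_bot"
      by (intro tendsto_sum tendsto_power hermf_tendsto_0)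
    then show "((\<lambda>x. \<Sum>k\<le>K. (hermf k x)\<^sup>2) \<longlongrightarrow> 0) at_bot" by simp
    show "((\<lambda>x. \<Sum>k\<le>K. (hermf k x)\<^sup>2) has_real_derivative ?f y) (at y)" for y
      by (rule hermf_sum_sq_deriv)
    show "integrable lborel ?f" by (intro integrable_mult_right hermf_integrable_mult)
    show "continuous_on UNIV ?f" by (intro continuous_intros)
  qed
  also have "\<dots> \<le> (\<integral>t. sqrt (2 * (real K + 1)) * (((hermf K t * hermf K t) + (hermf (Suc K) t * hermf (Suc K) t)) / 2) \<partial>lborel)"
  proof (rule integral_mono)
    show "integrable lborel (\<lambda>t. ?f t * indicator {..x} t)"
      by (rule integrable_real_mult_indicator) (auto intro!: integrable_mult_right)
    fix t
    have "- (hermf K t * hermf (Suc K) t) \<le> ((hermf K t * hermf K t) + (hermf (Suc K) t * hermf (Suc K) t)) / 2"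
      using zero_le_power2[of "hermf K t + hermf (Suc K) t"] by (simp add: power2_eq_square algebra_simps)
    then have "?f t \<le> sqrt (2 * (real K + 1)) * (((hermf K t * hermf K t) + (hermf (Suc K) t * hermf (Suc K) t)) / 2)"
      using mult_left_mono[of "- (hermf K t * hermf (Suc K) t)" _ "sqrt (2 * (real K + 1))"] by fastforce
    then show "?f t * indicator {..x} t \<le> sqrt (2 * (real K + 1)) * (((hermf K t * hermf K t) + (hermf (Suc K) t * hermf (Suc K) t)) / 2)"
      by (auto simp: indicator_def)
  qed auto
  also have "\<dots> = sqrt (2 * (real K + 1))"
    by (simp add: hermf_orthonormal)
  finally show ?thesis .
qed

text \<open>At the origin the recurrence goes in steps of two and multiplies the square by
  \<open>(j + 1) / (j + 2)\<close>. The left side does not increase along these steps because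
  \<open>(j + 1) * (j + 3) \<le> (j + 2)^2\<close>; odd indices start from the value 0.\<close>

lemma hermf_zero_sq_le: "(hermf m 0)\<^sup>2 * sqrt (real m + 1) \<le> 1"
proof (induction m rule: less_induct)
  case (less m)
  consider "m = 0" | "m = 1" | j where "m = Suc (Suc j)" by (metis One_nat_def old.nat.exhaust)
  then show ?case
  proof cases
    case 1
    have "pi powr (-1/4) \<le> 1" using ge_one_powr_ge_zero[of pi "1/4"] pi_ge_two by (simp add: powr_minus inverse_le_1_iff)
    then show ?thesis using 1 by (auto simp: hermf.simps intro!: power_le_one)
  next
    case 3
    have "(hermf m 0)\<^sup>2 * sqrt (real m + 1) = (real j + 1) / (real j + 2) * ((hermf j 0)\<^sup>2 * sqrt (real m + 1))"
      using 3 by (simp add: hermf.simps power_mult_distrib power_divide)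
    also have "\<dots> \<le> (hermf j 0)\<^sup>2 * sqrt (real j + 1)"
    proof -
      have "(real j + 1) / (real j + 2) * sqrt (real m + 1) \<le> sqrt (real j + 1)"
      proof (rule power2_le_imp_le)
        have "((real j + 1) / (real j + 2) * sqrt (real m + 1))\<^sup>2 = (real j + 1)\<^sup>2 * (real j + 3) / (real j + 2)\<^sup>2"
          using 3 by (simp add: power_mult_distrib power_divide add.commute)
        also have "\<dots> \<le> real j + 1"
        proof -
          have "(real j + 1)\<^sup>2 * (real j + 3) \<le> (real j + 1) * (real j + 2)\<^sup>2"
            by (simp add: power2_eq_square algebra_simps)
          then show ?thesis by (simp add: divide_le_eq)
        qed
        finally show "((real j + 1) / (real j + 2) * sqrt (real m + 1))\<^sup>2 \<le> (sqrt (real j + 1))\<^sup>2" by simp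
      qed simp
      from mult_left_mono[OF this, of "(hermf j 0)\<^sup>2"] show ?thesis by (simp add: mult_ac)
    qed
    also have "\<dots> \<le> 1" using less[of j] 3 by simp
    finally show ?thesis .
  qed (simp add: hermf.simps)
qed

section \<open>Products of Hermite functions\<close>

text \<open>Let X and Y be the raising operators in two variables and read \<open>z^k\<close> as X^k
  Y^(n - k) with n = p + m. Then this is (X + Y)^p (X - Y)^m at Y = 1. Applied to the ground state,
  X^k Y^(n - k) has norm \<open>sqrt (k! (n - k)!)\<close>, which explains the square root in
  \<open>krav\<close>.\<close>

definition kravp :: "nat \<Rightarrow> nat \<Rightarrow> real poly" where
  "kravp p m = [:1, 1:] ^ p * [:- 1, 1:] ^ m"

text \<open>
  The coefficients of the rotation by \<open>pi / 4\<close> on two-dimensional Hermite functions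
  (normalised Kravchuk polynomials). Raising operators act as multiplication by \<open>z + 1\<close> and
  \<open>z - 1\<close> on the generating polynomial.
\<close>

definition krav :: "nat \<Rightarrow> nat \<Rightarrow> nat \<Rightarrow> real" where
  "krav p m k = sqrt (fact k * fact (p + m - k) / (fact p * fact m)) * coeff (kravp p m) k / sqrt 2 ^ (p + m)"

section \<open>Ladder relations and orthonormality of the Kravchuk coefficients\<close>

lemma kravp_Suc: "kravp (Suc p) m = kravp p m + pCons 0 (kravp p m)"
  "kravp p (Suc m) = - kravp p m + pCons 0 (kravp p m)"
proof -
  have "kravp (Suc p) m = [:1, 1:] * kravp p m" by (simp only: kravp_def power_Suc mult.assoc)
  then show "kravp (Suc p) m = kravp p m + pCons 0 (kravp p m)" by simp
  have "kravp p (Suc m) = [:- 1, 1:] * kravp p m" by (simp only: kravp_def power_Suc mult.left_commute)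
  then show "kravp p (Suc m) = - kravp p m + pCons 0 (kravp p m)" by simp
qed

lemma coeff_kravp_0_eq: "k > p + m \<Longrightarrow> coeff (kravp p m) k = 0"
proof -
  assume "k > p + m"
  moreover have "degree (kravp p m) \<le> p + m"
    unfolding kravp_def
    by (rule order_trans[OF degree_mult_le]) (intro add_mono order_trans[OF degree_power_le], auto)
  ultimately show ?thesis by (intro coeff_eq_0) simp
qed

lemma krav_0_eq: "k > p + m \<Longrightarrow> krav p m k = 0"
  by (simp add: krav_def coeff_kravp_0_eq)

text \<open>In homogeneous variables this reads (d/dX + d/dY) ((X + Y)^p (X - Y)^m) = 2 p (X + Y)^(p
  - 1) (X - Y)^m: d/dX contributes the term with \<open>k + 1\<close>, d/dY the term with
  \<open>p + m - k\<close>. \<open>kravp_lower_minus\<close> is its counterpart for d/dX -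
  d/dY.\<close>

lemma kravp_lower_plus:
  "(real k + 1) * coeff (kravp p m) (Suc k) + (real (p + m) - real k) * coeff (kravp p m) k
    = 2 * real p * coeff (kravp (p - 1) m) k"
proof (induction m arbitrary: k)
  case 0
  show ?case
  proof (induction p arbitrary: k)
    case 0
    show ?case by (cases k) (simp_all add: kravp_def)
  next
    case (Suc p)
    note IH = Suc.IH
    have eq: "real p * coeff (kravp p 0) k = real p * (coeff (kravp (p - 1) 0) k + coeff (pCons 0 (kravp (p - 1) 0)) k)" for k
      by (cases p) (auto simp: kravp_Suc)
    show ?case
    proof (cases k)
      case 0
      then show ?thesis using IH[of 0] eq[of 0] by (auto simp: kravp_Suc algebra_simps)
    next
      case (Suc j)
      then show ?thesis using IH[of k] IH[of j] eq[of k] by (simp add: kravp_Suc algebra_simps)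
    qed
  qed
next
  case (Suc m)
  show ?case
  proof (cases k)
    case 0
    then show ?thesis using Suc[of 0] by (simp add: kravp_Suc algebra_simps)
  next
    case (Suc j)
    then show ?thesis using Suc.IH[of k] Suc.IH[of j] by (simp add: kravp_Suc algebra_simps)
  qed
qed

lemma kravp_lower_minus:
  "(real k + 1) * coeff (kravp p m) (Suc k) - (real (p + m) - real k) * coeff (kravp p m) k
    = 2 * real m * coeff (kravp p (m - 1)) k"
proof (induction p arbitrary: k)
  case 0
  show ?case
  proof (induction m arbitrary: k)
    case 0
    show ?case by (cases k) (simp_all add: kravp_def)
  next
    case (Suc m)
    note IH = Suc.IH
    have eq: "real m * coeff (kravp 0 m) k = real m * (- coeff (kravp 0 (m - 1)) k + coeff (pCons 0 (kravp 0 (m - 1))) k)" for k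
      by (cases m) (auto simp: kravp_Suc)
    show ?case
    proof (cases k)
      case 0
      then show ?thesis using IH[of 0] eq[of 0] by (auto simp: kravp_Suc algebra_simps)
    next
      case (Suc j)
      then show ?thesis using IH[of k] IH[of j] eq[of k] by (simp add: kravp_Suc algebra_simps)
    qed
  qed
next
  case (Suc p)
  show ?case
  proof (cases k)
    case 0
    then show ?thesis using Suc[of 0] by (simp add: kravp_Suc algebra_simps)
  next
    case (Suc j)
    then show ?thesis using Suc.IH[of k] Suc.IH[of j] by (simp add: kravp_Suc algebra_simps)
  qed
qed

lemma sqrt_mult_sqrt_fact: "sqrt (real (Suc n)) * sqrt (fact n * x) = sqrt (fact (Suc n) * x)"
  by (simp add: real_sqrt_mult[symmetric] algebra_simps)

lemma sqrt_fact_Suc_left: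
  "sqrt (real k + 1) * sqrt (fact (Suc k) * fact j / x) = sqrt (fact k * fact j / x) * (real k + 1)"
proof -
  have "sqrt (fact (Suc k) * fact j / x) = sqrt (real (Suc k)) * sqrt (fact k * (fact j / x))"
    unfolding sqrt_mult_sqrt_fact by simp
  moreover have "sqrt (real k + 1) * sqrt (real (Suc k)) = real k + 1"
    by (simp add: add.commute)
  ultimately show ?thesis by (metis mult.assoc mult.commute times_divide_eq_right)
qed

lemma sqrt_fact_Suc_right:
  "sqrt (real (Suc j)) * sqrt (fact k * fact (Suc j) / x) = sqrt (fact k * fact j / x) * real (Suc j)"
  using sqrt_fact_Suc_left[of j k x] by (simp only: mult.commute[of "fact k"] of_nat_Suc add.commute)

text \<open>In the four identities below \<open>p + m - k\<close> is truncated; for \<open>k > p + m\<close> all terms vanish.\<close>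

lemma krav_raise_aux:
  assumes n: "p + m + 1 = p' + m'" and f: "fact p' * fact m' = real a * (fact p * fact m)"
    and a: "a > 0" and s: "\<bar>s\<bar> = 1"
    and c: "kravp p' m' = smult s (kravp p m) + pCons 0 (kravp p m)"
  shows "sqrt a * krav p' m' k
    = (sqrt k * krav p m (k - 1) + s * sqrt (real (p + m + 1 - k)) * krav p m k) / sqrt 2"
proof (cases "k \<le> p + m + 1")
  case False
  then show ?thesis using n by (simp add: krav_0_eq)
next
  case True
  let ?n = "p + m"
  let ?F = "fact p * fact m :: real"
  have F: "?F > 0" by simp
  have l: "sqrt a * krav p' m' k = sqrt (fact k * fact (?n + 1 - k) / ?F) * coeff (kravp p' m') k / sqrt 2 ^ (?n + 1)"
    unfolding krav_def n[symmetric] f using a F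
    by (simp add: real_sqrt_mult real_sqrt_divide field_simps)
  have t1: "sqrt k * krav p m (k - 1) = sqrt (fact k * fact (?n + 1 - k) / ?F) * coeff (pCons 0 (kravp p m)) k / sqrt 2 ^ ?n"
  proof (cases k)
    case (Suc j)
    have "sqrt (real k) * sqrt (fact j * (fact (?n - j) / ?F)) = sqrt (fact k * (fact (?n - j) / ?F))"
      unfolding Suc by (rule sqrt_mult_sqrt_fact)
    then show ?thesis using Suc by (simp add: krav_def mult.assoc[symmetric])
  qed simp
  have t2: "sqrt (real (?n + 1 - k)) * krav p m k = sqrt (fact k * fact (?n + 1 - k) / ?F) * coeff (kravp p m) k / sqrt 2 ^ ?n"
  proof (cases "k = ?n + 1")
    case True
    then show ?thesis by (simp add: coeff_kravp_0_eq)
  next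
    case False
    then obtain j where j: "?n - k = j" "?n + 1 - k = Suc j" using True by (metis Suc_diff_le Suc_eq_plus1 le_Suc_eq)
    have "sqrt (real (Suc j)) * sqrt (fact j * (fact k / ?F)) = sqrt (fact (Suc j) * (fact k / ?F))"
      by (rule sqrt_mult_sqrt_fact)
    then show ?thesis unfolding krav_def j by (simp add: mult_ac del: fact_Suc of_nat_Suc)
  qed
  have "(sqrt k * krav p m (k - 1) + s * sqrt (real (?n + 1 - k)) * krav p m k) / sqrt 2
    = (sqrt k * krav p m (k - 1) + s * (sqrt (real (?n + 1 - k)) * krav p m k)) / sqrt 2" by simp
  also have "\<dots> = sqrt (fact k * fact (?n + 1 - k) / ?F) * coeff (kravp p' m') k / sqrt 2 ^ (?n + 1)"
    unfolding t1 t2 c by (simp add: field_simps)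
  finally show ?thesis using l by simp
qed

lemma krav_raise_plus:
  "sqrt (real p + 1) * krav (Suc p) m k
    = (sqrt k * krav p m (k - 1) + sqrt (real (p + m + 1 - k)) * krav p m k) / sqrt 2"
  using krav_raise_aux[of p m "Suc p" m "Suc p" 1 k] by (simp add: kravp_Suc add.commute)

lemma krav_raise_minus:
  "sqrt (real m + 1) * krav p (Suc m) k
    = (sqrt k * krav p m (k - 1) - sqrt (real (p + m + 1 - k)) * krav p m k) / sqrt 2"
  using krav_raise_aux[of p m p "Suc m" "Suc m" "-1" k] by (simp add: kravp_Suc add.commute)

text \<open>Both lowering relations at once: \<open>s\<close> is the sign and \<open>a\<close> the
  index that is lowered. Dividing by the factorials takes \<open>a > 0\<close>, so the two lemmas
  below treat the index 0 separately.\<close>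

lemma krav_lower_aux:
  assumes n: "p + m = p' + m' + 1" and f: "fact p * fact m = real a * (fact p' * fact m')" and a: "a > 0"
    and c: "(real k + 1) * coeff (kravp p m) (Suc k) + s * (real (p + m) - real k) * coeff (kravp p m) k
      = 2 * real a * coeff (kravp p' m') k"
  shows "(sqrt (real k + 1) * krav p m (Suc k) + s * sqrt (real (p + m - k)) * krav p m k) / sqrt 2
    = sqrt a * krav p' m' k"
proof (cases "k < p + m")
  case False
  then show ?thesis using n by (simp add: krav_0_eq)
next
  case True
  define j where "j = p' + m' - k"
  have j: "p' + m' - k = j" "p + m - Suc k = j" "p + m - k = Suc j" "real (p + m) - real k = real (Suc j)"
    using True n by (auto simp: j_def)
  let ?F = "fact p' * fact m' :: real"
  let ?Q = "sqrt (fact k * fact j / (real a * ?F))"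
  have t1: "sqrt (real k + 1) * krav p m (Suc k) = ?Q * ((real k + 1) * coeff (kravp p m) (Suc k)) / sqrt 2 ^ (p + m)"
  proof -
    have "sqrt (real k + 1) * sqrt (fact (Suc k) * fact j / (real a * ?F)) = ?Q * (real k + 1)"
      by (rule sqrt_fact_Suc_left)
    then show ?thesis unfolding krav_def j f by (simp del: fact_Suc)
  qed
  have t2: "sqrt (real (p + m - k)) * krav p m k = ?Q * (real (Suc j) * coeff (kravp p m) k) / sqrt 2 ^ (p + m)"
  proof -
    have "sqrt (real (Suc j)) * sqrt (fact k * fact (Suc j) / (real a * ?F)) = ?Q * real (Suc j)"
      by (rule sqrt_fact_Suc_right)
    then show ?thesis unfolding krav_def j f by (simp del: fact_Suc of_nat_Suc)
  qed
  have "(sqrt (real k + 1) * krav p m (Suc k) + s * sqrt (real (p + m - k)) * krav p m k) / sqrt 2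
     = (sqrt (real k + 1) * krav p m (Suc k) + s * (sqrt (real (p + m - k)) * krav p m k)) / sqrt 2" by simp
  also have "\<dots> = ?Q * ((real k + 1) * coeff (kravp p m) (Suc k) + s * real (Suc j) * coeff (kravp p m) k) / (sqrt 2 ^ (p + m) * sqrt 2)"
    unfolding t1 t2 by (simp add: field_simps)
  also have "(real k + 1) * coeff (kravp p m) (Suc k) + s * real (Suc j) * coeff (kravp p m) k = 2 * real a * coeff (kravp p' m') k"
    using c unfolding j(4) .
  also have "?Q * (2 * real a * coeff (kravp p' m') k) / (sqrt 2 ^ (p + m) * sqrt 2) = sqrt a * krav p' m' k"
  proof -
    have "?Q * real a = sqrt a * sqrt (fact k * fact j / ?F)"
      using a by (simp add: real_sqrt_mult real_sqrt_divide field_simps)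
    moreover have "sqrt 2 ^ (p + m) * sqrt 2 = 2 * sqrt 2 ^ (p' + m')"
      unfolding n by simp
    ultimately show ?thesis unfolding krav_def j by (simp add: mult_ac)
  qed
  finally show ?thesis .
qed

lemma krav_lower_plus:
  "(sqrt (real k + 1) * krav p m (Suc k) + sqrt (real (p + m - k)) * krav p m k) / sqrt 2
    = sqrt p * krav (p - 1) m k"
proof (cases "p = 0")
  \<comment> \<open>For \<open>p = 0\<close> the right side vanishes through \<open>sqrt 0\<close>,
    and the left side has to vanish by \<open>kravp_lower_plus\<close>, whose right side is 0 as
    well.\<close>
  case True
  show ?thesis
  proof (cases "k < m")
    case False
    then show ?thesis using True by (simp add: krav_0_eq)
  next
    case less: True
    define j where "j = m - Suc k"
    have j: "m - Suc k = j" "m - k = Suc j" "real m - real k = real (Suc j)" using less by (auto simp: j_def)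
    have c: "(real k + 1) * coeff (kravp 0 m) (Suc k) + real (Suc j) * coeff (kravp 0 m) k = 0"
      using kravp_lower_plus[of k 0 m] j by simp
    have "sqrt (real k + 1) * sqrt (fact (Suc k) * fact j / fact m) = sqrt (fact k * fact j / fact m) * (real k + 1)"
      by (rule sqrt_fact_Suc_left)
    moreover have "sqrt (real (Suc j)) * sqrt (fact k * fact (Suc j) / fact m) = sqrt (fact k * fact j / fact m) * real (Suc j)"
      by (rule sqrt_fact_Suc_right)
    ultimately have "sqrt (real k + 1) * krav 0 m (Suc k) + sqrt (real (m - k)) * krav 0 m k
      = sqrt (fact k * fact j / fact m) * ((real k + 1) * coeff (kravp 0 m) (Suc k) + real (Suc j) * coeff (kravp 0 m) k) / sqrt 2 ^ m"
      unfolding krav_def using j by (simp add: distrib_left add_divide_distrib mult.assoc[symmetric] del: fact_Suc of_nat_Suc)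
    then show ?thesis using True c by simp
  qed
next
  case False
  then obtain q where "p = Suc q" by (cases p) auto
  then show ?thesis using krav_lower_aux[of p m q m p k 1] kravp_lower_plus[of k p m] by simp
qed

lemma krav_lower_minus:
  "(sqrt (real k + 1) * krav p m (Suc k) - sqrt (real (p + m - k)) * krav p m k) / sqrt 2
    = sqrt m * krav p (m - 1) k"
proof (cases "m = 0")
  case True
  show ?thesis
  proof (cases "k < p")
    case False
    then show ?thesis using True by (simp add: krav_0_eq)
  next
    case less: True
    define j where "j = p - Suc k"
    have j: "p - Suc k = j" "p - k = Suc j" "real p - real k = real (Suc j)" using less by (auto simp: j_def)
    have c: "(real k + 1) * coeff (kravp p 0) (Suc k) - real (Suc j) * coeff (kravp p 0) k = 0"
      using kravp_lower_minus[of k p 0] j by simp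
    have "sqrt (real k + 1) * sqrt (fact (Suc k) * fact j / fact p) = sqrt (fact k * fact j / fact p) * (real k + 1)"
      by (rule sqrt_fact_Suc_left)
    moreover have "sqrt (real (Suc j)) * sqrt (fact k * fact (Suc j) / fact p) = sqrt (fact k * fact j / fact p) * real (Suc j)"
      by (rule sqrt_fact_Suc_right)
    ultimately have "sqrt (real k + 1) * krav p 0 (Suc k) - sqrt (real (p - k)) * krav p 0 k
      = sqrt (fact k * fact j / fact p) * ((real k + 1) * coeff (kravp p 0) (Suc k) - real (Suc j) * coeff (kravp p 0) k) / sqrt 2 ^ p"
      unfolding krav_def using j by (simp add: right_diff_distrib diff_divide_distrib mult.assoc[symmetric] del: fact_Suc of_nat_Suc)
    then show ?thesis using True c by simp
  qed
next
  case False
  then obtain q where "m = Suc q" by (cases m) auto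
  then have q: "p + m = p + q + 1" "fact p * fact m = real m * (fact p * fact q)" "m > 0" "q = m - 1" by simp_all
  have "(real k + 1) * coeff (kravp p m) (Suc k) + (- 1) * (real (p + m) - real k) * coeff (kravp p m) k
    = 2 * real m * coeff (kravp p q) k"
    using kravp_lower_minus[of k p m] unfolding q(4) by (simp only: mult_minus1 minus_mult_left[symmetric] add_uminus_conv_diff)
  from krav_lower_aux[OF q(1-3) this] show ?thesis unfolding q(4) by (simp only: mult_minus1 minus_mult_left[symmetric] add_uminus_conv_diff mult_1_left)
qed

text \<open>Raising and lowering are transposed matrices. Together with the ladder relations this
  moves one step from a Kravchuk row to the row it is paired with.\<close>

lemma krav_adjoint:
  fixes a b :: "nat \<Rightarrow> real"
  shows "(\<Sum>k\<le>Suc n. (sqrt k * a (k - 1) + s * sqrt (real (n + 1 - k)) * a k) * b k)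
    = (\<Sum>k\<le>n. a k * (sqrt (real k + 1) * b (Suc k) + s * sqrt (real (n + 1 - k)) * b k))"
proof -
  have "(\<Sum>k\<le>Suc n. (sqrt k * a (k - 1) + s * sqrt (real (n + 1 - k)) * a k) * b k)
    = (\<Sum>k\<le>Suc n. sqrt k * a (k - 1) * b k) + (\<Sum>k\<le>Suc n. s * sqrt (real (n + 1 - k)) * a k * b k)"
    by (simp only: distrib_right sum.distrib)
  also have "(\<Sum>k\<le>Suc n. sqrt k * a (k - 1) * b k) = (\<Sum>k\<le>n. sqrt (real k + 1) * a k * b (Suc k))"
    by (subst sum.atMost_Suc_shift) (simp add: add.commute)
  also have "(\<Sum>k\<le>Suc n. s * sqrt (real (n + 1 - k)) * a k * b k) = (\<Sum>k\<le>n. s * sqrt (real (n + 1 - k)) * a k * b k)"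
    by simp
  finally show ?thesis by (simp add: sum.distrib[symmetric] algebra_simps)
qed

lemma krav_step_plus:
  assumes "p + m = n" "p' + m' = Suc n"
  shows "sqrt (real p + 1) * (\<Sum>k\<le>Suc n. krav (Suc p) m k * krav p' m' k)
    = sqrt p' * (\<Sum>k\<le>n. krav p m k * krav (p' - 1) m' k)"
proof -
  have "sqrt (real p + 1) * (\<Sum>k\<le>Suc n. krav (Suc p) m k * krav p' m' k)
    = (\<Sum>k\<le>Suc n. (sqrt k * krav p m (k - 1) + 1 * sqrt (real (n + 1 - k)) * krav p m k) * krav p' m' k) / sqrt 2"
    using krav_raise_plus[of p m] assms(1)
    by (simp only: sum_distrib_left sum_divide_distrib mult.assoc[symmetric]) (simp add: algebra_simps)
  also have "\<dots> = (\<Sum>k\<le>n. krav p m k * ((sqrt (real k + 1) * krav p' m' (Suc k) + sqrt (real (n + 1 - k)) * krav p' m' k) / sqrt 2))"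
    unfolding krav_adjoint by (simp add: sum_divide_distrib)
  also have "\<dots> = (\<Sum>k\<le>n. krav p m k * (sqrt p' * krav (p' - 1) m' k))"
    using krav_lower_plus[of _ p' m', unfolded assms(2)] by (simp only: Suc_eq_plus1[symmetric])
  finally show ?thesis by (simp add: sum_distrib_left mult_ac)
qed

lemma krav_step_minus:
  assumes "p + m = n" "p' + m' = Suc n"
  shows "sqrt (real m + 1) * (\<Sum>k\<le>Suc n. krav p (Suc m) k * krav p' m' k)
    = sqrt m' * (\<Sum>k\<le>n. krav p m k * krav p' (m' - 1) k)"
proof -
  have "sqrt (real m + 1) * (\<Sum>k\<le>Suc n. krav p (Suc m) k * krav p' m' k)
    = (\<Sum>k\<le>Suc n. (sqrt k * krav p m (k - 1) + (-1) * sqrt (real (n + 1 - k)) * krav p m k) * krav p' m' k) / sqrt 2"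
    using krav_raise_minus[of m p] assms(1)
    by (simp only: sum_distrib_left sum_divide_distrib mult.assoc[symmetric]) (simp add: algebra_simps)
  also have "\<dots> = (\<Sum>k\<le>n. krav p m k * ((sqrt (real k + 1) * krav p' m' (Suc k) - sqrt (real (n + 1 - k)) * krav p' m' k) / sqrt 2))"
    unfolding krav_adjoint by (simp add: sum_divide_distrib)
  also have "\<dots> = (\<Sum>k\<le>n. krav p m k * (sqrt m' * krav p' (m' - 1) k))"
    using krav_lower_minus[of _ p' m', unfolded assms(2)] by (simp only: Suc_eq_plus1[symmetric])
  finally show ?thesis by (simp add: sum_distrib_left mult_ac)
qed

text \<open>Induction on the total \<open>n\<close>: a row with \<open>p > 0\<close> is raised from
  a row of total \<open>n - 1\<close>, and \<open>krav_step_plus\<close> lowers the other row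
  instead. Symmetry covers \<open>p = 0 < p'\<close>, and \<open>krav_step_minus\<close> covers
  \<open>p = p' = 0\<close>.\<close>

lemma krav_orthonormal:
  "p + m = n \<Longrightarrow> p' + m' = n \<Longrightarrow> (\<Sum>k\<le>n. krav p m k * krav p' m' k) = (if p = p' then 1 else 0)"
proof (induction n arbitrary: p m p' m')
  case 0
  then show ?case by (simp add: krav_def kravp_def)
next
  case (Suc n)
  let ?I = "\<lambda>p m p' m'. \<Sum>k\<le>Suc n. krav p m k * krav p' m' k"
  have pos: "?I (Suc q) m p' m' = (if Suc q = p' then 1 else 0)"
    if "q + m = n" "p' + m' = Suc n" for q m p' m'
  proof -
    have eq: "sqrt (real q + 1) * ?I (Suc q) m p' m' = (if Suc q = p' then sqrt (real q + 1) else 0)"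
    proof (cases p')
      case (Suc r)
      then show ?thesis using krav_step_plus[OF that] Suc.IH[of q m r m'] that by (auto simp: add.commute)
    qed (use krav_step_plus[OF that] in simp)
    have "sqrt (real q + 1) \<noteq> 0" by (simp add: add_nonneg_eq_0_iff)
    with eq show ?thesis by (auto split: if_splits)
  qed
  show ?case
  proof (cases p)
    case (Suc q)
    then show ?thesis using pos[of q m p' m'] Suc.prems by simp
  next
    case p0: 0
    show ?thesis
    proof (cases p')
      case (Suc q)
      then have "?I p' m' p m = 0" using pos[of q m' p m] Suc.prems p0 by simp
      then show ?thesis using Suc p0 by (simp add: mult.commute)
    next
      case 0
      then have "m = Suc n" "m' = Suc n" using Suc.prems p0 by auto
      then have "sqrt (real n + 1) * ?I 0 (Suc n) 0 (Suc n) = sqrt (real n + 1) * 1"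
        using krav_step_minus[of 0 n n 0 "Suc n"] Suc.IH[of 0 n 0 n] by (simp add: add.commute)
      then have "?I 0 (Suc n) 0 (Suc n) = 1"
        by (subst (asm) mult_cancel_left) (auto simp: add_nonneg_eq_0_iff)
      then show ?thesis using p0 0 \<open>m = Suc n\<close> \<open>m' = Suc n\<close> by simp
    qed
  qed
qed

text \<open>Let B_r and B_s lower the indices \<open>p\<close> and \<open>m\<close>. The lowering
  operator in the second rotated variable is (B_r - B_s) / sqrt 2, so its number operator
  \<open>n - k\<close> is half of \<open>p + m\<close> minus the two hopping terms.\<close>

lemma krav_three_term:
  assumes "p + m = n" "k \<le> n"
  shows "real (n - k) * krav p m k = (real n * krav p m k
    - sqrt (real m * (real p + 1)) * krav (Suc p) (m - 1) k
    - sqrt (real p * (real m + 1)) * krav (p - 1) (Suc m) k) / 2"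
proof -
  let ?u = "krav p m"
  let ?X = "sqrt (real k * real (n + 1 - k)) * ?u (k - 1)" and ?Y = "sqrt (real (n - k) * (real k + 1)) * ?u (Suc k)"
  have r2: "sqrt 2 * (sqrt 2 * y) = 2 * y" for y :: real by (simp add: mult.assoc[symmetric])
  have kk: "sqrt (real k) * (sqrt (real k) * y) = real k * y" "sqrt (real (n-k)) * (sqrt (real (n-k)) * y) = real (n-k) * y" for y
    by (simp_all add: mult.assoc[symmetric])
  have Y: "?Y = sqrt (real (n - k)) * (sqrt (real k + 1) * ?u (Suc k))"
    by (simp add: real_sqrt_mult mult.assoc)
  have lp: "sqrt p * krav (p - 1) m j = (sqrt (real j + 1) * ?u (Suc j) + sqrt (real (n - j)) * ?u j) / sqrt 2" for j
    using krav_lower_plus[of j p m] assms(1) by simp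
  have lm: "sqrt m * krav p (m - 1) j = (sqrt (real j + 1) * ?u (Suc j) - sqrt (real (n - j)) * ?u j) / sqrt 2" for j
    using krav_lower_minus[of j p m] assms(1) by simp
  have shift: "sqrt (real k) * f (k - 1) = sqrt (real k) * (if k = 0 then 0 else f (k - 1))" for f :: "nat \<Rightarrow> real"
    by simp
  have lm': "sqrt k * (sqrt m * krav p (m - 1) (k - 1)) = (real k * ?u k - ?X) / sqrt 2"
  proof (cases k)
    case (Suc j)
    then show ?thesis using lm[of j] kk(1) by (simp add: real_sqrt_mult right_diff_distrib mult.assoc Suc_diff_Suc add.commute)
  qed simp
  have lp': "sqrt k * (sqrt p * krav (p - 1) m (k - 1)) = (real k * ?u k + ?X) / sqrt 2"
  proof (cases k)
    case (Suc j)
    then show ?thesis using lp[of j] kk(1) by (simp add: real_sqrt_mult distrib_left mult.assoc Suc_diff_Suc add.commute)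
  qed simp
  \<comment> \<open>\<open>A\<close> and \<open>B\<close> evaluate the two hopping terms by lowering
    one index and raising the other. The neighbours \<open>?X\<close> and \<open>?Y\<close> enter
    them with opposite signs and cancel in the sum.\<close>
  have A: "sqrt (real m * (real p + 1)) * krav (Suc p) (m - 1) k = (real k * ?u k - ?X + ?Y - real (n - k) * ?u k) / 2"
  proof (cases m)
    case 0
    have "k = n \<or> k < n" using assms by auto
    have "sqrt m * (sqrt k * krav p (m - 1) (k - 1) + sqrt (real (n - k)) * krav p (m - 1) k) = 0" using 0 by simp
    then have "sqrt k * (sqrt m * krav p (m - 1) (k - 1)) + sqrt (real (n - k)) * (sqrt m * krav p (m - 1) k) = 0"
      by (simp add: algebra_simps)
    then have "(real k * ?u k - ?X + (?Y - real (n - k) * ?u k)) / sqrt 2 = 0"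
      unfolding lm' unfolding lm[of k] using kk(2) by (simp add: real_sqrt_mult right_diff_distrib mult.assoc add_divide_distrib)
    then show ?thesis using 0 by simp
  next
    case (Suc q)
    have nq: "p + q + 1 - k = n - k" using assms Suc by simp
    have "sqrt (real m * (real p + 1)) * krav (Suc p) (m - 1) k = sqrt m * (sqrt (real p + 1) * krav (Suc p) q k)"
      using Suc by (simp add: real_sqrt_mult)
    also have "\<dots> = (sqrt k * (sqrt m * krav p q (k - 1)) + sqrt (real (n - k)) * (sqrt m * krav p q k)) / sqrt 2"
      unfolding krav_raise_plus nq by (simp add: algebra_simps)
    also have "\<dots> = ((real k * ?u k - ?X) / sqrt 2 + (?Y - real (n - k) * ?u k) / sqrt 2) / sqrt 2"
      using lm' lm[of k] Suc kk(2) by (simp add: real_sqrt_mult right_diff_distrib mult.assoc)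
    also have "\<dots> = (real k * ?u k - ?X + ?Y - real (n - k) * ?u k) / 2"
      by (simp add: field_simps)
    finally show ?thesis .
  qed
  have B: "sqrt (real p * (real m + 1)) * krav (p - 1) (Suc m) k = (real k * ?u k + ?X - ?Y - real (n - k) * ?u k) / 2"
  proof (cases p)
    case 0
    have "sqrt k * (sqrt p * krav (p - 1) m (k - 1)) - sqrt (real (n - k)) * (sqrt p * krav (p - 1) m k) = 0"
      using 0 by simp
    then have "(real k * ?u k + ?X - (?Y + real (n - k) * ?u k)) / sqrt 2 = 0"
      unfolding lp' unfolding lp[of k] Y using kk(2) by (simp add: distrib_left mult.assoc diff_divide_distrib)
    then show ?thesis using 0 by simp
  next
    case (Suc q)
    have nq: "q + m + 1 - k = n - k" using assms Suc by simp
    have "sqrt (real p * (real m + 1)) * krav (p - 1) (Suc m) k = sqrt p * (sqrt (real m + 1) * krav q (Suc m) k)"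
      using Suc by (simp add: real_sqrt_mult)
    also have "\<dots> = (sqrt k * (sqrt p * krav q m (k - 1)) - sqrt (real (n - k)) * (sqrt p * krav q m k)) / sqrt 2"
      unfolding krav_raise_minus nq by (simp add: algebra_simps)
    also have "\<dots> = ((real k * ?u k + ?X) / sqrt 2 - (?Y + real (n - k) * ?u k) / sqrt 2) / sqrt 2"
      unfolding Y using lp' lp[of k] Suc kk(2) by (simp add: distrib_left mult.assoc)
    also have "\<dots> = (real k * ?u k + ?X - ?Y - real (n - k) * ?u k) / 2"
      by (simp add: field_simps)
    finally show ?thesis .
  qed
  have "real n * ?u k = real k * ?u k + real (n - k) * ?u k"
    using assms by (simp add: distrib_right[symmetric])
  moreover have "nu = ku + ju \<Longrightarrow> ju = (nu - (ku - X + Y - ju) / 2 - (ku + X - Y - ju) / 2) / 2"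
    for nu ku ju X Y :: real by (simp add: field_simps)
  ultimately show ?thesis unfolding A B by blast
qed

section \<open>Rotation of two-dimensional Hermite functions by pi / 4\<close>

lemma raise_lower_hermf:
  "(x + s * y) * (\<Sum>k\<le>n. a k * hermf k x * hermf (n - k) y)
    = ((\<Sum>k\<le>Suc n. (sqrt k * a (k - 1) + s * sqrt (real (n + 1 - k)) * a k) * hermf k x * hermf (Suc n - k) y)
      + (\<Sum>k<n. (sqrt (real k + 1) * a (Suc k) + s * sqrt (real (n - k)) * a k) * hermf k x * hermf (n - 1 - k) y)) / sqrt 2"
proof -
  have x: "x * (\<Sum>k\<le>n. a k * hermf k x * hermf (n - k) y)
    = ((\<Sum>k\<le>n. sqrt (real k + 1) * a k * hermf (Suc k) x * hermf (n - k) y)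
       + (\<Sum>k\<le>n. sqrt k * a k * hermf (k - 1) x * hermf (n - k) y)) / sqrt 2"
  proof -
    have "x * (a k * hermf k x * hermf (n - k) y)
      = (sqrt (real k + 1) * a k * hermf (Suc k) x * hermf (n - k) y + sqrt k * a k * hermf (k - 1) x * hermf (n - k) y) / sqrt 2" for k
    proof -
      have "x * (a k * hermf k x * hermf (n - k) y) = (x * hermf k x) * (a k * hermf (n - k) y)" by simp
      then show ?thesis unfolding hermf_rec by (simp add: algebra_simps)
    qed
    then show ?thesis by (simp only: sum_distrib_left sum_divide_distrib[symmetric] sum.distrib)
  qed
  have y: "y * (\<Sum>k\<le>n. a k * hermf k x * hermf (n - k) y)
    = ((\<Sum>k\<le>n. sqrt (real (n + 1 - k)) * a k * hermf k x * hermf (Suc n - k) y)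
       + (\<Sum>k\<le>n. sqrt (real (n - k)) * a k * hermf k x * hermf (n - k - 1) y)) / sqrt 2"
  proof -
    have "y * (a k * hermf k x * hermf (n - k) y)
      = (sqrt (real (n + 1 - k)) * a k * hermf k x * hermf (Suc n - k) y + sqrt (real (n - k)) * a k * hermf k x * hermf (n - k - 1) y) / sqrt 2"
      if "k \<le> n" for k
    proof -
      have *: "Suc n - k = Suc (n - k)" "real (n + 1 - k) = real (n - k) + 1" using that by auto
      have "y * (a k * hermf k x * hermf (n - k) y) = (y * hermf (n - k) y) * (a k * hermf k x)" by simp
      then show ?thesis unfolding hermf_rec * by (simp add: algebra_simps)
    qed
    then have "y * (\<Sum>k\<le>n. a k * hermf k x * hermf (n - k) y)
      = (\<Sum>k\<le>n. (sqrt (real (n + 1 - k)) * a k * hermf k x * hermf (Suc n - k) y + sqrt (real (n - k)) * a k * hermf k x * hermf (n - k - 1) y) / sqrt 2)"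
      unfolding sum_distrib_left by (intro sum.cong refl) blast
    then show ?thesis by (simp only: sum_divide_distrib[symmetric] sum.distrib)
  qed
  have 1: "(\<Sum>k\<le>n. sqrt (real k + 1) * a k * hermf (Suc k) x * hermf (n - k) y)
    = (\<Sum>k\<le>Suc n. sqrt k * a (k - 1) * hermf k x * hermf (Suc n - k) y)"
    by (subst sum.atMost_Suc_shift) (simp add: add.commute)
  have 2: "(\<Sum>k\<le>n. sqrt k * a k * hermf (k - 1) x * hermf (n - k) y)
    = (\<Sum>k<n. sqrt (real k + 1) * a (Suc k) * hermf k x * hermf (n - 1 - k) y)"
  proof (cases n)
    case (Suc m)
    show ?thesis unfolding Suc by (subst sum.atMost_Suc_shift) (simp add: add.commute lessThan_Suc_atMost)
  qed simp
  have 3: "(\<Sum>k\<le>n. sqrt (real (n + 1 - k)) * a k * hermf k x * hermf (Suc n - k) y)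
    = (\<Sum>k\<le>Suc n. sqrt (real (n + 1 - k)) * a k * hermf k x * hermf (Suc n - k) y)"
    by simp
  have 4: "(\<Sum>k\<le>n. sqrt (real (n - k)) * a k * hermf k x * hermf (n - k - 1) y)
    = (\<Sum>k<n. sqrt (real (n - k)) * a k * hermf k x * hermf (n - 1 - k) y)"
    by (simp add: lessThan_Suc_atMost[symmetric] diff_commute)
  have "(x + s * y) * (\<Sum>k\<le>n. a k * hermf k x * hermf (n - k) y)
    = x * (\<Sum>k\<le>n. a k * hermf k x * hermf (n - k) y) + s * (y * (\<Sum>k\<le>n. a k * hermf k x * hermf (n - k) y))"
    by (simp add: algebra_simps)
  also have "\<dots> = ((\<Sum>k\<le>Suc n. sqrt k * a (k - 1) * hermf k x * hermf (Suc n - k) y)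
      + s * (\<Sum>k\<le>Suc n. sqrt (real (n + 1 - k)) * a k * hermf k x * hermf (Suc n - k) y)
      + ((\<Sum>k<n. sqrt (real k + 1) * a (Suc k) * hermf k x * hermf (n - 1 - k) y)
      + s * (\<Sum>k<n. sqrt (real (n - k)) * a k * hermf k x * hermf (n - 1 - k) y))) / sqrt 2"
    unfolding x y 1 2 3 4 by (simp only: add_divide_distrib times_divide_eq_right distrib_left ac_simps)
  finally show ?thesis
    by (simp only: sum_distrib_left sum.distrib[symmetric] distrib_right mult.assoc)
qed

text \<open>By \<open>hermf_rec_up\<close> a Hermite function in a rotated variable is raised by
  multiplying with \<open>x + y\<close> or \<open>x - y\<close> and subtracting the lowered term.
  \<open>raise_lower_hermf\<close> splits the product into the levels \<open>n\<close> and
  \<open>n - 2\<close>; the lower part cancels the subtracted term, and the upper part is the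
  raising relation for \<open>krav\<close>.\<close>

lemma hermf_rotation:
  "p + m = n \<Longrightarrow> hermf p ((x + y) / sqrt 2) * hermf m ((x - y) / sqrt 2)
    = (\<Sum>k\<le>n. krav p m k * hermf k x * hermf (n - k) y)"
proof (induction n arbitrary: p m rule: less_induct)
  case (less n)
  let ?r = "(x + y) / sqrt 2" and ?s = "(x - y) / sqrt 2"
  let ?P = "\<lambda>p m n. \<Sum>k\<le>n. krav p m k * hermf k x * hermf (n - k) y"
  have r2: "sqrt 2 * ?r = x + y" "sqrt 2 * ?s = x - y" by simp_all
  consider "p = 0" "m = 0" | q where "p = Suc q" | q where "p = 0" "m = Suc q" by (cases p; cases m) auto
  then show ?case
  proof cases
    case 1
    \<comment> \<open>The ground state is a Gaussian and hence invariant under rotation.\<close>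
    have e: "- ?r\<^sup>2 / 2 + - ?s\<^sup>2 / 2 = - x\<^sup>2 / 2 + - y\<^sup>2 / 2"
      by (simp add: power_divide power2_sum power2_diff field_simps)
    have "exp (- ?r\<^sup>2 / 2) * exp (- ?s\<^sup>2 / 2) = exp (- x\<^sup>2 / 2) * exp (- y\<^sup>2 / 2)"
      unfolding exp_add[symmetric] e ..
    then have "hermf 0 ?r * hermf 0 ?s = hermf 0 x * hermf 0 y"
      unfolding hermf.simps by (simp only: mult.assoc mult.left_commute[of "exp _" "pi powr _"])
    then show ?thesis using 1 less.prems by (simp add: krav_def kravp_def)
  next
    case (2 q)
    define j where "j = q + m"
    have n: "n = Suc j" "q + m = j" using less.prems 2 by (auto simp: j_def)
    \<comment> \<open>The lower part cancels: \<open>krav_lower_plus\<close> turns its coefficients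
      into a Kravchuk row of total \<open>j - 1\<close>, which the induction hypothesis sums up
      again. For \<open>q = 0\<close> all coefficients vanish.\<close>
    have low: "(\<Sum>k<j. (sqrt (real k + 1) * krav q m (Suc k) + 1 * sqrt (real (j - k)) * krav q m k) * hermf k x * hermf (j - 1 - k) y) / sqrt 2
       = sqrt q * (hermf (q - 1) ?r * hermf m ?s)"
    proof (cases q)
      case 0
      have "(sqrt (real k + 1) * krav q m (Suc k) + sqrt (real (j - k)) * krav q m k) / sqrt 2 = 0" for k
        using krav_lower_plus[of k q m] n 0 by simp
      then have z: "sqrt (real k + 1) * krav q m (Suc k) + 1 * sqrt (real (j - k)) * krav q m k = 0" for k
        by simp
      show ?thesis unfolding z using 0 by simp
    next
      case (Suc i)
      have "(\<Sum>k<j. (sqrt (real k + 1) * krav q m (Suc k) + 1 * sqrt (real (j - k)) * krav q m k) * hermf k x * hermf (j - 1 - k) y) / sqrt 2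
        = (\<Sum>k<j. sqrt q * (krav (q - 1) m k * hermf k x * hermf (j - 1 - k) y))"
        unfolding sum_divide_distrib
      proof (intro sum.cong refl)
        fix k
        have "(sqrt (real k + 1) * krav q m (Suc k) + sqrt (real (j - k)) * krav q m k) / sqrt 2 = sqrt q * krav (q - 1) m k"
          using krav_lower_plus[of k q m] n by simp
        then show "(sqrt (real k + 1) * krav q m (Suc k) + 1 * sqrt (real (j - k)) * krav q m k) * hermf k x * hermf (j - 1 - k) y / sqrt 2
          = sqrt q * (krav (q - 1) m k * hermf k x * hermf (j - 1 - k) y)"
          by (metis (no_types, opaque_lifting) mult.assoc mult_1 times_divide_eq_left)
      qed
      also have "\<dots> = sqrt q * ?P (q - 1) m (j - 1)"
        using Suc n by (simp only: sum_distrib_left) (auto intro!: sum.cong)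
      also have "?P (q - 1) m (j - 1) = hermf (q - 1) ?r * hermf m ?s"
        using less.IH[of "j - 1" "q - 1" m] Suc n by simp
      finally show ?thesis .
    qed
    have "sqrt (real q + 1) * (hermf p ?r * hermf m ?s) = (sqrt (real q + 1) * hermf (Suc q) ?r) * hermf m ?s"
      using 2 by simp
    also have "\<dots> = (x + 1 * y) * (hermf q ?r * hermf m ?s) - sqrt q * (hermf (q - 1) ?r * hermf m ?s)"
      unfolding hermf_rec_up r2(1) by (simp add: algebra_simps)
    also have "hermf q ?r * hermf m ?s = ?P q m j"
      using less.IH[of j q m] n by simp
    also have "(x + 1 * y) * ?P q m j - sqrt q * (hermf (q - 1) ?r * hermf m ?s)
      = (\<Sum>k\<le>Suc j. (sqrt k * krav q m (k - 1) + 1 * sqrt (real (j + 1 - k)) * krav q m k) * hermf k x * hermf (Suc j - k) y) / sqrt 2"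
      unfolding raise_lower_hermf low[symmetric] by (simp only: add_divide_distrib)
    also have "\<dots> = (\<Sum>k\<le>Suc j. (sqrt (real q + 1) * krav (Suc q) m k) * hermf k x * hermf (Suc j - k) y)"
      unfolding krav_raise_plus n sum_divide_distrib by (intro sum.cong refl) simp
    finally have "sqrt (real q + 1) * (hermf p ?r * hermf m ?s) = sqrt (real q + 1) * ?P p m n"
      using 2 n by (simp only: sum_distrib_left mult.assoc)
    moreover have "sqrt (real q + 1) \<noteq> 0" by (simp add: add_nonneg_eq_0_iff)
    ultimately show ?thesis by (simp only: mult_cancel_left simp_thms)
  next
    case (3 q)
    have n: "n = Suc q" using less.prems 3 by auto
    have low: "(\<Sum>k<q. (sqrt (real k + 1) * krav 0 q (Suc k) + (-1) * sqrt (real (q - k)) * krav 0 q k) * hermf k x * hermf (q - 1 - k) y) / sqrt 2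
       = sqrt q * (hermf 0 ?r * hermf (q - 1) ?s)"
    proof (cases q)
      case (Suc i)
      have "(\<Sum>k<q. (sqrt (real k + 1) * krav 0 q (Suc k) + (-1) * sqrt (real (q - k)) * krav 0 q k) * hermf k x * hermf (q - 1 - k) y) / sqrt 2
        = (\<Sum>k<q. sqrt q * (krav 0 (q - 1) k * hermf k x * hermf (q - 1 - k) y))"
        unfolding sum_divide_distrib
      proof (intro sum.cong refl)
        fix k
        have "(sqrt (real k + 1) * krav 0 q (Suc k) + (-1) * sqrt (real (q - k)) * krav 0 q k) / sqrt 2 = sqrt q * krav 0 (q - 1) k"
          using krav_lower_minus[of k 0 q] by simp
        then show "(sqrt (real k + 1) * krav 0 q (Suc k) + (-1) * sqrt (real (q - k)) * krav 0 q k) * hermf k x * hermf (q - 1 - k) y / sqrt 2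
          = sqrt q * (krav 0 (q - 1) k * hermf k x * hermf (q - 1 - k) y)"
          by (metis (no_types, opaque_lifting) mult.assoc times_divide_eq_left)
      qed
      also have "\<dots> = sqrt q * ?P 0 (q - 1) (q - 1)"
        unfolding Suc by (simp add: sum_distrib_left lessThan_Suc_atMost del: sum.lessThan_Suc)
      also have "?P 0 (q - 1) (q - 1) = hermf 0 ?r * hermf (q - 1) ?s"
        using less.IH[of "q - 1" 0 "q - 1"] Suc n by simp
      finally show ?thesis .
    qed simp
    have "sqrt (real q + 1) * (hermf p ?r * hermf m ?s) = (sqrt (real q + 1) * hermf (Suc q) ?s) * hermf 0 ?r"
      using 3 by simp
    also have "\<dots> = (x + (-1) * y) * (hermf 0 ?r * hermf q ?s) - sqrt q * (hermf 0 ?r * hermf (q - 1) ?s)"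
      unfolding hermf_rec_up r2(2) by (simp add: algebra_simps)
    also have "hermf 0 ?r * hermf q ?s = ?P 0 q q"
      using less.IH[of q 0 q] n by simp
    also have "(x + (-1) * y) * ?P 0 q q - sqrt q * (hermf 0 ?r * hermf (q - 1) ?s)
      = (\<Sum>k\<le>Suc q. (sqrt k * krav 0 q (k - 1) + (-1) * sqrt (real (q + 1 - k)) * krav 0 q k) * hermf k x * hermf (Suc q - k) y) / sqrt 2"
      unfolding raise_lower_hermf low[symmetric] by (simp only: add_divide_distrib)
    also have "\<dots> = (\<Sum>k\<le>Suc q. (sqrt (real q + 1) * krav 0 (Suc q) k) * hermf k x * hermf (Suc q - k) y)"
      unfolding krav_raise_minus sum_divide_distrib by (intro sum.cong refl) simp
    finally have "sqrt (real q + 1) * (hermf p ?r * hermf m ?s) = sqrt (real q + 1) * ?P p m n"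
      using 3 n by (simp only: sum_distrib_left mult.assoc)
    moreover have "sqrt (real q + 1) \<noteq> 0" by (simp add: add_nonneg_eq_0_iff)
    ultimately show ?thesis by (simp only: mult_cancel_left simp_thms)
  qed
qed

text \<open>The rotation at the point \<open>(sqrt 2 * x, 0)\<close>, where both rotated arguments
  equal \<open>x\<close>.\<close>

lemma hermf_product:
  "hermf p x * hermf m x = (\<Sum>k\<le>p + m. krav p m k * hermf (p + m - k) 0 * hermf k (sqrt 2 * x))"
  using hermf_rotation[of p m "p + m" "sqrt 2 * x" 0] by (simp add: mult_ac)

text \<open>
  \<open>n - k\<close> is the energy in the direction \<open>x - y\<close>. If \<open>p\<close> carries almost all of the energy
  \<open>p + m = n\<close>, then \<open>x - y\<close> carries a fixed proportion of it, up to exponentially small tails.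
  The tridiagonal operator \<open>A\<close> below is \<open>n - k + 1\<close> in the basis indexed by \<open>p\<close>; it is bounded
  below by \<open>n / 4\<close> on the range where \<open>m\<close> is at most \<open>n / 16\<close>, and a cut-off argument transfers this to its inverse.
\<close>

context
  fixes n :: nat and z :: "nat \<Rightarrow> real"
  assumes n: "n \<ge> 1"
begin

private definition e :: "nat \<Rightarrow> real" where "e p = sqrt ((real p + 1) * real (n - p))"

private definition A :: "nat \<Rightarrow> real" where
  "A p = (real n / 2 + 1) * z p - (e p * z (Suc p) + sqrt (real p * (real (n - p) + 1)) * z (p - 1)) / 2"

private lemma A_form:
  "(\<Sum>p\<le>n. w p * A p) = (real n / 2 + 1) * (\<Sum>p\<le>n. w p * z p)
    - (\<Sum>p<n. e p * (w p * z (Suc p) + w (Suc p) * z p)) / 2"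
proof -
  have 1: "(\<Sum>p\<le>n. w p * (e p * z (Suc p))) = (\<Sum>p<n. e p * (w p * z (Suc p)))"
    by (simp add: lessThan_Suc_atMost[symmetric] e_def mult_ac)
  have 2: "(\<Sum>p\<le>n. w p * (sqrt (real p * (real (n - p) + 1)) * z (p - 1))) = (\<Sum>p<n. e p * (w (Suc p) * z p))"
  proof -
    have "w (Suc p) * (sqrt (real (Suc p) * (real (n - Suc p) + 1)) * z p) = e p * (w (Suc p) * z p)" if "p < n" for p
    proof -
      have "real (n - Suc p) + 1 = real (n - p)" using that by simp
      then show ?thesis by (simp add: e_def add.commute)
    qed
    then have "(\<Sum>p<n. w (Suc p) * (sqrt (real (Suc p) * (real (n - Suc p) + 1)) * z (Suc p - 1))) = (\<Sum>p<n. e p * (w (Suc p) * z p))"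
      by (intro sum.cong refl) (simp only: diff_Suc_1 lessThan_iff)
    then show ?thesis unfolding sum.atMost_shift
      by (simp only: of_nat_0 mult_zero_left real_sqrt_zero mult_zero_right add_0)
  qed
  have "(\<Sum>p\<le>n. w p * A p) = (\<Sum>p\<le>n. (real n / 2 + 1) * (w p * z p)
      - (w p * (e p * z (Suc p)) + w p * (sqrt (real p * (real (n - p) + 1)) * z (p - 1))) / 2)"
    unfolding A_def by (intro sum.cong refl) (simp add: field_simps)
  also have "\<dots> = (real n / 2 + 1) * (\<Sum>p\<le>n. w p * z p)
     - ((\<Sum>p<n. e p * (w p * z (Suc p))) + (\<Sum>p<n. e p * (w (Suc p) * z p))) / 2"
    by (simp only: sum_subtractf sum_distrib_left sum_divide_distrib[symmetric] sum.distrib 1 2)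
  finally show ?thesis by (simp only: sum.distrib[symmetric] distrib_left)
qed

text \<open>The form of \<open>A - 1\<close> is that of \<open>n - k\<close>, so it is nonnegative.
  Directly: complete the square of \<open>sqrt (p + 1) * z (Suc p) - sqrt (n - p) * z p\<close>; the
  weights that meet at the site \<open>p\<close> are \<open>p\<close> and \<open>n - p\<close>, with
  sum \<open>n\<close>.\<close>

private lemma A_ge: "(\<Sum>p\<le>n. (z p)\<^sup>2) \<le> (\<Sum>p\<le>n. z p * A p)"
proof -
  have "e p * (z p * z (Suc p) + z (Suc p) * z p) \<le> (real p + 1) * (z (Suc p))\<^sup>2 + real (n - p) * (z p)\<^sup>2" for p
  proof -
    have "e p = sqrt (real p + 1) * sqrt (real (n - p))" by (simp add: e_def real_sqrt_mult)
    then show ?thesis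
      using zero_le_power2[of "sqrt (real p + 1) * z (Suc p) - sqrt (real (n - p)) * z p"]
      by (simp add: power2_diff power_mult_distrib mult_ac)
  qed
  then have "(\<Sum>p<n. e p * (z p * z (Suc p) + z (Suc p) * z p))
     \<le> (\<Sum>p<n. (real p + 1) * (z (Suc p))\<^sup>2 + real (n - p) * (z p)\<^sup>2)" by (intro sum_mono)
  also have "\<dots> = (\<Sum>p<n. real (Suc p) * (z (Suc p))\<^sup>2) + (\<Sum>p<n. real (n - p) * (z p)\<^sup>2)"
    by (simp add: sum.distrib add.commute)
  also have "(\<Sum>p<n. real (Suc p) * (z (Suc p))\<^sup>2) = (\<Sum>p\<le>n. real p * (z p)\<^sup>2)"
    unfolding sum.atMost_shift[of _ n] by simp
  also have "(\<Sum>p<n. real (n - p) * (z p)\<^sup>2) = (\<Sum>p\<le>n. real (n - p) * (z p)\<^sup>2)"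
    by (simp add: lessThan_Suc_atMost[symmetric])
  also have "(\<Sum>p\<le>n. real p * (z p)\<^sup>2) + (\<Sum>p\<le>n. real (n - p) * (z p)\<^sup>2) = real n * (\<Sum>p\<le>n. (z p)\<^sup>2)"
    by (simp add: sum.distrib[symmetric] distrib_right[symmetric] sum_distrib_left of_nat_diff)
  finally show ?thesis unfolding A_form by (simp add: power2_eq_square algebra_simps)
qed

text \<open>\<open>z\<close> is the inverse of \<open>A\<close> applied to \<open>c\<close>. The
  equation is tested against \<open>\<theta>^2 * z\<close> with a cut-off \<open>\<theta>\<close>
  that is 1 on the support of \<open>c\<close>; where \<open>\<theta>\<close> lives, the hopping
  terms are too small to compete with the diagonal. \<open>A_ge\<close> controls the error of the
  cut-off by the left side \<open>S\<close> itself.\<close>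

lemma tridiagonal_inverse_bound:
  assumes eq: "\<And>p. p \<le> n \<Longrightarrow> (real n / 2 + 1) * z p
      - (sqrt ((real p + 1) * real (n - p)) * z (Suc p) + sqrt (real p * (real (n - p) + 1)) * z (p - 1)) / 2 = c p"
    and supp: "\<And>p. p \<le> n \<Longrightarrow> c p \<noteq> 0 \<Longrightarrow> 32 * real (n - p) \<le> real n"
  shows "(\<Sum>p\<le>n. z p * c p) \<le> 2052 / real n * (\<Sum>p\<le>n. (c p)\<^sup>2)"
proof -
  have Ac: "A p = c p" if "p \<le> n" for p using eq[OF that] by (simp add: A_def e_def)
  have n0: "real n > 0" using n by simp
  \<comment> \<open>Equal to 1 for \<open>n - p \<le> n / 32\<close>, which contains the support of
    \<open>c\<close>, equal to 0 for \<open>n - p \<ge> n / 16\<close>, and linear in between with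
    steps of at most \<open>32 / n\<close>.\<close>
  define \<theta> where "\<theta> p = max 0 (min 1 (2 - 32 * real (n - p) / real n))" for p
  define y where "y p = \<theta> p * z p" for p
  define S where "S = (\<Sum>p\<le>n. z p * c p)"
  have \<theta>1: "\<theta> p * c p = c p" if "p \<le> n" for p
  proof (cases "c p = 0")
    case False
    then have "32 * real (n - p) / real n \<le> 1" using supp[OF that] n0 by (simp add: divide_le_eq)
    then show ?thesis by (simp add: \<theta>_def)
  qed simp
  have \<theta>0: "16 * real (n - p) < real n" if "\<theta> p \<noteq> 0" for p
  proof -
    have "32 * real (n - p) / real n < 2" using that by (auto simp: \<theta>_def max_def min_def split: if_splits)
    then show ?thesis using n0 by (simp add: divide_less_eq)
  qed
  have \<theta>d: "(\<theta> p - \<theta> (Suc p))\<^sup>2 \<le> (32 / real n)\<^sup>2" if "p < n" for p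
  proof -
    have r: "real (n - p) = real (n - Suc p) + 1" using that by simp
    have clip: "\<bar>max 0 (min 1 (2 - a)) - max 0 (min 1 (2 - b))\<bar> \<le> d" if "a = b + d" "d \<ge> 0" for a b d :: real
      using that by (auto simp: max_def min_def)
    have step: "32 * real (n - p) / real n = 32 * real (n - Suc p) / real n + 32 / real n"
      unfolding r by (simp only: add_divide_distrib distrib_left mult_1_right)
    have "0 \<le> 32 / real n" by simp
    from clip[OF step this] have "\<bar>\<theta> p - \<theta> (Suc p)\<bar> \<le> 32 / real n"
      unfolding \<theta>_def .
    from power_mono[OF this abs_ge_zero, of 2] show ?thesis unfolding power2_abs .
  qed
  have e_le: "0 \<le> e p" "e p \<le> real n" if "p < n" for p
  proof -
    have "real p + 1 \<le> real n" using that by linarith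
    then have "(real p + 1) * real (n - p) \<le> real n * real n" by (rule mult_mono) simp_all
    from real_sqrt_le_mono[OF this] show "e p \<le> real n"
      unfolding e_def real_sqrt_abs2 abs_of_nat .
    show "0 \<le> e p" unfolding e_def by (intro real_sqrt_ge_zero mult_nonneg_nonneg) simp_all
  qed
  have S_eq: "S = (\<Sum>p\<le>n. z p * A p)" unfolding S_def using Ac by simp
  have zS: "(\<Sum>p\<le>n. (z p)\<^sup>2) \<le> S" unfolding S_eq by (rule A_ge)
  have S0: "S \<ge> 0" by (rule order_trans[OF _ zS]) (simp add: sum_nonneg)
  have pair: "(\<Sum>p<n. ((f p)\<^sup>2 + (f (Suc p))\<^sup>2) / 2) \<le> (\<Sum>p\<le>n. (f p)\<^sup>2)" for f :: "nat \<Rightarrow> real"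
  proof -
    have "(\<Sum>p<n. (f p)\<^sup>2) \<le> (\<Sum>p\<le>n. (f p)\<^sup>2)" by (intro sum_mono2) auto
    moreover have "(\<Sum>p<n. (f (Suc p))\<^sup>2) \<le> (\<Sum>p\<le>n. (f p)\<^sup>2)"
    proof -
      have "(\<Sum>p<n. (f (Suc p))\<^sup>2) = (\<Sum>p\<in>Suc ` {..<n}. (f p)\<^sup>2)" by (simp add: sum.reindex)
      also have "\<dots> \<le> (\<Sum>p\<le>n. (f p)\<^sup>2)" by (intro sum_mono2) auto
      finally show ?thesis .
    qed
    ultimately show ?thesis by (simp add: sum_divide_distrib[symmetric] sum.distrib)
  qed
  have abs_pair: "\<bar>a * b\<bar> \<le> (a\<^sup>2 + b\<^sup>2) / 2" for a b :: real
    using sum_squares_bound[of "\<bar>a\<bar>" "\<bar>b\<bar>"] by (simp add: abs_mult)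
  \<comment> \<open>The factor \<open>\<theta>^2\<close> may be inserted because
    \<open>\<theta> = 1\<close> on the support of \<open>c\<close>.\<close>
  have "S = (\<Sum>p\<le>n. ((\<theta> p)\<^sup>2 * z p) * A p)"
    unfolding S_def
  proof (intro sum.cong refl)
    fix p assume "p \<in> {..n}"
    then have p: "p \<le> n" by simp
    have "((\<theta> p)\<^sup>2 * z p) * A p = z p * (\<theta> p * (\<theta> p * c p))"
      unfolding Ac[OF p] by (simp add: power2_eq_square mult_ac)
    then show "z p * c p = ((\<theta> p)\<^sup>2 * z p) * A p" unfolding \<theta>1[OF p] ..
  qed
  also have "\<dots> = (real n / 2 + 1) * (\<Sum>p\<le>n. (y p)\<^sup>2)
      - (\<Sum>p<n. e p * (y p * y (Suc p)) + (e p * (\<theta> p - \<theta> (Suc p))\<^sup>2) * (z p * z (Suc p)) / 2)"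
  proof -
    \<comment> \<open>\<open>a^2 + b^2 = 2 * a * b + (a - b)^2\<close> for the neighbouring values
      of \<open>\<theta>\<close>: only squared differences of the cut-off survive, and these are of
      order \<open>1 / n^2\<close>.\<close>
    have "(\<Sum>p<n. e p * (((\<theta> p)\<^sup>2 * z p) * z (Suc p) + ((\<theta> (Suc p))\<^sup>2 * z (Suc p)) * z p)) / 2
      = (\<Sum>p<n. e p * (y p * y (Suc p)) + (e p * (\<theta> p - \<theta> (Suc p))\<^sup>2) * (z p * z (Suc p)) / 2)"
      unfolding sum_divide_distrib
      by (intro sum.cong refl) (simp add: y_def power2_diff power2_eq_square field_simps)
    then show ?thesis unfolding A_form by (simp add: y_def power_mult_distrib power2_eq_square mult_ac)
  qed
  \<comment> \<open>Where \<open>y p\<close> is not zero, \<open>n - p \<le> n / 16\<close> and thus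
    \<open>e p \<le> n / 4\<close>, half of the diagonal. The error has the weight
    \<open>n * (32 / n)^2 / 2 = 512 / n\<close>.\<close>
  also have "\<dots> \<ge> (real n / 2 + 1) * (\<Sum>p\<le>n. (y p)\<^sup>2)
      - (\<Sum>p<n. (real n / 4) * (((y p)\<^sup>2 + (y (Suc p))\<^sup>2) / 2) + (512 / real n) * (((z p)\<^sup>2 + (z (Suc p))\<^sup>2) / 2))"
  proof (intro diff_left_mono sum_mono add_mono)
    fix p assume "p \<in> {..<n}"
    then have p: "p < n" by simp
    show "e p * (y p * y (Suc p)) \<le> (real n / 4) * (((y p)\<^sup>2 + (y (Suc p))\<^sup>2) / 2)"
    proof (cases "y p * y (Suc p) = 0")
      case False
      then have "\<theta> p \<noteq> 0" by (auto simp: y_def)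
      from \<theta>0[OF this] have "real (n - p) \<le> real n / 16" by simp
      then have "(real p + 1) * real (n - p) \<le> real n * (real n / 16)" using p by (intro mult_mono) auto
      also have "\<dots> = (real n / 4)\<^sup>2" by (simp add: power2_eq_square)
      finally have "e p \<le> real n / 4" unfolding e_def by (rule real_le_lsqrt[rotated]) simp
      from order_trans[OF mult_left_mono[OF abs_ge_self e_le(1)[OF p]] mult_right_mono[OF this abs_ge_zero]]
      have "e p * (y p * y (Suc p)) \<le> (real n / 4) * \<bar>y p * y (Suc p)\<bar>" .
      also have "\<dots> \<le> (real n / 4) * (((y p)\<^sup>2 + (y (Suc p))\<^sup>2) / 2)"
        by (intro mult_left_mono abs_pair) simp
      finally show ?thesis .
    next
      case True
      show ?thesis unfolding True by simp
    qed
    have "e p * (\<theta> p - \<theta> (Suc p))\<^sup>2 \<le> real n * (32 / real n)\<^sup>2"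
      using e_le[OF p] \<theta>d[OF p] by (intro mult_mono) auto
    also have "\<dots> = 1024 / real n" using n0 by (simp add: power2_eq_square)
    finally have *: "e p * (\<theta> p - \<theta> (Suc p))\<^sup>2 \<le> 1024 / real n" .
    have "(e p * (\<theta> p - \<theta> (Suc p))\<^sup>2) * (z p * z (Suc p)) \<le> (e p * (\<theta> p - \<theta> (Suc p))\<^sup>2) * (((z p)\<^sup>2 + (z (Suc p))\<^sup>2) / 2)"
      using e_le(1)[OF p] by (intro mult_left_mono order_trans[OF abs_ge_self abs_pair]) auto
    also have "\<dots> \<le> 1024 / real n * (((z p)\<^sup>2 + (z (Suc p))\<^sup>2) / 2)"
      by (intro mult_right_mono *) auto
    finally show "(e p * (\<theta> p - \<theta> (Suc p))\<^sup>2) * (z p * z (Suc p)) / 2 \<le> (512 / real n) * (((z p)\<^sup>2 + (z (Suc p))\<^sup>2) / 2)"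
      by (simp add: field_simps)
  qed
  finally have "(real n / 2 + 1) * (\<Sum>p\<le>n. (y p)\<^sup>2)
      \<le> S + ((real n / 4) * (\<Sum>p<n. ((y p)\<^sup>2 + (y (Suc p))\<^sup>2) / 2) + (512 / real n) * (\<Sum>p<n. ((z p)\<^sup>2 + (z (Suc p))\<^sup>2) / 2))"
    by (simp only: sum.distrib sum_distrib_left[symmetric])
  also have "\<dots> \<le> S + ((real n / 4) * (\<Sum>p\<le>n. (y p)\<^sup>2) + (512 / real n) * S)"
    using order_trans[OF pair zS] by (intro add_left_mono add_mono mult_left_mono pair) auto
  also have "(512 / real n) * S \<le> 512 * S" using n S0 by (intro mult_right_mono) (auto simp: divide_le_eq)
  finally have yS: "(real n / 4) * (\<Sum>p\<le>n. (y p)\<^sup>2) \<le> 513 * S"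
    using sum_nonneg[of "{..n}" "\<lambda>p. (y p)\<^sup>2"] by (simp add: algebra_simps)
  \<comment> \<open>\<open>2052 = 4 * 513\<close>. By \<open>yS\<close> this is the weight for which
    the \<open>y\<close> half of the AM-GM bound is at most \<open>S / 2\<close> and can be
    absorbed.\<close>
  define \<tau> where "\<tau> = 2052 / real n"
  have \<tau>: "\<tau> > 0" using n0 by (simp add: \<tau>_def)
  have "S = (\<Sum>p\<le>n. y p * c p)"
    unfolding S_def y_def using \<theta>1 by (intro sum.cong refl) (metis atMost_iff mult.assoc mult.commute)
  also have "\<dots> \<le> (\<Sum>p\<le>n. (\<tau> * (c p)\<^sup>2 + (y p)\<^sup>2 / \<tau>) / 2)"
  proof (intro sum_mono)
    fix p
    show "y p * c p \<le> (\<tau> * (c p)\<^sup>2 + (y p)\<^sup>2 / \<tau>) / 2"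
      using zero_le_power2[of "\<tau> * c p - y p"] \<tau> by (simp add: power2_diff power_mult_distrib field_simps power2_eq_square)
  qed
  also have "\<dots> = (\<tau> * (\<Sum>p\<le>n. (c p)\<^sup>2) + (\<Sum>p\<le>n. (y p)\<^sup>2) / \<tau>) / 2"
    by (simp only: sum_divide_distrib[symmetric] sum.distrib sum_distrib_left[symmetric])
  finally have "S \<le> (\<tau> * (\<Sum>p\<le>n. (c p)\<^sup>2) + (\<Sum>p\<le>n. (y p)\<^sup>2) / \<tau>) / 2" .
  moreover have "(\<Sum>p\<le>n. (y p)\<^sup>2) / \<tau> \<le> S"
    using yS n0 by (simp add: \<tau>_def field_simps)
  moreover have "s \<le> (a + b) / 2 \<Longrightarrow> b \<le> s \<Longrightarrow> s \<le> a" for s a b :: real by simp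
  ultimately have "S \<le> \<tau> * (\<Sum>p\<le>n. (c p)\<^sup>2)" by blast
  then show ?thesis by (simp add: S_def \<tau>_def)
qed

end

section \<open>The bilinear estimate on the line at a fixed total energy\<close>

lemma integral_hermf_scaled:
  "integrable lborel (\<lambda>x. hermf k (sqrt 2 * x) * hermf l (sqrt 2 * x))"
  "(\<integral>x. hermf k (sqrt 2 * x) * hermf l (sqrt 2 * x) \<partial>lborel) = (if k = l then 1 / sqrt 2 else 0)"
  using lborel_integrable_real_affine[OF hermf_integrable_mult[of k l], of "sqrt 2" 0]
    lborel_integral_real_affine[of "sqrt 2" "\<lambda>x. hermf k x * hermf l x" 0] hermf_orthonormal[of k l]
  by (auto simp: field_simps split: if_splits)

lemma integral_sum_hermf_scaled:
  "integrable lborel (\<lambda>x. (\<Sum>k\<in>K. a k * hermf k (sqrt 2 * x))\<^sup>2)"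
  "finite K \<Longrightarrow> (\<integral>x. (\<Sum>k\<in>K. a k * hermf k (sqrt 2 * x))\<^sup>2 \<partial>lborel) = (\<Sum>k\<in>K. (a k)\<^sup>2) / sqrt 2"
proof -
  have eq: "(\<Sum>k\<in>K. a k * hermf k (sqrt 2 * x))\<^sup>2
    = (\<Sum>k\<in>K. \<Sum>l\<in>K. a k * a l * (hermf k (sqrt 2 * x) * hermf l (sqrt 2 * x)))" for x
    by (simp add: power2_eq_square sum_product mult_ac)
  show "integrable lborel (\<lambda>x. (\<Sum>k\<in>K. a k * hermf k (sqrt 2 * x))\<^sup>2)"
    unfolding eq by (intro Bochner_Integration.integrable_sum integrable_mult_right integral_hermf_scaled)
  assume "finite K"
  then show "(\<integral>x. (\<Sum>k\<in>K. a k * hermf k (sqrt 2 * x))\<^sup>2 \<partial>lborel) = (\<Sum>k\<in>K. (a k)\<^sup>2) / sqrt 2"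
    unfolding eq
    by (simp add: Bochner_Integration.integral_sum integral_hermf_scaled sum_divide_distrib power2_eq_square
        if_distrib[of "(*) _"] sum.delta cong: if_cong)
qed

text \<open>After the rotation the squared norm is a sum of squared coefficients \<open>w k\<close>
  with the weights \<open>hermf (n - k) 0\<close> squared. AM-GM replaces these weights by a
  combination of \<open>1 / (n - k + 1)\<close>, handled by
  \<open>tridiagonal_inverse_bound\<close>, and of the constant 1, for which the rotation is an
  isometry.\<close>

lemma bilinear_real:
  fixes c :: "nat \<Rightarrow> real"
  assumes n: "n \<ge> 1" and supp: "\<And>p. p \<le> n \<Longrightarrow> c p \<noteq> 0 \<Longrightarrow> 32 * (n - p) \<le> n"
  shows "integrable lborel (\<lambda>x. (\<Sum>p\<le>n. c p * (hermf p x * hermf (n - p) x))\<^sup>2)"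
    "(\<integral>x. (\<Sum>p\<le>n. c p * (hermf p x * hermf (n - p) x))\<^sup>2 \<partial>lborel) \<le> 1027 / sqrt n * (\<Sum>p\<le>n. (c p)\<^sup>2)"
proof -
  define u where "u p k = krav p (n - p) k" for p k
  \<comment> \<open>\<open>w\<close> holds the coefficients in the rotated basis; \<open>z\<close>
    divides them by \<open>n - k + 1\<close> and returns to the basis indexed by
    \<open>p\<close>.\<close>
  define w where "w k = (\<Sum>p\<le>n. c p * u p k)" for k
  define z where "z p = (\<Sum>k\<le>n. u p k * (w k / (real (n - k) + 1)))" for p
  have orth: "(\<Sum>k\<le>n. u p k * u q k) = (if p = q then 1 else 0)" if "p \<le> n" "q \<le> n" for p q
    unfolding u_def using that by (intro krav_orthonormal) auto
  have dbl: "(\<Sum>k\<le>n. u q k * w k) = c q" if "q \<le> n" for q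
  proof -
    have "(\<Sum>k\<le>n. u q k * w k) = (\<Sum>p\<le>n. c p * (\<Sum>k\<le>n. u q k * u p k))"
      unfolding w_def sum_distrib_left by (subst sum.swap) (simp add: mult_ac)
    also have "\<dots> = (\<Sum>p\<le>n. if p = q then c p else 0)"
      using that by (intro sum.cong refl) (auto simp: orth)
    finally show ?thesis using that by simp
  qed
  have wsq: "(\<Sum>k\<le>n. (w k)\<^sup>2) = (\<Sum>p\<le>n. (c p)\<^sup>2)"
  proof -
    have "(\<Sum>k\<le>n. (w k)\<^sup>2) = (\<Sum>k\<le>n. \<Sum>p\<le>n. c p * (u p k * w k))"
    proof (intro sum.cong refl)
      fix k
      have "(w k)\<^sup>2 = (\<Sum>p\<le>n. c p * u p k) * w k" unfolding power2_eq_square w_def ..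
      then show "(w k)\<^sup>2 = (\<Sum>p\<le>n. c p * (u p k * w k))" by (simp only: sum_distrib_right mult.assoc)
    qed
    also have "\<dots> = (\<Sum>p\<le>n. c p * (\<Sum>k\<le>n. u p k * w k))"
      by (subst sum.swap) (simp add: sum_distrib_left)
    finally show ?thesis by (simp add: dbl power2_eq_square)
  qed
  have zc: "(\<Sum>p\<le>n. z p * c p) = (\<Sum>k\<le>n. (w k)\<^sup>2 / (real (n - k) + 1))"
  proof -
    have "(\<Sum>p\<le>n. z p * c p) = (\<Sum>p\<le>n. \<Sum>k\<le>n. (c p * u p k) * (w k / (real (n - k) + 1)))"
      unfolding z_def sum_distrib_right by (simp add: mult_ac)
    also have "\<dots> = (\<Sum>k\<le>n. w k * (w k / (real (n - k) + 1)))"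
      by (subst sum.swap) (simp only: sum_distrib_right[symmetric] w_def[symmetric])
    finally show ?thesis by (simp add: power2_eq_square)
  qed
  have "(\<Sum>p\<le>n. z p * c p) \<le> 2052 / real n * (\<Sum>p\<le>n. (c p)\<^sup>2)"
  proof (rule tridiagonal_inverse_bound[OF n])
    fix p assume p: "p \<le> n"
    have Sp: "sqrt ((real p + 1) * real (n - p)) * z (Suc p)
        = (\<Sum>k\<le>n. sqrt (real (n - p) * (real p + 1)) * krav (Suc p) (n - p - 1) k * (w k / (real (n - k) + 1)))"
      by (simp add: z_def u_def sum_distrib_left mult_ac)
    have Pp: "sqrt (real p * (real (n - p) + 1)) * z (p - 1)
        = (\<Sum>k\<le>n. sqrt (real p * (real (n - p) + 1)) * krav (p - 1) (Suc (n - p)) k * (w k / (real (n - k) + 1)))"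
    proof (cases p)
      case (Suc q)
      then have "n - (p - 1) = Suc (n - p)" using p by auto
      then show ?thesis by (simp add: z_def u_def sum_distrib_left mult_ac)
    qed simp
    have alg: "a * (b * v) - (b' * v + b'' * v) / 2 = (a * b - (b' + b'') / 2) * v" for a b b' b'' v :: real
      by (simp add: algebra_simps)
    have "(real n / 2 + 1) * z p - (sqrt ((real p + 1) * real (n - p)) * z (Suc p) + sqrt (real p * (real (n - p) + 1)) * z (p - 1)) / 2
      = (\<Sum>k\<le>n. ((real n / 2 + 1) * krav p (n - p) k - (sqrt (real (n - p) * (real p + 1)) * krav (Suc p) (n - p - 1) k
          + sqrt (real p * (real (n - p) + 1)) * krav (p - 1) (Suc (n - p)) k) / 2) * (w k / (real (n - k) + 1)))"
      unfolding Sp Pp z_def[of p] u_def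
      by (simp only: sum_distrib_left sum.distrib[symmetric] sum_divide_distrib sum_subtractf[symmetric])
         (intro sum.cong refl, rule alg)
    \<comment> \<open>By \<open>krav_three_term\<close> the tridiagonal expression multiplies by
      \<open>n - k + 1\<close>, which cancels the denominator in \<open>z\<close>. What is left is
      the transform of \<open>w\<close> back to \<open>c\<close>.\<close>
    also have "\<dots> = (\<Sum>k\<le>n. u p k * w k)"
    proof (intro sum.cong refl)
      fix k assume "k \<in> {..n}"
      then have "k \<le> n" by simp
      from krav_three_term[of p "n - p" n k] this p
      have "(real n / 2 + 1) * krav p (n - p) k - (sqrt (real (n - p) * (real p + 1)) * krav (Suc p) (n - p - 1) k
          + sqrt (real p * (real (n - p) + 1)) * krav (p - 1) (Suc (n - p)) k) / 2 = (real (n - k) + 1) * u p k"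
        by (simp add: u_def field_simps)
      then show "((real n / 2 + 1) * krav p (n - p) k - (sqrt (real (n - p) * (real p + 1)) * krav (Suc p) (n - p - 1) k
          + sqrt (real p * (real (n - p) + 1)) * krav (p - 1) (Suc (n - p)) k) / 2) * (w k / (real (n - k) + 1)) = u p k * w k"
        by (simp add: add_nonneg_eq_0_iff)
    qed
    finally show "(real n / 2 + 1) * z p - (sqrt ((real p + 1) * real (n - p)) * z (Suc p) + sqrt (real p * (real (n - p) + 1)) * z (p - 1)) / 2 = c p"
      using dbl[OF p] by simp
  next
    fix p assume "p \<le> n" "c p \<noteq> 0"
    from supp[OF this] show "32 * real (n - p) \<le> real n" by linarith
  qed
  then have S: "(\<Sum>k\<le>n. (w k)\<^sup>2 / (real (n - k) + 1)) \<le> 2052 / real n * (\<Sum>p\<le>n. (c p)\<^sup>2)" unfolding zc .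
  have eq: "(\<Sum>p\<le>n. c p * (hermf p x * hermf (n - p) x)) = (\<Sum>k\<le>n. (w k * hermf (n - k) 0) * hermf k (sqrt 2 * x))" for x
  proof -
    have "(\<Sum>p\<le>n. c p * (hermf p x * hermf (n - p) x))
      = (\<Sum>p\<le>n. \<Sum>k\<le>n. (c p * u p k) * (hermf (n - k) 0 * hermf k (sqrt 2 * x)))"
      unfolding hermf_product by (intro sum.cong refl) (simp add: u_def sum_distrib_left mult_ac)
    also have "\<dots> = (\<Sum>k\<le>n. w k * (hermf (n - k) 0 * hermf k (sqrt 2 * x)))"
      by (subst sum.swap) (simp only: sum_distrib_right[symmetric] w_def[symmetric])
    finally show ?thesis by (simp add: mult_ac)
  qed
  show "integrable lborel (\<lambda>x. (\<Sum>p\<le>n. c p * (hermf p x * hermf (n - p) x))\<^sup>2)"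
    unfolding eq by (rule integral_sum_hermf_scaled)
  have n0: "real n > 0" using n by simp
  have "(\<integral>x. (\<Sum>p\<le>n. c p * (hermf p x * hermf (n - p) x))\<^sup>2 \<partial>lborel) = (\<Sum>k\<le>n. (w k * hermf (n - k) 0)\<^sup>2) / sqrt 2"
    unfolding eq by (simp add: integral_sum_hermf_scaled)
  also have "\<dots> \<le> (\<Sum>k\<le>n. (w k * hermf (n - k) 0)\<^sup>2)"
    using divide_left_mono[of 1 "sqrt 2" "\<Sum>k\<le>n. (w k * hermf (n - k) 0)\<^sup>2"] by (simp add: sum_nonneg)
  also have "\<dots> \<le> (\<Sum>k\<le>n. (sqrt n * ((w k)\<^sup>2 / (real (n - k) + 1)) + (w k)\<^sup>2 / sqrt n) / 2)"
  proof (intro sum_mono)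
    fix k
    let ?m = "real (n - k) + 1"
    have "(hermf (n - k) 0)\<^sup>2 \<le> 1 / sqrt ?m"
      using hermf_zero_sq_le[of "n - k"] by (simp add: le_divide_eq)
    also have "\<dots> \<le> (sqrt n / ?m + 1 / sqrt n) / 2"
    proof -
      have amgm: "1 / b \<le> (a / (b * b) + 1 / a) / 2" if "a > 0" "b > 0" for a b :: real
      proof -
        have "(a / (b * b) + 1 / a) / 2 - 1 / b = (a - b)\<^sup>2 / (2 * a * b * b)"
          using that by (simp add: field_simps power2_eq_square)
        moreover have "\<dots> \<ge> 0" using that by simp
        ultimately show ?thesis by linarith
      qed
      show ?thesis using amgm[of "sqrt n" "sqrt ?m"] n0 by (simp del: of_nat_diff)
    qed
    finally have "(w k)\<^sup>2 * (hermf (n - k) 0)\<^sup>2 \<le> (w k)\<^sup>2 * ((sqrt n / ?m + 1 / sqrt n) / 2)"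
      by (intro mult_left_mono) auto
    then show "(w k * hermf (n - k) 0)\<^sup>2 \<le> (sqrt n * ((w k)\<^sup>2 / ?m) + (w k)\<^sup>2 / sqrt n) / 2"
      by (simp add: power_mult_distrib algebra_simps)
  qed
  also have "\<dots> = (sqrt n * (\<Sum>k\<le>n. (w k)\<^sup>2 / (real (n - k) + 1)) + (\<Sum>p\<le>n. (c p)\<^sup>2) / sqrt n) / 2"
    by (simp only: sum_divide_distrib[symmetric] sum.distrib sum_distrib_left[symmetric] wsq)
  also have "\<dots> \<le> (sqrt n * (2052 / real n * (\<Sum>p\<le>n. (c p)\<^sup>2)) + (\<Sum>p\<le>n. (c p)\<^sup>2) / sqrt n) / 2"
    using S by (intro divide_right_mono add_right_mono mult_left_mono) auto
  also have "sqrt n * (2052 / real n * (\<Sum>p\<le>n. (c p)\<^sup>2)) = 2052 / sqrt n * (\<Sum>p\<le>n. (c p)\<^sup>2)"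
  proof -
    have "sqrt n * (2052 / real n * C) = (sqrt n / real n) * (2052 * C)" for C by simp
    moreover have "sqrt n / real n = 1 / sqrt n" using n0 by (simp add: field_simps)
    ultimately show ?thesis by simp
  qed
  \<comment> \<open>Half of \<open>2052 + 1\<close>, rounded up.\<close>
  also have "(2052 / sqrt n * (\<Sum>p\<le>n. (c p)\<^sup>2) + (\<Sum>p\<le>n. (c p)\<^sup>2) / sqrt n) / 2 \<le> 1027 / sqrt n * (\<Sum>p\<le>n. (c p)\<^sup>2)"
  proof -
    have "0 \<le> (\<Sum>p\<le>n. (c p)\<^sup>2) / sqrt n" by (simp add: sum_nonneg)
    then show ?thesis by simp
  qed
  finally show "(\<integral>x. (\<Sum>p\<le>n. c p * (hermf p x * hermf (n - p) x))\<^sup>2 \<partial>lborel) \<le> 1027 / sqrt n * (\<Sum>p\<le>n. (c p)\<^sup>2)" .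
qed

section \<open>Complete orthonormal systems\<close>

text \<open>The finite sets \<open>A n\<close> replace an enumeration of the index type. Partial
  sums run along them, which fits initial segments on the line as well as boxes of
  multi-indices.\<close>

locale complete_orthonormal =
  fixes e :: "'i \<Rightarrow> 'a::euclidean_space \<Rightarrow> complex" and A :: "nat \<Rightarrow> 'i set"
  assumes e_L2: "e i \<in> L2"
    and orthonormal: "l2_inner (e i) (e j) = (if i = j then 1 else 0)"
    and finite_A: "finite (A n)" and mono_A: "m \<le> n \<Longrightarrow> A m \<subseteq> A n" and UN_A: "\<exists>n. i \<in> A n"
    and complete: "f \<in> L2 \<Longrightarrow> (\<And>i. l2_inner (e i) f = 0) \<Longrightarrow> AE x in lborel. f x = 0"
begin

lemma finite_sum_L2: "(\<lambda>x. \<Sum>i\<in>S. c i * e i x) \<in> L2"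
  by (intro L2_sum L2_scale e_L2)

lemma inner_finite_sum:
  "f \<in> L2 \<Longrightarrow> l2_inner f (\<lambda>x. \<Sum>i\<in>S. c i * e i x) = (\<Sum>i\<in>S. c i * l2_inner f (e i))"
  by (subst l2_inner_sum_right) (auto intro: L2_scale e_L2 simp: l2_inner_scale_right)

lemma coeff_finite_sum:
  "finite S \<Longrightarrow> l2_inner (e j) (\<lambda>x. \<Sum>i\<in>S. c i * e i x) = (if j \<in> S then c j else 0)"
  by (simp add: inner_finite_sum e_L2 orthonormal if_distrib[of "(*) _"] sum.delta cong: if_cong)

lemma norm_finite_sum:
  assumes "finite S" shows "(l2_norm (\<lambda>x. \<Sum>i\<in>S. c i * e i x))\<^sup>2 = (\<Sum>i\<in>S. (cmod (c i))\<^sup>2)"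
proof -
  let ?s = "\<lambda>x. \<Sum>i\<in>S. c i * e i x"
  have "complex_of_real ((l2_norm ?s)\<^sup>2) = l2_inner ?s ?s" by (simp only: l2_inner_self)
  also have "\<dots> = (\<Sum>i\<in>S. c i * cnj (l2_inner (e i) ?s))"
    unfolding inner_finite_sum[OF finite_sum_L2] by (intro sum.cong refl) (metis l2_inner_commute)
  also have "\<dots> = (\<Sum>i\<in>S. c i * cnj (c i))" using assms by (simp add: coeff_finite_sum)
  also have "\<dots> = complex_of_real (\<Sum>i\<in>S. (cmod (c i))\<^sup>2)"
    unfolding of_real_sum complex_norm_square ..
  finally show ?thesis by (simp only: of_real_eq_iff)
qed

lemma riesz_fischer:
  assumes bd: "\<And>n. (\<Sum>i\<in>A n. (cmod (c i))\<^sup>2) \<le> K"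
  shows "\<exists>g\<in>L2. (\<forall>i. l2_inner (e i) g = c i) \<and>
    (\<lambda>n. l2_norm (\<lambda>x. (\<Sum>i\<in>A n. c i * e i x) - g x)) \<longlonglongrightarrow> 0"
proof -
  define s where "s n x = (\<Sum>i\<in>A n. c i * e i x)" for n x
  define S where "S n = (\<Sum>i\<in>A n. (cmod (c i))\<^sup>2)" for n
  have s: "s n \<in> L2" for n unfolding s_def[abs_def] by (rule finite_sum_L2)
  \<comment> \<open>The squared distance of two partial sums is an increment of the bounded monotone
    sequence \<open>S\<close>, so convergence of \<open>S\<close> is the Cauchy property.\<close>
  have diff: "(l2_norm (\<lambda>x. s n x - s m x))\<^sup>2 = S n - S m" if "m \<le> n" for m n
  proof -
    have "s n x - s m x = (\<Sum>i\<in>A n - A m. c i * e i x)" for x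
      unfolding s_def using sum_diff[OF finite_A mono_A[OF that], of "\<lambda>i. c i * e i x"] by simp
    then have "(l2_norm (\<lambda>x. s n x - s m x))\<^sup>2 = (\<Sum>i\<in>A n - A m. (cmod (c i))\<^sup>2)"
      using norm_finite_sum[of "A n - A m" c] finite_A by simp
    also have "\<dots> = S n - S m" unfolding S_def by (rule sum_diff[OF finite_A mono_A[OF that]])
    finally show ?thesis .
  qed
  have "incseq S" unfolding S_def using mono_A finite_A by (auto simp: incseq_def intro!: sum_mono2)
  moreover have "\<forall>n. S n \<le> K" using bd by (simp add: S_def)
  ultimately obtain L where "S \<longlonglongrightarrow> L" by (rule incseq_convergent)
  then have "convergent S" by (rule convergentI)
  then have cauchy: "Cauchy S" by (rule convergent_Cauchy)
  have "\<exists>g\<in>L2. (\<lambda>n. l2_norm (\<lambda>x. s n x - g x)) \<longlonglongrightarrow> 0"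
  proof (rule L2_complete[OF s])
    fix d :: real assume "d > 0"
    then have "d\<^sup>2 > 0" by simp
    from CauchyD[OF cauchy this] obtain M where M: "\<forall>m\<ge>M. \<forall>n\<ge>M. norm (S m - S n) < d\<^sup>2" by blast
    have "l2_norm (\<lambda>x. s m x - s n x) < d" if "m \<ge> M" "n \<ge> M" for m n
    proof -
      have "(l2_norm (\<lambda>x. s m x - s n x))\<^sup>2 = \<bar>S m - S n\<bar>"
      proof (cases "n \<le> m")
        case True
        have "0 \<le> S m - S n" unfolding diff[OF True, symmetric] by simp
        with diff[OF True] show ?thesis by simp
      next
        case False
        then have le: "m \<le> n" by simp
        have "0 \<le> S n - S m" unfolding diff[OF le, symmetric] by simp
        with diff[OF le] show ?thesis by (subst l2_norm_minus_commute) simp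
      qed
      also have "\<dots> < d\<^sup>2" using M that by simp
      finally show ?thesis using \<open>d > 0\<close> by (rule power_less_imp_less_base[OF _ less_imp_le])
    qed
    then show "\<exists>M. \<forall>m\<ge>M. \<forall>n\<ge>M. l2_norm (\<lambda>x. s m x - s n x) < d" by blast
  qed
  then obtain g where g: "g \<in> L2" "(\<lambda>n. l2_norm (\<lambda>x. s n x - g x)) \<longlonglongrightarrow> 0" by blast
  have "l2_inner (e i) g = c i" for i
  proof -
    obtain n where n: "i \<in> A n" using UN_A by blast
    have "(\<lambda>n. l2_inner (e i) (s n)) \<longlonglongrightarrow> l2_inner (e i) g"
      by (rule l2_inner_tendsto[OF s g(1) e_L2 g(2)])
    moreover have "\<forall>\<^sub>F m in sequentially. l2_inner (e i) (s m) = c i"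
      using eventually_ge_at_top[of n]
    proof eventually_elim
      case (elim m)
      then have "i \<in> A m" using n mono_A by blast
      then show ?case unfolding s_def[abs_def] using finite_A by (simp add: coeff_finite_sum)
    qed
    then have "(\<lambda>n. l2_inner (e i) (s n)) \<longlonglongrightarrow> c i" by (rule tendsto_eventually)
    ultimately show ?thesis by (rule LIMSEQ_unique)
  qed
  with g show ?thesis unfolding s_def by blast
qed

lemma bessel:
  assumes f: "f \<in> L2" and S: "finite S"
  shows "(\<Sum>i\<in>S. (cmod (l2_inner (e i) f))\<^sup>2) \<le> (l2_norm f)\<^sup>2"
proof -
  define c where "c i = l2_inner (e i) f" for i
  let ?s = "\<lambda>x. \<Sum>i\<in>S. (- c i) * e i x"
  have "l2_inner f ?s = (\<Sum>i\<in>S. (- c i) * cnj (c i))"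
    unfolding inner_finite_sum[OF f] c_def by (intro sum.cong refl) (metis l2_inner_commute)
  also have "\<dots> = complex_of_real (- (\<Sum>i\<in>S. (cmod (c i))\<^sup>2))"
    unfolding of_real_minus of_real_sum complex_norm_square by (simp add: sum_negf)
  finally have "Re (l2_inner f ?s) = - (\<Sum>i\<in>S. (cmod (c i))\<^sup>2)" by simp
  moreover have "0 \<le> (l2_norm (\<lambda>x. f x + ?s x))\<^sup>2" by simp
  ultimately show ?thesis
    unfolding l2_norm_add_sq[OF f finite_sum_L2] norm_finite_sum[OF S] by (simp add: c_def)
qed

text \<open>The limit supplied by \<open>riesz_fischer\<close> has the coefficients of
  \<open>f\<close>, and completeness identifies the two.\<close>

lemma expansion:
  assumes f: "f \<in> L2"
  shows "(\<lambda>n. l2_norm (\<lambda>x. (\<Sum>i\<in>A n. l2_inner (e i) f * e i x) - f x)) \<longlonglongrightarrow> 0"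
proof -
  obtain g where g: "g \<in> L2" "\<And>i. l2_inner (e i) g = l2_inner (e i) f"
    and lim: "(\<lambda>n. l2_norm (\<lambda>x. (\<Sum>i\<in>A n. l2_inner (e i) f * e i x) - g x)) \<longlonglongrightarrow> 0"
    using riesz_fischer[of "\<lambda>i. l2_inner (e i) f" "(l2_norm f)\<^sup>2"] bessel[OF f finite_A] by auto
  have "AE x in lborel. g x - f x = 0"
    by (rule complete) (use g f in \<open>auto simp: l2_inner_diff_right e_L2 L2_diff\<close>)
  then have ae: "AE x in lborel. g x = f x" by simp
  have "l2_norm (\<lambda>x. (\<Sum>i\<in>A n. l2_inner (e i) f * e i x) - g x) = l2_norm (\<lambda>x. (\<Sum>i\<in>A n. l2_inner (e i) f * e i x) - f x)" for n
    by (rule l2_norm_cong_AE)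
       (use ae in \<open>auto intro!: borel_measurable_diff L2_measurable[OF finite_sum_L2] L2_measurable[OF g(1)] L2_measurable[OF f] elim: AE_mp\<close>)
  with lim show ?thesis by simp
qed

lemma eq_AE_coeffI:
  "f \<in> L2 \<Longrightarrow> g \<in> L2 \<Longrightarrow> (\<And>i. l2_inner (e i) f = l2_inner (e i) g) \<Longrightarrow> AE x in lborel. f x = g x"
  using complete[of "\<lambda>x. f x - g x"] by (simp add: l2_inner_diff_right e_L2 L2_diff)

lemma parseval_lim:
  assumes f: "f \<in> L2" and g: "g \<in> L2"
  shows "(\<lambda>n. \<Sum>i\<in>A n. cnj (l2_inner (e i) f) * l2_inner (e i) g) \<longlonglongrightarrow> l2_inner f g"
proof -
  have "(\<lambda>n. l2_inner f (\<lambda>x. \<Sum>i\<in>A n. l2_inner (e i) g * e i x)) \<longlonglongrightarrow> l2_inner f g"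
    by (rule l2_inner_tendsto[OF finite_sum_L2 g f expansion[OF g]])
  moreover have "l2_inner f (\<lambda>x. \<Sum>i\<in>S. l2_inner (e i) g * e i x) = (\<Sum>i\<in>S. cnj (l2_inner (e i) f) * l2_inner (e i) g)" for S
    unfolding inner_finite_sum[OF f] by (intro sum.cong refl) (metis l2_inner_commute mult.commute)
  ultimately show ?thesis by simp
qed

text \<open>Monotone convergence along \<open>A n\<close>. It passes from limits of partial sums to
  integrals over \<open>count_space\<close>, the form in which the spectral measures of H
  appear.\<close>

lemma nn_integral_count_lim:
  fixes \<phi> :: "'i \<Rightarrow> real"
  assumes "\<And>i. \<phi> i \<ge> 0" "(\<lambda>n. \<Sum>i\<in>A n. \<phi> i) \<longlonglongrightarrow> L"
  shows "(\<integral>\<^sup>+i. ennreal (\<phi> i) \<partial>count_space UNIV) = ennreal L"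
proof -
  have sup: "(SUP n. ennreal (\<phi> i) * indicator (A n) i) = ennreal (\<phi> i)" for i
  proof (rule antisym)
    show "(SUP n. ennreal (\<phi> i) * indicator (A n) i) \<le> ennreal (\<phi> i)"
      by (intro SUP_least) (auto simp: indicator_def)
    obtain n where "i \<in> A n" using UN_A by blast
    then show "ennreal (\<phi> i) \<le> (SUP n. ennreal (\<phi> i) * indicator (A n) i)"
      by (intro SUP_upper2[of n]) auto
  qed
  have "(\<integral>\<^sup>+i. ennreal (\<phi> i) \<partial>count_space UNIV) = (\<integral>\<^sup>+i. (SUP n. ennreal (\<phi> i) * indicator (A n) i) \<partial>count_space UNIV)"
    by (simp only: sup)
  also have "\<dots> = (SUP n. \<integral>\<^sup>+i. ennreal (\<phi> i) * indicator (A n) i \<partial>count_space UNIV)"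
    using mono_A by (intro nn_integral_monotone_convergence_SUP)
      (auto simp: incseq_def le_fun_def indicator_def intro!: mult_left_mono)
  also have "\<dots> = (SUP n. ennreal (\<Sum>i\<in>A n. \<phi> i))"
    using finite_A assms(1) by (simp add: nn_integral_count_space_indicator[symmetric] nn_integral_count_space_finite sum_ennreal)
  also have "\<dots> = ennreal L"
  proof (rule LIMSEQ_unique[OF LIMSEQ_SUP])
    show "incseq (\<lambda>n. ennreal (\<Sum>i\<in>A n. \<phi> i))"
      using mono_A finite_A assms(1) by (auto simp: incseq_def intro!: ennreal_leI sum_mono2)
    show "(\<lambda>n. ennreal (\<Sum>i\<in>A n. \<phi> i)) \<longlonglongrightarrow> ennreal L"
      by (intro tendsto_ennrealI assms(2))
  qed
  finally show ?thesis .
qed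

lemma parseval_norm:
  assumes f: "f \<in> L2"
  shows "(\<integral>\<^sup>+i. ennreal ((cmod (l2_inner (e i) f))\<^sup>2) \<partial>count_space UNIV) = ennreal ((l2_norm f)\<^sup>2)"
proof (rule nn_integral_count_lim)
  have "(\<lambda>n. Re (\<Sum>i\<in>A n. cnj (l2_inner (e i) f) * l2_inner (e i) f)) \<longlonglongrightarrow> Re (l2_inner f f)"
    by (intro tendsto_Re parseval_lim f)
  moreover have "Re (cnj z * z) = (cmod z)\<^sup>2" for z
    unfolding cmod_power2 by (simp add: power2_eq_square)
  ultimately show "(\<lambda>n. \<Sum>i\<in>A n. (cmod (l2_inner (e i) f))\<^sup>2) \<longlonglongrightarrow> (l2_norm f)\<^sup>2"
    by (simp add: l2_inner_self)
qed simp

lemma coeff_sq_integrable: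
  "f \<in> L2 \<Longrightarrow> integrable (count_space UNIV) (\<lambda>i. (cmod (l2_inner (e i) f))\<^sup>2)"
  by (intro integrableI_nonneg) (auto simp: parseval_norm)

lemma coeff_mult_integrable:
  assumes "f \<in> L2" "g \<in> L2"
  shows "integrable (count_space UNIV) (\<lambda>i. cnj (l2_inner (e i) f) * l2_inner (e i) g)"
proof (rule Bochner_Integration.integrable_bound)
  show "integrable (count_space UNIV) (\<lambda>i. (cmod (l2_inner (e i) f))\<^sup>2 + (cmod (l2_inner (e i) g))\<^sup>2)"
    using assms by (intro Bochner_Integration.integrable_add coeff_sq_integrable)
  have "cmod a * cmod b \<le> (cmod a)\<^sup>2 + (cmod b)\<^sup>2" for a b
  proof -
    have "0 \<le> cmod a * cmod b" by simp
    with sum_squares_bound[of "cmod a" "cmod b"] show ?thesis by linarith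
  qed
  then show "AE i in count_space UNIV. norm (cnj (l2_inner (e i) f) * l2_inner (e i) g)
      \<le> norm ((cmod (l2_inner (e i) f))\<^sup>2 + (cmod (l2_inner (e i) g))\<^sup>2)"
    by (auto simp: norm_mult)
qed simp

lemma parseval:
  assumes f: "f \<in> L2" and g: "g \<in> L2"
  shows "l2_inner f g = (\<integral>i. cnj (l2_inner (e i) f) * l2_inner (e i) g \<partial>count_space UNIV)"
proof -
  let ?\<phi> = "\<lambda>i. cnj (l2_inner (e i) f) * l2_inner (e i) g"
  have "(\<lambda>n. \<integral>i. indicator (A n) i *\<^sub>R ?\<phi> i \<partial>count_space UNIV) \<longlonglongrightarrow> (\<integral>i. ?\<phi> i \<partial>count_space UNIV)"
  proof (rule integral_dominated_convergence[where w="\<lambda>i. norm (?\<phi> i)"])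
    show "integrable (count_space UNIV) (\<lambda>i. norm (?\<phi> i))"
      by (intro integrable_norm coeff_mult_integrable f g)
    show "AE i in count_space UNIV. (\<lambda>n. indicator (A n) i *\<^sub>R ?\<phi> i) \<longlonglongrightarrow> ?\<phi> i"
    proof (intro AE_I2 tendsto_eventually)
      fix i
      obtain n where n: "i \<in> A n" using UN_A by blast
      show "\<forall>\<^sub>F m in sequentially. indicator (A m) i *\<^sub>R ?\<phi> i = ?\<phi> i"
        using eventually_ge_at_top[of n] by eventually_elim (use n mono_A in \<open>auto simp: indicator_def\<close>)
    qed
  qed (auto simp: indicator_def)
  moreover have "(\<integral>i. indicator (A n) i *\<^sub>R ?\<phi> i \<partial>count_space UNIV) = (\<Sum>i\<in>A n. ?\<phi> i)" for n
  proof -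
    have "(\<integral>i. indicator (A n) i *\<^sub>R ?\<phi> i \<partial>count_space UNIV) = (\<integral>i. ?\<phi> i \<partial>restrict_space (count_space UNIV) (A n))"
      by (subst integral_restrict_space) auto
    also have "\<dots> = (\<Sum>i\<in>A n. ?\<phi> i)"
      by (simp add: restrict_count_space lebesgue_integral_count_space_finite finite_A)
    finally show ?thesis .
  qed
  ultimately show ?thesis using parseval_lim[OF f g] LIMSEQ_unique by fastforce
qed

end

section \<open>Completeness of the Hermite functions on the line\<close>

text \<open>\<open>P 1\<close> and \<open>P (-1)\<close> are the positive and the negative part of
  \<open>G\<close>. The value at \<open>t = 0\<close> shows that they have the same mass
  \<open>c\<close>; divided by \<open>c\<close> they become probability densities with equal
  characteristic functions, and Levy's uniqueness theorem applies.\<close>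

lemma fourier_transform_eq_0D:
  fixes G :: "real \<Rightarrow> real"
  assumes G: "integrable lborel G" and zero: "\<And>t. (\<integral>x. G x *\<^sub>R iexp (t * x) \<partial>lborel) = 0"
  shows "AE x in lborel. G x = 0"
proof -
  note Gm [measurable] = borel_measurable_integrable[OF G]
  define P where "P s x = max 0 (s * G x)" for s x :: real
  have Pi: "integrable lborel (P s)" for s unfolding P_def[abs_def] by (intro Bochner_Integration.integrable_max integrable_mult_right G) simp
  have Pm [measurable]: "P s \<in> borel_measurable borel" for s unfolding P_def[abs_def] by measurable
  have P0: "P s x \<ge> 0" for s x by (simp add: P_def)
  have split: "G x = P 1 x - P (-1) x" for x by (simp add: P_def max_def)
  have F: "integrable lborel (\<lambda>x. P s x *\<^sub>R iexp (t * x))" for s t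
    by (rule Bochner_Integration.integrable_bound[OF Pi[of s]]) (auto simp: P0)
  have Feq: "(\<integral>x. P 1 x *\<^sub>R iexp (t * x) \<partial>lborel) = (\<integral>x. P (-1) x *\<^sub>R iexp (t * x) \<partial>lborel)" for t
  proof -
    have "(\<integral>x. P 1 x *\<^sub>R iexp (t * x) - P (-1) x *\<^sub>R iexp (t * x) \<partial>lborel) = 0"
      using zero[of t] unfolding split scaleR_diff_left .
    then show ?thesis unfolding Bochner_Integration.integral_diff[OF F F] by simp
  qed
  define c where "c = (\<integral>x. P 1 x \<partial>lborel)"
  have "(\<integral>x. P 1 x \<partial>lborel) = (\<integral>x. P (-1) x \<partial>lborel)"
  proof -
    have "(\<integral>x. complex_of_real (P 1 x) \<partial>lborel) = (\<integral>x. complex_of_real (P (-1) x) \<partial>lborel)"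
      using Feq[of 0] by (simp add: scaleR_conv_of_real)
    then show ?thesis by simp
  qed
  then have c: "(\<integral>x. P s x \<partial>lborel) = c" if "s = 1 \<or> s = -1" for s using that by (auto simp: c_def)
  have c0: "c \<ge> 0" unfolding c_def using P0 by simp
  show ?thesis
  proof (cases "c = 0")
    case True
    have "AE x in lborel. P s x = 0" if "s = 1 \<or> s = -1" for s
      using integral_nonneg_eq_0_iff_AE[OF Pi[of s]] c[OF that] True P0 by auto
    from this[of 1] this[of "-1"] have "AE x in lborel. P 1 x = 0" "AE x in lborel. P (-1) x = 0" by auto
    then show ?thesis by eventually_elim (simp add: split)
  next
    case False
    with c0 have c1: "c > 0" by simp
    define M where "M s = density lborel (\<lambda>x. ennreal (P s x / c))" for s
    have rd: "real_distribution (M s)" if "s = 1 \<or> s = -1" for s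
    proof -
      have "(\<integral>\<^sup>+x. ennreal (P s x / c) \<partial>lborel) = ennreal (\<integral>x. P s x / c \<partial>lborel)"
        using P0 c1 Pi[of s] by (intro nn_integral_eq_integral integrable_divide) (auto intro!: AE_I2 divide_nonneg_nonneg)
      also have "\<dots> = 1" using c[OF that] c1 by simp
      finally have "prob_space (M s)" unfolding M_def by (intro prob_spaceI) (simp add: emeasure_density)
      then show ?thesis unfolding real_distribution_def real_distribution_axioms_def M_def by simp
    qed
    have ch: "char (M s) t = (\<integral>x. P s x *\<^sub>R iexp (t * x) \<partial>lborel) / of_real c" for s t
    proof -
      have "char (M s) t = (\<integral>x. (P s x / c) *\<^sub>R iexp (t * x) \<partial>lborel)"
        unfolding char_def M_def using P0 c1 by (intro integral_density) (auto intro!: AE_I2 divide_nonneg_nonneg)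
      also have "\<dots> = (\<integral>x. (P s x *\<^sub>R iexp (t * x)) / of_real c \<partial>lborel)"
        by (simp add: scaleR_conv_of_real)
      finally show ?thesis by simp
    qed
    have "M 1 = M (-1)"
    proof (rule Levy_uniqueness[OF rd rd])
      show "char (M 1) = char (M (-1))" unfolding fun_eq_iff ch Feq by simp
    qed simp_all
    then have "AE x in lborel. ennreal (P 1 x / c) = ennreal (P (-1) x / c)"
      unfolding M_def by (intro sigma_finite_measure.density_unique[OF sigma_finite_lborel]) auto
    then show ?thesis
    proof eventually_elim
      case (elim x)
      have "P 1 x / c \<ge> 0" "P (-1) x / c \<ge> 0" using P0 c1 by (auto intro!: divide_nonneg_nonneg)
      with elim have "P 1 x / c = P (-1) x / c" by (simp only: ennreal_inj)
      then have "P 1 x = P (-1) x" using c1 by simp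
      then show ?case by (simp add: split)
    qed
  qed
qed

lemma gauss_bound_L2:
  fixes h :: "real \<Rightarrow> real"
  assumes [measurable]: "h \<in> borel_measurable borel" and bd: "\<And>x. \<bar>h x\<bar> \<le> C * exp (- x\<^sup>2 / 4)"
  shows "(\<lambda>x. complex_of_real (h x)) \<in> L2"
proof (rule L2_I)
  have "integrable lborel (\<lambda>x::real. C\<^sup>2 * exp (- (1/2) * x\<^sup>2))"
    by (intro integrable_mult_right integrable_gauss) simp
  then show "integrable lborel (\<lambda>x. (cmod (complex_of_real (h x)))\<^sup>2)"
  proof (rule Bochner_Integration.integrable_bound)
    have "(h x)\<^sup>2 \<le> C\<^sup>2 * exp (- (1/2) * x\<^sup>2)" for x
    proof -
      have "\<bar>h x\<bar>\<^sup>2 \<le> (C * exp (- x\<^sup>2 / 4))\<^sup>2" using bd[of x] by (intro power_mono) auto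
      also have "\<dots> = C\<^sup>2 * (exp (- x\<^sup>2 / 4) * exp (- x\<^sup>2 / 4))" by (simp add: power2_eq_square)
      also have "exp (- x\<^sup>2 / 4) * exp (- x\<^sup>2 / 4) = exp (- (1/2) * x\<^sup>2)" by (simp add: exp_add[symmetric])
      finally show ?thesis by simp
    qed
    then show "AE x in lborel. norm ((cmod (complex_of_real (h x)))\<^sup>2) \<le> norm (C\<^sup>2 * exp (- (1/2) * x\<^sup>2))" by simp
  qed measurable
qed measurable

lemma hermf_power_L2: "(\<lambda>x. complex_of_real (x ^ j * hermf k x)) \<in> L2"
proof -
  obtain C where "\<And>x. \<bar>x ^ j * hermf k x\<bar> \<le> C * exp (- x\<^sup>2 / 4)" using hermf_decay by blast
  then show ?thesis by (intro gauss_bound_L2) auto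
qed

lemma hermf_L2: "(\<lambda>x. complex_of_real (hermf k x)) \<in> L2"
  using hermf_power_L2[of 0 k] by simp

lemma L2_real_mult_integrable:
  fixes h g :: "'a::euclidean_space \<Rightarrow> real"
  assumes "(\<lambda>x. complex_of_real (h x)) \<in> L2" "(\<lambda>x. complex_of_real (g x)) \<in> L2"
  shows "integrable lborel (\<lambda>x. h x * g x)"
  using integrable_Re[OF L2_inner_integrable[OF assms]] by simp

lemma hermf_pos: "hermf 0 x > 0"
  by (simp add: hermf.simps)

text \<open>Through the recurrence, orthogonality to all Hermite functions makes all moments of
  \<open>hermf 0 * g\<close> vanish. Gaussian decay allows the exponential series to be integrated
  term by term, so the Fourier transform of \<open>hermf 0 * g\<close> is zero.\<close>

lemma hermf_complete_real:
  fixes g :: "real \<Rightarrow> real"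
  assumes g: "(\<lambda>x. complex_of_real (g x)) \<in> L2" and gm [measurable]: "g \<in> borel_measurable borel"
    and zero: "\<And>k. (\<integral>x. hermf k x * g x \<partial>lborel) = 0"
  shows "AE x in lborel. g x = 0"
proof -
  have int: "integrable lborel (\<lambda>x. x ^ j * hermf k x * g x)" for j k
    by (rule L2_real_mult_integrable[OF hermf_power_L2 g])
  have mom: "(\<integral>x. x ^ j * hermf k x * g x \<partial>lborel) = 0" for j k
  proof (induction j arbitrary: k)
    case (Suc j)
    have "x ^ Suc j * hermf k x * g x = (sqrt (real k + 1) * (x ^ j * hermf (Suc k) x * g x)
        + sqrt k * (x ^ j * hermf (k - 1) x * g x)) / sqrt 2" for x
    proof -
      have "x ^ Suc j * hermf k x * g x = (x * hermf k x) * (x ^ j * g x)" by simp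
      then show ?thesis unfolding hermf_rec by (simp add: algebra_simps)
    qed
    then show ?case using Suc int by simp
  qed (use zero in simp)
  define G where "G x = hermf 0 x * g x" for x
  have Gm [measurable]: "G \<in> borel_measurable borel" unfolding G_def[abs_def] by measurable
  have G: "integrable lborel G" using int[of 0 0] unfolding G_def[abs_def] by simp
  have "AE x in lborel. G x = 0"
  proof (rule fourier_transform_eq_0D[OF G])
    fix t :: real
    let ?s = "\<lambda>n x. G x *\<^sub>R (\<Sum>m<n. (\<i> * of_real (t * x)) ^ m /\<^sub>R fact m)"
    have "(\<lambda>n. \<integral>x. ?s n x \<partial>lborel) \<longlonglongrightarrow> (\<integral>x. G x *\<^sub>R iexp (t * x) \<partial>lborel)"
    proof (rule integral_dominated_convergence[where w="\<lambda>x. exp \<bar>t * x\<bar> * \<bar>G x\<bar>"])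
      show "AE x in lborel. (\<lambda>n. ?s n x) \<longlonglongrightarrow> G x *\<^sub>R iexp (t * x)"
        using exp_converges unfolding sums_def by (intro AE_I2 tendsto_scaleR tendsto_const)
      \<comment> \<open>The dominating function is integrable because \<open>t * x\<close> is
        absorbed by half of the Gaussian exponent, at the price of the constant
        \<open>exp (t^2)\<close>.\<close>
      have b1: "\<bar>exp \<bar>t * x\<bar> * hermf 0 x\<bar> \<le> (pi powr (-1/4) * exp (t\<^sup>2)) * exp (- x\<^sup>2 / 4)" for x
      proof -
        have "\<bar>t * x\<bar> \<le> t\<^sup>2 + x\<^sup>2 / 4"
          using zero_le_power2[of "\<bar>t\<bar> - \<bar>x\<bar> / 2"] by (simp add: power2_diff abs_mult power_divide)
        then have "exp (\<bar>t * x\<bar> + - x\<^sup>2 / 2) \<le> exp (t\<^sup>2 + - x\<^sup>2 / 4)" by simp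
        then have "exp \<bar>t * x\<bar> * exp (- x\<^sup>2 / 2) \<le> exp (t\<^sup>2) * exp (- x\<^sup>2 / 4)" unfolding exp_add .
        then have "pi powr (-1/4) * (exp \<bar>t * x\<bar> * exp (- x\<^sup>2 / 2)) \<le> pi powr (-1/4) * (exp (t\<^sup>2) * exp (- x\<^sup>2 / 4))"
          by (rule mult_left_mono) simp
        then show ?thesis by (simp add: hermf.simps abs_mult mult_ac)
      qed
      have "(\<lambda>x. complex_of_real (exp \<bar>t * x\<bar> * hermf 0 x)) \<in> L2"
        by (rule gauss_bound_L2[OF _ b1]) measurable
      from integrable_abs[OF L2_real_mult_integrable[OF this g]]
      show "integrable lborel (\<lambda>x. exp \<bar>t * x\<bar> * \<bar>G x\<bar>)"
        by (simp add: G_def abs_mult mult.assoc)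
      fix n
      have "norm (\<Sum>m<n. (\<i> * of_real (t * x)) ^ m /\<^sub>R fact m) \<le> exp \<bar>t * x\<bar>" for x
      proof -
        have "norm (\<Sum>m<n. (\<i> * of_real (t * x)) ^ m /\<^sub>R fact m) \<le> (\<Sum>m<n. norm ((\<i> * of_real (t * x)) ^ m /\<^sub>R fact m))"
          by (rule norm_sum)
        also have "\<dots> = (\<Sum>m<n. \<bar>t * x\<bar> ^ m /\<^sub>R fact m)"
          by (intro sum.cong refl) (simp add: norm_power norm_mult abs_mult)
        also have "\<dots> \<le> (\<Sum>m. \<bar>t * x\<bar> ^ m /\<^sub>R fact m)"
          by (intro sum_le_suminf summable_exp_generic) auto
        finally show ?thesis unfolding exp_def .
      qed
      then show "AE x in lborel. norm (?s n x) \<le> exp \<bar>t * x\<bar> * \<bar>G x\<bar>"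
        by (intro AE_I2) (simp add: mult.commute mult_left_mono)
    qed measurable
    moreover have "(\<integral>x. ?s n x \<partial>lborel) = 0" for n
    proof -
      have "?s n x = (\<Sum>m<n. ((\<i> * of_real t) ^ m / fact m) * of_real (x ^ m * hermf 0 x * g x))" for x
        by (simp add: G_def scaleR_sum_right scaleR_conv_of_real power_mult_distrib sum_distrib_left field_simps)
      then have "(\<integral>x. ?s n x \<partial>lborel) = (\<integral>x. (\<Sum>m<n. ((\<i> * of_real t) ^ m / fact m) * of_real (x ^ m * hermf 0 x * g x)) \<partial>lborel)"
        by simp
      also have "\<dots> = (\<Sum>m<n. \<integral>x. ((\<i> * of_real t) ^ m / fact m) * of_real (x ^ m * hermf 0 x * g x) \<partial>lborel)"
        by (intro Bochner_Integration.integral_sum integrable_mult_right integrable_of_real int)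
      also have "\<dots> = (\<Sum>m<n. ((\<i> * of_real t) ^ m / fact m) * of_real (\<integral>x. x ^ m * hermf 0 x * g x \<partial>lborel))"
        by (simp only: integral_mult_right_zero integral_complex_of_real)
      finally show ?thesis unfolding mom by simp
    qed
    ultimately have "(\<lambda>n. 0) \<longlonglongrightarrow> (\<integral>x. G x *\<^sub>R iexp (t * x) \<partial>lborel)" by simp
    then show "(\<integral>x. G x *\<^sub>R iexp (t * x) \<partial>lborel) = 0" by (simp add: LIMSEQ_const_iff)
  qed
  then show ?thesis
  proof eventually_elim
    case (elim x)
    then show ?case using hermf_pos[of x] by (simp add: G_def)
  qed
qed

lemma L2_Re_Im:
  assumes "f \<in> L2"
  shows "(\<lambda>x. complex_of_real (Re (f x))) \<in> L2" "(\<lambda>x. complex_of_real (Im (f x))) \<in> L2"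
proof -
  note [measurable] = L2_measurable[OF assms]
  show "(\<lambda>x. complex_of_real (Re (f x))) \<in> L2"
    by (rule L2_I, measurable, rule Bochner_Integration.integrable_bound[OF L2_integrable[OF assms]])
       (auto simp: cmod_power2)
  show "(\<lambda>x. complex_of_real (Im (f x))) \<in> L2"
    by (rule L2_I, measurable, rule Bochner_Integration.integrable_bound[OF L2_integrable[OF assms]])
       (auto simp: cmod_power2)
qed

lemma l2_inner_real_left:
  assumes "(\<lambda>x. complex_of_real (h x)) \<in> L2" "f \<in> L2"
  shows "Re (l2_inner (\<lambda>x. complex_of_real (h x)) f) = (\<integral>x. h x * Re (f x) \<partial>lborel)"
    "Im (l2_inner (\<lambda>x. complex_of_real (h x)) f) = (\<integral>x. h x * Im (f x) \<partial>lborel)"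
proof -
  have i: "integrable lborel (\<lambda>x. cnj (complex_of_real (h x)) * f x)"
    by (rule L2_inner_integrable[OF assms])
  show "Re (l2_inner (\<lambda>x. complex_of_real (h x)) f) = (\<integral>x. h x * Re (f x) \<partial>lborel)"
    unfolding l2_inner_def by (subst integral_Re[OF i, symmetric]) simp
  show "Im (l2_inner (\<lambda>x. complex_of_real (h x)) f) = (\<integral>x. h x * Im (f x) \<partial>lborel)"
    unfolding l2_inner_def by (subst integral_Im[OF i, symmetric]) simp
qed

interpretation hermf: complete_orthonormal "\<lambda>k x. complex_of_real (hermf k x)" "\<lambda>n. {..<n}"
proof
  fix i j :: nat
  show "(\<lambda>x. complex_of_real (hermf i x)) \<in> L2" by (rule hermf_L2)
  show "l2_inner (\<lambda>x. complex_of_real (hermf i x)) (\<lambda>x. complex_of_real (hermf j x)) = (if i = j then 1 else 0)"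
    unfolding l2_inner_def complex_cnj_complex_of_real of_real_mult[symmetric] integral_complex_of_real hermf_orthonormal
    by simp
  show "\<exists>n. i \<in> {..<n}" by auto
next
  fix f :: "real \<Rightarrow> complex" assume f: "f \<in> L2" and z: "\<And>i. l2_inner (\<lambda>x. complex_of_real (hermf i x)) f = 0"
  note [measurable] = L2_measurable[OF f]
  have "AE x in lborel. Re (f x) = 0" "AE x in lborel. Im (f x) = 0"
    using z l2_inner_real_left[OF hermf_L2 f]
    by (auto intro!: hermf_complete_real L2_Re_Im[OF f] )
  then show "AE x in lborel. f x = 0" by eventually_elim (simp add: complex_eq_iff)
qed auto

section \<open>Hermite functions in several variables\<close>

definition hermite :: "('n \<Rightarrow> nat) \<Rightarrow> real ^ 'n::finite \<Rightarrow> real" where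
  "hermite \<alpha> x = (\<Prod>i\<in>UNIV. hermf (\<alpha> i) (x $ i))"

lemma bij_betw_axis: "bij_betw (\<lambda>i. axis i (1::real)) (UNIV :: 'n::finite set) Basis"
  by (auto simp: bij_betw_def inj_on_def axis_eq_axis Basis_vec_def)

text \<open>\<open>lborel_eq\<close> presents Lebesgue measure as an image of the product measure
  over \<open>Basis\<close>; \<open>idx\<close> leads from basis vectors back to coordinates, and
  the product integrals are then computed factor by factor.\<close>

lemma
  fixes f :: "'n::finite \<Rightarrow> real \<Rightarrow> 'b::{real_normed_field,banach,second_countable_topology}"
  assumes f: "\<And>i. integrable lborel (f i)"
  shows integrable_prod_vec: "integrable lborel (\<lambda>x::real^'n. \<Prod>i\<in>UNIV. f i (x $ i))"
    and integral_prod_vec: "(\<integral>x. (\<Prod>i\<in>UNIV. f i (x $ i)) \<partial>(lborel :: (real^'n) measure)) = (\<Prod>i\<in>UNIV. \<integral>x. f i x \<partial>lborel)"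
proof -
  let ?B = "Basis :: (real^'n) set"
  let ?T = "\<lambda>g. \<Sum>b\<in>?B. g b *\<^sub>R b"
  define idx where "idx b = (THE i. b = axis i (1::real))" for b :: "real^'n"
  have idx: "idx (axis i 1) = i" for i unfolding idx_def by (rule the_equality) (auto simp: axis_eq_axis)
  interpret P: product_sigma_finite "\<lambda>b::real^'n. lborel :: real measure" ..
  have fm [measurable]: "f i \<in> borel_measurable borel" for i using borel_measurable_integrable[OF f] by simp
  have comp: "?T g $ i = g (axis i 1)" for g :: "real^'n \<Rightarrow> real" and i
    by (simp add: sum.reindex_bij_betw[OF bij_betw_axis, symmetric] axis_def if_distrib[of "(*) _"] cong: if_cong)
  have eq: "(\<Prod>i\<in>UNIV. f i (?T g $ i)) = (\<Prod>b\<in>?B. f (idx b) (g b))" for g :: "real^'n \<Rightarrow> real"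
    unfolding comp by (subst prod.reindex_bij_betw[OF bij_betw_axis, symmetric]) (simp add: idx)
  have Pint: "integrable (\<Pi>\<^sub>M b\<in>?B. lborel) (\<lambda>g. \<Prod>b\<in>?B. f (idx b) (g b))"
    by (rule P.product_integrable_prod) (auto intro: f)
  have T [measurable]: "?T \<in> measurable (\<Pi>\<^sub>M b\<in>?B. lborel) borel" by measurable
  have m: "(\<lambda>x::real^'n. \<Prod>i\<in>UNIV. f i (x $ i)) \<in> borel_measurable borel" by measurable
  show "integrable lborel (\<lambda>x::real^'n. \<Prod>i\<in>UNIV. f i (x $ i))"
    unfolding lborel_eq[where 'a="real^'n"] by (subst integrable_distr_eq[OF T m]) (simp only: eq Pint)
  have "(\<integral>x. (\<Prod>i\<in>UNIV. f i (x $ i)) \<partial>(lborel :: (real^'n) measure)) = (\<integral>g. (\<Prod>b\<in>?B. f (idx b) (g b)) \<partial>(\<Pi>\<^sub>M b\<in>?B. lborel))"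
    unfolding lborel_eq[where 'a="real^'n"] by (subst integral_distr[OF T m]) (simp only: eq)
  also have "\<dots> = (\<Prod>b\<in>?B. \<integral>x. f (idx b) x \<partial>lborel)"
    by (rule P.product_integral_prod) (auto intro: f)
  also have "\<dots> = (\<Prod>i\<in>UNIV. \<integral>x. f i x \<partial>lborel)"
    by (subst prod.reindex_bij_betw[OF bij_betw_axis, symmetric]) (simp add: idx)
  finally show "(\<integral>x. (\<Prod>i\<in>UNIV. f i (x $ i)) \<partial>(lborel :: (real^'n) measure)) = (\<Prod>i\<in>UNIV. \<integral>x. f i x \<partial>lborel)" .
qed

lemma prod_vec_L2:
  fixes f :: "'n::finite \<Rightarrow> real \<Rightarrow> complex"
  assumes f: "\<And>i. f i \<in> L2"
  shows "(\<lambda>x::real^'n. \<Prod>i\<in>UNIV. f i (x $ i)) \<in> L2"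
    and "l2_norm (\<lambda>x::real^'n. \<Prod>i\<in>UNIV. f i (x $ i)) = (\<Prod>i\<in>UNIV. l2_norm (f i))"
proof -
  note [measurable] = L2_measurable[OF f]
  have eq: "(cmod (\<Prod>i\<in>UNIV. f i (x $ i)))\<^sup>2 = (\<Prod>i\<in>UNIV. (cmod (f i (x $ i)))\<^sup>2)" for x :: "real^'n"
    by (simp add: prod_norm[symmetric] prod_power_distrib)
  show "(\<lambda>x::real^'n. \<Prod>i\<in>UNIV. f i (x $ i)) \<in> L2"
    by (rule L2_I) (measurable, unfold eq, rule integrable_prod_vec[OF L2_integrable[OF f]])
  have "(l2_norm (\<lambda>x::real^'n. \<Prod>i\<in>UNIV. f i (x $ i)))\<^sup>2 = (\<Prod>i\<in>UNIV. l2_norm (f i))\<^sup>2"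
    unfolding l2_norm_sq eq by (subst integral_prod_vec[OF L2_integrable[OF f]]) (simp add: prod_power_distrib l2_norm_sq)
  then show "l2_norm (\<lambda>x::real^'n. \<Prod>i\<in>UNIV. f i (x $ i)) = (\<Prod>i\<in>UNIV. l2_norm (f i))"
    by (rule power2_eq_imp_eq) (auto intro: prod_nonneg)
qed

lemma hermite_L2: "(\<lambda>x. complex_of_real (hermite \<alpha> x)) \<in> L2"
  using prod_vec_L2(1)[of "\<lambda>i x. complex_of_real (hermf (\<alpha> i) x)"] by (simp add: hermite_def hermf_L2)

lemma hermite_orthonormal:
  fixes \<alpha> \<beta> :: "'n::finite \<Rightarrow> nat"
  shows "(\<integral>x. hermite \<alpha> x * hermite \<beta> x \<partial>lborel) = (if \<alpha> = \<beta> then 1 else 0)"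
proof -
  have "(\<integral>x. hermite \<alpha> x * hermite \<beta> x \<partial>lborel) = (\<Prod>i\<in>UNIV. if \<alpha> i = \<beta> i then 1 else (0::real))"
    unfolding hermite_def prod.distrib[symmetric] by (subst integral_prod_vec) (auto simp: hermf_orthonormal intro!: prod.cong)
  then show ?thesis by (auto simp: fun_eq_iff prod_zero_iff)
qed

text \<open>The positive and the negative part of \<open>g\<close> are densities of two measures
  that agree and are finite on boxes. Boxes are stable under intersection and generate the Borel
  sets.\<close>

lemma L2_eq_0_boxes:
  fixes g :: "'a::euclidean_space \<Rightarrow> real"
  assumes g: "(\<lambda>x. complex_of_real (g x)) \<in> L2" and [measurable]: "g \<in> borel_measurable borel"
    and zero: "\<And>l u. (\<integral>x. indicator (box l u) x * g x \<partial>lborel) = 0"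
  shows "AE x in lborel. g x = 0"
proof -
  define P where "P s x = max 0 (s * g x)" for s x
  have Pm [measurable]: "P s \<in> borel_measurable borel" for s unfolding P_def[abs_def] by measurable
  have P0: "P s x \<ge> 0" for s x by (simp add: P_def)
  have split: "g x = P 1 x - P (-1) x" for x by (simp add: P_def max_def)
  have box_L2: "(\<lambda>x. complex_of_real (indicator (box l u) x)) \<in> L2" for l u :: 'a
  proof (rule L2_I)
    have "(cmod (complex_of_real (indicator (box l u) x)))\<^sup>2 = indicator (box l u) x" for x
      by (simp add: indicator_def)
    then show "integrable lborel (\<lambda>x. (cmod (complex_of_real (indicator (box l u) x)))\<^sup>2)"
      using integrable_real_indicator[OF _ emeasure_lborel_box_finite, of l u] by simp
  qed measurable
  have gi: "integrable lborel (\<lambda>x. indicator (box l u) x * g x)" for l u :: 'a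
    by (rule L2_real_mult_integrable[OF box_L2 g])
  have Pi: "integrable lborel (\<lambda>x. indicator (box l u) x * P s x)" if "s = 1 \<or> s = -1" for s and l u :: 'a
    by (rule Bochner_Integration.integrable_bound[OF gi[of l u]]) (use that in \<open>auto simp: P_def indicator_def abs_if\<close>)
  have em: "emeasure (density lborel (\<lambda>x. ennreal (P s x))) (box l u) = ennreal (\<integral>x. indicator (box l u) x * P s x \<partial>lborel)"
    if "s = 1 \<or> s = -1" for s and l u :: 'a
  proof -
    have "emeasure (density lborel (\<lambda>x. ennreal (P s x))) (box l u) = (\<integral>\<^sup>+x. ennreal (indicator (box l u) x * P s x) \<partial>lborel)"
      by (subst emeasure_density) (auto intro!: nn_integral_cong simp: indicator_def)
    also have "\<dots> = ennreal (\<integral>x. indicator (box l u) x * P s x \<partial>lborel)"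
      by (rule nn_integral_eq_integral[OF Pi[OF that]]) (auto simp: P0 indicator_def)
    finally show ?thesis .
  qed
  have "density lborel (\<lambda>x. ennreal (P 1 x)) = density lborel (\<lambda>x. ennreal (P (-1) x))"
  proof (rule measure_eqI_generator_eq)
    let ?E = "range (\<lambda>(a, b). box a b::'a set)"
    show "Int_stable ?E" by (auto simp: Int_stable_def box_Int_box)
    show "?E \<subseteq> Pow UNIV" "sets (density lborel (\<lambda>x. ennreal (P 1 x))) = sigma_sets UNIV ?E"
      "sets (density lborel (\<lambda>x. ennreal (P (-1) x))) = sigma_sets UNIV ?E"
      by (simp_all add: borel_eq_box)
    let ?A = "\<lambda>n::nat. box (- (real n *\<^sub>R One)) (real n *\<^sub>R One) :: 'a set"
    show "range ?A \<subseteq> ?E" "(\<Union>i. ?A i) = UNIV" unfolding UN_box_eq_UNIV by auto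
    show "emeasure (density lborel (\<lambda>x. ennreal (P 1 x))) (?A i) \<noteq> \<infinity>" for i by (simp add: em)
    fix X assume "X \<in> ?E"
    then obtain l u :: 'a where X: "X = box l u" by auto
    have "(\<integral>x. indicator (box l u) x * P 1 x - indicator (box l u) x * P (-1) x \<partial>lborel) = 0"
      using zero[of l u] unfolding split right_diff_distrib .
    then show "emeasure (density lborel (\<lambda>x. ennreal (P 1 x))) X = emeasure (density lborel (\<lambda>x. ennreal (P (-1) x))) X"
      by (simp add: X em Pi)
  qed
  then have "AE x in lborel. ennreal (P 1 x) = ennreal (P (-1) x)"
    by (intro sigma_finite_measure.density_unique[OF sigma_finite_lborel]) auto
  then show ?thesis by eventually_elim (simp add: split P0)
qed

text \<open>\<open>J\<close> collects the coordinates whose factor is arbitrary, and the induction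
  frees one coordinate at a time. The factor in the new coordinate is the limit of its
  one-dimensional Hermite expansion, and a tensor product depends continuously on each factor
  because norms multiply.\<close>

lemma hermite_complete_tensor:
  fixes f :: "real ^ 'n::finite \<Rightarrow> complex"
  assumes f: "f \<in> L2" and zero: "\<And>\<alpha>. l2_inner (\<lambda>x. complex_of_real (hermite \<alpha> x)) f = 0"
    and \<phi>: "\<And>i. \<phi> i \<in> L2" and J: "finite J"
    and herm: "\<And>i. i \<notin> J \<Longrightarrow> \<exists>k. \<phi> i = (\<lambda>x. complex_of_real (hermf k x))"
  shows "l2_inner (\<lambda>x. \<Prod>i\<in>UNIV. \<phi> i (x $ i)) f = 0"
  using J \<phi> herm
proof (induction J arbitrary: \<phi> rule: finite_induct)
  case empty
  then obtain \<alpha> where "\<And>i. \<phi> i = (\<lambda>x. complex_of_real (hermf (\<alpha> i) x))" by (metis empty_iff)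
  then have "(\<lambda>x. \<Prod>i\<in>UNIV. \<phi> i (x $ i)) = (\<lambda>x. complex_of_real (hermite \<alpha> x))"
    by (simp add: hermite_def)
  then show ?case using zero by simp
next
  case (insert j J)
  note L = insert.prems(1)
  define \<Phi> where "\<Phi> \<psi> x = (\<Prod>i\<in>UNIV. (\<phi>(j := \<psi>)) i (x $ i))" for \<psi> and x :: "real^'n"
  have upd: "(\<phi>(j := \<psi>)) i \<in> L2" if "\<psi> \<in> L2" for \<psi> i using that L by simp
  have \<Phi>L: "\<Phi> \<psi> \<in> L2" if "\<psi> \<in> L2" for \<psi>
    unfolding \<Phi>_def[abs_def] by (rule prod_vec_L2(1)) (rule upd[OF that])
  have \<Phi>eq: "\<Phi> \<psi> x = \<psi> (x $ j) * (\<Prod>i\<in>UNIV - {j}. \<phi> i (x $ i))" for \<psi> x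
    unfolding \<Phi>_def by (subst prod.remove[of _ j]) (auto intro!: prod.cong)
  define K where "K = (\<Prod>i\<in>UNIV - {j}. l2_norm (\<phi> i))"
  have \<Phi>norm: "l2_norm (\<Phi> \<psi>) = l2_norm \<psi> * K" if "\<psi> \<in> L2" for \<psi>
  proof -
    have "l2_norm (\<Phi> \<psi>) = (\<Prod>i\<in>UNIV. l2_norm ((\<phi>(j := \<psi>)) i))"
      unfolding \<Phi>_def[abs_def] by (rule prod_vec_L2(2)) (rule upd[OF that])
    then show ?thesis unfolding K_def by (subst (asm) prod.remove[of _ j]) (auto intro!: prod.cong)
  qed
  have herm0: "l2_inner (\<Phi> (\<lambda>x. complex_of_real (hermf k x))) f = 0" for k
    unfolding \<Phi>_def[abs_def]
  proof (rule insert.IH)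
    show "(\<phi>(j := \<lambda>x. complex_of_real (hermf k x))) i \<in> L2" for i by (rule upd[OF hermf_L2])
    show "\<exists>k'. (\<phi>(j := \<lambda>x. complex_of_real (hermf k x))) i = (\<lambda>x. complex_of_real (hermf k' x))" if "i \<notin> J" for i
      using insert.prems(2)[of i] that by (cases "i = j") auto
  qed
  define c where "c k = l2_inner (\<lambda>x. complex_of_real (hermf k x)) (\<phi> j)" for k
  define s where "s n x = (\<Sum>k\<in>{..<n}. c k * complex_of_real (hermf k x))" for n x
  have sL: "s n \<in> L2" for n unfolding s_def[abs_def] by (rule hermf.finite_sum_L2)
  have s0: "l2_inner f (\<Phi> (s n)) = 0" for n
  proof -
    have "\<Phi> (s n) = (\<lambda>x. \<Sum>k\<in>{..<n}. c k * \<Phi> (\<lambda>x. complex_of_real (hermf k x)) x)"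
      by (simp add: fun_eq_iff \<Phi>eq s_def sum_distrib_right mult.assoc)
    then have "l2_inner f (\<Phi> (s n)) = (\<Sum>k\<in>{..<n}. c k * l2_inner f (\<Phi> (\<lambda>x. complex_of_real (hermf k x))))"
      by (simp add: l2_inner_sum_right[OF f] L2_scale \<Phi>L hermf_L2 l2_inner_scale_right)
    also have "\<dots> = 0" using herm0 by (subst l2_inner_commute) simp
    finally show ?thesis .
  qed
  have "(\<lambda>n. l2_norm (\<lambda>x. s n x - \<phi> j x)) \<longlonglongrightarrow> 0"
    unfolding s_def c_def by (rule hermf.expansion[OF L])
  then have "(\<lambda>n. l2_norm (\<lambda>x. s n x - \<phi> j x) * K) \<longlonglongrightarrow> 0" by (rule tendsto_mult_left_zero)
  moreover have "l2_norm (\<lambda>x. s n x - \<phi> j x) * K = l2_norm (\<lambda>x. \<Phi> (s n) x - \<Phi> (\<phi> j) x)" for n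
  proof -
    have "(\<lambda>x. \<Phi> (s n) x - \<Phi> (\<phi> j) x) = \<Phi> (\<lambda>x. s n x - \<phi> j x)"
      by (simp add: fun_eq_iff \<Phi>eq left_diff_distrib)
    then show ?thesis by (simp add: \<Phi>norm L2_diff sL L)
  qed
  ultimately have "(\<lambda>n. l2_norm (\<lambda>x. \<Phi> (s n) x - \<Phi> (\<phi> j) x)) \<longlonglongrightarrow> 0" by simp
  from l2_inner_tendsto[OF \<Phi>L[OF sL] \<Phi>L[OF L] f this]
  have "l2_inner f (\<Phi> (\<phi> j)) = 0" unfolding s0 by (simp add: LIMSEQ_const_iff)
  moreover have "\<Phi> (\<phi> j) = (\<lambda>x. \<Prod>i\<in>UNIV. \<phi> i (x $ i))" by (simp add: \<Phi>_def[abs_def] del: fun_upd_apply)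
  ultimately show ?case by (subst l2_inner_commute) simp
qed

lemma finite_multi_index: "finite {\<alpha> :: 'n::finite \<Rightarrow> nat. \<forall>i. \<alpha> i \<le> n}"
proof -
  have "{\<alpha> :: 'n \<Rightarrow> nat. \<forall>i. \<alpha> i \<le> n} = PiE UNIV (\<lambda>_. {..n})" by (auto simp: PiE_def extensional_def)
  then show ?thesis by (simp add: finite_PiE)
qed

text \<open>Indicators of boxes are tensor products of indicators of intervals. With all coordinates
  free, \<open>hermite_complete_tensor\<close> makes \<open>f\<close> orthogonal to them, and
  \<open>L2_eq_0_boxes\<close> concludes for the real and the imaginary part.\<close>

interpretation hermite: complete_orthonormal "\<lambda>\<alpha> (x :: real ^ 'n::finite). complex_of_real (hermite \<alpha> x)" "\<lambda>n. {\<alpha>. \<forall>i. \<alpha> i \<le> n}"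
proof
  fix \<alpha> \<beta> :: "'n \<Rightarrow> nat"
  show "(\<lambda>x. complex_of_real (hermite \<alpha> x)) \<in> L2" by (rule hermite_L2)
  show "l2_inner (\<lambda>x. complex_of_real (hermite \<alpha> x)) (\<lambda>x. complex_of_real (hermite \<beta> x)) = (if \<alpha> = \<beta> then 1 else 0)"
    unfolding l2_inner_def complex_cnj_complex_of_real of_real_mult[symmetric] integral_complex_of_real hermite_orthonormal
    by simp
  show "\<exists>n. \<alpha> \<in> {\<alpha>. \<forall>i. \<alpha> i \<le> n}"
    by (intro exI[of _ "Max (range \<alpha>)"]) auto
next
  fix f :: "real^'n \<Rightarrow> complex" assume f: "f \<in> L2" and z: "\<And>\<alpha>. l2_inner (\<lambda>x. complex_of_real (hermite \<alpha> x)) f = 0"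
  note [measurable] = L2_measurable[OF f]
  have ind: "(\<lambda>x. complex_of_real (indicator {a<..<b} x)) \<in> L2" for a b :: real
  proof (rule L2_I)
    have "(cmod (complex_of_real (indicator {a<..<b} x)))\<^sup>2 = indicator {a<..<b} x" for x
      by (simp add: indicator_def)
    then show "integrable lborel (\<lambda>x. (cmod (complex_of_real (indicator {a<..<b} x)))\<^sup>2)"
      by (cases "a \<le> b") (simp_all add: integrable_real_indicator)
  qed measurable
  have box: "l2_inner (\<lambda>x. complex_of_real (indicator (box l u) x)) f = 0"
    and box_L2: "(\<lambda>x. complex_of_real (indicator (box l u) x)) \<in> L2" for l u :: "real^'n"
  proof -
    have eq: "(\<Prod>i\<in>UNIV. complex_of_real (indicator {l $ i<..<u $ i} (x $ i))) = complex_of_real (indicator (box l u) x)" for x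
      by (auto simp: indicator_def mem_box_cart prod_zero_iff intro!: prod.neutral)
    show "l2_inner (\<lambda>x. complex_of_real (indicator (box l u) x)) f = 0"
      using hermite_complete_tensor[OF f z ind finite[of "UNIV :: 'n set"], of "\<lambda>i. l $ i" "\<lambda>i. u $ i"] unfolding eq by simp
    show "(\<lambda>x. complex_of_real (indicator (box l u) x)) \<in> L2"
      using prod_vec_L2(1)[OF ind, of "\<lambda>i. l $ i" "\<lambda>i. u $ i"] unfolding eq .
  qed
  have "AE x in lborel. Re (f x) = 0" "AE x in lborel. Im (f x) = 0"
    using box l2_inner_real_left[OF box_L2 f] by (auto intro!: L2_eq_0_boxes L2_Re_Im[OF f])
  then show "AE x in lborel. f x = 0" by eventually_elim (simp add: complex_eq_iff)
qed (auto simp: finite_multi_index intro: order_trans)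

section \<open>Orthogonality in time\<close>

lemma l2_norm_orthogonal_sum:
  assumes "finite S" "\<And>i. i \<in> S \<Longrightarrow> f i \<in> L2"
    and "\<And>i j. i \<in> S \<Longrightarrow> j \<in> S \<Longrightarrow> i \<noteq> j \<Longrightarrow> l2_inner (f i) (f j) = 0"
  shows "(l2_norm (\<lambda>x. \<Sum>i\<in>S. f i x))\<^sup>2 = (\<Sum>i\<in>S. (l2_norm (f i))\<^sup>2)"
  using assms
proof (induction S rule: finite_induct)
  case empty
  then show ?case by (simp add: l2_norm_def)
next
  case (insert a S)
  have L: "(\<lambda>x. \<Sum>i\<in>S. f i x) \<in> L2" using insert.prems(1) by (intro L2_sum) auto
  have "l2_inner (f a) (\<lambda>x. \<Sum>i\<in>S. f i x) = (\<Sum>i\<in>S. l2_inner (f a) (f i))"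
    using insert.prems(1) by (intro l2_inner_sum_right) auto
  also have "\<dots> = 0" using insert.hyps insert.prems(2) by (intro sum.neutral) auto
  finally have 0: "l2_inner (f a) (\<lambda>x. \<Sum>i\<in>S. f i x) = 0" .
  have fa: "f a \<in> L2" using insert.prems(1) by simp
  have "(l2_norm (\<lambda>x. f a x + (\<Sum>i\<in>S. f i x)))\<^sup>2 = (l2_norm (f a))\<^sup>2 + (l2_norm (\<lambda>x. \<Sum>i\<in>S. f i x))\<^sup>2"
    unfolding l2_norm_add_sq[OF fa L] 0 by simp
  then show ?case using insert by simp
qed

text \<open>Frequencies are written as \<open>2 * k\<close> because energies differ by even
  integers; all these exponentials have the period \<open>pi\<close>.\<close>

lemma exp_has_integral_periods:
  fixes k :: int
  shows "((\<lambda>t. exp (\<i> * of_real (2 * t * of_int k))) has_integral (if k = 0 then of_real (real m * pi) else 0)) {0..real m * pi}"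
proof (cases "k = 0")
  case True
  have "((\<lambda>t. 1 :: complex) has_integral of_real (real m * pi)) {0..real m * pi}"
    using has_integral_const_real[of "1::complex" 0 "real m * pi"] by (simp add: scaleR_conv_of_real)
  then show ?thesis using True by simp
next
  case False
  define F where "F t = exp (\<i> * of_real (2 * t * of_int k)) / (\<i> * of_real (2 * of_int k))" for t :: real
  have k0: "complex_of_int k \<noteq> 0" using False by simp
  have "(F has_vector_derivative exp (\<i> * of_real (2 * t * of_int k))) (at t within {0..real m * pi})" for t
  proof -
    have "((\<lambda>z. exp (\<i> * (2 * z * of_int k)) / (\<i> * (2 * of_int k))) has_field_derivative exp (\<i> * (2 * of_real t * of_int k))) (at (of_real t))"
      using k0 by (auto intro!: derivative_eq_intros simp: field_simps)
    from has_vector_derivative_real_field[OF this] show ?thesis unfolding F_def[abs_def]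
      by (simp add: has_vector_derivative_at_within)
  qed
  then have "((\<lambda>t. exp (\<i> * of_real (2 * t * of_int k))) has_integral (F (real m * pi) - F 0)) {0..real m * pi}"
    by (intro fundamental_theorem_of_calculus) auto
  moreover have "exp (\<i> * of_real (2 * (real m * pi) * of_int k)) = 1"
  proof -
    have "\<i> * complex_of_real (2 * (real m * pi) * of_int k) = \<i> * (of_real (2 * real_of_int (int m * k) * pi))"
      by (simp add: mult_ac)
    then show ?thesis by (metis exp_integer_2pi Ints_of_int of_real_mult of_real_numeral of_real_of_int_eq mult.assoc mult.commute)
  qed
  ultimately show ?thesis using False by (simp add: F_def)
qed

text \<open>The squared norm at time \<open>t\<close> is a trigonometric polynomial with the
  frequencies \<open>2 * (k - n)\<close>, and over whole periods only the terms with
  \<open>k = n\<close> survive. The orthogonality stems from time alone, whatever the inner products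
  of the \<open>Z n\<close> are.\<close>

lemma time_orthogonality:
  fixes Z :: "nat \<Rightarrow> 'a::euclidean_space \<Rightarrow> complex"
  assumes Z: "\<And>n. Z n \<in> L2" and J: "finite J"
  defines "w \<equiv> \<lambda>t x. \<Sum>n\<in>J. exp (\<i> * of_real (2 * t * real n)) * Z n x"
  shows "(\<integral>\<^sup>+t\<in>{0..real m * pi}. (\<integral>\<^sup>+x. ennreal ((cmod (w t x))\<^sup>2) \<partial>lborel) \<partial>lborel)
      = ennreal (real m * pi * (\<Sum>n\<in>J. (l2_norm (Z n))\<^sup>2))"
    and "(\<lambda>t. \<integral>\<^sup>+x. ennreal ((cmod (w t x))\<^sup>2) \<partial>lborel) \<in> borel_measurable borel"
proof -
  define F where "F t = (\<Sum>n\<in>J. \<Sum>k\<in>J. exp (\<i> * of_real (2 * t * of_int (int k - int n))) * l2_inner (Z n) (Z k))" for t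
  have wL: "w t \<in> L2" for t unfolding w_def by (intro L2_sum L2_scale Z)
  have norm: "complex_of_real ((l2_norm (w t))\<^sup>2) = F t" for t
  proof -
    have r: "l2_inner g (w t) = (\<Sum>k\<in>J. exp (\<i> * of_real (2 * t * real k)) * l2_inner g (Z k))" if "g \<in> L2" for g
      unfolding w_def using that by (subst l2_inner_sum_right) (auto intro: L2_scale Z simp: l2_inner_scale_right)
    have "l2_inner (w t) (w t) = (\<Sum>k\<in>J. exp (\<i> * of_real (2 * t * real k)) * cnj (l2_inner (Z k) (w t)))"
      unfolding r[OF wL] by (intro sum.cong refl) (metis l2_inner_commute)
    also have "\<dots> = (\<Sum>k\<in>J. \<Sum>n\<in>J. exp (\<i> * of_real (2 * t * of_int (int k - int n))) * l2_inner (Z n) (Z k))"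
    proof (intro sum.cong refl)
      fix k
      have "exp (\<i> * of_real (2 * t * real k)) * cnj (exp (\<i> * of_real (2 * t * real n))) = exp (\<i> * of_real (2 * t * of_int (int k - int n)))" for n
        by (simp add: exp_cnj exp_add[symmetric] algebra_simps)
      then show "exp (\<i> * of_real (2 * t * real k)) * cnj (l2_inner (Z k) (w t)) = (\<Sum>n\<in>J. exp (\<i> * of_real (2 * t * of_int (int k - int n))) * l2_inner (Z n) (Z k))"
        unfolding r[OF Z] cnj_sum complex_cnj_mult sum_distrib_left l2_inner_commute[of _ "Z k", symmetric]
        by (simp only: mult.assoc[symmetric])
    qed
    also have "\<dots> = F t" unfolding F_def by (rule sum.swap)
    finally show ?thesis by (simp only: l2_inner_self)
  qed
  have Re: "(l2_norm (w t))\<^sup>2 = Re (F t)" for t unfolding norm[symmetric] by simp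
  have inner: "(\<integral>\<^sup>+x. ennreal ((cmod (w t x))\<^sup>2) \<partial>lborel) = ennreal (Re (F t))" for t
    unfolding nn_integral_L2[OF wL] Re ..
  have cont: "continuous_on UNIV F" unfolding F_def by (intro continuous_intros)
  then have meas: "(\<lambda>t. Re (F t)) \<in> borel_measurable borel"
    by (intro borel_measurable_continuous_onI continuous_intros)
  then show "(\<lambda>t. \<integral>\<^sup>+x. ennreal ((cmod (w t x))\<^sup>2) \<partial>lborel) \<in> borel_measurable borel"
    unfolding inner by measurable
  have "(F has_integral (\<Sum>n\<in>J. \<Sum>k\<in>J. (if int k - int n = 0 then of_real (real m * pi) else 0) * l2_inner (Z n) (Z k))) {0..real m * pi}"
    unfolding F_def by (intro has_integral_sum J has_integral_mult_left exp_has_integral_periods)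
  also have "(\<Sum>n\<in>J. \<Sum>k\<in>J. (if int k - int n = 0 then of_real (real m * pi) else 0) * l2_inner (Z n) (Z k))
      = complex_of_real (real m * pi * (\<Sum>n\<in>J. (l2_norm (Z n))\<^sup>2))"
  proof -
    have "(\<Sum>k\<in>J. (if int k - int n = 0 then of_real (real m * pi) else 0) * l2_inner (Z n) (Z k))
        = of_real (real m * pi) * of_real ((l2_norm (Z n))\<^sup>2)" if "n \<in> J" for n
    proof -
      have "(\<Sum>k\<in>J. (if int k - int n = 0 then of_real (real m * pi) else 0) * l2_inner (Z n) (Z k))
          = (\<Sum>k\<in>J. if k = n then of_real (real m * pi) * l2_inner (Z n) (Z k) else 0)"
        by (intro sum.cong refl) auto
      then show ?thesis using J that by (simp only: sum.delta' sum.delta if_True l2_inner_self)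
    qed
    then have "(\<Sum>n\<in>J. \<Sum>k\<in>J. (if int k - int n = 0 then of_real (real m * pi) else 0) * l2_inner (Z n) (Z k))
        = (\<Sum>n\<in>J. of_real (real m * pi) * complex_of_real ((l2_norm (Z n))\<^sup>2))" by (rule sum.cong[OF refl])
    then show ?thesis by (simp only: of_real_mult of_real_sum sum_distrib_left)
  qed
  finally have FI: "(F has_integral complex_of_real (real m * pi * (\<Sum>n\<in>J. (l2_norm (Z n))\<^sup>2))) {0..real m * pi}" .
  have "((\<lambda>t. Re (F t)) has_integral (real m * pi * (\<Sum>n\<in>J. (l2_norm (Z n))\<^sup>2))) {0..real m * pi}"
    using has_integral_linear[OF FI bounded_linear_Re] by (simp only: o_def Re_complex_of_real)
  then show "(\<integral>\<^sup>+t\<in>{0..real m * pi}. (\<integral>\<^sup>+x. ennreal ((cmod (w t x))\<^sup>2) \<partial>lborel) \<partial>lborel)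
      = ennreal (real m * pi * (\<Sum>n\<in>J. (l2_norm (Z n))\<^sup>2))"
    unfolding inner by (intro nn_integral_has_integral_lebesgue') (simp_all add: Re[symmetric])
qed

text \<open>The vanishing conditions allow the rectangle of index pairs to be enlarged to the
  triangle \<open>k + l \<le> B + L\<close>, which is the union of the diagonals
  \<open>k + l = n\<close>.\<close>

lemma sum_product_by_total:
  fixes f g :: "nat \<Rightarrow> 'b::comm_semiring_1"
  assumes "\<And>k. k > B \<Longrightarrow> f k = 0" "\<And>l. l > L \<Longrightarrow> g l = 0"
  shows "(\<Sum>k\<le>B. f k) * (\<Sum>l\<le>L. g l) = (\<Sum>n\<le>B + L. \<Sum>p\<le>n. f p * g (n - p))"
proof -
  have "(\<Sum>k\<le>B. f k) * (\<Sum>l\<le>L. g l) = (\<Sum>(k, l)\<in>{..B} \<times> {..L}. f k * g l)"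
    by (simp add: sum_product sum.cartesian_product)
  also have "\<dots> = (\<Sum>(k, l)\<in>{(k, l). k + l \<le> B + L}. f k * g l)"
  proof (rule sum.mono_neutral_left)
    show "finite {(k, l). k + l \<le> B + L}"
      by (rule finite_subset[of _ "{..B + L} \<times> {..B + L}"]) auto
    show "\<forall>i\<in>{(k, l). k + l \<le> B + L} - {..B} \<times> {..L}. (case i of (k, l) \<Rightarrow> f k * g l) = 0"
    proof
      fix i assume i: "i \<in> {(k, l). k + l \<le> B + L} - {..B} \<times> {..L}"
      obtain k l where kl: "i = (k, l)" by (cases i)
      with i have "k > B \<or> l > L" by auto
      with assms have "f k = 0 \<or> g l = 0" by blast
      then show "(case i of (k, l) \<Rightarrow> f k * g l) = 0" unfolding kl by auto
    qed
  qed auto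
  also have "\<dots> = (\<Sum>n\<le>B + L. \<Sum>p\<le>n. f p * g (n - p))"
    by (rule sum.triangle_reindex_eq)
  finally show ?thesis .
qed

section \<open>The bilinear estimate for separated frequencies\<close>

lemma bilinear_complex:
  fixes c :: "nat \<Rightarrow> complex"
  assumes n: "n \<ge> 1" and supp: "\<And>p. p \<le> n \<Longrightarrow> c p \<noteq> 0 \<Longrightarrow> 32 * (n - p) \<le> n"
  shows "(\<lambda>x. \<Sum>p\<le>n. c p * of_real (hermf p x * hermf (n - p) x)) \<in> L2" (is "?Z \<in> L2")
    "(l2_norm (\<lambda>x. \<Sum>p\<le>n. c p * of_real (hermf p x * hermf (n - p) x)))\<^sup>2 \<le> 1027 / sqrt n * (\<Sum>p\<le>n. (cmod (c p))\<^sup>2)"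
proof -
  let ?R = "\<lambda>x. \<Sum>p\<le>n. Re (c p) * (hermf p x * hermf (n - p) x)"
  let ?I = "\<lambda>x. \<Sum>p\<le>n. Im (c p) * (hermf p x * hermf (n - p) x)"
  have supp': "p \<le> n \<Longrightarrow> Re (c p) \<noteq> 0 \<Longrightarrow> 32 * (n - p) \<le> n" "p \<le> n \<Longrightarrow> Im (c p) \<noteq> 0 \<Longrightarrow> 32 * (n - p) \<le> n"
    for p using supp[of p] by (metis zero_complex.simps)+
  note R = bilinear_real[OF n, of "\<lambda>p. Re (c p)", OF supp'(1)]
  note I = bilinear_real[OF n, of "\<lambda>p. Im (c p)", OF supp'(2)]
  have eq: "(cmod (?Z x))\<^sup>2 = (?R x)\<^sup>2 + (?I x)\<^sup>2" for x
    by (simp add: cmod_power2)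
  show "?Z \<in> L2"
    by (rule L2_I) (measurable, unfold eq, intro Bochner_Integration.integrable_add R I)
  have "(l2_norm ?Z)\<^sup>2 = (\<integral>x. (?R x)\<^sup>2 \<partial>lborel) + (\<integral>x. (?I x)\<^sup>2 \<partial>lborel)"
    unfolding l2_norm_sq eq by (intro Bochner_Integration.integral_add R I)
  also have "\<dots> \<le> 1027 / sqrt n * (\<Sum>p\<le>n. (Re (c p))\<^sup>2) + 1027 / sqrt n * (\<Sum>p\<le>n. (Im (c p))\<^sup>2)"
    by (intro add_mono R I)
  also have "\<dots> = 1027 / sqrt n * (\<Sum>p\<le>n. (cmod (c p))\<^sup>2)"
    by (simp add: cmod_power2 sum.distrib distrib_left)
  finally show "(l2_norm ?Z)\<^sup>2 \<le> 1027 / sqrt n * (\<Sum>p\<le>n. (cmod (c p))\<^sup>2)" .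
qed

text \<open>In the block of total \<open>n\<close>, a nonzero coefficient has
  \<open>32 * (n - p) \<le> 32 * L \<le> K \<le> p \<le> n\<close>, which is the support condition
  of \<open>bilinear_complex\<close>. Blocks with \<open>n < K\<close> are empty, so
  \<open>1 / sqrt K\<close> serves for all of them.\<close>

lemma bilinear_line_time:
  fixes a b :: "nat \<Rightarrow> complex"
  assumes K: "K > 0" "32 * real L \<le> K" and a: "\<And>k. a k \<noteq> 0 \<Longrightarrow> K \<le> real k \<and> k \<le> B"
    and b: "\<And>l. b l \<noteq> 0 \<Longrightarrow> l \<le> L"
  defines "f \<equiv> \<lambda>t y. \<Sum>k\<le>B. a k * exp (\<i> * of_real (2 * t * real k)) * of_real (hermf k y)"
    and "g \<equiv> \<lambda>t y. \<Sum>l\<le>L. b l * exp (\<i> * of_real (2 * t * real l)) * of_real (hermf l y)"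
  shows "(\<integral>\<^sup>+t\<in>{0..real m * pi}. (\<integral>\<^sup>+y. ennreal ((cmod (f t y * g t y))\<^sup>2) \<partial>lborel) \<partial>lborel)
      \<le> ennreal (real m * pi * (1027 / sqrt K) * ((\<Sum>k\<le>B. (cmod (a k))\<^sup>2) * (\<Sum>l\<le>L. (cmod (b l))\<^sup>2)))"
    and "(\<lambda>t. \<integral>\<^sup>+y. ennreal ((cmod (f t y * g t y))\<^sup>2) \<partial>lborel) \<in> borel_measurable borel"
    and "(\<lambda>y. f t y * g t y) \<in> L2"
proof -
  define c where "c n p = a p * b (n - p)" for n p
  define Z where "Z n y = (\<Sum>p\<le>n. c n p * of_real (hermf p y * hermf (n - p) y))" for n y
  have c: "K \<le> real p \<and> n - p \<le> L" if "c n p \<noteq> 0" for n p using that a b by (auto simp: c_def)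
  have ZL: "Z n \<in> L2" and Zn: "(l2_norm (Z n))\<^sup>2 \<le> 1027 / sqrt K * (\<Sum>p\<le>n. (cmod (c n p))\<^sup>2)" for n
  proof -
    have "Z n \<in> L2 \<and> (l2_norm (Z n))\<^sup>2 \<le> 1027 / sqrt K * (\<Sum>p\<le>n. (cmod (c n p))\<^sup>2)"
    proof (cases "real n < K")
      case True
      have "c n p = 0" if "p \<le> n" for p using c[of n p] that True by linarith
      then have "Z n = (\<lambda>y. 0)" by (simp add: Z_def[abs_def])
      then show ?thesis using K by (simp add: L2_zero l2_norm_def sum_nonneg)
    next
      case False
      then have n1: "n \<ge> 1" using K(1) by (cases n) auto
      have supp: "32 * (n - p) \<le> n" if "p \<le> n" "c n p \<noteq> 0" for p
      proof -
        have "32 * real (n - p) \<le> real n" using c[OF that(2)] K(2) False by linarith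
        then show ?thesis by linarith
      qed
      note bc = bilinear_complex[OF n1 supp]
      have "1027 / sqrt n \<le> 1027 / sqrt K" using K(1) False by (intro divide_left_mono) auto
      then have "1027 / sqrt n * (\<Sum>p\<le>n. (cmod (c n p))\<^sup>2) \<le> 1027 / sqrt K * (\<Sum>p\<le>n. (cmod (c n p))\<^sup>2)"
        by (intro mult_right_mono sum_nonneg) auto
      with bc show ?thesis unfolding Z_def[abs_def] by (meson order_trans)
    qed
    then show "Z n \<in> L2" "(l2_norm (Z n))\<^sup>2 \<le> 1027 / sqrt K * (\<Sum>p\<le>n. (cmod (c n p))\<^sup>2)" by auto
  qed
  have fg: "f t y * g t y = (\<Sum>n\<in>{..B + L}. exp (\<i> * of_real (2 * t * real n)) * Z n y)" for t y
  proof -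
    have "f t y * g t y = (\<Sum>n\<le>B + L. \<Sum>p\<le>n. (a p * exp (\<i> * of_real (2 * t * real p)) * of_real (hermf p y))
        * (b (n - p) * exp (\<i> * of_real (2 * t * real (n - p))) * of_real (hermf (n - p) y)))"
      unfolding f_def g_def using a b by (intro sum_product_by_total) fastforce+
    also have "\<dots> = (\<Sum>n\<in>{..B + L}. exp (\<i> * of_real (2 * t * real n)) * Z n y)"
      unfolding Z_def sum_distrib_left
    proof (intro sum.cong refl)
      fix n p :: nat assume "p \<in> {..n}"
      then have "real n = real p + real (n - p)" by simp
      then have "exp (\<i> * of_real (2 * t * real n)) = exp (\<i> * of_real (2 * t * real p)) * exp (\<i> * of_real (2 * t * real (n - p)))"
        by (simp only: exp_add[symmetric] of_real_add distrib_left)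
      then show "(a p * exp (\<i> * of_real (2 * t * real p)) * of_real (hermf p y))
        * (b (n - p) * exp (\<i> * of_real (2 * t * real (n - p))) * of_real (hermf (n - p) y))
        = exp (\<i> * of_real (2 * t * real n)) * (c n p * of_real (hermf p y * hermf (n - p) y))"
        by (simp only: c_def of_real_mult mult_ac)
    qed
    finally show ?thesis .
  qed
  show "(\<lambda>y. f t y * g t y) \<in> L2" unfolding fg by (intro L2_sum L2_scale ZL)
  show "(\<lambda>t. \<integral>\<^sup>+y. ennreal ((cmod (f t y * g t y))\<^sup>2) \<partial>lborel) \<in> borel_measurable borel"
    unfolding fg by (rule time_orthogonality(2)[OF ZL finite_atMost])
  have "(\<integral>\<^sup>+t\<in>{0..real m * pi}. (\<integral>\<^sup>+y. ennreal ((cmod (f t y * g t y))\<^sup>2) \<partial>lborel) \<partial>lborel)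
      = ennreal (real m * pi * (\<Sum>n\<le>B + L. (l2_norm (Z n))\<^sup>2))"
    unfolding fg by (rule time_orthogonality(1)[OF ZL finite_atMost])
  also have "\<dots> \<le> ennreal (real m * pi * (\<Sum>n\<le>B + L. 1027 / sqrt K * (\<Sum>p\<le>n. (cmod (c n p))\<^sup>2)))"
    by (intro ennreal_leI mult_left_mono sum_mono Zn) auto
  also have "(\<Sum>n\<le>B + L. 1027 / sqrt K * (\<Sum>p\<le>n. (cmod (c n p))\<^sup>2))
     = 1027 / sqrt K * (\<Sum>n\<le>B + L. \<Sum>p\<le>n. (cmod (a p))\<^sup>2 * (cmod (b (n - p)))\<^sup>2)"
    by (simp only: sum_distrib_left c_def norm_mult power_mult_distrib)
  also have "(\<Sum>n\<le>B + L. \<Sum>p\<le>n. (cmod (a p))\<^sup>2 * (cmod (b (n - p)))\<^sup>2) = (\<Sum>k\<le>B. (cmod (a k))\<^sup>2) * (\<Sum>l\<le>L. (cmod (b l))\<^sup>2)"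
    using a b by (intro sum_product_by_total[symmetric]) fastforce+
  finally show "(\<integral>\<^sup>+t\<in>{0..real m * pi}. (\<integral>\<^sup>+y. ennreal ((cmod (f t y * g t y))\<^sup>2) \<partial>lborel) \<partial>lborel)
      \<le> ennreal (real m * pi * (1027 / sqrt K) * ((\<Sum>k\<le>B. (cmod (a k))\<^sup>2) * (\<Sum>l\<le>L. (cmod (b l))\<^sup>2)))"
    by (simp only: mult.assoc)
qed

section \<open>Finite Hermite evolutions and their slices in one coordinate\<close>

definition hslice :: "'n \<Rightarrow> ('n \<Rightarrow> nat) \<Rightarrow> real ^ 'n::finite \<Rightarrow> real" where
  "hslice j \<alpha> x = (\<Prod>i\<in>UNIV - {j}. hermf (\<alpha> i) (x $ i))"

definition energy :: "('n::finite \<Rightarrow> nat) \<Rightarrow> real" where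
  "energy \<alpha> = 2 * (\<Sum>i\<in>UNIV. real (\<alpha> i)) + real CARD('n)"

abbreviation box_le :: "nat \<Rightarrow> ('n::finite \<Rightarrow> nat) set" where
  "box_le n \<equiv> {\<alpha>. \<forall>i. \<alpha> i \<le> n}"

text \<open>An explicit stand-in for the propagator on finite Hermite sums. It is measurable in time
  and space together, whereas \<open>propagator t\<close> is for each \<open>t\<close> only
  determined almost everywhere.\<close>

definition evol :: "nat \<Rightarrow> (('n::finite \<Rightarrow> nat) \<Rightarrow> complex) \<Rightarrow> real \<Rightarrow> real ^ 'n \<Rightarrow> complex" where
  "evol B a t x = (\<Sum>\<alpha>\<in>box_le B. a \<alpha> * exp (\<i> * of_real (t * energy \<alpha>)) * of_real (hermite \<alpha> x))"

lemma evol_L2: "evol B a t \<in> L2"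
  unfolding evol_def[abs_def] by (rule hermite.finite_sum_L2)

lemma hermite_upd: "hermite (\<alpha>(j := k)) x = hermf k (x $ j) * hslice j \<alpha> x"
  unfolding hermite_def hslice_def by (subst prod.remove[of _ j]) (auto intro!: prod.cong)

lemma energy_upd: "\<alpha> j = 0 \<Longrightarrow> energy (\<alpha>(j := k)) = energy \<alpha> + 2 * real k"
  unfolding energy_def by (subst (1 2) sum.remove[of _ j]) (auto intro!: sum.cong)

lemma sum_box_split:
  fixes F :: "('n::finite \<Rightarrow> nat) \<Rightarrow> 'b::comm_monoid_add"
  shows "(\<Sum>\<alpha>\<in>box_le B. F \<alpha>) = (\<Sum>\<alpha>\<in>{\<alpha>\<in>box_le B. \<alpha> j = 0}. \<Sum>k\<le>B. F (\<alpha>(j := k)))"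
proof -
  have "bij_betw (\<lambda>(\<alpha>, k). \<alpha>(j := k)) ({\<alpha>\<in>box_le B. \<alpha> j = 0} \<times> {..B}) (box_le B)"
  proof (rule bij_betwI[where g="\<lambda>\<alpha>. (\<alpha>(j := 0), \<alpha> j)"])
    fix p :: "('n \<Rightarrow> nat) \<times> nat" assume p: "p \<in> {\<alpha>\<in>box_le B. \<alpha> j = 0} \<times> {..B}"
    obtain \<alpha> k where pk: "p = (\<alpha>, k)" by (cases p)
    with p have "\<alpha> j = 0" by simp
    then have "\<alpha>(j := 0) = \<alpha>" by auto
    then show "(\<lambda>\<alpha>. (\<alpha>(j := 0), \<alpha> j)) ((\<lambda>(\<alpha>, k). \<alpha>(j := k)) p) = p" by (simp add: pk)
  qed auto
  from sum.reindex_bij_betw[OF this, of F, symmetric]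
  have "(\<Sum>\<alpha>\<in>box_le B. F \<alpha>) = (\<Sum>(\<alpha>, k)\<in>{\<alpha>\<in>box_le B. \<alpha> j = 0} \<times> {..B}. F (\<alpha>(j := k)))"
    by (simp add: case_prod_unfold)
  then show ?thesis by (simp add: sum.cartesian_product)
qed

lemma finite_box0: "finite {\<alpha>\<in>box_le B. (\<alpha> :: 'n::finite \<Rightarrow> nat) j = 0}"
  by (rule finite_subset[OF _ finite_multi_index[of B]]) auto

lemma l2_inner_prod_vec:
  fixes f g :: "'n::finite \<Rightarrow> real \<Rightarrow> complex"
  assumes "\<And>i. f i \<in> L2" "\<And>i. g i \<in> L2"
  shows "l2_inner (\<lambda>x::real^'n. \<Prod>i\<in>UNIV. f i (x $ i)) (\<lambda>x. \<Prod>i\<in>UNIV. g i (x $ i)) = (\<Prod>i\<in>UNIV. l2_inner (f i) (g i))"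
  unfolding l2_inner_def cnj_prod prod.distrib[symmetric]
  using L2_inner_integrable[OF assms] by (rule integral_prod_vec)

text \<open>Two different multi-indices that vanish at \<open>j\<close> differ in another
  coordinate. There the Hermite factors are orthogonal, whatever the functions \<open>F\<close> in
  the coordinate \<open>j\<close> are.\<close>

lemma slice_norm:
  fixes F :: "('n::finite \<Rightarrow> nat) \<Rightarrow> real \<Rightarrow> complex"
  assumes F: "\<And>\<alpha>. F \<alpha> \<in> L2" and S: "finite S" "\<And>\<alpha>. \<alpha> \<in> S \<Longrightarrow> \<alpha> j = 0"
  shows "(\<lambda>x. \<Sum>\<alpha>\<in>S. F \<alpha> (x $ j) * of_real (hslice j \<alpha> x)) \<in> L2"
    and "(l2_norm (\<lambda>x. \<Sum>\<alpha>\<in>S. F \<alpha> (x $ j) * of_real (hslice j \<alpha> x)))\<^sup>2 = (\<Sum>\<alpha>\<in>S. (l2_norm (F \<alpha>))\<^sup>2)"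
proof -
  define \<phi> where "\<phi> \<alpha> i = (if i = j then F \<alpha> else (\<lambda>x. complex_of_real (hermf (\<alpha> i) x)))" for \<alpha> i
  have \<phi>L: "\<phi> \<alpha> i \<in> L2" for \<alpha> i by (simp add: \<phi>_def F hermf_L2)
  have eq: "F \<alpha> (x $ j) * of_real (hslice j \<alpha> x) = (\<Prod>i\<in>UNIV. \<phi> \<alpha> i (x $ i))" for \<alpha> and x :: "real^'n"
  proof -
    have "(\<Prod>i\<in>UNIV. \<phi> \<alpha> i (x $ i)) = \<phi> \<alpha> j (x $ j) * (\<Prod>i\<in>UNIV - {j}. \<phi> \<alpha> i (x $ i))"
      by (rule prod.remove) auto
    also have "(\<Prod>i\<in>UNIV - {j}. \<phi> \<alpha> i (x $ i)) = of_real (hslice j \<alpha> x)"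
      unfolding hslice_def of_real_prod by (intro prod.cong) (auto simp: \<phi>_def)
    finally show ?thesis by (simp add: \<phi>_def)
  qed
  have L: "(\<lambda>x::real^'n. F \<alpha> (x $ j) * of_real (hslice j \<alpha> x)) \<in> L2" for \<alpha>
    unfolding eq by (rule prod_vec_L2(1)[OF \<phi>L])
  then show "(\<lambda>x. \<Sum>\<alpha>\<in>S. F \<alpha> (x $ j) * of_real (hslice j \<alpha> x)) \<in> L2" by (intro L2_sum)
  have herm1: "l2_inner (\<lambda>x. complex_of_real (hermf k x)) (\<lambda>x. complex_of_real (hermf l x)) = (if k = l then 1 else 0)" for k l
    by (rule hermf.orthonormal)
  have one: "l2_norm (\<lambda>x. complex_of_real (hermf k x)) = 1" for k
  proof -
    have "complex_of_real ((l2_norm (\<lambda>x. complex_of_real (hermf k x)))\<^sup>2) = 1"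
      unfolding l2_inner_self[symmetric] herm1 by simp
    then have "(l2_norm (\<lambda>x. complex_of_real (hermf k x)))\<^sup>2 = 1" by (simp only: of_real_eq_1_iff)
    then show ?thesis by (simp add: power2_eq_1_iff) (metis l2_norm_nonneg neg_0_le_iff_le not_one_le_zero)
  qed
  have "l2_norm (\<lambda>x::real^'n. F \<alpha> (x $ j) * of_real (hslice j \<alpha> x)) = l2_norm (F \<alpha>)" for \<alpha>
  proof -
    have "l2_norm (\<lambda>x::real^'n. F \<alpha> (x $ j) * of_real (hslice j \<alpha> x)) = (\<Prod>i\<in>UNIV. l2_norm (\<phi> \<alpha> i))"
      unfolding eq by (rule prod_vec_L2(2)[OF \<phi>L])
    also have "\<dots> = l2_norm (\<phi> \<alpha> j) * (\<Prod>i\<in>UNIV - {j}. l2_norm (\<phi> \<alpha> i))" by (rule prod.remove) auto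
    also have "(\<Prod>i\<in>UNIV - {j}. l2_norm (\<phi> \<alpha> i)) = 1" by (intro prod.neutral) (auto simp: \<phi>_def one)
    finally show ?thesis by (simp add: \<phi>_def)
  qed
  moreover have "l2_inner (\<lambda>x::real^'n. F \<alpha> (x $ j) * of_real (hslice j \<alpha> x)) (\<lambda>x. F \<beta> (x $ j) * of_real (hslice j \<beta> x)) = 0"
    if "\<alpha> \<in> S" "\<beta> \<in> S" "\<alpha> \<noteq> \<beta>" for \<alpha> \<beta>
  proof -
    from \<open>\<alpha> \<noteq> \<beta>\<close> obtain i where i: "\<alpha> i \<noteq> \<beta> i" by (auto simp: fun_eq_iff)
    then have ij: "i \<noteq> j" using S(2) that by metis
    have "l2_inner (\<phi> \<alpha> i) (\<phi> \<beta> i) = 0" using i ij by (simp add: \<phi>_def herm1)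
    then show ?thesis unfolding eq l2_inner_prod_vec[OF \<phi>L \<phi>L] by (intro prod_zero) auto
  qed
  ultimately show "(l2_norm (\<lambda>x. \<Sum>\<alpha>\<in>S. F \<alpha> (x $ j) * of_real (hslice j \<alpha> x)))\<^sup>2 = (\<Sum>\<alpha>\<in>S. (l2_norm (F \<alpha>))\<^sup>2)"
    using l2_norm_orthogonal_sum[OF S(1) L] by simp
qed

lemma sum_box_prod:
  fixes F :: "'n::finite \<Rightarrow> nat \<Rightarrow> 'b::comm_semiring_1"
  shows "(\<Sum>\<alpha>\<in>box_le B. \<Prod>i\<in>UNIV. F i (\<alpha> i)) = (\<Prod>i\<in>UNIV. \<Sum>k\<le>B. F i k)"
proof -
  have "box_le B = (PiE UNIV (\<lambda>_. {..B}) :: ('n \<Rightarrow> nat) set)" by (auto simp: PiE_def extensional_def)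
  then show ?thesis by (simp add: prod_sum_PiE)
qed

text \<open>The condition \<open>\<beta> j = 0\<close> is put into the factor \<open>F j\<close>, so
  that the sum over the box factorises; each of the remaining coordinates is bounded by
  \<open>hermf_sum_sq_le\<close>.\<close>

lemma sum_hslice_sq_le:
  "(\<Sum>\<beta>\<in>{\<beta>\<in>box_le L. \<beta> j = 0}. (hslice j \<beta> x)\<^sup>2) \<le> sqrt (2 * (real L + 1)) ^ (CARD('n::finite) - 1)" for x :: "real^'n"
proof -
  define F where "F i k = (if i = j then of_bool (k = 0) else (hermf k (x $ i))\<^sup>2)" for i k
  have "(\<Sum>\<beta>\<in>{\<beta>\<in>box_le L. \<beta> j = 0}. (hslice j \<beta> x)\<^sup>2) = (\<Sum>\<beta>\<in>box_le L. \<Prod>i\<in>UNIV. F i (\<beta> i))"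
  proof (rule sum.mono_neutral_cong_left[OF finite_multi_index])
    show "\<forall>\<beta>\<in>box_le L - {\<beta> \<in> box_le L. \<beta> j = 0}. (\<Prod>i\<in>UNIV. F i (\<beta> i)) = 0"
      by (auto intro!: prod_zero bexI[of _ j] simp: F_def)
    fix \<beta> assume "\<beta> \<in> {\<beta> \<in> box_le L. \<beta> j = 0}"
    then have "F j (\<beta> j) = 1" by (simp add: F_def)
    then have "(\<Prod>i\<in>UNIV. F i (\<beta> i)) = (\<Prod>i\<in>UNIV - {j}. F i (\<beta> i))"
      by (subst prod.remove[of _ j]) auto
    also have "\<dots> = (hslice j \<beta> x)\<^sup>2"
      unfolding hslice_def prod_power_distrib by (intro prod.cong) (auto simp: F_def)
    finally show "(hslice j \<beta> x)\<^sup>2 = (\<Prod>i\<in>UNIV. F i (\<beta> i))" by simp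
  qed auto
  also have "\<dots> = (\<Prod>i\<in>UNIV. \<Sum>k\<le>L. F i k)" by (rule sum_box_prod)
  also have "\<dots> = (\<Sum>k\<le>L. F j k) * (\<Prod>i\<in>UNIV - {j}. \<Sum>k\<le>L. F i k)" by (rule prod.remove) auto
  also have "(\<Sum>k\<le>L. F j k) = 1" by (simp add: F_def of_bool_def)
  also have "1 * (\<Prod>i\<in>UNIV - {j}. \<Sum>k\<le>L. F i k) \<le> (\<Prod>i\<in>UNIV - {j}. sqrt (2 * (real L + 1)))"
    unfolding mult_1_left
  proof (intro prod_mono conjI)
    fix i assume i: "i \<in> UNIV - {j}"
    then show "0 \<le> (\<Sum>k\<le>L. F i k)" by (auto simp: F_def intro!: sum_nonneg)
    show "(\<Sum>k\<le>L. F i k) \<le> sqrt (2 * (real L + 1))" using i hermf_sum_sq_le[of "x $ i" L] by (simp add: F_def)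
  qed
  finally show ?thesis by (simp add: card_Diff_singleton)
qed

lemma cmod_sum_mult_sq_le:
  "(cmod (\<Sum>i\<in>S. f i * g i))\<^sup>2 \<le> (\<Sum>i\<in>S. (cmod (f i))\<^sup>2) * (\<Sum>i\<in>S. (cmod (g i))\<^sup>2)"
proof -
  have "(cmod (\<Sum>i\<in>S. f i * g i))\<^sup>2 \<le> (\<Sum>i\<in>S. cmod (f i) * cmod (g i))\<^sup>2"
    by (intro power_mono order_trans[OF norm_sum]) (auto simp: norm_mult)
  also have "\<dots> \<le> (\<Sum>i\<in>S. (cmod (f i))\<^sup>2) * (\<Sum>i\<in>S. (cmod (g i))\<^sup>2)"
    by (rule Cauchy_Schwarz_ineq_sum)
  finally show ?thesis .
qed

lemma evol_slice:
  "evol B a t x = (\<Sum>\<alpha>\<in>{\<alpha>\<in>box_le B. \<alpha> j = 0}. (exp (\<i> * of_real (t * energy \<alpha>)) *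
     (\<Sum>k\<le>B. a (\<alpha>(j := k)) * exp (\<i> * of_real (2 * t * real k)) * of_real (hermf k (x $ j)))) * of_real (hslice j \<alpha> x))"
  unfolding evol_def
proof (subst sum_box_split[of _ B j], intro sum.cong refl)
  fix \<alpha> assume "\<alpha> \<in> {\<alpha>\<in>box_le B. \<alpha> j = 0}"
  then have e: "energy (\<alpha>(j := k)) = energy \<alpha> + 2 * real k" for k by (intro energy_upd) simp
  have "exp (\<i> * of_real (t * energy (\<alpha>(j := k)))) = exp (\<i> * of_real (t * energy \<alpha>)) * exp (\<i> * of_real (2 * t * real k))" for k
    unfolding e exp_add[symmetric] by (simp add: algebra_simps)
  then show "(\<Sum>k\<le>B. a (\<alpha>(j := k)) * exp (\<i> * of_real (t * energy (\<alpha>(j := k)))) * of_real (hermite (\<alpha>(j := k)) x))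
    = (exp (\<i> * of_real (t * energy \<alpha>)) *
     (\<Sum>k\<le>B. a (\<alpha>(j := k)) * exp (\<i> * of_real (2 * t * real k)) * of_real (hermf k (x $ j)))) * of_real (hslice j \<alpha> x)"
    by (simp add: hermite_upd sum_distrib_left sum_distrib_right mult_ac)
qed

text \<open>Cauchy-Schwarz over the slices of the low frequency factor costs \<open>S\<close>,
  uniformly in \<open>x\<close>, and leaves functions \<open>g\<close> of the single coordinate
  \<open>x $ j\<close>. Multiplication by them preserves the orthogonality of the slices of the high
  frequency factor, so everything reduces to \<open>bilinear_line_time\<close> for each pair of
  slices.\<close>

lemma bilinear_separated:
  fixes a b :: "('n::finite \<Rightarrow> nat) \<Rightarrow> complex"
  assumes K: "K > 0" "32 * real L \<le> K" and a: "\<And>\<alpha>. a \<alpha> \<noteq> 0 \<Longrightarrow> K \<le> real (\<alpha> j) \<and> \<alpha> j \<le> B"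
    and b: "\<And>\<beta>. b \<beta> \<noteq> 0 \<Longrightarrow> \<beta> j \<le> L"
  shows "(\<integral>\<^sup>+t\<in>{0..real m * pi}. (\<integral>\<^sup>+x. ennreal ((cmod (evol B a t x * evol L b t x))\<^sup>2) \<partial>lborel) \<partial>lborel)
      \<le> ennreal (sqrt (2 * (real L + 1)) ^ (CARD('n) - 1) * (real m * pi * (1027 / sqrt K))
          * ((\<Sum>\<alpha>\<in>box_le B. (cmod (a \<alpha>))\<^sup>2) * (\<Sum>\<beta>\<in>box_le L. (cmod (b \<beta>))\<^sup>2)))"
proof -
  let ?U = "{\<alpha>\<in>box_le B. \<alpha> j = 0}" and ?V = "{\<alpha>\<in>box_le L. \<alpha> j = 0}"
  define S where "S = sqrt (2 * (real L + 1)) ^ (CARD('n) - 1)"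
  define f where "f \<alpha> t y = (\<Sum>k\<le>B. a (\<alpha>(j := k)) * exp (\<i> * of_real (2 * t * real k)) * of_real (hermf k y))" for \<alpha> t y
  define g where "g \<beta> t y = (\<Sum>l\<le>L. b (\<beta>(j := l)) * exp (\<i> * of_real (2 * t * real l)) * of_real (hermf l y))" for \<beta> t y
  have S0: "S \<ge> 0" by (simp add: S_def)
  have a': "K \<le> real k \<and> k \<le> B" if "a (\<alpha>(j := k)) \<noteq> 0" for \<alpha> k using a[OF that] by simp
  have b': "l \<le> L" if "b (\<beta>(j := l)) \<noteq> 0" for \<beta> l using b[OF that] by simp
  note line = bilinear_line_time[OF K, of "\<lambda>k. a (\<alpha>(j := k))" B "\<lambda>l. b (\<beta>(j := l))" for \<alpha> \<beta>, OF a' b', folded f_def g_def]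
  have unit: "cmod (exp (\<i> * of_real r)) = 1" for r by simp
  have v: "(cmod (evol L b t x))\<^sup>2 \<le> S * (\<Sum>\<beta>\<in>?V. (cmod (g \<beta> t (x $ j)))\<^sup>2)" for t x
  proof -
    have "(cmod (evol L b t x))\<^sup>2 \<le> (\<Sum>\<beta>\<in>?V. (cmod (exp (\<i> * of_real (t * energy \<beta>)) * g \<beta> t (x $ j)))\<^sup>2)
        * (\<Sum>\<beta>\<in>?V. (cmod (complex_of_real (hslice j \<beta> x)))\<^sup>2)"
      unfolding evol_slice[of L b t x j] g_def[symmetric] by (rule cmod_sum_mult_sq_le)
    also have "\<dots> = (\<Sum>\<beta>\<in>?V. (cmod (g \<beta> t (x $ j)))\<^sup>2) * (\<Sum>\<beta>\<in>?V. (hslice j \<beta> x)\<^sup>2)"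
      by (simp add: norm_mult)
    also have "\<dots> \<le> (\<Sum>\<beta>\<in>?V. (cmod (g \<beta> t (x $ j)))\<^sup>2) * S"
      unfolding S_def by (intro mult_left_mono sum_hslice_sq_le sum_nonneg) auto
    finally show ?thesis by (simp add: mult.commute)
  qed
  have x_int: "(\<integral>\<^sup>+x. ennreal ((cmod (evol B a t x * g \<beta> t (x $ j)))\<^sup>2) \<partial>lborel)
      = (\<Sum>\<alpha>\<in>?U. \<integral>\<^sup>+y. ennreal ((cmod (f \<alpha> t y * g \<beta> t y))\<^sup>2) \<partial>lborel)"
    and x_L2: "(\<lambda>x. evol B a t x * g \<beta> t (x $ j)) \<in> L2" for t \<beta>
  proof -
    let ?F = "\<lambda>\<alpha> y. exp (\<i> * of_real (t * energy \<alpha>)) * (f \<alpha> t y * g \<beta> t y)"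
    have FL: "?F \<alpha> \<in> L2" for \<alpha> by (intro L2_scale line(3))
    have eq: "evol B a t x * g \<beta> t (x $ j) = (\<Sum>\<alpha>\<in>?U. ?F \<alpha> (x $ j) * of_real (hslice j \<alpha> x))" for x
      unfolding evol_slice[of B a t x j] f_def[symmetric] sum_distrib_right by (intro sum.cong refl) (simp only: mult_ac)
    note sl = slice_norm[of ?F, OF FL finite_box0[of B j], of j]
    show "(\<lambda>x. evol B a t x * g \<beta> t (x $ j)) \<in> L2" unfolding eq using sl(1) by simp
    have "(\<integral>\<^sup>+x. ennreal ((cmod (evol B a t x * g \<beta> t (x $ j)))\<^sup>2) \<partial>lborel) = ennreal (\<Sum>\<alpha>\<in>?U. (l2_norm (?F \<alpha>))\<^sup>2)"
      unfolding eq using sl by (simp add: nn_integral_L2)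
    also have "\<dots> = (\<Sum>\<alpha>\<in>?U. ennreal ((l2_norm (\<lambda>y. f \<alpha> t y * g \<beta> t y))\<^sup>2))"
      by (simp add: l2_norm_scale sum_ennreal)
    also have "\<dots> = (\<Sum>\<alpha>\<in>?U. \<integral>\<^sup>+y. ennreal ((cmod (f \<alpha> t y * g \<beta> t y))\<^sup>2) \<partial>lborel)"
      by (intro sum.cong refl nn_integral_L2[symmetric] line(3))
    finally show "(\<integral>\<^sup>+x. ennreal ((cmod (evol B a t x * g \<beta> t (x $ j)))\<^sup>2) \<partial>lborel)
      = (\<Sum>\<alpha>\<in>?U. \<integral>\<^sup>+y. ennreal ((cmod (f \<alpha> t y * g \<beta> t y))\<^sup>2) \<partial>lborel)" .
  qed
  have fix_t: "(\<integral>\<^sup>+x. ennreal ((cmod (evol B a t x * evol L b t x))\<^sup>2) \<partial>lborel)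
      \<le> ennreal S * (\<Sum>\<beta>\<in>?V. \<Sum>\<alpha>\<in>?U. \<integral>\<^sup>+y. ennreal ((cmod (f \<alpha> t y * g \<beta> t y))\<^sup>2) \<partial>lborel)" for t
  proof -
    have "(cmod (evol B a t x * evol L b t x))\<^sup>2 \<le> S * (\<Sum>\<beta>\<in>?V. (cmod (evol B a t x * g \<beta> t (x $ j)))\<^sup>2)" for x
      using mult_left_mono[OF v[of t x], of "(cmod (evol B a t x))\<^sup>2"]
      by (simp add: norm_mult power_mult_distrib sum_distrib_left mult_ac)
    then have "ennreal ((cmod (evol B a t x * evol L b t x))\<^sup>2) \<le> ennreal S * (\<Sum>\<beta>\<in>?V. ennreal ((cmod (evol B a t x * g \<beta> t (x $ j)))\<^sup>2))" for x
      using S0 by (simp add: sum_ennreal ennreal_mult[symmetric] sum_nonneg ennreal_leI)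
    then have "(\<integral>\<^sup>+x. ennreal ((cmod (evol B a t x * evol L b t x))\<^sup>2) \<partial>lborel)
      \<le> (\<integral>\<^sup>+x. ennreal S * (\<Sum>\<beta>\<in>?V. ennreal ((cmod (evol B a t x * g \<beta> t (x $ j)))\<^sup>2)) \<partial>lborel)"
      by (rule nn_integral_mono)
    also have "\<dots> = ennreal S * (\<Sum>\<beta>\<in>?V. \<integral>\<^sup>+x. ennreal ((cmod (evol B a t x * g \<beta> t (x $ j)))\<^sup>2) \<partial>lborel)"
    proof -
      have [measurable]: "(\<lambda>x. evol B a t x * g \<beta> t (x $ j)) \<in> borel_measurable borel" for \<beta>
        by (rule L2_measurable[OF x_L2])
      show ?thesis by (subst nn_integral_cmult, measurable, subst nn_integral_sum, measurable)
    qed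
    finally show ?thesis unfolding x_int .
  qed
  have "(\<integral>\<^sup>+t\<in>{0..real m * pi}. (\<integral>\<^sup>+x. ennreal ((cmod (evol B a t x * evol L b t x))\<^sup>2) \<partial>lborel) \<partial>lborel)
    \<le> (\<integral>\<^sup>+t\<in>{0..real m * pi}. ennreal S * (\<Sum>\<beta>\<in>?V. \<Sum>\<alpha>\<in>?U. \<integral>\<^sup>+y. ennreal ((cmod (f \<alpha> t y * g \<beta> t y))\<^sup>2) \<partial>lborel) \<partial>lborel)"
    by (intro nn_integral_mono mult_right_mono fix_t) auto
  also have "\<dots> = ennreal S * (\<Sum>\<beta>\<in>?V. \<Sum>\<alpha>\<in>?U. \<integral>\<^sup>+t\<in>{0..real m * pi}. (\<integral>\<^sup>+y. ennreal ((cmod (f \<alpha> t y * g \<beta> t y))\<^sup>2) \<partial>lborel) \<partial>lborel)"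
  proof -
    note [measurable] = line(2)
    show ?thesis
      unfolding mult.assoc sum_distrib_right
      by (subst nn_integral_cmult, measurable, subst nn_integral_sum, measurable, subst nn_integral_sum, measurable)
  qed
  also have "\<dots> \<le> ennreal S * (\<Sum>\<beta>\<in>?V. \<Sum>\<alpha>\<in>?U. ennreal (real m * pi * (1027 / sqrt K)
      * ((\<Sum>k\<le>B. (cmod (a (\<alpha>(j := k))))\<^sup>2) * (\<Sum>l\<le>L. (cmod (b (\<beta>(j := l))))\<^sup>2))))"
    by (intro mult_left_mono sum_mono line(1)) auto
  also have "\<dots> = ennreal (S * (\<Sum>\<beta>\<in>?V. \<Sum>\<alpha>\<in>?U. real m * pi * (1027 / sqrt K)
      * ((\<Sum>k\<le>B. (cmod (a (\<alpha>(j := k))))\<^sup>2) * (\<Sum>l\<le>L. (cmod (b (\<beta>(j := l))))\<^sup>2))))"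
    using S0 K(1) by (simp add: sum_ennreal sum_nonneg ennreal_mult)
  also have "(\<Sum>\<beta>\<in>?V. \<Sum>\<alpha>\<in>?U. real m * pi * (1027 / sqrt K)
      * ((\<Sum>k\<le>B. (cmod (a (\<alpha>(j := k))))\<^sup>2) * (\<Sum>l\<le>L. (cmod (b (\<beta>(j := l))))\<^sup>2)))
    = real m * pi * (1027 / sqrt K) * ((\<Sum>\<alpha>\<in>box_le B. (cmod (a \<alpha>))\<^sup>2) * (\<Sum>\<beta>\<in>box_le L. (cmod (b \<beta>))\<^sup>2))"
    unfolding sum_box_split[of _ B j] sum_box_split[of _ L j]
    by (simp only: sum_distrib_left[symmetric] sum_distrib_right[symmetric])
  finally show ?thesis unfolding S_def by (simp only: mult.assoc)
qed

section \<open>The bilinear estimate for comparable frequencies\<close>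

text \<open>One of the two indices is at least \<open>m div 2\<close> and supplies the decay
  \<open>1 / s\<close>; the sum over the other one is at most \<open>sqrt 2 * s\<close> by
  \<open>hermf_sum_sq_le\<close>. The powers of \<open>m\<close> cancel, and the two halves together
  give \<open>2 * sqrt 2 \<le> 3\<close>.\<close>

lemma hermf_zero_convolution: "(\<Sum>p\<le>m. (hermf p 0)\<^sup>2 * (hermf (m - p) 0)\<^sup>2) \<le> 3"
proof -
  define q where "q = m div 2"
  define s where "s = sqrt (real q + 1)"
  have s0: "s > 0" by (simp add: s_def)
  define F where "F p = (if p \<le> q then (hermf p 0)\<^sup>2 / s else 0)" for p
  have far: "(hermf k 0)\<^sup>2 \<le> 1 / s" if "k \<ge> q" for k
  proof -
    have "(hermf k 0)\<^sup>2 \<le> 1 / sqrt (real k + 1)"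
      using hermf_zero_sq_le[of k] by (simp add: le_divide_eq)
    also have "\<dots> \<le> 1 / s" using that s0 by (intro divide_left_mono) (auto simp: s_def)
    finally show ?thesis .
  qed
  have near: "x * (hermf k 0)\<^sup>2 \<le> x / s" if "k \<ge> q" "x \<ge> 0" for k and x :: real
    using mult_left_mono[OF far[OF that(1)] that(2)] by simp
  have Fge: "F p \<ge> 0" for p using s0 by (simp add: F_def)
  have "(hermf p 0)\<^sup>2 * (hermf (m - p) 0)\<^sup>2 \<le> F p + F (m - p)" if "p \<le> m" for p
  proof (cases "p \<le> q")
    case True
    then have "m - p \<ge> q" by (simp add: q_def)
    from near[OF this, of "(hermf p 0)\<^sup>2"] True Fge[of "m - p"] show ?thesis by (simp add: F_def[of p])
  next
    case False
    then have "m - p \<le> q" "p \<ge> q" by (auto simp: q_def)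
    from near[OF this(2), of "(hermf (m - p) 0)\<^sup>2"] this(1) Fge[of p] show ?thesis
      by (simp add: F_def[of "m - p"] mult.commute)
  qed
  then have "(\<Sum>p\<le>m. (hermf p 0)\<^sup>2 * (hermf (m - p) 0)\<^sup>2) \<le> (\<Sum>p\<le>m. F p + F (m - p))"
    by (intro sum_mono) simp
  also have "\<dots> = (\<Sum>p\<le>m. F p) + (\<Sum>p\<le>m. F (m - p))" by (rule sum.distrib)
  also have "(\<Sum>p\<le>m. F (m - p)) = (\<Sum>p\<le>m. F p)"
    by (rule sum.reindex_bij_witness[where i="\<lambda>p. m - p" and j="\<lambda>p. m - p"]) auto
  also have "(\<Sum>p\<le>m. F p) = (\<Sum>p\<le>q. (hermf p 0)\<^sup>2 / s)"
    by (rule sum.mono_neutral_cong_right) (auto simp: F_def q_def)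
  also have "\<dots> \<le> sqrt 2"
  proof -
    have "(\<Sum>p\<le>q. (hermf p 0)\<^sup>2) \<le> sqrt 2 * s"
      using hermf_sum_sq_le[of 0 q] by (simp only: real_sqrt_mult s_def)
    then show ?thesis using s0 by (simp only: sum_divide_distrib[symmetric] pos_divide_le_eq)
  qed
  finally have "(\<Sum>p\<le>m. (hermf p 0)\<^sup>2 * (hermf (m - p) 0)\<^sup>2) \<le> sqrt 2 + sqrt 2" by simp
  moreover have "sqrt 2 \<le> 3 / 2" by (rule real_le_lsqrt) (simp_all add: power2_eq_square)
  ultimately show ?thesis by linarith
qed

text \<open>The constraint on the total is spent on the two coordinates \<open>i\<close> and
  \<open>j\<close>, whose convolution is bounded by 3. The other coordinates are summed freely and
  contribute a factor \<open>sqrt (2 * (m + 1))\<close> each.\<close>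

lemma hermite_zero_sphere:
  fixes i j :: "'n::finite"
  assumes ij: "i \<noteq> j"
  shows "(\<Sum>\<tau>\<in>{\<tau> :: 'n \<Rightarrow> nat. \<tau> \<in> box_le m \<and> (\<Sum>l\<in>UNIV. \<tau> l) = m}. \<Prod>l\<in>UNIV. (hermf (\<tau> l) 0)\<^sup>2)
    \<le> 3 * sqrt (2 * (real m + 1)) ^ (CARD('n) - 2)"
proof -
  let ?S = "{\<tau>::'n \<Rightarrow> nat. \<tau> \<in> box_le m \<and> (\<Sum>l\<in>UNIV. \<tau> l) = m}"
  let ?R = "{\<rho>::'n \<Rightarrow> nat. \<rho> \<in> box_le m \<and> \<rho> i = 0 \<and> \<rho> j = 0}"
  let ?I = "UNIV - {i, j}"
  define w where "w \<rho> = (\<Prod>l\<in>?I. (hermf (\<rho> l) 0)\<^sup>2)" for \<rho> :: "'n \<Rightarrow> nat"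
  define G where "G x = (case x of (\<rho>, p) \<Rightarrow> w \<rho> * ((hermf p 0)\<^sup>2 * (hermf (m - sum \<rho> UNIV - p) 0)\<^sup>2))" for x :: "('n \<Rightarrow> nat) \<times> nat"
  \<comment> \<open>The coordinates \<open>i\<close> and \<open>j\<close> are erased and only the
    entry at \<open>i\<close> is remembered; the entry at \<open>j\<close> is recovered from the
    total.\<close>
  define \<phi> where "\<phi> \<tau> = (\<tau>(i := 0, j := 0), \<tau> i)" for \<tau> :: "'n \<Rightarrow> nat"
  have split: "sum \<tau> UNIV = \<tau> i + (\<tau> j + sum \<tau> ?I)" for \<tau> :: "'n \<Rightarrow> nat"
  proof -
    have "sum \<tau> UNIV = \<tau> i + sum \<tau> (UNIV - {i})" by (rule sum.remove) auto
    also have "sum \<tau> (UNIV - {i}) = \<tau> j + sum \<tau> (UNIV - {i} - {j})" using ij by (intro sum.remove) auto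
    also have "UNIV - {i} - {j} = ?I" by auto
    finally show ?thesis .
  qed
  have splitp: "(\<Prod>l\<in>UNIV. (hermf (\<tau> l) 0)\<^sup>2) = (hermf (\<tau> i) 0)\<^sup>2 * ((hermf (\<tau> j) 0)\<^sup>2 * w \<tau>)" for \<tau> :: "'n \<Rightarrow> nat"
  proof -
    have "(\<Prod>l\<in>UNIV. (hermf (\<tau> l) 0)\<^sup>2) = (hermf (\<tau> i) 0)\<^sup>2 * (\<Prod>l\<in>UNIV - {i}. (hermf (\<tau> l) 0)\<^sup>2)" by (rule prod.remove) auto
    also have "(\<Prod>l\<in>UNIV - {i}. (hermf (\<tau> l) 0)\<^sup>2) = (hermf (\<tau> j) 0)\<^sup>2 * (\<Prod>l\<in>UNIV - {i} - {j}. (hermf (\<tau> l) 0)\<^sup>2)"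
      using ij by (intro prod.remove) auto
    also have "UNIV - {i} - {j} = ?I" by auto
    finally show ?thesis unfolding w_def .
  qed
  have sum0: "sum (\<tau>(i := 0, j := 0)) UNIV = sum \<tau> ?I" for \<tau> :: "'n \<Rightarrow> nat"
  proof -
    have "sum (\<tau>(i := 0, j := 0)) ?I = sum \<tau> ?I" by (intro sum.cong) auto
    then show ?thesis unfolding split[of "\<tau>(i := 0, j := 0)"] using ij by simp
  qed
  have w0: "w (\<tau>(i := 0, j := 0)) = w \<tau>" for \<tau>
    unfolding w_def by (intro prod.cong) auto
  have inj: "inj_on \<phi> ?S"
  proof (rule inj_onI)
    fix \<tau> \<tau>' assume t: "\<tau> \<in> ?S" "\<tau>' \<in> ?S" and eq: "\<phi> \<tau> = \<phi> \<tau>'"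
    from eq have e: "\<tau>(i := 0, j := 0) = \<tau>'(i := 0, j := 0)" "\<tau> i = \<tau>' i" by (auto simp: \<phi>_def)
    have "sum \<tau> ?I = sum \<tau>' ?I" using sum0[of \<tau>] sum0[of \<tau>'] e(1) by simp
    then have j: "\<tau> j = \<tau>' j" using t split[of \<tau>] split[of \<tau>'] e(2) by simp
    show "\<tau> = \<tau>'"
    proof
      fix l show "\<tau> l = \<tau>' l" using fun_cong[OF e(1), of l] e(2) j by (auto split: if_splits)
    qed
  qed
  have "(\<Sum>\<tau>\<in>?S. \<Prod>l\<in>UNIV. (hermf (\<tau> l) 0)\<^sup>2) = (\<Sum>\<tau>\<in>?S. G (\<phi> \<tau>))"
  proof (intro sum.cong refl)
    fix \<tau> assume "\<tau> \<in> ?S"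
    then have "m - sum (\<tau>(i := 0, j := 0)) UNIV - \<tau> i = \<tau> j" unfolding sum0 using split[of \<tau>] by auto
    then show "(\<Prod>l\<in>UNIV. (hermf (\<tau> l) 0)\<^sup>2) = G (\<phi> \<tau>)"
      unfolding splitp G_def \<phi>_def by (simp add: w0)
  qed
  also have "\<dots> = sum G (\<phi> ` ?S)" unfolding sum.reindex[OF inj] o_def ..
  also have "\<dots> \<le> sum G (Sigma ?R (\<lambda>\<rho>. {..m - sum \<rho> UNIV}))"
  proof (rule sum_mono2)
    have "finite ?R" by (rule finite_subset[OF _ finite_multi_index[of m]]) auto
    then show "finite (Sigma ?R (\<lambda>\<rho>. {..m - sum \<rho> UNIV}))" by simp
    show "\<phi> ` ?S \<subseteq> Sigma ?R (\<lambda>\<rho>. {..m - sum \<rho> UNIV})"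
    proof
      fix x assume "x \<in> \<phi> ` ?S"
      then obtain \<tau> where t: "\<tau> \<in> ?S" "x = \<phi> \<tau>" by blast
      then have "\<tau> i \<le> m - sum (\<tau>(i := 0, j := 0)) UNIV" unfolding sum0 using split[of \<tau>] by auto
      then show "x \<in> Sigma ?R (\<lambda>\<rho>. {..m - sum \<rho> UNIV})" using t by (simp add: \<phi>_def)
    qed
    show "0 \<le> G x" for x by (cases x) (auto simp: G_def w_def intro!: mult_nonneg_nonneg prod_nonneg)
  qed
  also have "\<dots> = (\<Sum>\<rho>\<in>?R. \<Sum>p\<le>m - sum \<rho> UNIV. w \<rho> * ((hermf p 0)\<^sup>2 * (hermf (m - sum \<rho> UNIV - p) 0)\<^sup>2))"
  proof -
    have "finite ?R" by (rule finite_subset[OF _ finite_multi_index[of m]]) auto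
    then show ?thesis by (subst sum.Sigma) (auto simp: G_def case_prod_unfold)
  qed
  also have "\<dots> \<le> (\<Sum>\<rho>\<in>?R. w \<rho> * 3)"
    unfolding sum_distrib_left[symmetric]
    by (intro sum_mono mult_left_mono hermf_zero_convolution) (auto simp: w_def intro!: prod_nonneg)
  also have "\<dots> = (\<Sum>\<rho>\<in>?R. w \<rho>) * 3" by (simp add: sum_distrib_right)
  also have "(\<Sum>\<rho>\<in>?R. w \<rho>) \<le> sqrt (2 * (real m + 1)) ^ (CARD('n) - 2)"
  proof -
    define F where "F l k = (if l \<in> {i, j} then of_bool (k = 0) else (hermf k 0)\<^sup>2)" for l k
    have rest: "(\<Prod>l\<in>UNIV. f l) = (\<Prod>l\<in>?I. f l)" if "f i = 1" "f j = 1" for f :: "'n \<Rightarrow> real"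
      using that by (intro prod.mono_neutral_right) auto
    have "(\<Sum>\<rho>\<in>?R. w \<rho>) = (\<Sum>\<rho>\<in>box_le m. \<Prod>l\<in>UNIV. F l (\<rho> l))"
    proof (rule sum.mono_neutral_cong_left[OF finite_multi_index])
      show "\<forall>\<rho>\<in>box_le m - ?R. (\<Prod>l\<in>UNIV. F l (\<rho> l)) = 0"
      proof
        fix \<rho> assume "\<rho> \<in> box_le m - ?R"
        then have "F i (\<rho> i) = 0 \<or> F j (\<rho> j) = 0" by (auto simp: F_def)
        then show "(\<Prod>l\<in>UNIV. F l (\<rho> l)) = 0" by (auto intro: prod_zero)
      qed
      fix \<rho> assume "\<rho> \<in> ?R"
      then have "F i (\<rho> i) = 1" "F j (\<rho> j) = 1" by (auto simp: F_def)
      from rest[of "\<lambda>l. F l (\<rho> l)", OF this] show "w \<rho> = (\<Prod>l\<in>UNIV. F l (\<rho> l))"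
        unfolding w_def by (simp only:) (intro prod.cong refl, auto simp: F_def)
    qed auto
    also have "\<dots> = (\<Prod>l\<in>UNIV. \<Sum>k\<le>m. F l k)" by (rule sum_box_prod)
    also have "\<dots> = (\<Prod>l\<in>?I. \<Sum>k\<le>m. F l k)" by (rule rest) (simp_all add: F_def of_bool_def)
    also have "\<dots> \<le> (\<Prod>l\<in>?I. sqrt (2 * (real m + 1)))"
    proof (intro prod_mono conjI)
      fix l assume l: "l \<in> ?I"
      then show "0 \<le> (\<Sum>k\<le>m. F l k)" by (auto simp: F_def intro!: sum_nonneg)
      show "(\<Sum>k\<le>m. F l k) \<le> sqrt (2 * (real m + 1))" using l hermf_sum_sq_le[of 0 m] by (simp add: F_def)
    qed
    also have "\<dots> = sqrt (2 * (real m + 1)) ^ (CARD('n) - 2)"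
      using ij by (simp add: card_Diff_subset)
    finally show ?thesis .
  qed
  finally show ?thesis by (simp add: mult.commute)
qed

section \<open>Rotation in all coordinates\<close>

definition scaled_hermite :: "('n::finite \<Rightarrow> nat) \<Rightarrow> real ^ 'n \<Rightarrow> complex" where
  "scaled_hermite \<kappa> x = (\<Prod>i\<in>UNIV. complex_of_real (hermf (\<kappa> i) (sqrt 2 * x $ i)))"

lemma scaled_hermf_L2: "(\<lambda>x. complex_of_real (hermf k (sqrt 2 * x))) \<in> L2"
  by (rule L2_I) (measurable, use integral_hermf_scaled(1)[of k k] in \<open>simp add: power2_eq_square\<close>)

lemma scaled_hermite_L2: "scaled_hermite \<kappa> \<in> L2"
  unfolding scaled_hermite_def[abs_def] by (rule prod_vec_L2(1)[of "\<lambda>i x. complex_of_real (hermf (\<kappa> i) (sqrt 2 * x))"]) (rule scaled_hermf_L2)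

lemma scaled_hermite_inner:
  fixes \<kappa> \<nu> :: "'n::finite \<Rightarrow> nat"
  shows "l2_inner (scaled_hermite \<kappa>) (scaled_hermite \<nu>) = (if \<kappa> = \<nu> then of_real ((1 / sqrt 2) ^ CARD('n)) else 0)"
proof -
  have "l2_inner (scaled_hermite \<kappa>) (scaled_hermite \<nu>)
    = (\<Prod>i\<in>UNIV. l2_inner (\<lambda>x. complex_of_real (hermf (\<kappa> i) (sqrt 2 * x))) (\<lambda>x. complex_of_real (hermf (\<nu> i) (sqrt 2 * x))))"
    unfolding scaled_hermite_def[abs_def]
    by (rule l2_inner_prod_vec[of "\<lambda>i x. complex_of_real (hermf (\<kappa> i) (sqrt 2 * x))" "\<lambda>i x. complex_of_real (hermf (\<nu> i) (sqrt 2 * x))"])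
       (rule scaled_hermf_L2)+
  also have "\<dots> = (\<Prod>i\<in>UNIV. complex_of_real (if \<kappa> i = \<nu> i then 1 / sqrt 2 else 0))"
    by (simp only: l2_inner_def complex_cnj_complex_of_real of_real_mult[symmetric] integral_complex_of_real integral_hermf_scaled)
  finally have eq: "l2_inner (scaled_hermite \<kappa>) (scaled_hermite \<nu>)
    = (\<Prod>i\<in>UNIV. complex_of_real (if \<kappa> i = \<nu> i then 1 / sqrt 2 else 0))" .
  show ?thesis
  proof (cases "\<kappa> = \<nu>")
    case False
    then obtain i where "\<kappa> i \<noteq> \<nu> i" by (auto simp: fun_eq_iff)
    then have "(\<Prod>i\<in>UNIV. complex_of_real (if \<kappa> i = \<nu> i then 1 / sqrt 2 else 0)) = 0" by (intro prod_zero) auto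
    then show ?thesis unfolding eq using False by simp
  next
    case True
    then show ?thesis unfolding eq by simp
  qed
qed

lemma scaled_hermite_sum_norm:
  fixes y :: "('n::finite \<Rightarrow> nat) \<Rightarrow> complex"
  assumes "finite S"
  shows "(l2_norm (\<lambda>x. \<Sum>\<kappa>\<in>S. y \<kappa> * scaled_hermite \<kappa> x))\<^sup>2 \<le> (\<Sum>\<kappa>\<in>S. (cmod (y \<kappa>))\<^sup>2)"
proof -
  have "(l2_norm (\<lambda>x. \<Sum>\<kappa>\<in>S. y \<kappa> * scaled_hermite \<kappa> x))\<^sup>2 = (\<Sum>\<kappa>\<in>S. (l2_norm (\<lambda>x. y \<kappa> * scaled_hermite \<kappa> x))\<^sup>2)"
    using assms by (rule l2_norm_orthogonal_sum)
      (auto intro!: L2_scale scaled_hermite_L2 simp: l2_inner_scale_left l2_inner_scale_right scaled_hermite_inner)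
  also have "\<dots> \<le> (\<Sum>\<kappa>\<in>S. (cmod (y \<kappa>))\<^sup>2)"
  proof (rule sum_mono)
    fix \<kappa> :: "'n \<Rightarrow> nat"
    have "complex_of_real ((l2_norm (scaled_hermite \<kappa>))\<^sup>2) = complex_of_real ((1 / sqrt 2) ^ CARD('n))"
      unfolding l2_inner_self[symmetric] scaled_hermite_inner by simp
    then have "(l2_norm (scaled_hermite \<kappa>))\<^sup>2 = (1 / sqrt 2) ^ CARD('n)" by (simp only: of_real_eq_iff)
    also have "\<dots> \<le> 1" by (rule power_le_one) auto
    finally show "(l2_norm (\<lambda>x. y \<kappa> * scaled_hermite \<kappa> x))\<^sup>2 \<le> (cmod (y \<kappa>))\<^sup>2"
      by (simp add: l2_norm_scale power_mult_distrib mult_left_le)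
  qed
  finally show ?thesis .
qed

definition kravn :: "('n::finite \<Rightarrow> nat) \<Rightarrow> ('n \<Rightarrow> nat) \<Rightarrow> ('n \<Rightarrow> nat) \<Rightarrow> real" where
  "kravn \<alpha> \<beta> \<kappa> = (\<Prod>i\<in>UNIV. krav (\<alpha> i) (\<beta> i) (\<kappa> i))"

text \<open>\<open>D\<close> gives all pairs a common summation range. Beyond
  \<open>\<alpha> i + \<beta> i\<close>, where the subtraction is truncated, the Kravchuk
  coefficient vanishes.\<close>

lemma hermite_product:
  assumes D: "\<And>i. \<alpha> i + \<beta> i \<le> D"
  shows "complex_of_real (hermite \<alpha> x * hermite \<beta> x)
    = (\<Sum>\<kappa>\<in>box_le D. of_real (kravn \<alpha> \<beta> \<kappa> * (\<Prod>i\<in>UNIV. hermf (\<alpha> i + \<beta> i - \<kappa> i) 0)) * scaled_hermite \<kappa> x)"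
proof -
  define F where "F i k = krav (\<alpha> i) (\<beta> i) k * hermf (\<alpha> i + \<beta> i - k) 0 * hermf k (sqrt 2 * x $ i)" for i k
  have "hermf (\<alpha> i) (x $ i) * hermf (\<beta> i) (x $ i) = (\<Sum>k\<le>D. F i k)" for i
    unfolding hermf_product F_def using D[of i] by (intro sum.mono_neutral_left) (auto simp: krav_0_eq)
  then have "hermite \<alpha> x * hermite \<beta> x = (\<Prod>i\<in>UNIV. \<Sum>k\<le>D. F i k)"
    unfolding hermite_def prod.distrib[symmetric] by simp
  also have "\<dots> = (\<Sum>\<kappa>\<in>box_le D. \<Prod>i\<in>UNIV. F i (\<kappa> i))" by (rule sum_box_prod[symmetric])
  finally show ?thesis
    by (simp add: F_def prod.distrib kravn_def scaled_hermite_def)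
qed

lemma kravn_orthonormal:
  assumes \<sigma>: "\<And>i. \<sigma> i \<le> D" and "\<And>i. \<alpha> i \<le> \<sigma> i" "\<And>i. \<alpha>' i \<le> \<sigma> i"
  shows "(\<Sum>\<kappa>\<in>box_le D. kravn \<alpha> (\<lambda>i. \<sigma> i - \<alpha> i) \<kappa> * kravn \<alpha>' (\<lambda>i. \<sigma> i - \<alpha>' i) \<kappa>) = (if \<alpha> = \<alpha>' then 1 else 0)"
proof -
  have "(\<Sum>\<kappa>\<in>box_le D. kravn \<alpha> (\<lambda>i. \<sigma> i - \<alpha> i) \<kappa> * kravn \<alpha>' (\<lambda>i. \<sigma> i - \<alpha>' i) \<kappa>)
    = (\<Prod>i\<in>UNIV. \<Sum>k\<le>D. krav (\<alpha> i) (\<sigma> i - \<alpha> i) k * krav (\<alpha>' i) (\<sigma> i - \<alpha>' i) k)"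
    unfolding kravn_def prod.distrib[symmetric] by (rule sum_box_prod)
  also have "\<dots> = (\<Prod>i\<in>UNIV. if \<alpha> i = \<alpha>' i then 1 else 0)"
  proof (intro prod.cong refl)
    fix i
    have "(\<Sum>k\<le>D. krav (\<alpha> i) (\<sigma> i - \<alpha> i) k * krav (\<alpha>' i) (\<sigma> i - \<alpha>' i) k)
      = (\<Sum>k\<le>\<sigma> i. krav (\<alpha> i) (\<sigma> i - \<alpha> i) k * krav (\<alpha>' i) (\<sigma> i - \<alpha>' i) k)"
      using assms by (intro sum.mono_neutral_right) (auto simp: krav_0_eq)
    also have "\<dots> = (if \<alpha> i = \<alpha>' i then 1 else 0)" using assms by (intro krav_orthonormal) auto
    finally show "(\<Sum>k\<le>D. krav (\<alpha> i) (\<sigma> i - \<alpha> i) k * krav (\<alpha>' i) (\<sigma> i - \<alpha>' i) k) = (if \<alpha> i = \<alpha>' i then 1 else 0)" .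
  qed
  also have "\<dots> = (if \<alpha> = \<alpha>' then 1 else 0)" by (auto simp: fun_eq_iff intro!: prod_zero)
  finally show ?thesis .
qed

lemma orthonormal_rows_norm:
  fixes c :: "'i \<Rightarrow> complex" and U :: "'i \<Rightarrow> 'k \<Rightarrow> real"
  assumes "finite A" and U: "\<And>i j. i \<in> A \<Longrightarrow> j \<in> A \<Longrightarrow> (\<Sum>k\<in>K. U i k * U j k) = (if i = j then 1 else 0)"
  shows "(\<Sum>k\<in>K. (cmod (\<Sum>i\<in>A. c i * of_real (U i k)))\<^sup>2) = (\<Sum>i\<in>A. (cmod (c i))\<^sup>2)"
proof -
  have "complex_of_real (\<Sum>k\<in>K. (cmod (\<Sum>i\<in>A. c i * of_real (U i k)))\<^sup>2)
    = (\<Sum>k\<in>K. \<Sum>i\<in>A. \<Sum>j\<in>A. c i * cnj (c j) * of_real (U i k * U j k))"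
    unfolding of_real_sum complex_norm_square by (simp add: sum_product mult_ac)
  also have "\<dots> = (\<Sum>i\<in>A. \<Sum>j\<in>A. \<Sum>k\<in>K. c i * cnj (c j) * of_real (U i k * U j k))"
    by (subst sum.swap) (intro sum.cong refl sum.swap)
  also have "\<dots> = (\<Sum>i\<in>A. \<Sum>j\<in>A. if i = j then c i * cnj (c i) else 0)"
    unfolding sum_distrib_left[symmetric] of_real_sum[symmetric] using U by (intro sum.cong refl) auto
  also have "\<dots> = complex_of_real (\<Sum>i\<in>A. (cmod (c i))\<^sup>2)"
    unfolding of_real_sum complex_norm_square using assms(1) by simp
  finally show ?thesis by (simp only: of_real_eq_iff)
qed

text \<open>Pairs of multi-indices are grouped by their sum \<open>\<sigma>\<close>; \<open>\<sigma> - \<alpha>\<close> is taken componentwise.\<close>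

definition pair_block :: "(('n::finite \<Rightarrow> nat) \<Rightarrow> ('n \<Rightarrow> nat) \<Rightarrow> complex) \<Rightarrow> nat \<Rightarrow> nat \<Rightarrow> real ^ 'n \<Rightarrow> complex" where
  "pair_block c D n x = (\<Sum>\<sigma>\<in>{\<sigma>\<in>box_le D. sum \<sigma> UNIV = n}. \<Sum>\<alpha>\<in>{\<alpha>. \<forall>i. \<alpha> i \<le> \<sigma> i}.
     c \<alpha> (\<lambda>i. \<sigma> i - \<alpha> i) * of_real (hermite \<alpha> x * hermite (\<lambda>i. \<sigma> i - \<alpha> i) x))"

lemma finite_below: "finite {\<alpha> :: 'n::finite \<Rightarrow> nat. \<forall>i. \<alpha> i \<le> \<sigma> i}"
  by (rule finite_subset[OF _ finite_multi_index[of "Max (range \<sigma>)"]]) (auto intro: order_trans[OF _ Max_ge])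

text \<open>For a fixed sum \<open>\<sigma>\<close> the Kravchuk matrix is an isometry, but all
  \<open>\<sigma>\<close> of total \<open>n\<close> feed the same functions
  \<open>scaled_hermite \<kappa>\<close>. Cauchy-Schwarz over \<open>\<sigma>\<close> costs the sum
  of the squared values at the origin over the differences \<open>\<sigma> - \<kappa>\<close>. These
  have a fixed total of at most \<open>n\<close>, so \<open>hermite_zero_sphere\<close>
  applies.\<close>

lemma pair_block_bound:
  fixes c :: "('n::finite \<Rightarrow> nat) \<Rightarrow> ('n \<Rightarrow> nat) \<Rightarrow> complex"
  assumes card: "CARD('n) \<ge> 2"
  shows "pair_block c D n \<in> L2"
    and "(l2_norm (pair_block c D n))\<^sup>2 \<le> 3 * sqrt (2 * (real n + 1)) ^ (CARD('n) - 2) *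
      (\<Sum>\<sigma>\<in>{\<sigma>\<in>box_le D. sum \<sigma> UNIV = n}. \<Sum>\<alpha>\<in>{\<alpha>. \<forall>i. \<alpha> i \<le> \<sigma> i}. (cmod (c \<alpha> (\<lambda>i. \<sigma> i - \<alpha> i)))\<^sup>2)"
proof -
  let ?T = "{\<sigma>::'n \<Rightarrow> nat. \<sigma> \<in> box_le D \<and> sum \<sigma> UNIV = n}"
  let ?A = "\<lambda>\<sigma>::'n \<Rightarrow> nat. {\<alpha>. \<forall>i. \<alpha> i \<le> \<sigma> i}"
  obtain i j :: 'n where ij: "i \<noteq> j"
    using card by (metis (full_types) One_nat_def card_1_singleton_iff card_le_Suc0_iff_eq finite iso_tuple_UNIV_I not_less_eq_eq numeral_2_eq_2)
  define w where "w \<sigma> \<kappa> = (\<Sum>\<alpha>\<in>?A \<sigma>. c \<alpha> (\<lambda>i. \<sigma> i - \<alpha> i) * of_real (kravn \<alpha> (\<lambda>i. \<sigma> i - \<alpha> i) \<kappa>))" for \<sigma> \<kappa>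
  define h where "h \<sigma> \<kappa> = (\<Prod>i\<in>UNIV. hermf (\<sigma> i - \<kappa> i) 0)" for \<sigma> \<kappa> :: "'n \<Rightarrow> nat"
  define y where "y \<kappa> = (\<Sum>\<sigma>\<in>?T. of_real (h \<sigma> \<kappa>) * w \<sigma> \<kappa>)" for \<kappa>
  have finT: "finite ?T" by (rule finite_subset[OF _ finite_multi_index[of D]]) auto
  have block: "pair_block c D n x = (\<Sum>\<kappa>\<in>box_le D. y \<kappa> * scaled_hermite \<kappa> x)" for x
  proof -
    have "c \<alpha> (\<lambda>i. \<sigma> i - \<alpha> i) * of_real (hermite \<alpha> x * hermite (\<lambda>i. \<sigma> i - \<alpha> i) x)
      = (\<Sum>\<kappa>\<in>box_le D. of_real (h \<sigma> \<kappa>) * (c \<alpha> (\<lambda>i. \<sigma> i - \<alpha> i) * of_real (kravn \<alpha> (\<lambda>i. \<sigma> i - \<alpha> i) \<kappa>)) * scaled_hermite \<kappa> x)"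
      if "\<sigma> \<in> ?T" "\<alpha> \<in> ?A \<sigma>" for \<sigma> \<alpha>
    proof -
      have e: "\<alpha> i + (\<sigma> i - \<alpha> i) = \<sigma> i" for i using that by simp
      have "complex_of_real (hermite \<alpha> x * hermite (\<lambda>i. \<sigma> i - \<alpha> i) x)
        = (\<Sum>\<kappa>\<in>box_le D. of_real (kravn \<alpha> (\<lambda>i. \<sigma> i - \<alpha> i) \<kappa> * h \<sigma> \<kappa>) * scaled_hermite \<kappa> x)"
        using hermite_product[of \<alpha> "\<lambda>i. \<sigma> i - \<alpha> i" D x] that unfolding e h_def by simp
      then show ?thesis by (simp add: sum_distrib_left mult_ac)
    qed
    then have "pair_block c D n x = (\<Sum>\<sigma>\<in>?T. \<Sum>\<alpha>\<in>?A \<sigma>. \<Sum>\<kappa>\<in>box_le D. of_real (h \<sigma> \<kappa>) * (c \<alpha> (\<lambda>i. \<sigma> i - \<alpha> i) * of_real (kravn \<alpha> (\<lambda>i. \<sigma> i - \<alpha> i) \<kappa>)) * scaled_hermite \<kappa> x)"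
      unfolding pair_block_def by (intro sum.cong refl) blast
    also have "\<dots> = (\<Sum>\<sigma>\<in>?T. \<Sum>\<kappa>\<in>box_le D. of_real (h \<sigma> \<kappa>) * w \<sigma> \<kappa> * scaled_hermite \<kappa> x)"
      unfolding w_def sum_distrib_left sum_distrib_right by (intro sum.cong refl sum.swap)
    also have "\<dots> = (\<Sum>\<kappa>\<in>box_le D. y \<kappa> * scaled_hermite \<kappa> x)"
      unfolding y_def sum_distrib_right by (rule sum.swap)
    finally show ?thesis .
  qed
  then have eq: "pair_block c D n = (\<lambda>x. \<Sum>\<kappa>\<in>box_le D. y \<kappa> * scaled_hermite \<kappa> x)" by (simp add: fun_eq_iff)
  show "pair_block c D n \<in> L2" unfolding eq by (intro L2_sum L2_scale scaled_hermite_L2)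
  define G where "G = 3 * sqrt (2 * (real n + 1)) ^ (CARD('n) - 2)"
  have G0: "G \<ge> 0" by (simp add: G_def)
  have ybd: "(cmod (y \<kappa>))\<^sup>2 \<le> G * (\<Sum>\<sigma>\<in>?T. (cmod (w \<sigma> \<kappa>))\<^sup>2)" for \<kappa>
  proof -
    \<comment> \<open>Only where \<open>\<kappa> \<le> \<sigma>\<close> is the componentwise
      difference exact, and hence \<open>\<psi>\<close> below injective; for all other
      \<open>\<sigma>\<close> the coefficient \<open>w \<sigma> \<kappa>\<close> is zero.\<close>
    let ?T' = "{\<sigma>\<in>?T. \<forall>i. \<kappa> i \<le> \<sigma> i}"
    have w0: "w \<sigma> \<kappa> = 0" if s: "\<sigma> \<in> ?T - ?T'" for \<sigma>
    proof -
      from s have "\<not> (\<forall>i. \<kappa> i \<le> \<sigma> i)" by blast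
      then obtain i where i: "\<kappa> i > \<sigma> i" by (auto simp: not_le)
      have "kravn \<alpha> (\<lambda>i. \<sigma> i - \<alpha> i) \<kappa> = 0" if "\<alpha> \<in> ?A \<sigma>" for \<alpha>
      proof -
        have "krav (\<alpha> i) (\<sigma> i - \<alpha> i) (\<kappa> i) = 0" using i that by (intro krav_0_eq) simp
        then show ?thesis unfolding kravn_def by (intro prod_zero) auto
      qed
      then show ?thesis unfolding w_def by simp
    qed
    have y: "y \<kappa> = (\<Sum>\<sigma>\<in>?T'. of_real (h \<sigma> \<kappa>) * w \<sigma> \<kappa>)"
      unfolding y_def using finT w0 by (intro sum.mono_neutral_right) auto
    have "(cmod (y \<kappa>))\<^sup>2 \<le> (\<Sum>\<sigma>\<in>?T'. (cmod (complex_of_real (h \<sigma> \<kappa>)))\<^sup>2) * (\<Sum>\<sigma>\<in>?T'. (cmod (w \<sigma> \<kappa>))\<^sup>2)"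
      unfolding y by (rule cmod_sum_mult_sq_le)
    also have "\<dots> \<le> G * (\<Sum>\<sigma>\<in>?T. (cmod (w \<sigma> \<kappa>))\<^sup>2)"
    proof (intro mult_mono sum_mono2 finT sum_nonneg)
      define m where "m = n - sum \<kappa> UNIV"
      define \<psi> where "\<psi> \<sigma> i = \<sigma> i - \<kappa> i" for \<sigma> and i :: 'n
      have inj: "inj_on \<psi> ?T'"
      proof (rule inj_onI)
        fix \<sigma> \<sigma>' assume s: "\<sigma> \<in> ?T'" "\<sigma>' \<in> ?T'" and e: "\<psi> \<sigma> = \<psi> \<sigma>'"
        show "\<sigma> = \<sigma>'"
        proof
          fix i
          have "\<sigma> i - \<kappa> i = \<sigma>' i - \<kappa> i" using fun_cong[OF e, of i] by (simp add: \<psi>_def)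
          moreover have "\<kappa> i \<le> \<sigma> i" "\<kappa> i \<le> \<sigma>' i" using s by auto
          ultimately show "\<sigma> i = \<sigma>' i" by simp
        qed
      qed
      have im: "\<psi> ` ?T' \<subseteq> {\<tau> :: 'n \<Rightarrow> nat. \<tau> \<in> box_le m \<and> sum \<tau> UNIV = m}"
      proof
        fix \<tau> assume "\<tau> \<in> \<psi> ` ?T'"
        then obtain \<sigma> where s: "\<sigma> \<in> ?T'" "\<tau> = \<psi> \<sigma>" by blast
        have "sum \<tau> UNIV = sum \<sigma> UNIV - sum \<kappa> UNIV"
          unfolding s(2) \<psi>_def using s(1) by (intro sum_subtractf_nat) auto
        then have t: "sum \<tau> UNIV = m" using s(1) by (simp add: m_def)
        have "\<tau> i \<le> sum \<tau> UNIV" for i by (rule member_le_sum) auto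
        with t show "\<tau> \<in> {\<tau> :: 'n \<Rightarrow> nat. \<tau> \<in> box_le m \<and> sum \<tau> UNIV = m}" by simp
      qed
      have "(\<Sum>\<sigma>\<in>?T'. (cmod (complex_of_real (h \<sigma> \<kappa>)))\<^sup>2) = (\<Sum>\<sigma>\<in>?T'. \<Prod>l\<in>UNIV. (hermf (\<psi> \<sigma> l) 0)\<^sup>2)"
        by (simp add: h_def \<psi>_def prod_power_distrib flip: of_real_prod)
      also have "\<dots> = (\<Sum>\<tau>\<in>\<psi> ` ?T'. \<Prod>l\<in>UNIV. (hermf (\<tau> l) 0)\<^sup>2)"
        unfolding sum.reindex[OF inj] o_def ..
      also have "\<dots> \<le> (\<Sum>\<tau>\<in>{\<tau> :: 'n \<Rightarrow> nat. \<tau> \<in> box_le m \<and> sum \<tau> UNIV = m}. \<Prod>l\<in>UNIV. (hermf (\<tau> l) 0)\<^sup>2)"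
        by (rule sum_mono2[OF _ im]) (auto intro!: prod_nonneg finite_subset[OF _ finite_multi_index[of m]])
      also have "\<dots> \<le> 3 * sqrt (2 * (real m + 1)) ^ (CARD('n) - 2)" by (rule hermite_zero_sphere[OF ij])
      also have "\<dots> \<le> G" unfolding G_def by (intro mult_left_mono power_mono) (auto simp: m_def)
      finally show "(\<Sum>\<sigma>\<in>?T'. (cmod (complex_of_real (h \<sigma> \<kappa>)))\<^sup>2) \<le> G" .
    qed (auto simp: G0)
    finally show ?thesis .
  qed
  have "(l2_norm (pair_block c D n))\<^sup>2 \<le> (\<Sum>\<kappa>\<in>box_le D. (cmod (y \<kappa>))\<^sup>2)"
    unfolding eq by (rule scaled_hermite_sum_norm[OF finite_multi_index])
  also have "\<dots> \<le> (\<Sum>\<kappa>\<in>box_le D. G * (\<Sum>\<sigma>\<in>?T. (cmod (w \<sigma> \<kappa>))\<^sup>2))" by (intro sum_mono ybd)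
  also have "\<dots> = G * (\<Sum>\<sigma>\<in>?T. \<Sum>\<kappa>\<in>box_le D. (cmod (w \<sigma> \<kappa>))\<^sup>2)"
    unfolding sum_distrib_left[symmetric] by (subst sum.swap) (rule refl)
  also have "(\<Sum>\<sigma>\<in>?T. \<Sum>\<kappa>\<in>box_le D. (cmod (w \<sigma> \<kappa>))\<^sup>2) = (\<Sum>\<sigma>\<in>?T. \<Sum>\<alpha>\<in>?A \<sigma>. (cmod (c \<alpha> (\<lambda>i. \<sigma> i - \<alpha> i)))\<^sup>2)"
    unfolding w_def
    by (intro sum.cong refl orthonormal_rows_norm finite_below kravn_orthonormal) auto
  finally show "(l2_norm (pair_block c D n))\<^sup>2 \<le> 3 * sqrt (2 * (real n + 1)) ^ (CARD('n) - 2) *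
      (\<Sum>\<sigma>\<in>{\<sigma>\<in>box_le D. sum \<sigma> UNIV = n}. \<Sum>\<alpha>\<in>{\<alpha>. \<forall>i. \<alpha> i \<le> \<sigma> i}. (cmod (c \<alpha> (\<lambda>i. \<sigma> i - \<alpha> i)))\<^sup>2)"
    unfolding G_def .
qed

text \<open>The pair of indices is replaced by its sum and its first entry, and the sums are grouped
  by their total. The vanishing condition extends the summation to all pairs whose sum lies in the
  larger box.\<close>

lemma sum_pairs_by_total:
  fixes F :: "('n::finite \<Rightarrow> nat) \<Rightarrow> ('n \<Rightarrow> nat) \<Rightarrow> 'b::comm_monoid_add"
  assumes F: "\<And>\<alpha> \<beta>. \<not> (\<alpha> \<in> box_le B \<and> \<beta> \<in> box_le L) \<Longrightarrow> F \<alpha> \<beta> = 0"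
  shows "(\<Sum>\<alpha>\<in>box_le B. \<Sum>\<beta>\<in>box_le L. F \<alpha> \<beta>)
    = (\<Sum>n\<le>CARD('n) * (B + L). \<Sum>\<sigma>\<in>{\<sigma>\<in>box_le (B + L). sum \<sigma> UNIV = n}. \<Sum>\<alpha>\<in>{\<alpha>. \<forall>i. \<alpha> i \<le> \<sigma> i}. F \<alpha> (\<lambda>i. \<sigma> i - \<alpha> i))"
proof -
  let ?A = "\<lambda>\<sigma>::'n \<Rightarrow> nat. {\<alpha>. \<forall>i. \<alpha> i \<le> \<sigma> i}"
  let ?D = "box_le (B + L) :: ('n \<Rightarrow> nat) set"
  let ?P = "{p :: ('n \<Rightarrow> nat) \<times> ('n \<Rightarrow> nat). \<forall>i. fst p i + snd p i \<le> B + L}"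
  have "(\<Sum>\<alpha>\<in>box_le B. \<Sum>\<beta>\<in>box_le L. F \<alpha> \<beta>) = (\<Sum>p\<in>box_le B \<times> box_le L. F (fst p) (snd p))"
    by (simp add: sum.cartesian_product case_prod_unfold)
  also have "\<dots> = (\<Sum>p\<in>?P. F (fst p) (snd p))"
  proof (rule sum.mono_neutral_left)
    show "finite ?P"
    proof (rule finite_subset)
      show "?P \<subseteq> ?D \<times> ?D"
      proof
        fix p assume "p \<in> ?P"
        then have p: "fst p i + snd p i \<le> B + L" for i by simp
        have "fst p i \<le> B + L" "snd p i \<le> B + L" for i using p[of i] by linarith+
        then show "p \<in> ?D \<times> ?D" by (simp add: mem_Times_iff)
      qed
    qed (simp add: finite_multi_index)
    show "box_le B \<times> box_le L \<subseteq> ?P"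
    proof
      fix p :: "('n \<Rightarrow> nat) \<times> ('n \<Rightarrow> nat)" assume "p \<in> box_le B \<times> box_le L"
      then have "fst p i \<le> B" "snd p i \<le> L" for i by (simp_all add: mem_Times_iff)
      then show "p \<in> ?P" by (simp add: add_mono)
    qed
    show "\<forall>p\<in>?P - box_le B \<times> box_le L. F (fst p) (snd p) = 0"
    proof
      fix p assume "p \<in> ?P - box_le B \<times> box_le L"
      then have "\<not> (fst p \<in> box_le B \<and> snd p \<in> box_le L)" by (simp only: Diff_iff mem_Times_iff simp_thms)
      then show "F (fst p) (snd p) = 0" by (rule F)
    qed
  qed
  also have "\<dots> = (\<Sum>(\<sigma>, \<alpha>)\<in>Sigma ?D ?A. F \<alpha> (\<lambda>i. \<sigma> i - \<alpha> i))"
    by (rule sum.reindex_bij_witness[where i="\<lambda>(\<sigma>, \<alpha>). (\<alpha>, \<lambda>i. \<sigma> i - \<alpha> i)" and j="\<lambda>(\<alpha>, \<beta>). (\<lambda>i. \<alpha> i + \<beta> i, \<alpha>)"]) auto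
  also have "\<dots> = (\<Sum>\<sigma>\<in>?D. \<Sum>\<alpha>\<in>?A \<sigma>. F \<alpha> (\<lambda>i. \<sigma> i - \<alpha> i))"
    using finite_multi_index finite_below by (subst sum.Sigma) auto
  also have "\<dots> = (\<Sum>n\<le>CARD('n) * (B + L). \<Sum>\<sigma>\<in>{\<sigma>\<in>?D. sum \<sigma> UNIV = n}. \<Sum>\<alpha>\<in>?A \<sigma>. F \<alpha> (\<lambda>i. \<sigma> i - \<alpha> i))"
  proof (rule sum.group[symmetric])
    have "sum \<sigma> UNIV \<le> CARD('n) * (B + L)" if "\<sigma> \<in> ?D" for \<sigma>
      using that sum_bounded_above[of UNIV \<sigma> "B + L"] by simp
    then show "(\<lambda>\<sigma>. sum \<sigma> UNIV) ` ?D \<subseteq> {..CARD('n) * (B + L)}" by auto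
  qed (auto simp: finite_multi_index)
  finally show ?thesis .
qed

text \<open>Time decouples the product into the blocks of total \<open>n\<close>, to which
  \<open>pair_block_bound\<close> applies. Its constant grows with \<open>n\<close>, but no pair of
  coefficients has a total above \<open>2 * E\<close>.\<close>

lemma bilinear_comparable:
  fixes a b :: "('n::finite \<Rightarrow> nat) \<Rightarrow> complex"
  assumes card: "CARD('n) \<ge> 2"
    and a: "\<And>\<alpha>. a \<alpha> \<noteq> 0 \<Longrightarrow> \<alpha> \<in> box_le B \<and> real (sum \<alpha> UNIV) \<le> E"
    and b: "\<And>\<beta>. b \<beta> \<noteq> 0 \<Longrightarrow> \<beta> \<in> box_le L \<and> real (sum \<beta> UNIV) \<le> E"
  shows "(\<integral>\<^sup>+t\<in>{0..real m * pi}. (\<integral>\<^sup>+x. ennreal ((cmod (evol B a t x * evol L b t x))\<^sup>2) \<partial>lborel) \<partial>lborel)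
      \<le> ennreal (real m * pi * (3 * sqrt (2 * (2 * E + 1)) ^ (CARD('n) - 2))
          * ((\<Sum>\<alpha>\<in>box_le B. (cmod (a \<alpha>))\<^sup>2) * (\<Sum>\<beta>\<in>box_le L. (cmod (b \<beta>))\<^sup>2)))"
proof -
  let ?T = "\<lambda>n. {\<sigma>::'n \<Rightarrow> nat. \<sigma> \<in> box_le (B + L) \<and> sum \<sigma> UNIV = n}"
  let ?A = "\<lambda>\<sigma>::'n \<Rightarrow> nat. {\<alpha>. \<forall>i. \<alpha> i \<le> \<sigma> i}"
  define c where "c \<alpha> \<beta> = a \<alpha> * b \<beta>" for \<alpha> \<beta>
  define Z where "Z n = pair_block c (B + L) n" for n
  define N where "N = CARD('n) * (B + L)"
  note Z = pair_block_bound[OF card, of c "B + L", folded Z_def]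
  \<comment> \<open>Each of the two energies contains the ground state energy \<open>d\<close>,
    which yields the common phase \<open>2 * t * d\<close>; it disappears in the absolute
    value.\<close>
  have prod: "evol B a t x * evol L b t x
    = exp (\<i> * of_real (2 * t * real CARD('n))) * (\<Sum>n\<in>{..N}. exp (\<i> * of_real (2 * t * real n)) * Z n x)" for t x
  proof -
    let ?F = "\<lambda>\<alpha> \<beta>. (a \<alpha> * exp (\<i> * of_real (t * energy \<alpha>)) * of_real (hermite \<alpha> x)) * (b \<beta> * exp (\<i> * of_real (t * energy \<beta>)) * of_real (hermite \<beta> x))"
    have "evol B a t x * evol L b t x = (\<Sum>\<alpha>\<in>box_le B. \<Sum>\<beta>\<in>box_le L. ?F \<alpha> \<beta>)"
      unfolding evol_def sum_product ..
    also have "\<dots> = (\<Sum>n\<le>N. \<Sum>\<sigma>\<in>?T n. \<Sum>\<alpha>\<in>?A \<sigma>. ?F \<alpha> (\<lambda>i. \<sigma> i - \<alpha> i))"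
      unfolding N_def using a b by (intro sum_pairs_by_total) auto
    also have "\<dots> = (\<Sum>n\<le>N. exp (\<i> * of_real (2 * t * real CARD('n))) * (exp (\<i> * of_real (2 * t * real n)) * Z n x))"
    proof (intro sum.cong refl)
      fix n
      have "?F \<alpha> (\<lambda>i. \<sigma> i - \<alpha> i) = exp (\<i> * of_real (2 * t * real CARD('n))) * (exp (\<i> * of_real (2 * t * real n)) *
          (c \<alpha> (\<lambda>i. \<sigma> i - \<alpha> i) * of_real (hermite \<alpha> x * hermite (\<lambda>i. \<sigma> i - \<alpha> i) x)))"
        if "\<sigma> \<in> ?T n" "\<alpha> \<in> ?A \<sigma>" for \<sigma> \<alpha>
      proof -
        have "(\<Sum>i\<in>UNIV. real (\<alpha> i)) + (\<Sum>i\<in>UNIV. real (\<sigma> i - \<alpha> i)) = (\<Sum>i\<in>UNIV. real (\<sigma> i))"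
          unfolding sum.distrib[symmetric] using that(2) by (intro sum.cong refl) (simp add: of_nat_diff)
        also have "\<dots> = real n" using that(1) by (simp flip: of_nat_sum)
        finally have tot: "real n = (\<Sum>i\<in>UNIV. real (\<alpha> i)) + (\<Sum>i\<in>UNIV. real (\<sigma> i - \<alpha> i))" by (rule sym)
        have "t * energy \<alpha> + t * energy (\<lambda>i. \<sigma> i - \<alpha> i) = 2 * t * real CARD('n) + 2 * t * real n"
          unfolding energy_def tot by (simp only: distrib_left ac_simps)
        then have "\<i> * of_real (t * energy \<alpha>) + \<i> * of_real (t * energy (\<lambda>i. \<sigma> i - \<alpha> i)) = \<i> * of_real (2 * t * real CARD('n)) + \<i> * of_real (2 * t * real n)"
          by (simp only: distrib_left[symmetric] of_real_add[symmetric])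
        then have "exp (\<i> * of_real (t * energy \<alpha>)) * exp (\<i> * of_real (t * energy (\<lambda>i. \<sigma> i - \<alpha> i)))
          = exp (\<i> * of_real (2 * t * real CARD('n))) * exp (\<i> * of_real (2 * t * real n))"
          by (simp only: exp_add[symmetric])
        moreover have "?F \<alpha> (\<lambda>i. \<sigma> i - \<alpha> i) = (exp (\<i> * of_real (t * energy \<alpha>)) * exp (\<i> * of_real (t * energy (\<lambda>i. \<sigma> i - \<alpha> i))))
          * (c \<alpha> (\<lambda>i. \<sigma> i - \<alpha> i) * of_real (hermite \<alpha> x * hermite (\<lambda>i. \<sigma> i - \<alpha> i) x))"
          by (simp only: c_def of_real_mult mult_ac)
        ultimately show ?thesis by (simp only: mult.assoc)
      qed
      then have "(\<Sum>\<sigma>\<in>?T n. \<Sum>\<alpha>\<in>?A \<sigma>. ?F \<alpha> (\<lambda>i. \<sigma> i - \<alpha> i)) = (\<Sum>\<sigma>\<in>?T n. \<Sum>\<alpha>\<in>?A \<sigma>. exp (\<i> * of_real (2 * t * real CARD('n))) * (exp (\<i> * of_real (2 * t * real n)) *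
          (c \<alpha> (\<lambda>i. \<sigma> i - \<alpha> i) * of_real (hermite \<alpha> x * hermite (\<lambda>i. \<sigma> i - \<alpha> i) x))))"
        by (intro sum.cong refl) blast
      then show "(\<Sum>\<sigma>\<in>?T n. \<Sum>\<alpha>\<in>?A \<sigma>. ?F \<alpha> (\<lambda>i. \<sigma> i - \<alpha> i)) = exp (\<i> * of_real (2 * t * real CARD('n))) * (exp (\<i> * of_real (2 * t * real n)) * Z n x)"
        unfolding Z_def pair_block_def by (simp only: sum_distrib_left)
    qed
    finally show ?thesis by (simp only: sum_distrib_left)
  qed
  have nrm: "(cmod (evol B a t x * evol L b t x))\<^sup>2 = (cmod (\<Sum>n\<in>{..N}. exp (\<i> * of_real (2 * t * real n)) * Z n x))\<^sup>2" for t x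
    unfolding prod by (simp add: norm_mult)
  have "(\<integral>\<^sup>+t\<in>{0..real m * pi}. (\<integral>\<^sup>+x. ennreal ((cmod (evol B a t x * evol L b t x))\<^sup>2) \<partial>lborel) \<partial>lborel)
     = ennreal (real m * pi * (\<Sum>n\<in>{..N}. (l2_norm (Z n))\<^sup>2))"
    unfolding nrm by (rule time_orthogonality(1)[OF Z(1)]) simp
  also have "\<dots> \<le> ennreal (real m * pi * (\<Sum>n\<in>{..N}. 3 * sqrt (2 * (2 * E + 1)) ^ (CARD('n) - 2) *
      (\<Sum>\<sigma>\<in>?T n. \<Sum>\<alpha>\<in>?A \<sigma>. (cmod (c \<alpha> (\<lambda>i. \<sigma> i - \<alpha> i)))\<^sup>2)))"
  proof (intro ennreal_leI mult_left_mono sum_mono)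
    fix n
    let ?Q = "\<Sum>\<sigma>\<in>?T n. \<Sum>\<alpha>\<in>?A \<sigma>. (cmod (c \<alpha> (\<lambda>i. \<sigma> i - \<alpha> i)))\<^sup>2"
    show "(l2_norm (Z n))\<^sup>2 \<le> 3 * sqrt (2 * (2 * E + 1)) ^ (CARD('n) - 2) * ?Q"
    proof (cases "real n \<le> 2 * E")
      case True
      have "(l2_norm (Z n))\<^sup>2 \<le> 3 * sqrt (2 * (real n + 1)) ^ (CARD('n) - 2) * ?Q" by (rule Z(2))
      also have "\<dots> \<le> 3 * sqrt (2 * (2 * E + 1)) ^ (CARD('n) - 2) * ?Q"
        using True by (intro mult_right_mono mult_left_mono power_mono sum_nonneg) auto
      finally show ?thesis .
    next
      \<comment> \<open>Such a block is zero, so the estimate holds with any nonnegative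
        constant.\<close>
      case False
      have "c \<alpha> (\<lambda>i. \<sigma> i - \<alpha> i) = 0" if "\<sigma> \<in> ?T n" "\<alpha> \<in> ?A \<sigma>" for \<sigma> \<alpha>
      proof (rule ccontr)
        assume "c \<alpha> (\<lambda>i. \<sigma> i - \<alpha> i) \<noteq> 0"
        then have "real (sum \<alpha> UNIV) \<le> E" "real (\<Sum>i\<in>UNIV. \<sigma> i - \<alpha> i) \<le> E" using a b by (auto simp: c_def)
        moreover have "sum \<alpha> UNIV + (\<Sum>i\<in>UNIV. \<sigma> i - \<alpha> i) = n"
          unfolding sum.distrib[symmetric] using that by simp
        then have "real (sum \<alpha> UNIV) + real (\<Sum>i\<in>UNIV. \<sigma> i - \<alpha> i) = real n" by (simp only: of_nat_add[symmetric])
        ultimately show False using False by linarith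
      qed
      then have "?Q = 0" by (intro sum.neutral ballI) auto
      with Z(2)[of n] show ?thesis by simp
    qed
  qed simp
  also have "(\<Sum>n\<in>{..N}. 3 * sqrt (2 * (2 * E + 1)) ^ (CARD('n) - 2) *
      (\<Sum>\<sigma>\<in>?T n. \<Sum>\<alpha>\<in>?A \<sigma>. (cmod (c \<alpha> (\<lambda>i. \<sigma> i - \<alpha> i)))\<^sup>2))
    = 3 * sqrt (2 * (2 * E + 1)) ^ (CARD('n) - 2) * (\<Sum>\<alpha>\<in>box_le B. \<Sum>\<beta>\<in>box_le L. (cmod (c \<alpha> \<beta>))\<^sup>2)"
    unfolding sum_distrib_left[symmetric] N_def using a b
    by (subst sum_pairs_by_total[of B L "\<lambda>\<alpha> \<beta>. (cmod (c \<alpha> \<beta>))\<^sup>2"]) (auto simp: c_def)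
  also have "(\<Sum>\<alpha>\<in>box_le B. \<Sum>\<beta>\<in>box_le L. (cmod (c \<alpha> \<beta>))\<^sup>2) = (\<Sum>\<alpha>\<in>box_le B. (cmod (a \<alpha>))\<^sup>2) * (\<Sum>\<beta>\<in>box_le L. (cmod (b \<beta>))\<^sup>2)"
    unfolding sum_product c_def by (simp add: norm_mult power_mult_distrib)
  finally show ?thesis by (simp only: mult.assoc)
qed

section \<open>Both frequency regimes combined\<close>

lemma evol_measurable [measurable]:
  fixes a :: "('n::finite \<Rightarrow> nat) \<Rightarrow> complex"
  shows "(\<lambda>p. evol B a (fst p) (snd p)) \<in> borel_measurable (borel \<Otimes>\<^sub>M borel)"
proof -
  have "(\<lambda>x :: real^'n. x $ i) \<in> borel_measurable borel" for i
    by (intro borel_measurable_continuous_onI continuous_intros)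
  from measurable_compose[OF measurable_snd this]
  have [measurable]: "(\<lambda>p :: real \<times> (real^'n). snd p $ i) \<in> borel_measurable (borel \<Otimes>\<^sub>M borel)" for i .
  show ?thesis unfolding evol_def hermite_def by measurable
qed

lemma evol_product_measurable:
  "(\<lambda>t. \<integral>\<^sup>+x. ennreal ((cmod (evol B a t x * evol L b t x))\<^sup>2) \<partial>lborel) \<in> borel_measurable borel"
proof -
  have "(\<lambda>p. ennreal ((cmod (evol B a (fst p) (snd p) * evol L b (fst p) (snd p)))\<^sup>2)) \<in> borel_measurable (borel \<Otimes>\<^sub>M lborel)"
    by measurable
  from sigma_finite_measure.borel_measurable_nn_integral_fst[OF sigma_finite_lborel this] show ?thesis by simp
qed

lemma norm_sum_sq_le: "(norm (\<Sum>i\<in>S. z i :: 'b::real_normed_vector))\<^sup>2 \<le> real (card S) * (\<Sum>i\<in>S. (norm (z i))\<^sup>2)"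
proof -
  have "(norm (\<Sum>i\<in>S. z i))\<^sup>2 \<le> (\<Sum>i\<in>S. 1 * norm (z i))\<^sup>2"
    by (intro power_mono order_trans[OF norm_sum]) auto
  also have "\<dots> \<le> (\<Sum>i\<in>S. 1\<^sup>2) * (\<Sum>i\<in>S. (norm (z i))\<^sup>2)" by (rule Cauchy_Schwarz_ineq_sum)
  finally show ?thesis by simp
qed

text \<open>
  If \<open>M\<close> is small compared with \<open>N\<close>, the high frequency datum is split according to a coordinate
  carrying at least the average energy.
\<close>

lemma bilinear_gap:
  fixes a b :: "('n::finite \<Rightarrow> nat) \<Rightarrow> complex"
  defines "d \<equiv> real CARD('n)"
  assumes MN: "M \<ge> 1" "N > 0" and gap: "512 * d * M\<^sup>2 \<le> N\<^sup>2" and L: "real L \<le> M\<^sup>2"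
    and a: "\<And>\<alpha>. a \<alpha> \<noteq> 0 \<Longrightarrow> \<alpha> \<in> box_le B \<and> N\<^sup>2 / 4 \<le> energy \<alpha>"
    and b: "\<And>\<beta>. b \<beta> \<noteq> 0 \<Longrightarrow> \<beta> \<in> box_le L"
  shows "(\<integral>\<^sup>+t\<in>{0..real m * pi}. (\<integral>\<^sup>+x. ennreal ((cmod (evol B a t x * evol L b t x))\<^sup>2) \<partial>lborel) \<partial>lborel)
      \<le> ennreal (d * (2 ^ (CARD('n) - 1) * (real m * pi * (1027 * (4 * sqrt d)))) * (M ^ (CARD('n) - 1) / N)
          * ((\<Sum>\<alpha>\<in>box_le B. (cmod (a \<alpha>))\<^sup>2) * (\<Sum>\<beta>\<in>box_le L. (cmod (b \<beta>))\<^sup>2)))"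
proof -
  have d1: "d \<ge> 1" unfolding d_def by (simp add: Suc_le_eq)
  \<comment> \<open>If all \<open>d\<close> entries were below \<open>N^2 / (16 d)\<close>, the
    energy would be at most \<open>N^2 / 8 + d\<close>. This contradicts the lower bound
    \<open>N^2 / 4\<close> because \<open>d \<le> N^2 / 512\<close>. The gap constant is
    \<open>512 = 32 * 16\<close>, with 32 from the one-dimensional estimate.\<close>
  define K where "K = N\<^sup>2 / (16 * d)"
  have K: "K > 0" unfolding K_def using MN d1 by simp
  have M2: "M\<^sup>2 \<ge> 1" using MN(1) by simp
  have "32 * M\<^sup>2 \<le> K" using gap d1 by (simp add: K_def le_divide_eq mult_ac)
  then have LK: "32 * real L \<le> K" using L by linarith
  have "512 * d * 1 \<le> 512 * d * M\<^sup>2" using M2 d1 by (intro mult_left_mono) auto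
  then have dN: "512 * d \<le> N\<^sup>2" using gap by linarith
  have "\<exists>j. K \<le> real (\<alpha> j)" if "a \<alpha> \<noteq> 0" for \<alpha>
  proof (rule ccontr)
    assume "\<not> ?thesis"
    then have "(\<Sum>i\<in>UNIV. real (\<alpha> i)) \<le> (\<Sum>i\<in>(UNIV :: 'n set). K)" by (intro sum_mono) (simp add: not_le less_imp_le)
    also have "\<dots> = N\<^sup>2 / 16" using d1 by (simp add: K_def d_def)
    finally have "energy \<alpha> \<le> N\<^sup>2 / 8 + d" by (simp add: energy_def d_def)
    with a[OF that] have "N\<^sup>2 / 8 \<le> d" by simp
    with dN d1 show False by linarith
  qed
  then obtain J where J: "\<And>\<alpha>. a \<alpha> \<noteq> 0 \<Longrightarrow> K \<le> real (\<alpha> (J \<alpha>))" by metis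
  \<comment> \<open>Assigning each multi-index to one coordinate keeps the pieces disjoint: the
    squared coefficients add up exactly, and only the sum of \<open>d\<close> functions costs a
    factor \<open>d\<close>.\<close>
  define a' where "a' j \<alpha> = (if J \<alpha> = j then a \<alpha> else 0)" for j \<alpha>
  have split: "evol B a t x = (\<Sum>j\<in>UNIV. evol B (a' j) t x)" for t x
  proof -
    have "a \<alpha> = (\<Sum>j\<in>UNIV. a' j \<alpha>)" for \<alpha> by (simp add: a'_def)
    then have "evol B a t x = (\<Sum>\<alpha>\<in>box_le B. \<Sum>j\<in>UNIV. a' j \<alpha> * exp (\<i> * of_real (t * energy \<alpha>)) * of_real (hermite \<alpha> x))"
      unfolding evol_def by (simp add: sum_distrib_right)
    then show ?thesis unfolding evol_def by (subst (asm) sum.swap)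
  qed
  let ?I = "\<lambda>a. \<integral>\<^sup>+t\<in>{0..real m * pi}. (\<integral>\<^sup>+x. ennreal ((cmod (evol B a t x * evol L b t x))\<^sup>2) \<partial>lborel) \<partial>lborel"
  let ?b = "\<Sum>\<beta>\<in>box_le L. (cmod (b \<beta>))\<^sup>2" and ?a = "\<lambda>a. \<Sum>\<alpha>\<in>box_le B. (cmod (a \<alpha>))\<^sup>2"
  define c where "c = 2 ^ (CARD('n) - 1) * (real m * pi * (1027 * (4 * sqrt d))) * (M ^ (CARD('n) - 1) / N)"
  have c0: "c \<ge> 0" unfolding c_def using MN d1 by auto
  have piece: "?I (a' j) \<le> ennreal (c * (?a (a' j) * ?b))" for j
  proof -
    have "?I (a' j) \<le> ennreal (sqrt (2 * (real L + 1)) ^ (CARD('n) - 1) * (real m * pi * (1027 / sqrt K)) * (?a (a' j) * ?b))"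
      using J a b by (intro bilinear_separated[where j = j, OF K LK]) (auto simp: a'_def split: if_splits)
    also have "\<dots> \<le> ennreal (c * (?a (a' j) * ?b))"
    proof (intro ennreal_leI mult_right_mono mult_nonneg_nonneg sum_nonneg)
      \<comment> \<open>\<open>L \<le> M^2\<close> and \<open>1 \<le> M^2\<close> give
        \<open>2 * (L + 1) \<le> 4 * M^2\<close>.\<close>
      have "sqrt (2 * (real L + 1)) \<le> 2 * M"
      proof (rule real_le_lsqrt)
        show "2 * (real L + 1) \<le> (2 * M)\<^sup>2" using L M2 by (simp add: power_mult_distrib)
      qed (use MN in auto)
      then have "sqrt (2 * (real L + 1)) ^ (CARD('n) - 1) \<le> (2 * M) ^ (CARD('n) - 1)" by (intro power_mono) auto
      moreover have "sqrt K = N / (4 * sqrt d)"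
        unfolding K_def using MN(2) d1 by (simp add: real_sqrt_divide real_sqrt_mult)
      then have "1027 / sqrt K = 1027 * (4 * sqrt d) / N" by simp
      ultimately have "sqrt (2 * (real L + 1)) ^ (CARD('n) - 1) * (real m * pi * (1027 / sqrt K))
          \<le> (2 * M) ^ (CARD('n) - 1) * (real m * pi * (1027 * (4 * sqrt d) / N))"
        using MN d1 by (intro mult_mono) auto
      also have "\<dots> = c" by (simp add: c_def power_mult_distrib)
      finally show "sqrt (2 * (real L + 1)) ^ (CARD('n) - 1) * (real m * pi * (1027 / sqrt K)) \<le> c" .
    qed auto
    finally show ?thesis .
  qed
  have "?I a \<le> (\<integral>\<^sup>+t\<in>{0..real m * pi}. (ennreal d * (\<Sum>j\<in>UNIV. \<integral>\<^sup>+x. ennreal ((cmod (evol B (a' j) t x * evol L b t x))\<^sup>2) \<partial>lborel)) \<partial>lborel)"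
  proof (intro nn_integral_mono mult_right_mono)
    fix t
    have [measurable]: "evol B (a' j) t \<in> borel_measurable borel" "evol L b t \<in> borel_measurable borel" for j
      by (intro L2_measurable evol_L2)+
    have "(cmod (evol B a t x * evol L b t x))\<^sup>2 \<le> d * (\<Sum>j\<in>UNIV. (cmod (evol B (a' j) t x * evol L b t x))\<^sup>2)" for x
      unfolding split sum_distrib_right d_def by (rule norm_sum_sq_le)
    then have "ennreal ((cmod (evol B a t x * evol L b t x))\<^sup>2) \<le> ennreal d * (\<Sum>j\<in>UNIV. ennreal ((cmod (evol B (a' j) t x * evol L b t x))\<^sup>2))" for x
      using d1 by (simp add: sum_ennreal ennreal_mult[symmetric] sum_nonneg ennreal_leI)
    then have "(\<integral>\<^sup>+x. ennreal ((cmod (evol B a t x * evol L b t x))\<^sup>2) \<partial>lborel)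
      \<le> (\<integral>\<^sup>+x. ennreal d * (\<Sum>j\<in>UNIV. ennreal ((cmod (evol B (a' j) t x * evol L b t x))\<^sup>2)) \<partial>lborel)"
      by (rule nn_integral_mono)
    also have "\<dots> = ennreal d * (\<Sum>j\<in>UNIV. \<integral>\<^sup>+x. ennreal ((cmod (evol B (a' j) t x * evol L b t x))\<^sup>2) \<partial>lborel)"
      by (subst nn_integral_cmult, measurable, subst nn_integral_sum, measurable)
    finally show "(\<integral>\<^sup>+x. ennreal ((cmod (evol B a t x * evol L b t x))\<^sup>2) \<partial>lborel)
      \<le> ennreal d * (\<Sum>j\<in>UNIV. \<integral>\<^sup>+x. ennreal ((cmod (evol B (a' j) t x * evol L b t x))\<^sup>2) \<partial>lborel)" .
  qed auto
  also have "\<dots> = ennreal d * (\<Sum>j\<in>UNIV. ?I (a' j))"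
  proof -
    note [measurable] = evol_product_measurable
    show ?thesis unfolding mult.assoc sum_distrib_right
      by (subst nn_integral_cmult, measurable, subst nn_integral_sum, measurable)
  qed
  also have "\<dots> \<le> ennreal d * (\<Sum>j\<in>UNIV. ennreal (c * (?a (a' j) * ?b)))"
    by (intro mult_left_mono sum_mono piece) auto
  also have "\<dots> = ennreal (d * (\<Sum>j\<in>UNIV. c * (?a (a' j) * ?b)))"
  proof -
    have "0 \<le> c * (?a (a' j) * ?b)" for j using c0 by (intro mult_nonneg_nonneg sum_nonneg) auto
    then have "(\<Sum>j\<in>UNIV. ennreal (c * (?a (a' j) * ?b))) = ennreal (\<Sum>j\<in>UNIV. c * (?a (a' j) * ?b))"
      by (intro sum_ennreal) auto
    then show ?thesis using d1 by (simp only: ennreal_mult'[of d] zero_le_one order_trans[OF zero_le_one])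
  qed
  also have "(\<Sum>j\<in>UNIV. c * (?a (a' j) * ?b)) = c * (?a a * ?b)"
  proof -
    have "(\<Sum>j\<in>UNIV. ?a (a' j)) = (\<Sum>\<alpha>\<in>box_le B. \<Sum>j\<in>UNIV. (cmod (a' j \<alpha>))\<^sup>2)" by (rule sum.swap)
    also have "\<dots> = ?a a"
    proof (intro sum.cong refl)
      fix \<alpha>
      have "(\<Sum>j\<in>UNIV. (cmod (a' j \<alpha>))\<^sup>2) = (\<Sum>j\<in>UNIV. if J \<alpha> = j then (cmod (a \<alpha>))\<^sup>2 else 0)"
        by (intro sum.cong refl) (simp add: a'_def)
      then show "(\<Sum>j\<in>UNIV. (cmod (a' j \<alpha>))\<^sup>2) = (cmod (a \<alpha>))\<^sup>2" by simp
    qed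
    finally show ?thesis by (simp only: sum_distrib_left[symmetric] sum_distrib_right[symmetric])
  qed
  finally show ?thesis unfolding c_def by (simp only: mult.assoc)
qed

text \<open>\<open>bilinear_comparable\<close> with totals of at most \<open>N^2\<close> gives a
  multiple of \<open>N^(d - 2) = N^(d - 1) / N\<close>. Since
  \<open>N \<le> sqrt (512 * d) * M\<close>, the numerator may be replaced by a multiple of
  \<open>M^(d - 1)\<close>.\<close>

lemma bilinear_no_gap:
  fixes a b :: "('n::finite \<Rightarrow> nat) \<Rightarrow> complex"
  defines "d \<equiv> real CARD('n)"
  assumes card: "CARD('n) \<ge> 2" and MN: "1 \<le> M" "M \<le> N" and gap: "N\<^sup>2 \<le> 512 * d * M\<^sup>2"
    and a: "\<And>\<alpha>. a \<alpha> \<noteq> 0 \<Longrightarrow> \<alpha> \<in> box_le B \<and> energy \<alpha> \<le> 2 * N\<^sup>2"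
    and b: "\<And>\<beta>. b \<beta> \<noteq> 0 \<Longrightarrow> \<beta> \<in> box_le L \<and> energy \<beta> \<le> 2 * M\<^sup>2"
  shows "(\<integral>\<^sup>+t\<in>{0..real m * pi}. (\<integral>\<^sup>+x. ennreal ((cmod (evol B a t x * evol L b t x))\<^sup>2) \<partial>lborel) \<partial>lborel)
      \<le> ennreal (real m * pi * (3 * (3 ^ (CARD('n) - 2) * sqrt (512 * d) ^ (CARD('n) - 1))) * (M ^ (CARD('n) - 1) / N)
          * ((\<Sum>\<alpha>\<in>box_le B. (cmod (a \<alpha>))\<^sup>2) * (\<Sum>\<beta>\<in>box_le L. (cmod (b \<beta>))\<^sup>2)))"
proof -
  have N0: "N > 0" and N1: "N\<^sup>2 \<ge> 1" using MN by auto
  have M2: "M\<^sup>2 \<le> N\<^sup>2" using MN by (intro power_mono) auto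
  have tot: "real (sum \<alpha> UNIV) \<le> N\<^sup>2" if "energy \<alpha> \<le> 2 * N\<^sup>2" for \<alpha> :: "'n \<Rightarrow> nat"
    using that by (simp add: energy_def)
  have "(\<integral>\<^sup>+t\<in>{0..real m * pi}. (\<integral>\<^sup>+x. ennreal ((cmod (evol B a t x * evol L b t x))\<^sup>2) \<partial>lborel) \<partial>lborel)
      \<le> ennreal (real m * pi * (3 * sqrt (2 * (2 * N\<^sup>2 + 1)) ^ (CARD('n) - 2))
          * ((\<Sum>\<alpha>\<in>box_le B. (cmod (a \<alpha>))\<^sup>2) * (\<Sum>\<beta>\<in>box_le L. (cmod (b \<beta>))\<^sup>2)))"
  proof (rule bilinear_comparable[OF card])
    show "\<alpha> \<in> box_le B \<and> real (sum \<alpha> UNIV) \<le> N\<^sup>2" if "a \<alpha> \<noteq> 0" for \<alpha> using a[OF that] tot by blast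
    show "\<beta> \<in> box_le L \<and> real (sum \<beta> UNIV) \<le> N\<^sup>2" if "b \<beta> \<noteq> 0" for \<beta>
      using b[OF that] tot[of \<beta>] M2 by linarith
  qed
  also have "\<dots> \<le> ennreal (real m * pi * (3 * (3 ^ (CARD('n) - 2) * sqrt (512 * d) ^ (CARD('n) - 1))) * (M ^ (CARD('n) - 1) / N)
          * ((\<Sum>\<alpha>\<in>box_le B. (cmod (a \<alpha>))\<^sup>2) * (\<Sum>\<beta>\<in>box_le L. (cmod (b \<beta>))\<^sup>2)))"
  proof (intro ennreal_leI mult_right_mono mult_nonneg_nonneg sum_nonneg)
    have "sqrt (2 * (2 * N\<^sup>2 + 1)) \<le> 3 * N"
    proof (rule real_le_lsqrt)
      show "2 * (2 * N\<^sup>2 + 1) \<le> (3 * N)\<^sup>2" using N1 by (simp add: power_mult_distrib)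
    qed (use N0 in auto)
    then have "sqrt (2 * (2 * N\<^sup>2 + 1)) ^ (CARD('n) - 2) \<le> (3 * N) ^ (CARD('n) - 2)" by (intro power_mono) auto
    also have "\<dots> = 3 ^ (CARD('n) - 2) * N ^ (CARD('n) - 2)" by (rule power_mult_distrib)
    also have "N ^ (CARD('n) - 2) = N ^ (CARD('n) - 1) / N"
    proof -
      have "CARD('n) - 1 = Suc (CARD('n) - 2)" using card by simp
      then show ?thesis using N0 by simp
    qed
    also have "N ^ (CARD('n) - 1) \<le> (sqrt (512 * d) * M) ^ (CARD('n) - 1)"
    proof (rule power_mono)
      have "sqrt (N\<^sup>2) \<le> sqrt (512 * d * M\<^sup>2)" using gap by (rule real_sqrt_le_mono)
      then show "N \<le> sqrt (512 * d) * M" using MN N0 by (simp add: real_sqrt_mult)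
    qed (use N0 in simp)
    then have "3 ^ (CARD('n) - 2) * (N ^ (CARD('n) - 1) / N) \<le> 3 ^ (CARD('n) - 2) * ((sqrt (512 * d) * M) ^ (CARD('n) - 1) / N)"
      using N0 by (intro mult_left_mono divide_right_mono) auto
    also have "\<dots> = 3 ^ (CARD('n) - 2) * sqrt (512 * d) ^ (CARD('n) - 1) * (M ^ (CARD('n) - 1) / N)"
      by (simp add: power_mult_distrib)
    finally have "real m * pi * (3 * sqrt (2 * (2 * N\<^sup>2 + 1)) ^ (CARD('n) - 2))
      \<le> real m * pi * (3 * (3 ^ (CARD('n) - 2) * sqrt (512 * d) ^ (CARD('n) - 1) * (M ^ (CARD('n) - 1) / N)))"
      by (intro mult_left_mono) auto
    then show "real m * pi * (3 * sqrt (2 * (2 * N\<^sup>2 + 1)) ^ (CARD('n) - 2))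
      \<le> real m * pi * (3 * (3 ^ (CARD('n) - 2) * sqrt (512 * d) ^ (CARD('n) - 1))) * (M ^ (CARD('n) - 1) / N)"
      by (simp only: mult.assoc)
  qed auto
  finally show ?thesis .
qed

text \<open>The regimes meet at \<open>N^2 = 512 * d * M^2\<close>. The data enter only through
  boxes and energy bounds on their coefficients, so the constant is fixed before all of
  them.\<close>

theorem bilinear_finite:
  assumes card: "CARD('n::finite) \<ge> 2" and T: "T > 0"
  shows "\<exists>C>0. \<forall>M N B L (a :: ('n \<Rightarrow> nat) \<Rightarrow> complex) b. 1 \<le> M \<longrightarrow> M \<le> N \<longrightarrow> real L \<le> M\<^sup>2 \<longrightarrow>
    (\<forall>\<alpha>. a \<alpha> \<noteq> 0 \<longrightarrow> \<alpha> \<in> box_le B \<and> N\<^sup>2 / 4 \<le> energy \<alpha> \<and> energy \<alpha> \<le> 2 * N\<^sup>2) \<longrightarrow>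
    (\<forall>\<beta>. b \<beta> \<noteq> 0 \<longrightarrow> \<beta> \<in> box_le L \<and> energy \<beta> \<le> 2 * M\<^sup>2) \<longrightarrow>
    (\<integral>\<^sup>+t\<in>{0..T}. (\<integral>\<^sup>+x. ennreal ((cmod (evol B a t x * evol L b t x))\<^sup>2) \<partial>lborel) \<partial>lborel)
      \<le> ennreal (C * (M ^ (CARD('n) - 1) / N) * ((\<Sum>\<alpha>\<in>box_le B. (cmod (a \<alpha>))\<^sup>2) * (\<Sum>\<beta>\<in>box_le L. (cmod (b \<beta>))\<^sup>2)))"
proof -
  define d where "d = real CARD('n)"
  \<comment> \<open>The number of periods of length \<open>pi\<close> that cover
    \<open>[0, T]\<close>; this is where the constant depends on \<open>T\<close>.\<close>
  define m where "m = nat \<lceil>T / pi\<rceil>"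
  have Tm: "T \<le> real m * pi"
  proof -
    have "T / pi \<le> real m" unfolding m_def by linarith
    then show ?thesis by (simp add: divide_le_eq)
  qed
  have d1: "d \<ge> 1" unfolding d_def by (simp add: Suc_le_eq)
  define C1 where "C1 = d * (2 ^ (CARD('n) - 1) * (real m * pi * (1027 * (4 * sqrt d))))"
  define C2 where "C2 = real m * pi * (3 * (3 ^ (CARD('n) - 2) * sqrt (512 * d) ^ (CARD('n) - 1)))"
  have C: "C1 \<ge> 0" "C2 \<ge> 0" using d1 by (auto simp: C1_def C2_def)
  show ?thesis
  proof (intro exI[of _ "C1 + C2 + 1"] conjI allI impI)
    show "C1 + C2 + 1 > 0" using C by linarith
  next
    fix M N :: real and B L and a b :: "('n \<Rightarrow> nat) \<Rightarrow> complex"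
    assume MN: "1 \<le> M" "M \<le> N" and L: "real L \<le> M\<^sup>2"
      and a: "\<forall>\<alpha>. a \<alpha> \<noteq> 0 \<longrightarrow> \<alpha> \<in> box_le B \<and> N\<^sup>2 / 4 \<le> energy \<alpha> \<and> energy \<alpha> \<le> 2 * N\<^sup>2"
      and b: "\<forall>\<beta>. b \<beta> \<noteq> 0 \<longrightarrow> \<beta> \<in> box_le L \<and> energy \<beta> \<le> 2 * M\<^sup>2"
    let ?Q = "(\<Sum>\<alpha>\<in>box_le B. (cmod (a \<alpha>))\<^sup>2) * (\<Sum>\<beta>\<in>box_le L. (cmod (b \<beta>))\<^sup>2)"
    have Q: "?Q \<ge> 0" by (intro mult_nonneg_nonneg sum_nonneg) auto
    have R: "M ^ (CARD('n) - 1) / N \<ge> 0" using MN by simp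
    have "(\<integral>\<^sup>+t\<in>{0..T}. (\<integral>\<^sup>+x. ennreal ((cmod (evol B a t x * evol L b t x))\<^sup>2) \<partial>lborel) \<partial>lborel)
      \<le> (\<integral>\<^sup>+t\<in>{0..real m * pi}. (\<integral>\<^sup>+x. ennreal ((cmod (evol B a t x * evol L b t x))\<^sup>2) \<partial>lborel) \<partial>lborel)"
      using Tm by (intro nn_integral_mono mult_left_mono) (auto simp: indicator_def)
    also have "\<dots> \<le> ennreal ((C1 + C2 + 1) * (M ^ (CARD('n) - 1) / N) * ?Q)"
    proof (cases "512 * d * M\<^sup>2 \<le> N\<^sup>2")
      case True
      have "(\<integral>\<^sup>+t\<in>{0..real m * pi}. (\<integral>\<^sup>+x. ennreal ((cmod (evol B a t x * evol L b t x))\<^sup>2) \<partial>lborel) \<partial>lborel)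
        \<le> ennreal (C1 * (M ^ (CARD('n) - 1) / N) * ?Q)"
        unfolding C1_def d_def using MN True a b L by (intro bilinear_gap) (auto simp: d_def)
      also have "\<dots> \<le> ennreal ((C1 + C2 + 1) * (M ^ (CARD('n) - 1) / N) * ?Q)"
        using C Q R by (intro ennreal_leI mult_right_mono) auto
      finally show ?thesis .
    next
      case False
      have "(\<integral>\<^sup>+t\<in>{0..real m * pi}. (\<integral>\<^sup>+x. ennreal ((cmod (evol B a t x * evol L b t x))\<^sup>2) \<partial>lborel) \<partial>lborel)
        \<le> ennreal (C2 * (M ^ (CARD('n) - 1) / N) * ?Q)"
        unfolding C2_def d_def using MN False a b by (intro bilinear_no_gap[OF card]) (auto simp: d_def)
      also have "\<dots> \<le> ennreal ((C1 + C2 + 1) * (M ^ (CARD('n) - 1) / N) * ?Q)"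
        using C Q R by (intro ennreal_leI mult_right_mono) auto
      finally show ?thesis .
    qed
    finally show "(\<integral>\<^sup>+t\<in>{0..T}. (\<integral>\<^sup>+x. ennreal ((cmod (evol B a t x * evol L b t x))\<^sup>2) \<partial>lborel) \<partial>lborel)
      \<le> ennreal ((C1 + C2 + 1) * (M ^ (CARD('n) - 1) / N) * ?Q)" .
  qed
qed

section \<open>The graph of the harmonic oscillator\<close>

text \<open>Finite Hermite sums, presented inductively so that closure under derivatives and under
  multiplication by coordinates is a plain induction. They supply the Schwartz functions that
  approximate an element of the graph.\<close>

inductive_set hspan :: "(real ^ 'n::finite \<Rightarrow> complex) set" where
  zero: "(\<lambda>x. 0) \<in> hspan"
| add: "f \<in> hspan \<Longrightarrow> (\<lambda>x. c * of_real (hermite \<alpha> x) + f x) \<in> hspan"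

lemma hspan_hermite: "(\<lambda>x. c * of_real (hermite \<alpha> x)) \<in> hspan"
  using hspan.add[OF hspan.zero, of c \<alpha>] by simp

lemma hspan_add: "f \<in> hspan \<Longrightarrow> g \<in> hspan \<Longrightarrow> (\<lambda>x. f x + g x) \<in> hspan"
proof (induction rule: hspan.induct)
  case (add f c \<alpha>)
  then show ?case using hspan.add[of "\<lambda>x. f x + g x" c \<alpha>] by (simp add: add.assoc)
qed simp

lemma hspan_scale: "f \<in> hspan \<Longrightarrow> (\<lambda>x. k * f x) \<in> hspan"
proof (induction rule: hspan.induct)
  case (add f c \<alpha>)
  then show ?case using hspan.add[of "\<lambda>x. k * f x" "k * c" \<alpha>] by (simp add: distrib_left mult.assoc)
qed (simp add: hspan.zero)

lemma hspan_sum: "(\<And>i. i \<in> S \<Longrightarrow> f i \<in> hspan) \<Longrightarrow> (\<lambda>x. \<Sum>i\<in>S. f i x) \<in> hspan"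
  by (induction S rule: infinite_finite_induct) (auto intro: hspan_add hspan.zero)

definition hermite_dx :: "'n \<Rightarrow> ('n::finite \<Rightarrow> nat) \<Rightarrow> real ^ 'n \<Rightarrow> real" where
  "hermite_dx k \<alpha> x = (sqrt (\<alpha> k) * hermite (\<alpha>(k := \<alpha> k - 1)) x - sqrt (real (\<alpha> k) + 1) * hermite (\<alpha>(k := Suc (\<alpha> k))) x) / sqrt 2"

lemma hermite_eq_slice: "hermite \<alpha> x = hermf (\<alpha> k) (x $ k) * hslice k \<alpha> x"
  using hermite_upd[of \<alpha> k "\<alpha> k" x] by simp

lemma hermite_has_derivative:
  "((\<lambda>x. complex_of_real (hermite \<alpha> x)) has_derivative (\<lambda>y. \<Sum>k\<in>UNIV. of_real (y $ k) * of_real (hermite_dx k \<alpha> x))) (at x)"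
proof -
  let ?D = "\<lambda>k. (sqrt (\<alpha> k) * hermf (\<alpha> k - 1) (x $ k) - sqrt (real (\<alpha> k) + 1) * hermf (Suc (\<alpha> k)) (x $ k)) / sqrt 2"
  have comp: "((\<lambda>x::real^'a. hermf (\<alpha> k) (x $ k)) has_derivative (\<lambda>y. ?D k * (y $ k))) (at x)" for k
  proof -
    have "((\<lambda>x::real^'a. x $ k) has_derivative (\<lambda>y. y $ k)) (at x)"
      by (rule bounded_linear_imp_has_derivative[OF bounded_linear_vec_nth])
    from has_derivative_compose[OF this hermf_deriv[of "\<alpha> k" "x $ k", unfolded has_field_derivative_def]]
    show ?thesis .
  qed
  have "((\<lambda>x. hermite \<alpha> x) has_derivative (\<lambda>y. \<Sum>k\<in>UNIV. ?D k * (y $ k) * hslice k \<alpha> x)) (at x)"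
    unfolding hermite_def hslice_def by (rule has_derivative_prod) (rule comp)
  also have "(\<lambda>y. \<Sum>k\<in>UNIV. ?D k * (y $ k) * hslice k \<alpha> x) = (\<lambda>y. \<Sum>k\<in>UNIV. y $ k * hermite_dx k \<alpha> x)"
    unfolding hermite_dx_def hermite_upd by (simp add: fun_eq_iff algebra_simps)
  finally have "((\<lambda>x. hermite \<alpha> x) has_derivative (\<lambda>y. \<Sum>k\<in>UNIV. y $ k * hermite_dx k \<alpha> x)) (at x)" .
  from bounded_linear.has_derivative[OF bounded_linear_of_real this]
  show ?thesis by simp
qed

lemma has_derivative_partial:
  assumes "(f has_derivative f') (at x)" shows "partial_deriv b f x = f' b"
  using frechet_derivative_at[OF assms] by (simp add: partial_deriv_def)

lemma partial_deriv_add: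
  assumes "f differentiable (at x)" "g differentiable (at x)"
  shows "partial_deriv b (\<lambda>x. f x + g x) x = partial_deriv b f x + partial_deriv b g x"
proof -
  obtain f' g' where "(f has_derivative f') (at x)" "(g has_derivative g') (at x)"
    using assms by (auto simp: differentiable_def)
  then show ?thesis
    using has_derivative_partial[OF has_derivative_add] has_derivative_partial by metis
qed

lemma partial_deriv_scale:
  assumes "f differentiable (at x)"
  shows "partial_deriv b (\<lambda>x. c * f x) x = c * partial_deriv b f x"
proof -
  obtain f' where f: "(f has_derivative f') (at x)" using assms by (auto simp: differentiable_def)
  show ?thesis
    using has_derivative_partial[OF has_derivative_mult_right[OF f]] has_derivative_partial[OF f] by metis
qed

lemma hermite_differentiable: "(\<lambda>x. complex_of_real (hermite \<alpha> x)) differentiable (at x)"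
  using hermite_has_derivative differentiable_def by blast

lemma hermite_partial:
  "partial_deriv (axis k 1) (\<lambda>x. complex_of_real (hermite \<alpha> x)) = (\<lambda>x. complex_of_real (hermite_dx k \<alpha> x))"
proof
  fix x
  have "partial_deriv (axis k 1) (\<lambda>x. complex_of_real (hermite \<alpha> x)) x = (\<Sum>l\<in>UNIV. of_real (axis k 1 $ l) * of_real (hermite_dx l \<alpha> x))"
    by (rule has_derivative_partial[OF hermite_has_derivative])
  also have "\<dots> = (\<Sum>l\<in>UNIV. if l = k then of_real (hermite_dx k \<alpha> x) else 0)"
    by (intro sum.cong refl) (auto simp: axis_def)
  finally show "partial_deriv (axis k 1) (\<lambda>x. complex_of_real (hermite \<alpha> x)) x = complex_of_real (hermite_dx k \<alpha> x)" by simp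
qed

lemma hermite_dx_hspan: "(\<lambda>x. c * complex_of_real (hermite_dx k \<alpha> x)) \<in> hspan"
proof -
  have "c * complex_of_real (hermite_dx k \<alpha> x) = (c * of_real (sqrt (\<alpha> k) / sqrt 2)) * of_real (hermite (\<alpha>(k := \<alpha> k - 1)) x)
      + (- c * of_real (sqrt (real (\<alpha> k) + 1) / sqrt 2)) * of_real (hermite (\<alpha>(k := Suc (\<alpha> k))) x)" for x
    unfolding hermite_dx_def by (simp add: diff_divide_distrib right_diff_distrib mult.assoc)
  then show ?thesis by (simp only: hspan_add[OF hspan_hermite hspan_hermite])
qed

lemma hspan_differentiable: "f \<in> hspan \<Longrightarrow> f differentiable (at x)"
  by (induction rule: hspan.induct)
     (auto intro!: differentiable_add differentiable_mult hermite_differentiable)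

lemma partial_deriv_hspan: "f \<in> hspan \<Longrightarrow> b \<in> Basis \<Longrightarrow> partial_deriv b f \<in> hspan"
proof (induction rule: hspan.induct)
  case zero
  have "partial_deriv b (\<lambda>x::real^'a. 0::complex) = (\<lambda>x. 0)"
    using has_derivative_partial[OF has_derivative_const] by fastforce
  then show ?case using hspan.zero by simp
next
  case (add f c \<alpha>)
  from add.prems obtain k where b: "b = axis k 1" by (auto simp: Basis_vec_def)
  have d: "(\<lambda>x. c * complex_of_real (hermite \<alpha> x)) differentiable (at x)" for x
    by (intro hspan_differentiable hspan_hermite)
  have "partial_deriv b (\<lambda>x. c * of_real (hermite \<alpha> x) + f x) = (\<lambda>x. c * of_real (hermite_dx k \<alpha> x) + partial_deriv b f x)"
    unfolding b by (simp add: fun_eq_iff partial_deriv_add[OF d hspan_differentiable[OF add.hyps]]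
        partial_deriv_scale[OF hermite_differentiable] hermite_partial)
  then show ?case using hspan_add[OF hermite_dx_hspan add.IH[OF add.prems]] by simp
qed

lemma hermite_rec: "x $ k * hermite \<alpha> x
    = (sqrt (real (\<alpha> k) + 1) * hermite (\<alpha>(k := Suc (\<alpha> k))) x + sqrt (\<alpha> k) * hermite (\<alpha>(k := \<alpha> k - 1)) x) / sqrt 2"
proof -
  have "x $ k * hermite \<alpha> x = (x $ k * hermf (\<alpha> k) (x $ k)) * hslice k \<alpha> x"
    by (simp add: hermite_eq_slice[of \<alpha> x k])
  then show ?thesis unfolding hermf_rec hermite_upd by (simp add: field_simps)
qed

lemma coordinate_hspan: "f \<in> hspan \<Longrightarrow> (\<lambda>x. of_real (x $ k) * f x) \<in> hspan"
proof (induction rule: hspan.induct)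
  case (add f c \<alpha>)
  have "of_real (x $ k) * (c * complex_of_real (hermite \<alpha> x)) =
      (c * of_real (sqrt (real (\<alpha> k) + 1) / sqrt 2)) * of_real (hermite (\<alpha>(k := Suc (\<alpha> k))) x)
      + (c * of_real (sqrt (\<alpha> k) / sqrt 2)) * of_real (hermite (\<alpha>(k := \<alpha> k - 1)) x)" for x
  proof -
    have "of_real (x $ k) * (c * complex_of_real (hermite \<alpha> x)) = c * complex_of_real (x $ k * hermite \<alpha> x)" by simp
    then show ?thesis unfolding hermite_rec by (simp add: add_divide_distrib distrib_left mult.assoc)
  qed
  then have "(\<lambda>x. of_real (x $ k) * (c * complex_of_real (hermite \<alpha> x))) \<in> hspan"
    by (simp only: hspan_add[OF hspan_hermite hspan_hermite])
  from hspan_add[OF this add.IH] show ?case by (simp add: distrib_left)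
qed (simp add: hspan.zero)

lemma norm_vec_sq: "(norm x)\<^sup>2 = (\<Sum>k\<in>UNIV. (x $ k)\<^sup>2)" for x :: "real ^ 'n::finite"
  by (simp add: norm_vec_def L2_set_def sum_nonneg)

lemma norm_sq_hspan:
  fixes f :: "real ^ 'n::finite \<Rightarrow> complex"
  assumes "f \<in> hspan" shows "(\<lambda>x. of_real ((norm x)\<^sup>2) * f x) \<in> hspan"
proof -
  have "of_real ((norm x)\<^sup>2) * f x = (\<Sum>k\<in>UNIV. of_real (x $ k) * (of_real (x $ k) * f x))" for x
    unfolding norm_vec_sq of_real_sum sum_distrib_right by (simp add: power2_eq_square mult.assoc)
  then show ?thesis by (simp only: hspan_sum coordinate_hspan assms)
qed

text \<open>A crude consequence of keeping one term in \<open>hermf_sum_sq_le\<close>; only its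
  uniformity in \<open>x\<close> matters.\<close>

lemma hermf_bounded: "\<bar>hermf k x\<bar> \<le> 2 * real k + 2"
proof -
  have "(hermf k x)\<^sup>2 \<le> (\<Sum>j\<le>k. (hermf j x)\<^sup>2)" by (rule member_le_sum) auto
  also have "\<dots> \<le> sqrt (2 * (real k + 1))" by (rule hermf_sum_sq_le)
  also have "\<dots> \<le> (2 * real k + 2)\<^sup>2"
  proof (rule real_le_lsqrt)
    have "1 ^ 3 \<le> (2 * real k + 2) ^ 3" by (intro power_mono) auto
    then have "(2 * real k + 2) * 1 \<le> (2 * real k + 2) * (2 * real k + 2) ^ 3" by (intro mult_left_mono) auto
    also have "\<dots> = ((2 * real k + 2)\<^sup>2)\<^sup>2" by (simp only: power2_eq_square power3_eq_cube mult.assoc)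
    finally show "2 * (real k + 1) \<le> ((2 * real k + 2)\<^sup>2)\<^sup>2" by simp
  qed simp
  finally have "\<bar>hermf k x\<bar>\<^sup>2 \<le> (2 * real k + 2)\<^sup>2" by simp
  then show ?thesis by (rule power2_le_imp_le) simp
qed

lemma hspan_bounded: "f \<in> hspan \<Longrightarrow> \<exists>K. \<forall>x. cmod (f x) \<le> K"
proof (induction rule: hspan.induct)
  case (add f c \<alpha>)
  then obtain K where K: "\<And>x. cmod (f x) \<le> K" by blast
  have "\<bar>hermite \<alpha> x\<bar> \<le> (\<Prod>i\<in>UNIV. 2 * real (\<alpha> i) + 2)" for x
    unfolding hermite_def abs_prod by (intro prod_mono) (auto simp: hermf_bounded)
  then have "cmod (c * of_real (hermite \<alpha> x) + f x) \<le> cmod c * (\<Prod>i\<in>UNIV. 2 * real (\<alpha> i) + 2) + K" for x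
    by (intro order_trans[OF norm_triangle_ineq] add_mono K) (auto simp: norm_mult intro!: mult_left_mono)
  then show ?case by blast
qed auto

text \<open>Multiplication by \<open>(1 + |x|^2)^k\<close> does not leave \<open>hspan\<close>, and
  members of \<open>hspan\<close> are bounded.\<close>

lemma hspan_rapid:
  assumes "f \<in> hspan" shows "bounded (range (\<lambda>x. norm x ^ k *\<^sub>R f x))"
proof -
  have pow: "(\<lambda>x. of_real ((1 + (norm x)\<^sup>2) ^ j) * f x) \<in> hspan" for j
  proof (induction j)
    case (Suc j)
    from hspan_add[OF Suc norm_sq_hspan[OF Suc]] show ?case by (simp add: algebra_simps)
  qed (use assms in simp)
  obtain K where K: "\<And>x. cmod (of_real ((1 + (norm x)\<^sup>2) ^ k) * f x) \<le> K" using hspan_bounded[OF pow] by blast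
  have "norm (norm x ^ k *\<^sub>R f x) \<le> K" for x
  proof -
    have "norm x \<le> 1 + (norm x)\<^sup>2"
      using zero_le_power2[of "norm x - 1"] by (simp add: power2_diff) (smt (verit) zero_le_power2)
    then have "norm x ^ k \<le> (1 + (norm x)\<^sup>2) ^ k" by (intro power_mono) auto
    then have "norm (norm x ^ k *\<^sub>R f x) \<le> (1 + (norm x)\<^sup>2) ^ k * norm (f x)" by (simp add: mult_right_mono)
    also have "\<dots> = cmod (of_real ((1 + (norm x)\<^sup>2) ^ k) * f x)" unfolding norm_mult norm_of_real by simp
    finally show ?thesis using K[of x] by linarith
  qed
  then show ?thesis by (intro boundedI) auto
qed

lemma hspan_schwartz:
  assumes "f \<in> hspan" shows "schwartz f"
proof -
  have "set bs \<subseteq> Basis \<Longrightarrow> foldr partial_deriv bs f \<in> hspan" for bs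
    by (induction bs) (auto intro: assms partial_deriv_hspan)
  then show ?thesis unfolding schwartz_def using hspan_differentiable hspan_rapid by blast
qed

lemma harmonic_expression_cart:
  fixes f :: "real ^ 'n::finite \<Rightarrow> complex"
  shows
  "harmonic_expression f x = - (\<Sum>k\<in>UNIV. partial_deriv (axis k 1) (partial_deriv (axis k 1) f) x) + of_real ((norm x)\<^sup>2) * f x"
proof -
  have "(\<Sum>b\<in>Basis. partial_deriv b (partial_deriv b f) x) = (\<Sum>k\<in>UNIV. partial_deriv (axis k 1) (partial_deriv (axis k 1) f) x)"
    by (rule sum.reindex_bij_betw[OF bij_betw_axis, symmetric])
  then show ?thesis by (simp add: harmonic_expression_def scaleR_conv_of_real)
qed

text \<open>One factor \<open>x\<close> and one derivative are expanded by the ladder relations.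
  What then acts on the neighbours is \<open>x + d/dx\<close> on the index \<open>a + 1\<close>
  (\<open>xQ\<close>) and \<open>x - d/dx\<close> on the index \<open>a - 1\<close>
  (\<open>xP\<close>); both lead back to the index \<open>a\<close>, with the weights
  \<open>a + 1\<close> and \<open>a\<close>.\<close>

lemma hermite_coordinate_oscillator:
  "- partial_deriv (axis k 1) (partial_deriv (axis k 1) (\<lambda>x. complex_of_real (hermite \<alpha> x))) x
    + of_real ((x $ k)\<^sup>2) * of_real (hermite \<alpha> x) = of_real (2 * real (\<alpha> k) + 1) * of_real (hermite \<alpha> x)"
proof -
  define a where "a = \<alpha> k"
  let ?h = "\<lambda>j. hermite (\<alpha>(k := j)) x"
  have s2: "sqrt 2 * (sqrt 2 * y) = 2 * y" for y :: real by (simp add: mult.assoc[symmetric])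
  have dd: "partial_deriv (axis k 1) (\<lambda>x. complex_of_real (hermite_dx k \<alpha> x)) x
    = of_real ((sqrt a * hermite_dx k (\<alpha>(k := a - 1)) x - sqrt (real a + 1) * hermite_dx k (\<alpha>(k := Suc a)) x) / sqrt 2)"
  proof -
    have eq: "(\<lambda>x. complex_of_real (hermite_dx k \<alpha> x)) = (\<lambda>x. of_real (sqrt a / sqrt 2) * of_real (hermite (\<alpha>(k := a - 1)) x)
      + of_real (- sqrt (real a + 1) / sqrt 2) * of_real (hermite (\<alpha>(k := Suc a)) x))"
      by (simp add: fun_eq_iff hermite_dx_def a_def diff_divide_distrib)
    have pd: "partial_deriv (axis k 1) (\<lambda>x. c * complex_of_real (hermite \<beta> x) + c' * complex_of_real (hermite \<gamma> x)) x
      = c * of_real (hermite_dx k \<beta> x) + c' * of_real (hermite_dx k \<gamma> x)" for c c' \<beta> \<gamma>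
      by (simp add: partial_deriv_add partial_deriv_scale hspan_differentiable hspan_hermite hermite_differentiable hermite_partial)
    show ?thesis unfolding eq pd by (simp add: diff_divide_distrib)
  qed
  have real: "- ((sqrt a * hermite_dx k (\<alpha>(k := a - 1)) x - sqrt (real a + 1) * hermite_dx k (\<alpha>(k := Suc a)) x) / sqrt 2)
      + (x $ k)\<^sup>2 * hermite \<alpha> x = (2 * real a + 1) * hermite \<alpha> x"
  proof -
    define P where "P = hermite_dx k (\<alpha>(k := a - 1)) x"
    define Q where "Q = hermite_dx k (\<alpha>(k := Suc a)) x"
    have id: "?h a = hermite \<alpha> x" by (simp add: a_def)
    have x1: "x $ k * hermite \<alpha> x = (sqrt (real a + 1) * ?h (Suc a) + sqrt a * ?h (a - 1)) / sqrt 2"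
      using hermite_rec[of x k \<alpha>] by (simp add: a_def)
    have xQ: "x $ k * ?h (Suc a) + Q = sqrt 2 * sqrt (real a + 1) * hermite \<alpha> x"
      using hermite_rec[of x k "\<alpha>(k := Suc a)"] unfolding Q_def hermite_dx_def id[symmetric]
      by (simp add: field_simps s2)
    have xP: "sqrt a * (x $ k * ?h (a - 1) - P) = sqrt 2 * real a * hermite \<alpha> x"
    proof (cases a)
      case (Suc b)
      have "x $ k * ?h b - P = sqrt 2 * sqrt (real b + 1) * hermite \<alpha> x"
        using hermite_rec[of x k "\<alpha>(k := b)"] Suc unfolding P_def hermite_dx_def id[symmetric]
        by (simp add: field_simps s2)
      then have "sqrt a * (x $ k * ?h (a - 1) - P) = sqrt a * (sqrt 2 * sqrt a * hermite \<alpha> x)"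
        using Suc by (simp add: add.commute)
      also have "\<dots> = sqrt 2 * (sqrt a * sqrt a) * hermite \<alpha> x" by simp
      finally show ?thesis by simp
    qed simp
    have "(x $ k)\<^sup>2 * hermite \<alpha> x = x $ k * (x $ k * hermite \<alpha> x)" by (simp add: power2_eq_square)
    also have "\<dots> = (sqrt (real a + 1) * (x $ k * ?h (Suc a)) + sqrt a * (x $ k * ?h (a - 1))) / sqrt 2"
      unfolding x1 by (simp add: algebra_simps)
    finally have "- ((sqrt a * P - sqrt (real a + 1) * Q) / sqrt 2) + (x $ k)\<^sup>2 * hermite \<alpha> x
      = (sqrt (real a + 1) * (x $ k * ?h (Suc a) + Q) + sqrt a * (x $ k * ?h (a - 1) - P)) / sqrt 2"
      by (simp add: diff_divide_distrib add_divide_distrib distrib_left right_diff_distrib)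
    also have "\<dots> = (sqrt (real a + 1) * (sqrt 2 * sqrt (real a + 1) * hermite \<alpha> x) + sqrt 2 * real a * hermite \<alpha> x) / sqrt 2"
      unfolding xQ xP ..
    also have "\<dots> = (sqrt (real a + 1) * sqrt (real a + 1)) * hermite \<alpha> x + real a * hermite \<alpha> x"
      by (simp add: add_divide_distrib)
    finally show ?thesis unfolding P_def Q_def by (simp add: algebra_simps)
  qed
  show ?thesis
    unfolding hermite_partial dd using arg_cong[OF real, of complex_of_real] by (simp add: a_def)
qed

lemma harmonic_hermite:
  "harmonic_expression (\<lambda>x. complex_of_real (hermite \<alpha> x)) x = of_real (energy \<alpha>) * of_real (hermite \<alpha> x)"
proof -
  let ?P = "\<lambda>k. partial_deriv (axis k 1) (partial_deriv (axis k 1) (\<lambda>x. complex_of_real (hermite \<alpha> x))) x"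
  have "harmonic_expression (\<lambda>x. complex_of_real (hermite \<alpha> x)) x = (\<Sum>k\<in>UNIV. - ?P k + of_real ((x $ k)\<^sup>2) * of_real (hermite \<alpha> x))"
    unfolding harmonic_expression_cart norm_vec_sq of_real_sum sum_distrib_right by (simp only: sum.distrib sum_negf)
  also have "\<dots> = (\<Sum>k\<in>UNIV. of_real (2 * real (\<alpha> k) + 1) * of_real (hermite \<alpha> x))"
    by (simp only: hermite_coordinate_oscillator)
  also have "\<dots> = of_real (\<Sum>k\<in>UNIV. 2 * real (\<alpha> k) + 1) * of_real (hermite \<alpha> x)"
    by (simp only: of_real_sum sum_distrib_right)
  also have "(\<Sum>k\<in>UNIV. 2 * real (\<alpha> k) + 1) = energy \<alpha>"
    by (simp add: energy_def sum.distrib sum_distrib_left)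
  finally show ?thesis .
qed

lemma harmonic_hspan_sum:
  assumes "finite S"
  shows "harmonic_expression (\<lambda>x. \<Sum>\<alpha>\<in>S. c \<alpha> * of_real (hermite \<alpha> x)) x = (\<Sum>\<alpha>\<in>S. c \<alpha> * of_real (energy \<alpha>) * of_real (hermite \<alpha> x))"
proof -
  have add: "harmonic_expression (\<lambda>x. k * of_real (hermite \<alpha> x) + f x) x = k * (of_real (energy \<alpha>) * of_real (hermite \<alpha> x)) + harmonic_expression f x"
    if f: "f \<in> hspan" for k f \<alpha>
  proof -
    let ?h = "\<lambda>x. complex_of_real (hermite \<alpha> x)"
    have h: "?h \<in> hspan" using hspan_hermite[of 1 \<alpha>] by simp
    have ax: "axis j 1 \<in> (Basis :: (real^'a) set)" for j by (simp add: axis_in_Basis_iff)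
    have 1: "partial_deriv (axis j 1) (\<lambda>x. k * ?h x + f x) = (\<lambda>x. k * partial_deriv (axis j 1) ?h x + partial_deriv (axis j 1) f x)" for j
      using f h by (simp add: fun_eq_iff partial_deriv_add partial_deriv_scale hspan_differentiable hspan_scale)
    have 2: "partial_deriv (axis j 1) (partial_deriv (axis j 1) (\<lambda>x. k * ?h x + f x)) x
      = k * partial_deriv (axis j 1) (partial_deriv (axis j 1) ?h) x + partial_deriv (axis j 1) (partial_deriv (axis j 1) f) x" for j
      unfolding 1 using f h by (simp add: partial_deriv_add partial_deriv_scale hspan_differentiable hspan_scale partial_deriv_hspan ax)
    have "harmonic_expression (\<lambda>x. k * ?h x + f x) x = k * harmonic_expression ?h x + harmonic_expression f x"
      unfolding harmonic_expression_cart 2 by (simp add: sum.distrib sum_distrib_left algebra_simps)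
    then show ?thesis by (simp only: harmonic_hermite)
  qed
  show ?thesis using assms
  proof (induction S rule: finite_induct)
    case empty
    have "partial_deriv b (\<lambda>x::real^'a. 0::complex) = (\<lambda>x. 0)" for b
      using has_derivative_partial[OF has_derivative_const] by fastforce
    then show ?case by (simp add: harmonic_expression_def)
  next
    case (insert \<alpha> S)
    have "(\<lambda>x. \<Sum>\<alpha>\<in>S. c \<alpha> * of_real (hermite \<alpha> x)) \<in> hspan" by (intro hspan_sum hspan_hermite)
    from add[OF this, of "c \<alpha>" \<alpha>] show ?case using insert by (simp add: mult.assoc)
  qed
qed

section \<open>Integration by parts and the graph of H in Hermite coefficients\<close>

lemma integrable_lborel_translate:
  fixes G :: "'a::euclidean_space \<Rightarrow> 'b::{banach, second_countable_topology}"
  assumes "integrable lborel G"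
  shows "integrable lborel (\<lambda>x. G (c + x))" "(\<integral>x. G (c + x) \<partial>lborel) = (\<integral>x. G x \<partial>lborel)"
proof -
  have d: "distr lborel borel ((+) c) = (lborel :: 'a measure)" by (rule lborel_distr_plus)
  have m: "(+) c \<in> measurable lborel borel" by measurable
  have Gm: "G \<in> borel_measurable borel" using borel_measurable_integrable[OF assms] by simp
  show "integrable lborel (\<lambda>x. G (c + x))" using assms integrable_distr_eq[OF m Gm] unfolding d by simp
  show "(\<integral>x. G (c + x) \<partial>lborel) = (\<integral>x. G x \<partial>lborel)" using integral_distr[OF m Gm] unfolding d by simp
qed

text \<open>
  Averaging the derivative over the translates by \<open>t *\<^sub>R b\<close> with \<open>0 \<le> t \<le> 1\<close> turns it into the
  difference of two translates, whose integrals agree.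
\<close>

lemma integral_partial_deriv_zero:
  fixes F :: "'a::euclidean_space \<Rightarrow> complex"
  assumes F: "\<And>x. F differentiable (at x)" and Fi: "integrable lborel F"
    and G: "continuous_on UNIV (partial_deriv b F)" "integrable lborel (partial_deriv b F)"
  shows "(\<integral>x. partial_deriv b F x \<partial>lborel) = 0"
proof -
  let ?G = "partial_deriv b F"
  define f where "f t x = indicator {0..1} t *\<^sub>R ?G (t *\<^sub>R b + x)" for t :: real and x :: 'a
  have Gm [measurable]: "?G \<in> borel_measurable borel" using borel_measurable_integrable[OF G(2)] by simp
  have fm: "case_prod f \<in> borel_measurable (lborel \<Otimes>\<^sub>M lborel)"
    unfolding f_def case_prod_unfold by measurable
  have tr: "integrable lborel (\<lambda>x. ?G (t *\<^sub>R b + x))" "(\<integral>x. ?G (t *\<^sub>R b + x) \<partial>lborel) = (\<integral>x. ?G x \<partial>lborel)" for t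
    by (rule integrable_lborel_translate[OF G(2)])+
  have trn: "(\<integral>x. norm (?G (t *\<^sub>R b + x)) \<partial>lborel) = (\<integral>x. norm (?G x) \<partial>lborel)" for t
    by (rule integrable_lborel_translate(2)[OF integrable_norm[OF G(2)]])
  have ind: "integrable lborel (\<lambda>t::real. indicator {0..1} t * c)" for c :: real
    by (intro integrable_mult_left integrable_real_indicator) auto
  have int: "integrable (lborel \<Otimes>\<^sub>M lborel) (case_prod f)"
  proof (rule lborel_pair.Fubini_integrable[OF fm])
    have "(\<integral>x. norm (case_prod f (t, x)) \<partial>lborel) = indicator {0..1} t * (\<integral>x. norm (?G x) \<partial>lborel)" for t
      by (simp add: f_def trn)
    then show "integrable lborel (\<lambda>t. \<integral>x. norm (case_prod f (t, x)) \<partial>lborel)" by (simp only: ind)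
    show "AE t in lborel. integrable lborel (\<lambda>x. case_prod f (t, x))"
      unfolding f_def by (intro AE_I2) (simp add: tr)
  qed
  have line: "(\<integral>t. f t x \<partial>lborel) = F (b + x) - F x" for x
  proof -
    have "((\<lambda>t. F (t *\<^sub>R b + x)) has_vector_derivative ?G (t *\<^sub>R b + x)) (at t)" for t
    proof -
      obtain F' where F': "(F has_derivative F') (at (t *\<^sub>R b + x))" using F by (auto simp: differentiable_def)
      have "((\<lambda>t. t *\<^sub>R b + x) has_derivative (\<lambda>h. h *\<^sub>R b)) (at t)"
        by (auto intro!: derivative_eq_intros)
      from has_derivative_compose[OF this F'] have "((\<lambda>t. F (t *\<^sub>R b + x)) has_derivative (\<lambda>h. F' (h *\<^sub>R b))) (at t)" .
      moreover have "F' (h *\<^sub>R b) = h *\<^sub>R ?G (t *\<^sub>R b + x)" for h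
        using has_derivative_partial[OF F'] linear_scale[OF has_derivative_linear[OF F']] by simp
      ultimately show ?thesis by (simp add: has_vector_derivative_def)
    qed
    moreover have "continuous_on {0..1} (\<lambda>t. ?G (t *\<^sub>R b + x))"
      by (rule continuous_on_compose2[OF G(1)]) (auto intro!: continuous_intros)
    ultimately have "(\<integral>t. indicator {0..1} t *\<^sub>R ?G (t *\<^sub>R b + x) \<partial>lborel) = F (1 *\<^sub>R b + x) - F (0 *\<^sub>R b + x)"
      by (intro integral_FTC_Icc) (auto intro: has_vector_derivative_at_within)
    then show ?thesis by (simp add: f_def)
  qed
  have "(\<integral>x. \<integral>t. f t x \<partial>lborel \<partial>lborel) = (\<integral>t. \<integral>x. f t x \<partial>lborel \<partial>lborel)"
    by (rule lborel_pair.Fubini_integral[OF int])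
  also have "\<dots> = (\<integral>t. indicator {0..1} t *\<^sub>R (\<integral>x. ?G x \<partial>lborel) \<partial>(lborel :: real measure))"
    unfolding f_def by (simp add: tr)
  also have "\<dots> = (\<integral>x. ?G x \<partial>lborel)" by simp
  finally have "(\<integral>x. ?G x \<partial>lborel) = (\<integral>x. F (b + x) - F x \<partial>lborel)" unfolding line by simp
  also have "\<dots> = 0"
    using integrable_lborel_translate[OF Fi, of b] Fi by simp
  finally show ?thesis .
qed

lemma integrable_inverse_quadratic: "integrable lborel (\<lambda>x::real. 1 / (1 + x\<^sup>2))"
proof -
  let ?g = "\<lambda>x::real. indicator {0<..} x * (1 / (1 + x\<^sup>2))"
  have g: "integrable lborel ?g"
    using integrable_I0i_1_div_plus_square
    by (simp add: interval_lebesgue_integrable_def set_integrable_def einterval_def zero_ereal_def greaterThan_def)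
  have g': "integrable lborel (\<lambda>x. ?g (- x))"
    using lborel_integrable_real_affine[OF g, of "-1" 0] by simp
  have "integrable lborel (\<lambda>x. ?g x + ?g (- x))" using g g' by (rule Bochner_Integration.integrable_add)
  moreover have "AE x in lborel. ?g x + ?g (- x) = 1 / (1 + x\<^sup>2)"
    using AE_lborel_singleton[of "0::real"] by eventually_elim (auto simp: indicator_def)
  ultimately show ?thesis
    by (subst integrable_cong_AE[where g="\<lambda>x. ?g x + ?g (- x)"]) auto
qed

text \<open>The squared function is dominated by a tensor product of \<open>1 / (1 + t^2)\<close>:
  its product with \<open>(1 + |x|^2)^d\<close> is bounded, and \<open>1 + |x|^2\<close> dominates
  each factor \<open>1 + (x $ i)^2\<close>.\<close>

lemma rapid_L2:
  fixes f :: "real ^ 'n::finite \<Rightarrow> complex"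
  assumes cont: "continuous_on UNIV f" and bd: "\<And>k::nat. bounded (range (\<lambda>x. norm x ^ k *\<^sub>R f x))"
  shows "f \<in> L2"
proof (rule L2_I)
  show fm: "f \<in> borel_measurable lborel" using cont borel_measurable_continuous_onI by auto
  let ?d = "CARD('n)"
  obtain A where A: "\<And>x. norm (norm x ^ ?d *\<^sub>R f x) \<le> A" using bd[of ?d] by (auto simp: bounded_iff)
  obtain C where C: "\<And>x. norm (norm x ^ 0 *\<^sub>R f x) \<le> C" using bd[of 0] by (auto simp: bounded_iff)
  have "integrable lborel (\<lambda>x :: real^'n. \<Prod>i\<in>UNIV. 1 / (1 + (x $ i)\<^sup>2))"
    by (rule integrable_prod_vec[OF integrable_inverse_quadratic])
  then have "integrable lborel (\<lambda>x :: real^'n. (2 ^ ?d * (C\<^sup>2 + A\<^sup>2)) * (\<Prod>i\<in>UNIV. 1 / (1 + (x $ i)\<^sup>2)))"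
    by (rule integrable_mult_right)
  then show "integrable lborel (\<lambda>x. (cmod (f x))\<^sup>2)"
  proof (rule Bochner_Integration.integrable_bound)
    have "(cmod (f x))\<^sup>2 \<le> (2 ^ ?d * (C\<^sup>2 + A\<^sup>2)) * (\<Prod>i\<in>UNIV. 1 / (1 + (x $ i)\<^sup>2))" for x
    proof -
      let ?y = "(norm x)\<^sup>2"
      have "(1 + ?y) ^ ?d \<le> 2 ^ ?d * (1 + ?y ^ ?d)"
      proof -
        have "(1 + ?y) ^ ?d \<le> (2 * max 1 ?y) ^ ?d" by (intro power_mono) auto
        also have "\<dots> = 2 ^ ?d * max 1 ?y ^ ?d" by (rule power_mult_distrib)
        also have "max 1 ?y ^ ?d \<le> 1 + ?y ^ ?d" by (auto simp: max_def)
        finally show ?thesis by simp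
      qed
      then have "(1 + ?y) ^ ?d * (cmod (f x))\<^sup>2 \<le> 2 ^ ?d * (1 + ?y ^ ?d) * (cmod (f x))\<^sup>2"
        by (rule mult_right_mono) simp
      also have "\<dots> = 2 ^ ?d * ((cmod (f x))\<^sup>2 + (norm x ^ ?d * cmod (f x))\<^sup>2)"
        by (simp only: power_mult_distrib distrib_left distrib_right mult_1 mult.assoc power_even_eq power_mult[symmetric] mult.commute[of 2])
      also have "\<dots> \<le> 2 ^ ?d * (C\<^sup>2 + A\<^sup>2)"
        using A[of x] C[of x] by (intro mult_left_mono add_mono power_mono) auto
      finally have 1: "(1 + ?y) ^ ?d * (cmod (f x))\<^sup>2 \<le> 2 ^ ?d * (C\<^sup>2 + A\<^sup>2)" .
      have "(\<Prod>i\<in>UNIV. 1 + (x $ i)\<^sup>2) \<le> (\<Prod>i\<in>(UNIV :: 'n set). 1 + ?y)"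
        unfolding norm_vec_sq by (intro prod_mono) (auto intro!: member_le_sum)
      then have 2: "(\<Prod>i\<in>UNIV. 1 + (x $ i)\<^sup>2) \<le> (1 + ?y) ^ ?d" by simp
      have pos: "(\<Prod>i\<in>UNIV. 1 + (x $ i)\<^sup>2) > 0" by (intro prod_pos) (simp add: add_pos_nonneg)
      have "(\<Prod>i\<in>UNIV. 1 + (x $ i)\<^sup>2) * (cmod (f x))\<^sup>2 \<le> 2 ^ ?d * (C\<^sup>2 + A\<^sup>2)"
        using mult_right_mono[OF 2, of "(cmod (f x))\<^sup>2"] 1 by simp
      then show ?thesis using pos by (simp add: prod_dividef le_divide_eq mult.commute)
    qed
    then show "AE x in lborel. norm ((cmod (f x))\<^sup>2) \<le> norm ((2 ^ ?d * (C\<^sup>2 + A\<^sup>2)) * (\<Prod>i\<in>UNIV. 1 / (1 + (x $ i)\<^sup>2)))"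
      by (intro AE_I2) (simp add: order_trans[OF _ abs_ge_self])
  qed (use fm in measurable)
qed

lemma hermf_integrable: "integrable lborel (hermf k)"
proof -
  obtain C where C: "\<And>x. \<bar>x ^ 0 * hermf k x\<bar> \<le> C * exp (- x\<^sup>2 / 4)" using hermf_decay by blast
  have "integrable lborel (\<lambda>x. C * exp (- (1/4) * x\<^sup>2))" by (intro integrable_mult_right integrable_gauss) simp
  then show ?thesis
    by (rule Bochner_Integration.integrable_bound) (use C in \<open>auto intro!: AE_I2 order_trans[OF _ abs_ge_self]\<close>)
qed

lemma hspan_integrable: "f \<in> hspan \<Longrightarrow> integrable lborel f"
proof (induction rule: hspan.induct)
  case (add f c \<alpha>)
  have "integrable lborel (\<lambda>x. hermite \<alpha> x)"
    unfolding hermite_def by (rule integrable_prod_vec[OF hermf_integrable])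
  then show ?case using add by (intro Bochner_Integration.integrable_add integrable_mult_right integrable_of_real)
qed simp

lemma differentiable_continuous_UNIV:
  "(\<And>x. f differentiable (at x)) \<Longrightarrow> continuous_on UNIV f"
  by (simp add: continuous_at_imp_continuous_on differentiable_imp_continuous_within)

lemma hspan_mult_bounded_integrable:
  assumes h: "h \<in> hspan" and c: "continuous_on UNIV \<psi>" and b: "\<And>x. cmod (\<psi> x) \<le> K"
  shows "integrable lborel (\<lambda>x. h x * \<psi> x)"
proof -
  have "integrable lborel (\<lambda>x. of_real K * h x)" by (intro integrable_mult_right hspan_integrable h)
  then show ?thesis
  proof (rule Bochner_Integration.integrable_bound)
    have "continuous_on UNIV h" by (rule differentiable_continuous_UNIV[OF hspan_differentiable[OF h]])
    then show "(\<lambda>x. h x * \<psi> x) \<in> borel_measurable lborel"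
      using c by (auto intro!: borel_measurable_continuous_onI continuous_intros)
    have "cmod (\<psi> x) \<le> \<bar>K\<bar>" for x using b[of x] by simp
    then show "AE x in lborel. norm (h x * \<psi> x) \<le> norm (of_real K * h x)"
      by (intro AE_I2) (simp add: norm_mult mult.commute mult_right_mono)
  qed
qed

text \<open>The factor from \<open>hspan\<close> is integrable along with its derivative while the
  other factor is merely bounded, so the derivative of the product is integrable and has integral
  zero.\<close>

lemma integration_by_parts:
  assumes h: "h \<in> hspan" and b: "b \<in> Basis"
    and d: "\<And>x. \<psi> differentiable (at x)" "\<And>x. partial_deriv b \<psi> differentiable (at x)"
    and bd: "\<And>x. cmod (\<psi> x) \<le> K" "\<And>x. cmod (partial_deriv b \<psi> x) \<le> K'"
  shows "(\<integral>x. h x * partial_deriv b \<psi> x \<partial>lborel) = - (\<integral>x. partial_deriv b h x * \<psi> x \<partial>lborel)"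
proof -
  have c: "continuous_on UNIV \<psi>" "continuous_on UNIV (partial_deriv b \<psi>)"
    using differentiable_continuous_UNIV d by blast+
  have h': "partial_deriv b h \<in> hspan" by (rule partial_deriv_hspan[OF h b])
  have ch: "continuous_on UNIV h" "continuous_on UNIV (partial_deriv b h)"
    using differentiable_continuous_UNIV hspan_differentiable h h' by blast+
  have eq: "partial_deriv b (\<lambda>x. h x * \<psi> x) = (\<lambda>x. h x * partial_deriv b \<psi> x + partial_deriv b h x * \<psi> x)"
  proof
    fix x
    obtain f' g' where f': "(h has_derivative f') (at x)" and g': "(\<psi> has_derivative g') (at x)"
      using d(1)[of x] hspan_differentiable[OF h, of x] unfolding differentiable_def by blast
    show "partial_deriv b (\<lambda>x. h x * \<psi> x) x = h x * partial_deriv b \<psi> x + partial_deriv b h x * \<psi> x"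
      unfolding has_derivative_partial[OF has_derivative_mult[OF f' g']] has_derivative_partial[OF f'] has_derivative_partial[OF g'] ..
  qed
  have i1: "integrable lborel (\<lambda>x. h x * partial_deriv b \<psi> x)"
    by (rule hspan_mult_bounded_integrable[OF h c(2) bd(2)])
  have i2: "integrable lborel (\<lambda>x. partial_deriv b h x * \<psi> x)"
    by (rule hspan_mult_bounded_integrable[OF h' c(1) bd(1)])
  have "(\<integral>x. partial_deriv b (\<lambda>x. h x * \<psi> x) x \<partial>lborel) = 0"
  proof (rule integral_partial_deriv_zero)
    show "(\<lambda>x. h x * \<psi> x) differentiable (at x)" for x
      by (intro differentiable_mult hspan_differentiable h d)
    show "integrable lborel (\<lambda>x. h x * \<psi> x)" by (rule hspan_mult_bounded_integrable[OF h c(1) bd(1)])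
    show "continuous_on UNIV (partial_deriv b (\<lambda>x. h x * \<psi> x))"
      unfolding eq by (intro continuous_intros c ch)
    show "integrable lborel (partial_deriv b (\<lambda>x. h x * \<psi> x))"
      unfolding eq by (intro Bochner_Integration.integrable_add i1 i2)
  qed
  then show ?thesis unfolding eq using i1 i2 by (simp add: add_eq_0_iff2)
qed

lemma schwartz_partials:
  assumes "schwartz \<phi>" "set bs \<subseteq> Basis"
  shows "foldr partial_deriv bs \<phi> differentiable (at x)"
    "bounded (range (\<lambda>x. norm x ^ k *\<^sub>R foldr partial_deriv bs \<phi> x))"
    "\<exists>K. \<forall>x. cmod (foldr partial_deriv bs \<phi> x) \<le> K"
proof -
  show b: "bounded (range (\<lambda>x. norm x ^ k *\<^sub>R foldr partial_deriv bs \<phi> x))" for k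
    using assms unfolding schwartz_def by blast
  show "foldr partial_deriv bs \<phi> differentiable (at x)" using assms unfolding schwartz_def by blast
  show "\<exists>K. \<forall>x. cmod (foldr partial_deriv bs \<phi> x) \<le> K" using b[of 0] by (auto simp: bounded_iff)
qed

lemma schwartz_L2:
  fixes \<phi> :: "real ^ 'n::finite \<Rightarrow> complex"
  assumes \<phi>: "schwartz \<phi>"
  shows "\<phi> \<in> L2" "b \<in> Basis \<Longrightarrow> partial_deriv b (partial_deriv b \<phi>) \<in> L2"
    "(\<lambda>x. of_real ((norm x)\<^sup>2) * \<phi> x) \<in> L2"
proof -
  have c: "continuous_on UNIV (foldr partial_deriv bs \<phi>)" if "set bs \<subseteq> Basis" for bs
    by (rule differentiable_continuous_UNIV[OF schwartz_partials(1)[OF \<phi> that]])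
  show "\<phi> \<in> L2" using rapid_L2[OF c[of "[]"]] schwartz_partials(2)[OF \<phi>, of "[]"] by simp
  show "partial_deriv b (partial_deriv b \<phi>) \<in> L2" if "b \<in> Basis"
    using rapid_L2[OF c[of "[b, b]"]] schwartz_partials(2)[OF \<phi>, of "[b, b]"] that by simp
  show "(\<lambda>x. of_real ((norm x)\<^sup>2) * \<phi> x) \<in> L2"
  proof (rule rapid_L2)
    show "continuous_on UNIV (\<lambda>x. of_real ((norm x)\<^sup>2) * \<phi> x)"
      using c[of "[]"] by (auto intro!: continuous_intros)
    have "norm x ^ k *\<^sub>R (of_real ((norm x)\<^sup>2) * \<phi> x) = norm x ^ (k + 2) *\<^sub>R \<phi> x" for x k
      by (simp add: power_add power2_eq_square scaleR_conv_of_real mult.assoc)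
    then show "bounded (range (\<lambda>x. norm x ^ k *\<^sub>R (of_real ((norm x)\<^sup>2) * \<phi> x)))" for k
      using schwartz_partials(2)[OF \<phi>, of "[]" "k + 2"] by simp
  qed
qed

text \<open>H is symmetric between a Hermite function and an arbitrary Schwartz function: two
  integrations by parts move the Laplacian. This is what prevents the closure from being larger than
  the diagonal operator.\<close>

lemma harmonic_schwartz:
  fixes \<phi> :: "real ^ 'n::finite \<Rightarrow> complex"
  assumes \<phi>: "schwartz \<phi>"
  shows "harmonic_expression \<phi> \<in> L2"
    "l2_inner (\<lambda>x. complex_of_real (hermite \<alpha> x)) (harmonic_expression \<phi>)
      = of_real (energy \<alpha>) * l2_inner (\<lambda>x. complex_of_real (hermite \<alpha> x)) \<phi>"
proof -
  let ?h = "\<lambda>x. complex_of_real (hermite \<alpha> x)"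
  let ?d = "\<lambda>k. axis k (1::real) :: real^'n"
  have ax: "?d k \<in> Basis" for k by (simp add: axis_in_Basis_iff)
  have h: "?h \<in> hspan" using hspan_hermite[of 1 \<alpha>] by simp
  have eq: "harmonic_expression \<phi> = (\<lambda>x. (\<Sum>k\<in>UNIV. - partial_deriv (?d k) (partial_deriv (?d k) \<phi>) x) + of_real ((norm x)\<^sup>2) * \<phi> x)"
    by (simp add: fun_eq_iff harmonic_expression_cart sum_negf)
  have L: "(\<lambda>x. - partial_deriv (?d k) (partial_deriv (?d k) \<phi>) x) \<in> L2" for k
    by (intro L2_uminus schwartz_L2(2)[OF \<phi>] ax)
  show "harmonic_expression \<phi> \<in> L2" unfolding eq
    by (intro L2_add L2_sum L schwartz_L2(3)[OF \<phi>])
  have "l2_inner ?h (harmonic_expression \<phi>) = (\<Sum>k\<in>UNIV. l2_inner ?h (\<lambda>x. - partial_deriv (?d k) (partial_deriv (?d k) \<phi>) x))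
      + l2_inner ?h (\<lambda>x. of_real ((norm x)\<^sup>2) * \<phi> x)"
    unfolding eq l2_inner_add_right[OF hermite_L2 L2_sum[OF L] schwartz_L2(3)[OF \<phi>]] l2_inner_sum_right[OF hermite_L2 L] ..
  also have "\<dots> = (\<Sum>k\<in>UNIV. l2_inner (\<lambda>x. - partial_deriv (?d k) (partial_deriv (?d k) ?h) x) \<phi>)
      + l2_inner (\<lambda>x. of_real ((norm x)\<^sup>2) * ?h x) \<phi>"
  proof (intro arg_cong2[where f="(+)"] sum.cong refl)
    fix k
    define h' where "h' = (\<lambda>x. complex_of_real (hermite_dx k \<alpha> x))"
    have h': "partial_deriv (?d k) ?h = h'" unfolding h'_def by (rule hermite_partial)
    have h'H: "h' \<in> hspan" unfolding h'_def using hermite_dx_hspan[of 1 k \<alpha>] by simp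
    obtain K0 where K0: "\<And>x. cmod (\<phi> x) \<le> K0" using schwartz_partials(3)[OF \<phi>, of "[]"] by auto
    obtain K1 where K1: "\<And>x. cmod (partial_deriv (?d k) \<phi> x) \<le> K1" using schwartz_partials(3)[OF \<phi>, of "[?d k]"] ax by auto
    obtain K2 where K2: "\<And>x. cmod (partial_deriv (?d k) (partial_deriv (?d k) \<phi>) x) \<le> K2"
      using schwartz_partials(3)[OF \<phi>, of "[?d k, ?d k]"] ax by auto
    have D: "\<phi> differentiable (at x)" "partial_deriv (?d k) \<phi> differentiable (at x)"
      "partial_deriv (?d k) (partial_deriv (?d k) \<phi>) differentiable (at x)" for x
      using schwartz_partials(1)[OF \<phi>, of "[]"] schwartz_partials(1)[OF \<phi>, of "[?d k]"] schwartz_partials(1)[OF \<phi>, of "[?d k, ?d k]"] ax by auto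
    \<comment> \<open>The oscillator equation expresses this second derivative by real quantities,
      so the conjugation in the inner product does not affect it.\<close>
    have real2: "cnj (partial_deriv (?d k) h' x) = partial_deriv (?d k) h' x" for x
      using hermite_coordinate_oscillator[of k \<alpha> x] unfolding h' by (auto simp: complex_eq_iff)
    have "l2_inner ?h (\<lambda>x. - partial_deriv (?d k) (partial_deriv (?d k) \<phi>) x) = - (\<integral>x. ?h x * partial_deriv (?d k) (partial_deriv (?d k) \<phi>) x \<partial>lborel)"
      by (simp add: l2_inner_def)
    also have "\<dots> = (\<integral>x. h' x * partial_deriv (?d k) \<phi> x \<partial>lborel)"
      using integration_by_parts[OF h ax D(2,3) K1 K2] unfolding h' by simp
    also have "\<dots> = - (\<integral>x. partial_deriv (?d k) h' x * \<phi> x \<partial>lborel)"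
      by (rule integration_by_parts[OF h'H ax D(1,2) K0 K1])
    also have "\<dots> = l2_inner (\<lambda>x. - partial_deriv (?d k) (partial_deriv (?d k) ?h) x) \<phi>"
      by (simp add: l2_inner_def h' real2)
    finally show "l2_inner ?h (\<lambda>x. - partial_deriv (?d k) (partial_deriv (?d k) \<phi>) x) = l2_inner (\<lambda>x. - partial_deriv (?d k) (partial_deriv (?d k) ?h) x) \<phi>" .
  next
    show "l2_inner ?h (\<lambda>x. of_real ((norm x)\<^sup>2) * \<phi> x) = l2_inner (\<lambda>x. of_real ((norm x)\<^sup>2) * ?h x) \<phi>"
      unfolding l2_inner_def by (simp add: mult_ac)
  qed
  also have "\<dots> = l2_inner (\<lambda>x. (\<Sum>k\<in>UNIV. - partial_deriv (?d k) (partial_deriv (?d k) ?h) x) + of_real ((norm x)\<^sup>2) * ?h x) \<phi>"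
  proof -
    have sw: "schwartz ?h" by (rule hspan_schwartz[OF h])
    have L': "(\<lambda>x. - partial_deriv (?d k) (partial_deriv (?d k) ?h) x) \<in> L2" for k
      by (intro L2_uminus schwartz_L2(2)[OF sw] ax)
    have "l2_inner (\<lambda>x. \<Sum>k\<in>S. - partial_deriv (?d k) (partial_deriv (?d k) ?h) x) \<phi>
      = (\<Sum>k\<in>S. l2_inner (\<lambda>x. - partial_deriv (?d k) (partial_deriv (?d k) ?h) x) \<phi>)" if "finite S" for S
      by (subst (1 2) l2_inner_commute) (simp add: l2_inner_sum_right[OF schwartz_L2(1)[OF \<phi>] L'])
    then show ?thesis
      unfolding l2_inner_add_left[OF schwartz_L2(1)[OF \<phi>] L2_sum[OF L'] schwartz_L2(3)[OF sw]] by simp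
  qed
  also have "(\<lambda>x. (\<Sum>k\<in>UNIV. - partial_deriv (?d k) (partial_deriv (?d k) ?h) x) + of_real ((norm x)\<^sup>2) * ?h x) = (\<lambda>x. of_real (energy \<alpha>) * ?h x)"
    unfolding harmonic_hermite[symmetric] by (simp add: fun_eq_iff harmonic_expression_cart sum_negf)
  also have "l2_inner (\<lambda>x. of_real (energy \<alpha>) * ?h x) \<phi> = of_real (energy \<alpha>) * l2_inner ?h \<phi>"
    by (simp add: l2_inner_scale_left)
  finally show "l2_inner ?h (harmonic_expression \<phi>) = of_real (energy \<alpha>) * l2_inner ?h \<phi>" .
qed

definition hcoef :: "('n::finite \<Rightarrow> nat) \<Rightarrow> (real ^ 'n \<Rightarrow> complex) \<Rightarrow> complex" where
  "hcoef \<alpha> f = l2_inner (\<lambda>x. complex_of_real (hermite \<alpha> x)) f"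

text \<open>Coefficients are continuous in the norm, so the relation of
  \<open>harmonic_schwartz\<close> survives the closure. Conversely, the partial Hermite sums of
  \<open>f\<close> are Schwartz functions that H maps to the partial sums of
  \<open>g\<close>.\<close>

theorem harmonic_oscillator_hcoef:
  "(harmonic_oscillator :: ((real ^ 'n::finite \<Rightarrow> complex) \<times> _) set) = {(f, g). f \<in> L2 \<and> g \<in> L2 \<and> (\<forall>\<alpha>. hcoef \<alpha> g = of_real (energy \<alpha>) * hcoef \<alpha> f)}"
  (is "_ = ?R")
proof (intro set_eqI iffI)
  fix p :: "(real^'n \<Rightarrow> complex) \<times> (real^'n \<Rightarrow> complex)"
  obtain f g where p: "p = (f, g)" by (cases p)
  {
    assume "p \<in> harmonic_oscillator"
    then obtain \<phi> where f: "f \<in> L2" and g: "g \<in> L2" and \<phi>: "\<And>n. schwartz (\<phi> n)"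
      and l1: "(\<lambda>n. l2_norm (\<lambda>x. \<phi> n x - f x)) \<longlonglongrightarrow> 0"
      and l2: "(\<lambda>n. l2_norm (\<lambda>x. harmonic_expression (\<phi> n) x - g x)) \<longlonglongrightarrow> 0"
      unfolding p harmonic_oscillator_def by auto
    have "hcoef \<alpha> g = of_real (energy \<alpha>) * hcoef \<alpha> f" for \<alpha>
    proof (rule LIMSEQ_unique)
      show "(\<lambda>n. hcoef \<alpha> (harmonic_expression (\<phi> n))) \<longlonglongrightarrow> hcoef \<alpha> g"
        unfolding hcoef_def by (rule l2_inner_tendsto[OF harmonic_schwartz(1)[OF \<phi>] g hermite_L2 l2])
      show "(\<lambda>n. hcoef \<alpha> (harmonic_expression (\<phi> n))) \<longlonglongrightarrow> of_real (energy \<alpha>) * hcoef \<alpha> f"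
        unfolding hcoef_def harmonic_schwartz(2)[OF \<phi>]
        by (intro tendsto_mult_left l2_inner_tendsto[OF schwartz_L2(1)[OF \<phi>] f hermite_L2 l1])
    qed
    with f g show "p \<in> ?R" by (simp add: p)
  next
    assume "p \<in> ?R"
    then have f: "f \<in> L2" and g: "g \<in> L2" and c: "\<And>\<alpha>. hcoef \<alpha> g = of_real (energy \<alpha>) * hcoef \<alpha> f"
      by (auto simp: p)
    define \<phi> where "\<phi> n = (\<lambda>x. \<Sum>\<alpha>\<in>box_le n. hcoef \<alpha> f * of_real (hermite \<alpha> x))" for n
    have "schwartz (\<phi> n)" for n unfolding \<phi>_def by (intro hspan_schwartz hspan_sum hspan_hermite)
    moreover have "(\<lambda>n. l2_norm (\<lambda>x. \<phi> n x - f x)) \<longlonglongrightarrow> 0"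
      unfolding \<phi>_def hcoef_def by (rule hermite.expansion[OF f])
    moreover have "harmonic_expression (\<phi> n) x = (\<Sum>\<alpha>\<in>box_le n. hcoef \<alpha> g * of_real (hermite \<alpha> x))" for n x
      unfolding \<phi>_def harmonic_hspan_sum[OF finite_multi_index] c by (simp add: mult.commute)
    then have "(\<lambda>n. l2_norm (\<lambda>x. harmonic_expression (\<phi> n) x - g x)) \<longlonglongrightarrow> 0"
      unfolding hcoef_def using hermite.expansion[OF g] by simp
    ultimately show "p \<in> harmonic_oscillator" unfolding p harmonic_oscillator_def using f g by blast
  }
qed

section \<open>Spectral measures and diagonal projection-valued measures\<close>

lemma
  assumes "projection_valued_measure E"
  shows pvm_L2: "B \<in> sets borel \<Longrightarrow> f \<in> L2 \<Longrightarrow> E B f \<in> L2"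
    and pvm_sym: "B \<in> sets borel \<Longrightarrow> f \<in> L2 \<Longrightarrow> g \<in> L2 \<Longrightarrow> l2_inner (E B f) g = l2_inner f (E B g)"
    and pvm_Int: "B \<in> sets borel \<Longrightarrow> C \<in> sets borel \<Longrightarrow> f \<in> L2 \<Longrightarrow> AE x in lborel. E (B \<inter> C) f x = E B (E C f) x"
    and pvm_UNIV: "f \<in> L2 \<Longrightarrow> AE x in lborel. E UNIV f x = f x"
    and pvm_sums: "range A \<subseteq> sets borel \<Longrightarrow> disjoint_family A \<Longrightarrow> f \<in> L2 \<Longrightarrow>
      (\<lambda>i :: nat. (l2_norm (E (A i) f))\<^sup>2) sums (l2_norm (E (\<Union>i. A i) f))\<^sup>2"
  using assms unfolding projection_valued_measure_def by simp_all

lemma pvm_inner_Int: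
  assumes E: "projection_valued_measure E" and BC: "B \<in> sets borel" "C \<in> sets borel" and fg: "f \<in> L2" "g \<in> L2"
  shows "l2_inner (E B f) (E C g) = l2_inner f (E (B \<inter> C) g)"
proof -
  have "l2_inner (E B f) (E C g) = l2_inner f (E B (E C g))"
    using assms by (intro pvm_sym[OF E] pvm_L2[OF E])
  also have "\<dots> = l2_inner f (E (B \<inter> C) g)"
    using pvm_Int[OF E BC fg(2)] BC fg
    by (intro l2_inner_cong_AE pvm_L2[OF E] sets.Int) (auto elim: AE_mp)
  finally show ?thesis .
qed

lemma pvm_norm_sq:
  assumes E: "projection_valued_measure E" and B: "B \<in> sets borel" and f: "f \<in> L2"
  shows "of_real ((l2_norm (E B f))\<^sup>2) = l2_inner f (E B f)"
  using pvm_inner_Int[OF E B B f f] by (simp add: l2_inner_self del: of_real_power)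

lemma sets_spectral_measure [simp, measurable_cong]: "sets (spectral_measure E f) = sets borel"
proof -
  have "sigma_sets UNIV (sets (borel :: real measure)) = sets borel"
    using sets.sigma_sets_eq[of "borel :: real measure"] by simp
  then show ?thesis by (simp add: spectral_measure_def)
qed

lemma space_spectral_measure [simp]: "space (spectral_measure E f) = UNIV"
  by (simp add: spectral_measure_def space_measure_of_conv)

lemma emeasure_spectral_measure:
  assumes E: "projection_valued_measure E" and f: "f \<in> L2" and B: "B \<in> sets borel"
  shows "emeasure (spectral_measure E f) B = ennreal ((l2_norm (E B f))\<^sup>2)"
proof (rule emeasure_measure_of[OF spectral_measure_def])
  \<comment> \<open>Additivity for the constant sequence of empty sets gives a convergent constant
    series, which forces its terms to be zero.\<close>
  have "(\<lambda>i :: nat. (l2_norm (E {} f))\<^sup>2) sums (l2_norm (E (\<Union>i :: nat. {}) f))\<^sup>2"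
    by (rule pvm_sums[OF E _ _ f]) (auto simp: disjoint_family_on_def)
  then have "l2_norm (E {} f) = 0" by (auto dest!: sums_summable simp: summable_const_iff)
  then show "positive (sets (spectral_measure E f)) (\<lambda>B. ennreal ((l2_norm (E B f))\<^sup>2))"
    by (simp add: positive_def)
  show "countably_additive (sets (spectral_measure E f)) (\<lambda>B. ennreal ((l2_norm (E B f))\<^sup>2))"
    unfolding countably_additive_def
  proof (intro allI impI)
    fix A :: "nat \<Rightarrow> real set" assume "range A \<subseteq> sets (spectral_measure E f)" "disjoint_family A"
    then have "(\<lambda>i. (l2_norm (E (A i) f))\<^sup>2) sums (l2_norm (E (\<Union>i. A i) f))\<^sup>2"
      by (intro pvm_sums[OF E _ _ f]) auto
    then show "(\<Sum>i. ennreal ((l2_norm (E (A i) f))\<^sup>2)) = ennreal ((l2_norm (E (\<Union>i. A i) f))\<^sup>2)"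
      by (intro suminf_ennreal_eq) auto
  qed
qed (use B in auto)

lemma finite_spectral_measure:
  assumes "projection_valued_measure E" "f \<in> L2" shows "finite_measure (spectral_measure E f)"
  by (rule finite_measureI) (simp add: emeasure_spectral_measure[OF assms])

lemma hermite_coeff_eq_AE:
  "f \<in> L2 \<Longrightarrow> g \<in> L2 \<Longrightarrow> (\<And>\<alpha>. hcoef \<alpha> f = hcoef \<alpha> g) \<Longrightarrow> AE x in lborel. f x = g x"
  unfolding hcoef_def by (rule hermite.eq_AE_coeffI)

lemma hcoef_hermite: "hcoef \<alpha> (\<lambda>x. complex_of_real (hermite \<beta> x)) = (if \<alpha> = \<beta> then 1 else 0)"
  unfolding hcoef_def by (rule hermite.orthonormal)

lemma hcoef_add_scale:
  "f \<in> L2 \<Longrightarrow> g \<in> L2 \<Longrightarrow> hcoef \<alpha> (\<lambda>x. f x + c * g x) = hcoef \<alpha> f + c * hcoef \<alpha> g"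
  unfolding hcoef_def by (simp add: l2_inner_add_right hermite_L2 L2_scale l2_inner_scale_right)

text \<open>Point masses at the eigenvalues. As an image of a measure on multi-indices it takes care
  of multiplicities and turns spectral integrals into sums over multi-indices.\<close>

definition hermite_spectrum :: "(real ^ 'n::finite \<Rightarrow> complex) \<Rightarrow> real measure" where
  "hermite_spectrum f = distr (density (count_space UNIV) (\<lambda>\<alpha>. ennreal ((cmod (hcoef \<alpha> f))\<^sup>2))) borel energy"

lemma sets_hermite_spectrum [simp, measurable_cong]: "sets (hermite_spectrum f) = sets borel"
  by (simp add: hermite_spectrum_def)

text \<open>A relation and not a function, since coefficients determine \<open>g\<close> only almost
  everywhere.\<close>

definition spectral_cut :: "real set \<Rightarrow> (real ^ 'n::finite \<Rightarrow> complex) \<Rightarrow> (real ^ 'n \<Rightarrow> complex) \<Rightarrow> bool" where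
  "spectral_cut B f g \<longleftrightarrow> g \<in> L2 \<and> (\<forall>\<alpha>. hcoef \<alpha> g = of_bool (energy \<alpha> \<in> B) * hcoef \<alpha> f)"

lemma emeasure_hermite_spectrum:
  assumes "spectral_cut B f g" and B: "B \<in> sets borel"
  shows "emeasure (hermite_spectrum f) B = ennreal ((l2_norm g)\<^sup>2)"
proof -
  have g: "g \<in> L2" and c: "\<And>\<alpha>. hcoef \<alpha> g = of_bool (energy \<alpha> \<in> B) * hcoef \<alpha> f"
    using assms(1) by (auto simp: spectral_cut_def)
  have "emeasure (hermite_spectrum f) B = (\<integral>\<^sup>+\<alpha>. ennreal ((cmod (hcoef \<alpha> f))\<^sup>2) * indicator (energy -` B) \<alpha> \<partial>count_space UNIV)"
    unfolding hermite_spectrum_def using B by (subst emeasure_distr) (auto simp: emeasure_density)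
  also have "\<dots> = (\<integral>\<^sup>+\<alpha>. ennreal ((cmod (hcoef \<alpha> g))\<^sup>2) \<partial>count_space UNIV)"
    by (intro nn_integral_cong) (simp add: c indicator_def)
  also have "\<dots> = ennreal ((l2_norm g)\<^sup>2)" unfolding hcoef_def by (rule hermite.parseval_norm[OF g])
  finally show ?thesis .
qed

lemma integrable_hermite_spectrum:
  fixes F :: "real \<Rightarrow> 'b::{banach, second_countable_topology}"
  assumes "F \<in> borel_measurable borel"
  shows "integrable (hermite_spectrum f) F \<longleftrightarrow> integrable (count_space UNIV) (\<lambda>\<alpha>. (cmod (hcoef \<alpha> f))\<^sup>2 *\<^sub>R F (energy \<alpha>))"
  unfolding hermite_spectrum_def using assms
  by (subst integrable_distr_eq) (auto simp: integrable_density)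

lemma integral_hermite_spectrum:
  fixes F :: "real \<Rightarrow> 'b::{banach, second_countable_topology}"
  assumes "F \<in> borel_measurable borel"
  shows "(\<integral>s. F s \<partial>hermite_spectrum f) = (\<integral>\<alpha>. (cmod (hcoef \<alpha> f))\<^sup>2 *\<^sub>R F (energy \<alpha>) \<partial>count_space UNIV)"
  unfolding hermite_spectrum_def using assms
  by (subst integral_distr) (auto simp: integral_density)

definition diagonal_pvm :: "(real set \<Rightarrow> (real ^ 'n::finite \<Rightarrow> complex) \<Rightarrow> (real ^ 'n \<Rightarrow> complex)) \<Rightarrow> bool" where
  "diagonal_pvm E \<longleftrightarrow> projection_valued_measure E \<and> (\<forall>B\<in>sets borel. \<forall>f\<in>L2. spectral_cut B f (E B f))"

lemma diagonal_spectral_measure: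
  assumes "diagonal_pvm E" "f \<in> L2"
  shows "spectral_measure E f = hermite_spectrum f"
proof (rule measure_eqI)
  fix B assume "B \<in> sets (spectral_measure E f)"
  then show "emeasure (spectral_measure E f) B = emeasure (hermite_spectrum f) B"
    using assms by (simp add: diagonal_pvm_def emeasure_spectral_measure emeasure_hermite_spectrum[where g="E B f"])
qed simp

lemma diagonal_spectral_domain:
  assumes "diagonal_pvm E" and F: "F \<in> borel_measurable borel"
  shows "f \<in> spectral_domain E F \<longleftrightarrow>
    f \<in> L2 \<and> integrable (count_space UNIV) (\<lambda>\<alpha>. (cmod (F (energy \<alpha>) * hcoef \<alpha> f))\<^sup>2)"
proof -
  have [measurable]: "F \<in> borel_measurable borel" by fact
  show ?thesis using assms
    by (auto simp: spectral_domain_def diagonal_spectral_measure integrable_hermite_spectrum norm_mult power_mult_distrib mult.commute)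
qed

lemma polarization:
  "(\<Sum>k<4. (- \<i>) ^ k * of_real ((cmod (a + \<i> ^ k * b))\<^sup>2)) = 4 * (cnj a * b)"
proof -
  have "(\<Sum>k<4. (- \<i>) ^ k * of_real ((cmod (a + \<i> ^ k * b))\<^sup>2)) =
    of_real ((cmod (a + b))\<^sup>2) - \<i> * of_real ((cmod (a + \<i> * b))\<^sup>2) - of_real ((cmod (a - b))\<^sup>2) + \<i> * of_real ((cmod (a - \<i> * b))\<^sup>2)"
    by (simp add: eval_nat_numeral algebra_simps)
  also have "\<dots> = 4 * (cnj a * b)"
    unfolding cmod_power2 by (simp add: complex_eq_iff power2_eq_square algebra_simps)
  finally show ?thesis .
qed

text \<open>Polarization is applied coefficient by coefficient. Since \<open>F\<close> may be
  unbounded, exchanging it with the integral requires the four integrands to be integrable, which is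
  deduced from the spectral domain.\<close>

lemma diagonal_spectral_form:
  assumes E: "diagonal_pvm E" and F [measurable]: "F \<in> borel_measurable borel"
    and h: "h \<in> spectral_domain E F" and f: "f \<in> spectral_domain E F"
  shows "spectral_form E F h f = (\<integral>\<alpha>. cnj (hcoef \<alpha> h) * (F (energy \<alpha>) * hcoef \<alpha> f) \<partial>count_space UNIV)"
proof -
  let ?u = "\<lambda>k x. h x + \<i> ^ k * f x"
  have L: "h \<in> L2" "f \<in> L2" using h f by (auto simp: spectral_domain_def)
  have u: "?u k \<in> L2" for k by (intro L2_add L2_scale L)
  have cu: "hcoef \<alpha> (?u k) = hcoef \<alpha> h + \<i> ^ k * hcoef \<alpha> f" for \<alpha> k
    by (rule hcoef_add_scale[OF L])
  have sq: "integrable (count_space UNIV) (\<lambda>\<alpha>. (cmod (hcoef \<alpha> v))\<^sup>2)" if "v \<in> L2" for v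
    unfolding hcoef_def by (rule hermite.coeff_sq_integrable[OF that])
  have dom: "integrable (count_space UNIV) (\<lambda>\<alpha>. (cmod (hcoef \<alpha> v))\<^sup>2 * cmod (F (energy \<alpha>)))" if "v \<in> spectral_domain E F" for v
  proof (rule Bochner_Integration.integrable_bound)
    have v: "v \<in> L2" "integrable (count_space UNIV) (\<lambda>\<alpha>. (cmod (F (energy \<alpha>) * hcoef \<alpha> v))\<^sup>2)"
      using that diagonal_spectral_domain[OF E F] by auto
    then show "integrable (count_space UNIV) (\<lambda>\<alpha>. (cmod (hcoef \<alpha> v))\<^sup>2 + (cmod (F (energy \<alpha>) * hcoef \<alpha> v))\<^sup>2)"
      by (intro Bochner_Integration.integrable_add sq)
    \<comment> \<open>The domain controls only \<open>|F|^2\<close>; the first power of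
      \<open>|F|\<close> is bounded by \<open>1 + |F|^2\<close>.\<close>
    have "x * y \<le> x + x * y\<^sup>2" if "x \<ge> 0" for x y :: real
    proof -
      have "y \<le> 1 + y\<^sup>2" using zero_le_power2[of "y - 1/2"] by (simp add: power2_eq_square algebra_simps)
      from mult_left_mono[OF this that] show ?thesis by (simp add: distrib_left)
    qed
    from this[of "(cmod (hcoef _ v))\<^sup>2" "cmod (F (energy _))"]
    show "AE \<alpha> in count_space UNIV. norm ((cmod (hcoef \<alpha> v))\<^sup>2 * cmod (F (energy \<alpha>)))
        \<le> norm ((cmod (hcoef \<alpha> v))\<^sup>2 + (cmod (F (energy \<alpha>) * hcoef \<alpha> v))\<^sup>2)"
      by (intro AE_I2) (simp add: norm_mult power_mult_distrib mult.commute)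
  qed simp
  have int: "integrable (count_space UNIV) (\<lambda>\<alpha>. (cmod (hcoef \<alpha> (?u k)))\<^sup>2 *\<^sub>R F (energy \<alpha>))" for k
  proof (rule Bochner_Integration.integrable_bound)
    show "integrable (count_space UNIV) (\<lambda>\<alpha>. 2 * ((cmod (hcoef \<alpha> h))\<^sup>2 * cmod (F (energy \<alpha>)))
        + 2 * ((cmod (hcoef \<alpha> f))\<^sup>2 * cmod (F (energy \<alpha>))))"
      by (intro Bochner_Integration.integrable_add integrable_mult_right dom h f)
    have "(cmod (a + \<i> ^ k * b))\<^sup>2 * y \<le> 2 * ((cmod a)\<^sup>2 * y) + 2 * ((cmod b)\<^sup>2 * y)" if "y \<ge> 0" for a b y
      using mult_right_mono[OF norm_add_sq_le[of a "\<i> ^ k * b"] that] by (simp add: norm_mult norm_power algebra_simps)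
    then show "AE \<alpha> in count_space UNIV. norm ((cmod (hcoef \<alpha> (?u k)))\<^sup>2 *\<^sub>R F (energy \<alpha>))
        \<le> norm (2 * ((cmod (hcoef \<alpha> h))\<^sup>2 * cmod (F (energy \<alpha>))) + 2 * ((cmod (hcoef \<alpha> f))\<^sup>2 * cmod (F (energy \<alpha>))))"
      unfolding cu by (intro AE_I2) simp
  qed simp
  have "spectral_form E F h f = (\<Sum>k<4. (- \<i>) ^ k * (\<integral>\<alpha>. (cmod (hcoef \<alpha> (?u k)))\<^sup>2 *\<^sub>R F (energy \<alpha>) \<partial>count_space UNIV)) / 4"
    unfolding spectral_form_def diagonal_spectral_measure[OF E u] integral_hermite_spectrum[OF F] ..
  also have "\<dots> = (\<integral>\<alpha>. (\<Sum>k<4. (- \<i>) ^ k * ((cmod (hcoef \<alpha> (?u k)))\<^sup>2 *\<^sub>R F (energy \<alpha>))) / 4 \<partial>count_space UNIV)"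
    by (simp only: integral_divide_zero integral_mult_right_zero Bochner_Integration.integral_sum[OF integrable_mult_right[OF int]])
  also have "\<dots> = (\<integral>\<alpha>. cnj (hcoef \<alpha> h) * (F (energy \<alpha>) * hcoef \<alpha> f) \<partial>count_space UNIV)"
  proof (intro Bochner_Integration.integral_cong refl)
    fix \<alpha>
    have "(\<Sum>k<4. (- \<i>) ^ k * ((cmod (hcoef \<alpha> (?u k)))\<^sup>2 *\<^sub>R F (energy \<alpha>)))
        = (\<Sum>k<4. (- \<i>) ^ k * of_real ((cmod (hcoef \<alpha> h + \<i> ^ k * hcoef \<alpha> f))\<^sup>2)) * F (energy \<alpha>)"
      by (simp only: sum_distrib_right cu scaleR_conv_of_real mult.assoc)
    then show "(\<Sum>k<4. (- \<i>) ^ k * ((cmod (hcoef \<alpha> (?u k)))\<^sup>2 *\<^sub>R F (energy \<alpha>))) / 4 = cnj (hcoef \<alpha> h) * (F (energy \<alpha>) * hcoef \<alpha> f)"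
      unfolding polarization by simp
  qed
  finally show ?thesis .
qed

text \<open>Hermite functions belong to the domain of every Borel function \<open>F\<close>, so
  testing against them reads off the coefficients of \<open>g\<close>. The converse is Parseval's
  identity.\<close>

theorem diagonal_spectral_integral:
  assumes E: "diagonal_pvm (E :: real set \<Rightarrow> (real ^ 'n::finite \<Rightarrow> complex) \<Rightarrow> _)" and F: "F \<in> borel_measurable borel"
  shows "spectral_integral E F = {(f, g). f \<in> L2 \<and> g \<in> L2 \<and> (\<forall>\<alpha>. hcoef \<alpha> g = F (energy \<alpha>) * hcoef \<alpha> f)}"
proof (intro set_eqI iffI; clarify)
  fix f g :: "real ^ 'n \<Rightarrow> complex" assume "(f, g) \<in> spectral_integral E F"
  then have f: "f \<in> spectral_domain E F" and g: "g \<in> L2"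
    and fg: "\<And>h. h \<in> spectral_domain E F \<Longrightarrow> l2_inner h g = spectral_form E F h f"
    by (auto simp: spectral_integral_def)
  have "hcoef \<alpha> g = F (energy \<alpha>) * hcoef \<alpha> f" for \<alpha>
  proof -
    let ?h = "\<lambda>x. complex_of_real (hermite \<alpha> x)"
    \<comment> \<open>Only the value of \<open>F\<close> at one energy enters, hence the membership
      in the domain.\<close>
    have "integrable (count_space UNIV) (\<lambda>\<beta>. (cmod (F (energy \<alpha>)))\<^sup>2 * indicator {\<alpha>} \<beta> :: real)"
      by (intro integrable_mult_right integrable_real_indicator) auto
    moreover have "(cmod (F (energy \<beta>) * hcoef \<beta> ?h))\<^sup>2 = (cmod (F (energy \<alpha>)))\<^sup>2 * indicator {\<alpha>} \<beta>" for \<beta>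
      by (auto simp: hcoef_hermite)
    ultimately have h: "?h \<in> spectral_domain E F"
      by (simp add: diagonal_spectral_domain[OF E F] hermite_L2)
    have "hcoef \<alpha> g = (\<integral>\<beta>. cnj (hcoef \<beta> ?h) * (F (energy \<beta>) * hcoef \<beta> f) \<partial>count_space UNIV)"
      using fg[OF h] diagonal_spectral_form[OF E F h f] by (simp add: hcoef_def)
    also have "\<dots> = (\<integral>\<beta>. indicator {\<alpha>} \<beta> *\<^sub>R (F (energy \<alpha>) * hcoef \<alpha> f) \<partial>count_space UNIV)"
      by (intro Bochner_Integration.integral_cong) (auto simp: hcoef_hermite)
    also have "\<dots> = F (energy \<alpha>) * hcoef \<alpha> f" by simp
    finally show ?thesis .
  qed
  then show "f \<in> L2 \<and> g \<in> L2 \<and> (\<forall>\<alpha>. hcoef \<alpha> g = F (energy \<alpha>) * hcoef \<alpha> f)"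
    using f g by (auto simp: spectral_domain_def)
next
  fix f g :: "real ^ 'n \<Rightarrow> complex" assume f: "f \<in> L2" and g: "g \<in> L2" and c: "\<forall>\<alpha>. hcoef \<alpha> g = F (energy \<alpha>) * hcoef \<alpha> f"
  have "integrable (count_space UNIV) (\<lambda>\<alpha>. (cmod (hcoef \<alpha> g))\<^sup>2)"
    unfolding hcoef_def by (rule hermite.coeff_sq_integrable[OF g])
  with f c have fd: "f \<in> spectral_domain E F" by (simp add: diagonal_spectral_domain[OF E F])
  have "l2_inner h g = spectral_form E F h f" if h: "h \<in> spectral_domain E F" for h
    unfolding diagonal_spectral_form[OF E F h fd] c[rule_format, symmetric] unfolding hcoef_def
    using h g by (intro hermite.parseval) (auto simp: spectral_domain_def)
  then show "(f, g) \<in> spectral_integral E F" using fd g by (auto simp: spectral_integral_def)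
qed

lemma spectral_cut_exists:
  assumes f: "f \<in> L2" shows "\<exists>g. spectral_cut B f g"
proof -
  have "\<exists>g\<in>L2. (\<forall>\<alpha>. hcoef \<alpha> g = of_bool (energy \<alpha> \<in> B) * hcoef \<alpha> f) \<and>
      (\<lambda>n. l2_norm (\<lambda>x. (\<Sum>\<alpha>\<in>box_le n. (of_bool (energy \<alpha> \<in> B) * hcoef \<alpha> f) * of_real (hermite \<alpha> x)) - g x)) \<longlonglongrightarrow> 0"
    unfolding hcoef_def
  proof (rule hermite.riesz_fischer)
    fix n
    have "(\<Sum>\<alpha>\<in>box_le n. (cmod (of_bool (energy \<alpha> \<in> B) * l2_inner (\<lambda>x. complex_of_real (hermite \<alpha> x)) f))\<^sup>2)
        \<le> (\<Sum>\<alpha>\<in>box_le n. (cmod (l2_inner (\<lambda>x. complex_of_real (hermite \<alpha> x)) f))\<^sup>2)"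
      by (intro sum_mono) (auto simp: norm_mult)
    also have "\<dots> \<le> (l2_norm f)\<^sup>2" by (rule hermite.bessel[OF f finite_multi_index])
    finally show "(\<Sum>\<alpha>\<in>box_le n. (cmod (of_bool (energy \<alpha> \<in> B) * l2_inner (\<lambda>x. complex_of_real (hermite \<alpha> x)) f))\<^sup>2) \<le> (l2_norm f)\<^sup>2" .
  qed
  then show ?thesis by (auto simp: spectral_cut_def)
qed

text \<open>The identities between operators are compared coefficient by coefficient; countable
  additivity is that of the measure \<open>hermite_spectrum f\<close>.\<close>

lemma diagonal_pvm_exists: "\<exists>E. diagonal_pvm (E :: real set \<Rightarrow> (real ^ 'n::finite \<Rightarrow> complex) \<Rightarrow> _)"
proof
  define E where "E B f = (SOME g. spectral_cut B f g)" for B and f :: "real ^ 'n \<Rightarrow> complex"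
  have cut: "spectral_cut B f (E B f)" if "f \<in> L2" for B f
    unfolding E_def by (rule someI_ex[OF spectral_cut_exists[OF that]])
  then have L: "E B f \<in> L2" and c: "hcoef \<alpha> (E B f) = of_bool (energy \<alpha> \<in> B) * hcoef \<alpha> f" if "f \<in> L2" for B f \<alpha>
    using that by (auto simp: spectral_cut_def)
  have parseval: "l2_inner f g = (\<integral>\<alpha>. cnj (hcoef \<alpha> f) * hcoef \<alpha> g \<partial>count_space UNIV)" if "f \<in> L2" "g \<in> L2" for f g :: "real ^ 'n \<Rightarrow> complex"
    unfolding hcoef_def using that by (rule hermite.parseval)
  have "projection_valued_measure E"
    unfolding projection_valued_measure_def
  proof (intro conjI ballI allI impI)
    fix B and f g :: "real ^ 'n \<Rightarrow> complex" assume f: "f \<in> L2" and g: "g \<in> L2"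
    show "l2_inner (E B f) g = l2_inner f (E B g)"
      unfolding parseval[OF L[OF f] g] parseval[OF f L[OF g]] c[OF f] c[OF g]
      by (intro Bochner_Integration.integral_cong) (auto simp: of_bool_def)
  next
    fix B C and f :: "real ^ 'n \<Rightarrow> complex" assume f: "f \<in> L2"
    show "AE x in lborel. E (B \<inter> C) f x = E B (E C f) x"
      by (rule hermite_coeff_eq_AE) (simp_all add: L f c)
  next
    fix f :: "real ^ 'n \<Rightarrow> complex" assume f: "f \<in> L2"
    show "AE x in lborel. E UNIV f x = f x"
      by (rule hermite_coeff_eq_AE) (simp_all add: L f c)
  next
    fix A :: "nat \<Rightarrow> real set" and f :: "real ^ 'n \<Rightarrow> complex" assume A: "range A \<subseteq> sets borel" "disjoint_family A" and f: "f \<in> L2"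
    have em: "emeasure (hermite_spectrum f) B = ennreal ((l2_norm (E B f))\<^sup>2)" if "B \<in> sets borel" for B
      by (rule emeasure_hermite_spectrum[OF cut[OF f] that])
    then have m: "measure (hermite_spectrum f) B = (l2_norm (E B f))\<^sup>2" if "B \<in> sets borel" for B
      using that by (simp add: measure_def)
    have "space (hermite_spectrum f) = UNIV" by (simp add: hermite_spectrum_def)
    then interpret finite_measure "hermite_spectrum f" by (intro finite_measureI) (simp add: em)
    have "(\<lambda>i. measure (hermite_spectrum f) (A i)) sums measure (hermite_spectrum f) (\<Union>i. A i)"
      using A by (intro finite_measure_UNION) auto
    then show "(\<lambda>i. (l2_norm (E (A i) f))\<^sup>2) sums (l2_norm (E (\<Union>i. A i) f))\<^sup>2"
      using A(1) by (simp add: m sets.countable_UN range_subsetD)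
  qed (rule L)
  then show "diagonal_pvm E" using cut by (simp add: diagonal_pvm_def)
qed

section \<open>Every spectral resolution of H is diagonal\<close>

lemma diagonal_pvm_harmonic:
  "diagonal_pvm E \<Longrightarrow> spectral_integral E complex_of_real = (harmonic_oscillator :: ((real ^ 'n::finite \<Rightarrow> complex) \<times> _) set)"
  by (simp add: diagonal_spectral_integral harmonic_oscillator_hcoef)

text \<open>
  The converse: testing the spectral integral against \<open>E C g\<close> for an eigenfunction \<open>g\<close> with
  eigenvalue \<open>l\<close> shows that \<open>s - l\<close> has integral zero over every Borel set \<open>C\<close>, so the spectral
  measure of \<open>g\<close> sits at \<open>l\<close>.
\<close>

lemma spectral_measure_eigenfunction:
  assumes E: "projection_valued_measure E" and g: "g \<in> L2"
    and eig: "(g, \<lambda>x. complex_of_real l * g x) \<in> spectral_integral E complex_of_real"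
  shows "AE s in spectral_measure E g. s = l"
proof -
  define \<mu> where "\<mu> = spectral_measure E g"
  have [simp, measurable_cong]: "sets \<mu> = sets borel" and [simp]: "space \<mu> = UNIV" by (simp_all add: \<mu>_def)
  interpret finite_measure \<mu> unfolding \<mu>_def by (rule finite_spectral_measure[OF E g])
  have [simp]: "emeasure \<mu> X < top" for X by (simp add: less_top[symmetric])
  have em: "emeasure \<mu> B = ennreal ((l2_norm (E B g))\<^sup>2)" if "B \<in> sets borel" for B
    unfolding \<mu>_def by (rule emeasure_spectral_measure[OF E g that])
  have m: "measure \<mu> B = (l2_norm (E B g))\<^sup>2" if "B \<in> sets borel" for B
    using em[OF that] by (simp add: measure_def)
  have q: "l2_inner g (E B g) = of_real (measure \<mu> B)" if "B \<in> sets borel" for B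
    using pvm_norm_sq[OF E that g] m[OF that] by simp
  have sq: "integrable \<mu> (\<lambda>s. s\<^sup>2)"
    using eig by (simp add: spectral_integral_def spectral_domain_def \<mu>_def)
  have id: "integrable \<mu> (\<lambda>s. s)"
  proof (rule Bochner_Integration.integrable_bound)
    show "integrable \<mu> (\<lambda>s. 1 + s\<^sup>2)" using sq by simp
    have "\<bar>s\<bar> \<le> 1 + s\<^sup>2" for s :: real
      using zero_le_power2[of "\<bar>s\<bar> - 1/2"] by (simp add: power2_eq_square algebra_simps)
    then show "AE s in \<mu>. norm s \<le> norm (1 + s\<^sup>2)" by (intro AE_I2) (simp add: add_nonneg_nonneg)
  qed simp
  have key: "(\<integral>s. indicator C s * (s - l) \<partial>\<mu>) = 0" "integrable \<mu> (\<lambda>s. indicator C s * (s - l))"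
    if C [measurable]: "C \<in> sets borel" for C
  proof -
    define h where "h = E C g"
    have h: "h \<in> L2" unfolding h_def by (rule pvm_L2[OF E C g])
    have idC: "integrable \<mu> (\<lambda>s. indicator C s * s)"
      using integrable_mult_indicator[OF _ id, of C] by simp
    have hdom: "h \<in> spectral_domain E complex_of_real"
    proof -
      \<comment> \<open>\<open>E B h\<close> is \<open>E (B \<inter> C) g\<close> almost everywhere,
        so the measure of \<open>h\<close> is the restriction of \<open>\<mu>\<close> to
        \<open>C\<close>. It inherits the finite second moment, which makes \<open>h\<close> an
        admissible test function.\<close>
      have "spectral_measure E h = density \<mu> (\<lambda>s. ennreal (indicator C s))"
      proof (rule measure_eqI)
        fix B assume "B \<in> sets (spectral_measure E h)"
        then have B [measurable]: "B \<in> sets borel" by simp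
        have "l2_norm (E B h) = l2_norm (E (B \<inter> C) g)"
          using pvm_Int[OF E B C g] unfolding h_def
          by (intro l2_norm_cong_AE) (auto intro!: L2_measurable pvm_L2[OF E] g B C simp: eq_commute)
        moreover have "emeasure (density \<mu> (\<lambda>s. ennreal (indicator C s))) B = emeasure \<mu> (B \<inter> C)"
        proof -
          have "emeasure (density \<mu> (\<lambda>s. ennreal (indicator C s))) B = (\<integral>\<^sup>+s. ennreal (indicator C s) * indicator B s \<partial>\<mu>)"
            by (rule emeasure_density) simp_all
          also have "\<dots> = (\<integral>\<^sup>+s. indicator (B \<inter> C) s \<partial>\<mu>)"
            by (intro nn_integral_cong) (auto simp: indicator_def)
          also have "\<dots> = emeasure \<mu> (B \<inter> C)" by (rule nn_integral_indicator) simp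
          finally show ?thesis .
        qed
        ultimately show "emeasure (spectral_measure E h) B = emeasure (density \<mu> (\<lambda>s. ennreal (indicator C s))) B"
          using em[of "B \<inter> C"] by (simp add: emeasure_spectral_measure[OF E h B])
      qed simp
      then show ?thesis
        using integrable_mult_indicator[OF _ sq, of C]
        by (simp add: spectral_domain_def h integrable_density)
    qed
    \<comment> \<open>For \<open>h = E C g\<close> the cross terms make the measure of
      \<open>h + \<i>^k * g\<close> equal to \<open>\<mu>\<close> with the density
      \<open>1 + r k\<close> on \<open>C\<close> and 1 elsewhere. In the polarization sum the
      constant part cancels, and the weights of \<open>r k\<close> add up to 4.\<close>
    define r where "r k = 1 + 2 * Re (\<i> ^ k)" for k :: nat
    have r: "1 + r k * indicator C s \<ge> 0" for k s
    proof -
      have "\<bar>Re (\<i> ^ k)\<bar> \<le> 1" using abs_Re_le_cmod[of "\<i> ^ k"] by (simp add: norm_power)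
      then show ?thesis by (auto simp: r_def indicator_def)
    qed
    let ?v = "\<lambda>k x. h x + \<i> ^ k * g x"
    have v: "?v k \<in> L2" for k by (intro L2_add L2_scale h g)
    have nv: "(l2_norm (E B (?v k)))\<^sup>2 = measure \<mu> B + r k * measure \<mu> (B \<inter> C)" if B: "B \<in> sets borel" for B k
    proof -
      have Ev: "E B (?v k) \<in> L2" by (rule pvm_L2[OF E B v])
      have BC: "B \<inter> C \<in> sets borel" using B C by auto
      have "l2_inner h (E B (?v k)) = l2_inner (E B h) (?v k)" by (rule pvm_sym[OF E B h v, symmetric])
      also have "\<dots> = l2_inner (E B h) h + \<i> ^ k * l2_inner (E B h) g"
        by (simp add: l2_inner_add_right pvm_L2[OF E B h] h g L2_scale l2_inner_scale_right)
      also have "l2_inner (E B h) h = l2_inner g (E (C \<inter> (B \<inter> C)) g)"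
        unfolding h_def using pvm_inner_Int[OF E B C pvm_L2[OF E C g] g] pvm_inner_Int[OF E C BC g g] by simp
      also have "C \<inter> (B \<inter> C) = B \<inter> C" by auto
      also have "l2_inner (E B h) g = l2_inner g (E (B \<inter> C) g)"
        using pvm_sym[OF E B h g] pvm_inner_Int[OF E C B g g] unfolding h_def by (simp add: Int_commute)
      finally have 1: "l2_inner h (E B (?v k)) = of_real (measure \<mu> (B \<inter> C)) + \<i> ^ k * of_real (measure \<mu> (B \<inter> C))"
        by (simp only: q[OF BC])
      have "l2_inner g (E B (?v k)) = l2_inner (E B g) (?v k)" by (rule pvm_sym[OF E B g v, symmetric])
      also have "\<dots> = l2_inner (E B g) h + \<i> ^ k * l2_inner (E B g) g"
        by (simp add: l2_inner_add_right pvm_L2[OF E B g] h g L2_scale l2_inner_scale_right)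
      also have "l2_inner (E B g) h = l2_inner g (E (B \<inter> C) g)"
        unfolding h_def by (rule pvm_inner_Int[OF E B C g g])
      also have "l2_inner (E B g) g = l2_inner g (E B g)" by (rule pvm_sym[OF E B g g])
      finally have 2: "l2_inner g (E B (?v k)) = of_real (measure \<mu> (B \<inter> C)) + \<i> ^ k * of_real (measure \<mu> B)"
        by (simp only: q[OF BC] q[OF B])
      have "of_real ((l2_norm (E B (?v k)))\<^sup>2) = l2_inner (?v k) (E B (?v k))" by (rule pvm_norm_sq[OF E B v])
      also have "\<dots> = l2_inner h (E B (?v k)) + cnj (\<i> ^ k) * l2_inner g (E B (?v k))"
        unfolding l2_inner_add_left[OF Ev h L2_scale[OF g]] l2_inner_scale_left ..
      also have "\<dots> = of_real (measure \<mu> (B \<inter> C)) * (1 + (\<i> ^ k + cnj (\<i> ^ k))) + (\<i> ^ k * cnj (\<i> ^ k)) * of_real (measure \<mu> B)"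
        unfolding 1 2 by (simp add: algebra_simps)
      also have "\<i> ^ k * cnj (\<i> ^ k) = 1" by (simp add: power_mult_distrib[symmetric])
      also have "1 + (\<i> ^ k + cnj (\<i> ^ k)) = of_real (r k)" unfolding complex_add_cnj r_def by simp
      finally have "complex_of_real ((l2_norm (E B (?v k)))\<^sup>2) = of_real (measure \<mu> (B \<inter> C) * r k + 1 * measure \<mu> B)"
        by simp
      then show ?thesis unfolding of_real_eq_iff by simp
    qed
    have sv: "spectral_measure E (?v k) = density \<mu> (\<lambda>s. ennreal (1 + r k * indicator C s))" for k
    proof (rule measure_eqI)
      fix B assume "B \<in> sets (spectral_measure E (?v k))"
      then have B [measurable]: "B \<in> sets borel" by simp
      have BC: "B \<inter> C \<in> sets borel" by measurable
      have "emeasure (density \<mu> (\<lambda>s. ennreal (1 + r k * indicator C s))) B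
          = (\<integral>\<^sup>+s. ennreal (indicator B s + r k * indicator (B \<inter> C) s) \<partial>\<mu>)"
        by (subst emeasure_density) (auto intro!: nn_integral_cong simp: indicator_def)
      also have "\<dots> = ennreal (\<integral>s. indicator B s + r k * indicator (B \<inter> C) s \<partial>\<mu>)"
      proof (rule nn_integral_eq_integral)
        show "AE s in \<mu>. 0 \<le> indicator B s + r k * indicator (B \<inter> C) s"
          using r[of k] by (intro AE_I2) (auto simp: indicator_def split: if_splits)
      qed (intro Bochner_Integration.integrable_add integrable_mult_right integrable_real_indicator; use B BC in simp)
      also have "(\<integral>s. indicator B s + r k * indicator (B \<inter> C) s \<partial>\<mu>) = measure \<mu> B + r k * measure \<mu> (B \<inter> C)"
        using B BC by (subst Bochner_Integration.integral_add) auto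
      finally show "emeasure (spectral_measure E (?v k)) B = emeasure (density \<mu> (\<lambda>s. ennreal (1 + r k * indicator C s))) B"
        by (simp add: emeasure_spectral_measure[OF E v B] nv[OF B])
    qed simp
    define a where "a = (\<integral>s. s \<partial>\<mu>)"
    define b where "b = (\<integral>s. indicator C s * s \<partial>\<mu>)"
    have iv: "(\<integral>s. complex_of_real s \<partial>spectral_measure E (?v k)) = of_real (a + r k * b)" for k
    proof -
      have "(\<integral>s. complex_of_real s \<partial>spectral_measure E (?v k)) = (\<integral>s. (1 + r k * indicator C s) *\<^sub>R complex_of_real s \<partial>\<mu>)"
        unfolding sv using r by (subst integral_density) auto
      also have "\<dots> = (\<integral>s. complex_of_real (s + r k * (indicator C s * s)) \<partial>\<mu>)"
        by (intro Bochner_Integration.integral_cong refl) (simp add: scaleR_conv_of_real algebra_simps)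
      also have "\<dots> = of_real (\<integral>s. s + r k * (indicator C s * s) \<partial>\<mu>)" by (rule integral_complex_of_real)
      also have "(\<integral>s. s + r k * (indicator C s * s) \<partial>\<mu>) = a + r k * b"
        unfolding a_def b_def using id idC by simp
      finally show ?thesis .
    qed
    have "l2_inner h (\<lambda>x. complex_of_real l * g x) = spectral_form E complex_of_real h g"
      using eig hdom by (simp add: spectral_integral_def)
    also have "\<dots> = of_real b"
      unfolding spectral_form_def iv by (simp add: r_def eval_nat_numeral algebra_simps)
    also have "l2_inner h (\<lambda>x. complex_of_real l * g x) = of_real (l * measure \<mu> C)"
      using q[OF C] pvm_sym[OF E C g g] by (simp add: h_def l2_inner_scale_right)
    finally have "l * measure \<mu> C = b" by (simp only: of_real_eq_iff)
    moreover have "(\<integral>s. indicator C s * (s - l) \<partial>\<mu>) = b - l * measure \<mu> C"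
      unfolding right_diff_distrib b_def using idC
      by (subst Bochner_Integration.integral_diff) (auto intro!: integrable_mult_left integrable_real_indicator)
    ultimately show "(\<integral>s. indicator C s * (s - l) \<partial>\<mu>) = 0" by simp
    show "integrable \<mu> (\<lambda>s. indicator C s * (s - l))"
      unfolding right_diff_distrib using idC
      by (intro Bochner_Integration.integrable_diff integrable_mult_left integrable_real_indicator) auto
  qed
  \<comment> \<open>On the two open half-lines beside \<open>l\<close> the integrand has a constant
    sign, so a vanishing integral makes it vanish almost everywhere.\<close>
  have "AE s in \<mu>. indicator {l<..} s * (s - l) = 0"
    using key[of "{l<..}"] by (subst integral_nonneg_eq_0_iff_AE[symmetric]) (auto simp: indicator_def)
  moreover have "AE s in \<mu>. indicator {..<l} s * (s - l) = 0"
  proof -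
    have "AE s in \<mu>. - (indicator {..<l} s * (s - l)) = 0"
      using key[of "{..<l}"] by (subst integral_nonneg_eq_0_iff_AE[symmetric]) (auto simp: indicator_def)
    then show ?thesis by simp
  qed
  ultimately show ?thesis unfolding \<mu>_def[symmetric] by eventually_elim (auto simp: indicator_def split: if_splits)
qed

text \<open>The spectral measure of a Hermite function sits at its energy, so \<open>E B\<close>
  either fixes or annihilates it. Symmetry of \<open>E B\<close> transfers this to the coefficients
  of an arbitrary \<open>f\<close>.\<close>

lemma harmonic_pvm_diagonal:
  fixes E :: "real set \<Rightarrow> (real ^ 'n::finite \<Rightarrow> complex) \<Rightarrow> _"
  assumes E: "projection_valued_measure E" and H: "spectral_integral E complex_of_real = harmonic_oscillator"
  shows "diagonal_pvm E"
proof -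
  have "hcoef \<alpha> (E B f) = of_bool (energy \<alpha> \<in> B) * hcoef \<alpha> f" if B: "B \<in> sets borel" and f: "f \<in> L2" for B f \<alpha>
  proof -
    define g where "g = (\<lambda>x. complex_of_real (hermite \<alpha> x))"
    have g: "g \<in> L2" unfolding g_def by (rule hermite_L2)
    have sc: "hcoef \<beta> (\<lambda>x. c * g x) = c * hcoef \<beta> g" for \<beta> c by (simp add: hcoef_def l2_inner_scale_right)
    have "(g, \<lambda>x. complex_of_real (energy \<alpha>) * g x) \<in> spectral_integral E complex_of_real"
      unfolding H harmonic_oscillator_hcoef using g by (simp add: L2_scale sc) (simp add: g_def hcoef_hermite)
    then have ae: "AE s in spectral_measure E g. s = energy \<alpha>" by (rule spectral_measure_eigenfunction[OF E g])
    define c :: real where "c = of_bool (energy \<alpha> \<in> B)"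
    have UN: "l2_norm (E UNIV g) = l2_norm g"
      using pvm_UNIV[OF E g] by (intro l2_norm_cong_AE) (auto intro!: L2_measurable pvm_L2[OF E] g)
    have "emeasure (spectral_measure E g) B = (\<integral>\<^sup>+s. indicator B s \<partial>spectral_measure E g)" using B by simp
    also have "\<dots> = (\<integral>\<^sup>+s. ennreal c \<partial>spectral_measure E g)"
      by (rule nn_integral_cong_AE) (use ae in eventually_elim, simp add: c_def indicator_def)
    also have "\<dots> = ennreal c * emeasure (spectral_measure E g) UNIV" by simp
    finally have "ennreal ((l2_norm (E B g))\<^sup>2) = ennreal (c * (l2_norm g)\<^sup>2)"
      by (simp add: emeasure_spectral_measure[OF E g] B UN ennreal_mult c_def)
    then have nB: "(l2_norm (E B g))\<^sup>2 = c * (l2_norm g)\<^sup>2" by (simp add: c_def)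
    \<comment> \<open>The difference of \<open>E B g\<close> and its expected value
      \<open>c * g\<close>. Its norm follows from \<open>nB\<close> and vanishes because
      \<open>c\<close> is 0 or 1.\<close>
    define w where "w = (\<lambda>x. E B g x + complex_of_real (- c) * g x)"
    have EB: "E B g \<in> L2" by (rule pvm_L2[OF E B g])
    have w: "w \<in> L2" unfolding w_def by (intro L2_add L2_scale EB g)
    have "l2_inner (E B g) g = of_real (c * (l2_norm g)\<^sup>2)"
      unfolding nB[symmetric] pvm_norm_sq[OF E B g] by (rule pvm_sym[OF E B g g])
    then have "Re (l2_inner (E B g) (\<lambda>x. complex_of_real (- c) * g x)) = - c * (c * (l2_norm g)\<^sup>2)"
      unfolding l2_inner_scale_right by simp
    then have "(l2_norm w)\<^sup>2 = c * (l2_norm g)\<^sup>2 + 2 * (- c * (c * (l2_norm g)\<^sup>2)) + (c * l2_norm g)\<^sup>2"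
      unfolding w_def l2_norm_add_sq[OF EB L2_scale[OF g]] nB l2_norm_scale by (simp add: power_mult_distrib)
    then have "l2_norm w = 0" by (cases "energy \<alpha> \<in> B") (simp_all add: c_def)
    then have "l2_inner w f = 0" using l2_cauchy_schwarz[OF w f] by simp
    then have "l2_inner (E B g) f = of_real c * l2_inner g f"
      unfolding w_def l2_inner_add_left[OF f EB L2_scale[OF g]] l2_inner_scale_left by simp
    then show ?thesis
      unfolding hcoef_def g_def[symmetric] pvm_sym[OF E B g f, symmetric] by (simp add: c_def)
  qed
  then show ?thesis using E by (auto simp: diagonal_pvm_def spectral_cut_def pvm_L2)
qed

text \<open>The existence of a diagonal resolution makes the choice by \<open>SOME\<close>
  meaningful; whichever resolution is chosen, \<open>harmonic_pvm_diagonal\<close> applies to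
  it.\<close>

theorem diagonal_spectral_resolution:
  "diagonal_pvm (spectral_resolution (harmonic_oscillator :: ((real ^ 'n::finite \<Rightarrow> complex) \<times> _) set))"
proof -
  obtain E :: "real set \<Rightarrow> (real ^ 'n \<Rightarrow> complex) \<Rightarrow> (real ^ 'n \<Rightarrow> complex)" where "diagonal_pvm E"
    using diagonal_pvm_exists by blast
  then have "projection_valued_measure E \<and> spectral_integral E complex_of_real = harmonic_oscillator"
    using diagonal_pvm_harmonic by (auto simp: diagonal_pvm_def)
  then have "projection_valued_measure (spectral_resolution (harmonic_oscillator :: ((real ^ 'n \<Rightarrow> complex) \<times> _) set)) \<and>
      spectral_integral (spectral_resolution harmonic_oscillator) complex_of_real = (harmonic_oscillator :: ((real ^ 'n \<Rightarrow> complex) \<times> _) set)"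
    unfolding spectral_resolution_def
    by (rule someI[where P="\<lambda>E. projection_valued_measure E \<and> spectral_integral E complex_of_real = harmonic_oscillator"])
  then show ?thesis using harmonic_pvm_diagonal by blast
qed

section \<open>Functional calculus, frequency localization and the final estimate\<close>

theorem functional_calculus_hermite:
  fixes f g :: "real ^ 'n::finite \<Rightarrow> complex"
  assumes F: "F \<in> borel_measurable borel" and f: "f \<in> L2" and g: "g \<in> L2"
    and c: "\<And>\<alpha>. hcoef \<alpha> g = F (energy \<alpha>) * hcoef \<alpha> f"
  shows "functional_calculus harmonic_oscillator F f \<in> L2"
    "AE x in lborel. functional_calculus harmonic_oscillator F f x = g x"
proof -
  note mem = diagonal_spectral_integral[OF diagonal_spectral_resolution F]
  have "(f, g) \<in> spectral_integral (spectral_resolution harmonic_oscillator) F" unfolding mem using f g c by simp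
  then have "(f, functional_calculus harmonic_oscillator F f) \<in> spectral_integral (spectral_resolution harmonic_oscillator) F"
    unfolding functional_calculus_def
    by (rule someI[where P="\<lambda>g. (f, g) \<in> spectral_integral (spectral_resolution harmonic_oscillator) F"])
  then have *: "functional_calculus harmonic_oscillator F f \<in> L2"
    "\<And>\<alpha>. hcoef \<alpha> (functional_calculus harmonic_oscillator F f) = F (energy \<alpha>) * hcoef \<alpha> f"
    unfolding mem by auto
  show "functional_calculus harmonic_oscillator F f \<in> L2" by (rule *)
  show "AE x in lborel. functional_calculus harmonic_oscillator F f x = g x"
    by (rule hermite_coeff_eq_AE) (simp_all add: * g c)
qed

lemma functional_calculus_finite:
  fixes f :: "real ^ 'n::finite \<Rightarrow> complex"
  assumes F: "F \<in> borel_measurable borel" and f: "f \<in> L2"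
    and fin: "\<And>\<alpha>. F (energy \<alpha>) * hcoef \<alpha> f \<noteq> 0 \<Longrightarrow> \<alpha> \<in> box_le n"
  shows "functional_calculus harmonic_oscillator F f \<in> L2"
    "AE x in lborel. functional_calculus harmonic_oscillator F f x
      = (\<Sum>\<alpha>\<in>box_le n. F (energy \<alpha>) * hcoef \<alpha> f * of_real (hermite \<alpha> x))"
    "hcoef \<alpha> (functional_calculus harmonic_oscillator F f) = F (energy \<alpha>) * hcoef \<alpha> f"
proof -
  let ?g = "\<lambda>x. \<Sum>\<alpha>\<in>box_le n. F (energy \<alpha>) * hcoef \<alpha> f * complex_of_real (hermite \<alpha> x)"
  have g: "?g \<in> L2" by (rule hermite.finite_sum_L2)
  have c: "hcoef \<alpha> ?g = F (energy \<alpha>) * hcoef \<alpha> f" for \<alpha>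
    unfolding hcoef_def[of \<alpha> ?g] hermite.coeff_finite_sum[OF finite_multi_index] using fin[of \<alpha>] by auto
  show L: "functional_calculus harmonic_oscillator F f \<in> L2" by (rule functional_calculus_hermite(1)[OF F f g c])
  show ae: "AE x in lborel. functional_calculus harmonic_oscillator F f x = ?g x"
    by (rule functional_calculus_hermite(2)[OF F f g c])
  have "hcoef \<alpha> (functional_calculus harmonic_oscillator F f) = hcoef \<alpha> ?g"
    unfolding hcoef_def[of \<alpha> "functional_calculus harmonic_oscillator F f"] hcoef_def[of \<alpha> ?g]
    by (rule l2_inner_cong_AE[OF hermite_L2 L g ae])
  then show "hcoef \<alpha> (functional_calculus harmonic_oscillator F f) = F (energy \<alpha>) * hcoef \<alpha> f"
    by (simp only: c)
qed

lemma energy_le_imp_box_le: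
  assumes "energy \<alpha> \<le> 2 * R" shows "\<alpha> \<in> box_le (nat \<lfloor>R\<rfloor>)"
proof (intro CollectI allI le_nat_floor)
  fix i
  have "real (\<alpha> i) \<le> (\<Sum>i\<in>UNIV. real (\<alpha> i))" by (rule member_le_sum) auto
  then show "real (\<alpha> i) \<le> R" using assms unfolding energy_def by linarith
qed

text \<open>The multiplier \<open>F\<close> vanishes for \<open>0 \<le> s \<le> N^2 / 4\<close>,
  where both cut-off values are 1, and for \<open>s \<ge> 2 * N^2\<close>, where both are 0. A
  function fixed by the localization has coefficients equal to \<open>F (energy \<alpha>)\<close>
  times themselves, so a nonzero coefficient forces a nonzero multiplier.\<close>

lemma frequency_localized_support:
  fixes u :: "real ^ 'n::finite \<Rightarrow> complex"
  assumes \<eta>: "cutoff \<eta>" and N: "N \<ge> 1" and u: "u \<in> L2"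
    and loc: "AE x in lborel. frequency_localization \<eta> N u x = u x"
    and \<alpha>: "hcoef \<alpha> u \<noteq> 0"
  shows "N\<^sup>2 / 4 \<le> energy \<alpha>" "energy \<alpha> \<le> 2 * N\<^sup>2"
proof -
  define F where "F s = \<eta> (s / N\<^sup>2) - \<eta> (4 * (s / N\<^sup>2))" for s
  have N2: "N\<^sup>2 > 0" using N by simp
  have e0: "energy \<beta> \<ge> 0" for \<beta> :: "'n \<Rightarrow> nat" by (simp add: energy_def sum_nonneg)
  have one: "\<eta> x = 1" if "0 \<le> x" "x \<le> 1" for x using \<eta> that by (simp add: cutoff_def)
  have zero: "\<eta> x = 0" if "2 \<le> x" for x using \<eta> that by (simp add: cutoff_def)
  have "smooth \<eta>" using \<eta> by (simp add: cutoff_def)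
  then have "((\<lambda>g y. vector_derivative g (at y)) ^^ 0) \<eta> differentiable (at x)" for x
    unfolding smooth_def by blast
  then have "continuous_on UNIV \<eta>" by (intro differentiable_continuous_UNIV) simp
  then have [measurable]: "\<eta> \<in> borel_measurable borel" by (rule borel_measurable_continuous_onI)
  have F: "F \<in> borel_measurable borel" unfolding F_def by measurable
  have big: "energy \<beta> \<le> 2 * N\<^sup>2" if "F (energy \<beta>) \<noteq> 0" for \<beta> :: "'n \<Rightarrow> nat"
  proof (rule ccontr)
    assume "\<not> energy \<beta> \<le> 2 * N\<^sup>2"
    then have "2 \<le> energy \<beta> / N\<^sup>2" using N2 by (simp add: le_divide_eq)
    then have "F (energy \<beta>) = 0" by (simp add: F_def zero)
    with that show False by simp
  qed
  have small: "N\<^sup>2 / 4 \<le> energy \<beta>" if "F (energy \<beta>) \<noteq> 0" for \<beta> :: "'n \<Rightarrow> nat"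
  proof (rule ccontr)
    assume "\<not> N\<^sup>2 / 4 \<le> energy \<beta>"
    then have "4 * (energy \<beta> / N\<^sup>2) \<le> 1" "0 \<le> energy \<beta> / N\<^sup>2" using N2 e0 by (simp_all add: divide_le_eq)
    then have "F (energy \<beta>) = 0" by (simp add: F_def one)
    with that show False by simp
  qed
  have fl: "frequency_localization \<eta> N u = functional_calculus harmonic_oscillator F u"
    by (simp add: frequency_localization_def F_def[abs_def])
  have fin: "\<beta> \<in> box_le (nat \<lfloor>N\<^sup>2\<rfloor>)" if "F (energy \<beta>) * hcoef \<beta> u \<noteq> 0" for \<beta>
    using that by (intro energy_le_imp_box_le big) simp
  have "hcoef \<alpha> u = hcoef \<alpha> (functional_calculus harmonic_oscillator F u)"
    unfolding hcoef_def using loc u functional_calculus_finite(1)[OF F u fin] unfolding fl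
    by (intro l2_inner_cong_AE hermite_L2) (auto elim: AE_mp)
  then have "F (energy \<alpha>) \<noteq> 0"
    using \<alpha> functional_calculus_finite(3)[OF F u fin, of \<alpha>] by auto
  then show "N\<^sup>2 / 4 \<le> energy \<alpha>" "energy \<alpha> \<le> 2 * N\<^sup>2" by (fact small, fact big)
qed

lemma propagator_evol:
  fixes u :: "real ^ 'n::finite \<Rightarrow> complex"
  assumes u: "u \<in> L2" and fin: "\<And>\<alpha>. hcoef \<alpha> u \<noteq> 0 \<Longrightarrow> \<alpha> \<in> box_le n"
  shows "AE x in lborel. propagator t u x = evol n (\<lambda>\<alpha>. hcoef \<alpha> u) t x"
proof -
  have "(\<lambda>s. exp (\<i> * complex_of_real (t * s))) \<in> borel_measurable borel"
    by (intro borel_measurable_continuous_onI continuous_intros)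
  from functional_calculus_finite(2)[OF this u, of n] fin
  show ?thesis by (simp add: propagator_def evol_def mult.commute)
qed

lemma ennreal_sqrt_le:
  assumes "x \<le> ennreal K" "0 \<le> K" shows "ennreal_sqrt x \<le> ennreal (sqrt K)"
proof -
  have "x \<noteq> \<infinity>" using assms(1) by (auto simp: top_unique)
  moreover have "enn2real x \<le> K" using assms by (rule enn2real_leI[rotated])
  ultimately show ?thesis by (simp add: ennreal_sqrt_def ennreal_leI)
qed

lemma sqrt_power_eq_powr: "x > 0 \<Longrightarrow> sqrt (x ^ k) = x powr (real k / 2)"
  by (simp add: powr_half_sqrt[symmetric] powr_realpow[symmetric] powr_powr)

text \<open>The constant is the square root of that in \<open>bilinear_finite\<close>; it depends on
  \<open>T\<close> and the dimension and is the same for all cut-off functions.\<close>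

theorem theorem3p1:
  fixes \<eta> :: "real \<Rightarrow> complex" and T :: real
  assumes "cutoff \<eta>"
    and "CARD('n::finite) \<ge> 2"
    and "T > 0"
  shows "\<exists>C>0. \<forall>M\<in>dyadic. \<forall>N\<in>dyadic. 1 \<le> M \<longrightarrow> M \<le> N \<longrightarrow>
    (\<forall>u\<in>L2. \<forall>v\<in>(L2 :: (real ^ 'n \<Rightarrow> complex) set).
       (AE x in lborel. frequency_localization \<eta> N u x = u x) \<longrightarrow>
       (AE x in lborel. frequency_localization \<eta> M v x = v x) \<longrightarrow>
       spacetime_norm T (\<lambda>t x. propagator t u x * propagator t v x)
         \<le> ennreal (C * (M powr ((real CARD('n) - 1) / 2) / N powr (1 / 2))
             * l2_norm u * l2_norm v))"
proof -
  obtain C where C: "C > 0" and bil: "\<And>M N B L (a :: ('n \<Rightarrow> nat) \<Rightarrow> complex) b. 1 \<le> M \<Longrightarrow> M \<le> N \<Longrightarrow> real L \<le> M\<^sup>2 \<Longrightarrow>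
    (\<And>\<alpha>. a \<alpha> \<noteq> 0 \<Longrightarrow> \<alpha> \<in> box_le B \<and> N\<^sup>2 / 4 \<le> energy \<alpha> \<and> energy \<alpha> \<le> 2 * N\<^sup>2) \<Longrightarrow>
    (\<And>\<beta>. b \<beta> \<noteq> 0 \<Longrightarrow> \<beta> \<in> box_le L \<and> energy \<beta> \<le> 2 * M\<^sup>2) \<Longrightarrow>
    (\<integral>\<^sup>+t\<in>{0..T}. (\<integral>\<^sup>+x. ennreal ((cmod (evol B a t x * evol L b t x))\<^sup>2) \<partial>lborel) \<partial>lborel)
      \<le> ennreal (C * (M ^ (CARD('n) - 1) / N) * ((\<Sum>\<alpha>\<in>box_le B. (cmod (a \<alpha>))\<^sup>2) * (\<Sum>\<beta>\<in>box_le L. (cmod (b \<beta>))\<^sup>2)))"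
    using bilinear_finite[OF assms(2,3)] by (elim exE conjE) blast
  have main: "spacetime_norm T (\<lambda>t x. propagator t u x * propagator t v x)
         \<le> ennreal (sqrt C * (M powr ((real CARD('n) - 1) / 2) / N powr (1 / 2)) * l2_norm u * l2_norm v)"
    if MN: "1 \<le> M" "M \<le> N" and u: "u \<in> L2" and v: "v \<in> L2"
      and lu: "AE x in lborel. frequency_localization \<eta> N u x = u x"
      and lv: "AE x in lborel. frequency_localization \<eta> M v x = v x"
    for M N and u v :: "real ^ 'n \<Rightarrow> complex"
  proof -
    \<comment> \<open>Every entry of a multi-index is at most half its energy, hence at most
      \<open>N^2\<close> for \<open>u\<close> and \<open>M^2\<close> for \<open>v\<close>.\<close>
    define B where "B = nat \<lfloor>N\<^sup>2\<rfloor>"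
    define L where "L = nat \<lfloor>M\<^sup>2\<rfloor>"
    define a where "a \<alpha> = hcoef \<alpha> u" for \<alpha>
    define b where "b \<alpha> = hcoef \<alpha> v" for \<alpha>
    have N: "1 \<le> N" using MN by simp
    have a: "\<alpha> \<in> box_le B \<and> N\<^sup>2 / 4 \<le> energy \<alpha> \<and> energy \<alpha> \<le> 2 * N\<^sup>2" if "a \<alpha> \<noteq> 0" for \<alpha>
      using frequency_localized_support[OF assms(1) N u lu that[unfolded a_def]] energy_le_imp_box_le[of \<alpha> "N\<^sup>2"]
      unfolding B_def by blast
    have b: "\<alpha> \<in> box_le L \<and> energy \<alpha> \<le> 2 * M\<^sup>2" if "b \<alpha> \<noteq> 0" for \<alpha>
      using frequency_localized_support[OF assms(1) MN(1) v lv that[unfolded b_def]] energy_le_imp_box_le[of \<alpha> "M\<^sup>2"]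
      unfolding L_def by blast
    have pu: "AE x in lborel. propagator t u x = evol B a t x" for t
      unfolding a_def using a unfolding a_def by (intro propagator_evol[OF u]) blast
    have pv: "AE x in lborel. propagator t v x = evol L b t x" for t
      unfolding b_def using b unfolding b_def by (intro propagator_evol[OF v]) blast
    \<comment> \<open>For each fixed \<open>t\<close>, equality for almost every \<open>x\<close>
      already gives equal inner integrals, so the time dependence of the exceptional sets is
      harmless.\<close>
    have "(\<integral>\<^sup>+x. ennreal ((cmod (propagator t u x * propagator t v x))\<^sup>2) \<partial>lborel)
        = (\<integral>\<^sup>+x. ennreal ((cmod (evol B a t x * evol L b t x))\<^sup>2) \<partial>lborel)" for t
      by (rule nn_integral_cong_AE) (use pu[of t] pv[of t] in eventually_elim, simp)
    then have "(\<integral>\<^sup>+t\<in>{0..T}. (\<integral>\<^sup>+x. ennreal ((cmod (propagator t u x * propagator t v x))\<^sup>2) \<partial>lborel) \<partial>lborel)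
        = (\<integral>\<^sup>+t\<in>{0..T}. (\<integral>\<^sup>+x. ennreal ((cmod (evol B a t x * evol L b t x))\<^sup>2) \<partial>lborel) \<partial>lborel)" by (simp only:)
    also have "\<dots> \<le> ennreal (C * (M ^ (CARD('n) - 1) / N) * ((\<Sum>\<alpha>\<in>box_le B. (cmod (a \<alpha>))\<^sup>2) * (\<Sum>\<beta>\<in>box_le L. (cmod (b \<beta>))\<^sup>2)))"
      using a b by (intro bil MN) (auto simp: L_def)
    also have "\<dots> \<le> ennreal (C * (M ^ (CARD('n) - 1) / N) * ((l2_norm u)\<^sup>2 * (l2_norm v)\<^sup>2))"
    proof (intro ennreal_leI mult_left_mono mult_mono)
      show "(\<Sum>\<alpha>\<in>box_le B. (cmod (a \<alpha>))\<^sup>2) \<le> (l2_norm u)\<^sup>2"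
        unfolding a_def hcoef_def by (rule hermite.bessel[OF u finite_multi_index])
      show "(\<Sum>\<alpha>\<in>box_le L. (cmod (b \<alpha>))\<^sup>2) \<le> (l2_norm v)\<^sup>2"
        unfolding b_def hcoef_def by (rule hermite.bessel[OF v finite_multi_index])
    qed (use C MN in \<open>auto intro!: sum_nonneg\<close>)
    finally have "spacetime_norm T (\<lambda>t x. propagator t u x * propagator t v x)
        \<le> ennreal (sqrt (C * (M ^ (CARD('n) - 1) / N) * ((l2_norm u)\<^sup>2 * (l2_norm v)\<^sup>2)))"
      unfolding spacetime_norm_def by (rule ennreal_sqrt_le) (use C MN in simp)
    \<comment> \<open>\<open>N ^ 1\<close> is written so that one rule turns both square roots into
      real powers.\<close>
    also have "sqrt (C * (M ^ (CARD('n) - 1) / N) * ((l2_norm u)\<^sup>2 * (l2_norm v)\<^sup>2))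
        = sqrt C * (sqrt (M ^ (CARD('n) - 1)) / sqrt (N ^ 1)) * l2_norm u * l2_norm v"
      by (simp add: real_sqrt_mult real_sqrt_divide)
    also have "\<dots> = sqrt C * (M powr ((real CARD('n) - 1) / 2) / N powr (1 / 2)) * l2_norm u * l2_norm v"
      using MN assms(2) by (subst (1 2) sqrt_power_eq_powr) (auto simp: of_nat_diff)
    finally show ?thesis .
  qed
  show ?thesis
    by (intro exI[of _ "sqrt C"] conjI ballI impI main) (use C in auto)
qed

end
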